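(* Special $\Omega$-surfaces of type $1$ whose degree $1$ polynomial conserved quantity $p$ satisfies $(p(t),p(t))$ being linear with non-zero constant term are the non-channel Guichard surfaces in the conformal geometry of $\langle p(0)\rangle^\perp$. Explicitly: let $\mathfrak{p}\in\mathbb{R}^{4,2}$ be non-lightlike and non-zero, and let $f:\Sigma\to\mathcal{Z}$ be an umbilic-free Legendre map. Then the following are equivalent: (a) $f$ is a special $\Omega$-surface of type $1$ (with respect to some gauge potential) whose middle pencil admits a polynomial conserved quantity $p(t)=p_0+tp_1$ of degree $1$ with $p(0)=\mathfrak{p}$ such that $(p(t),p(t))$ is a polynomial of degree $1$ with non-zero constant term; (b) $\Lambda:=f\cap\langle\mathfrak{p}\rangle^\perp$ is a rank $1$ subbundle of $f$ and, as a map $\Lambda:\Sigma\to\mathbb{P}(\mathcal{L}\cap\langle\mathfrak{p}\rangle^\perp)$, is a non-channel Guichard surface in the conformal geometry of $\langle\mathfrak{p}\rangle^\perp$.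
   Context: $\mathbb{R}^{4,2}$ is a 6-dimensional real vector space with a non-degenerate symmetric bilinear form $(\,,\,)$ of signature $(4,2)$, $\mathcal{L}$ its lightcone; $\wedge^2\mathbb{R}^{4,2}\cong\mathfrak{o}(4,2)$ via $a\wedge b\,(c)=(a,c)b-(b,c)a$. $\Sigma$ is a smooth 2-manifold, $\underline{\mathbb{R}}^{4,2}=\Sigma\times\mathbb{R}^{4,2}$, $d$ its trivial connection; for a subbundle $W$, $W^{(1)}$ consists of the images of sections of $W$ and of their derivatives. $\mathcal{Z}$ is the Grassmannian of isotropic 2-dimensional subspaces; a smooth $f:\Sigma\to\mathcal{Z}$ (viewed as a rank 2 subbundle) is a Legendre map if $f^{(1)}\le f^\perp$ and no non-zero $X\in T\Sigma$ satisfies $d_X\sigma\in f$ for all $\sigma\in\Gamma f$. A curvature sphere at $x\in\Sigma$ is a line $s(x)\le f(x)$ killed by $\sigma\mapsto d_X\sigma\bmod f$ for all $X$ in some non-zero subspace of $T_x\Sigma$; the maximal such subspace is its curvature space. $f$ is umbilic-free if there are exactly two curvature spheres at each point, forming rank 1 bundles $s_1,s_2\le f$ with curvature subbundles $T_1,T_2$. A gauge potential is a closed $\eta\in\Omega^1(f\wedge f^\perp)$ with $[\eta\wedge\eta]=0$ such that $q(X,Y)=\mathrm{tr}(\sigma\mapsto\eta(X)d_Y\sigma:f\to f)$ is non-zero; $f$ is an $\Omega$-surface if $q$ is non-degenerate on a dense open set. Standing assumption: $q$ has constant signature on $\Sigma$. The gauge orbit of $\eta$ is $\{\eta-d\tau:\tau\in\Gamma(\wedge^2f)\}$.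 With $S_1=\langle\sigma_1,d_Y\sigma_1,d_Yd_Y\sigma_1\rangle$, $S_2=\langle\sigma_2,d_X\sigma_2,d_Xd_X\sigma_2\rangle$ ($\sigma_i\in\Gamma s_i$, $X\in\Gamma T_1$, $Y\in\Gamma T_2$), one has $\underline{\mathbb{R}}^{4,2}=S_1\oplus_\perp S_2$, and the middle potential $\eta^{mid}$ is the unique member of the gauge orbit whose $S_1\wedge S_2$-component takes values in $\wedge^2f$; the middle pencil is $\{d+t\eta^{mid}\}_{t\in\mathbb{R}}$. A polynomial conserved quantity of the middle pencil is a non-zero polynomial $p(t)=\sum_kp_kt^k$, $p_k\in\Gamma\underline{\mathbb{R}}^{4,2}$, with $(d+t\eta^{mid})p(t)=0$ for all $t$ (its constant term $p(0)=p_0$ is then a constant vector). A special $\Omega$-surface of type $d$ is an umbilic-free $\Omega$-surface whose middle pencil admits a polynomial conserved quantity of degree $d$. Guichard surfaces: a sphere congruence in the conformal geometry $\langle\mathfrak{p}\rangle^\perp$ is a rank 4 subbundle $V$ of $\Sigma\times\langle\mathfrak{p}\rangle^\perp$ of signature $(3,1)$; $V^\perp$ is its orthogonal complement in $\underline{\mathbb{R}}^{4,2}$. Write $d=\mathcal{D}^V+\mathcal{N}^V$, where $\mathcal{D}^V$ is the sum of the induced connections on $V$ and $V^\perp$ and $\mathcal{N}^V\in\Omega^1(V\wedge V^\perp)$. A map $\Lambda:\Sigma\to\mathbb{P}(\mathcal{L}\cap\langle\mathfrak{p}\rangle^\perp)$ envelops $V$ if $\Lambda^{(1)}\subset V$.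 $\Lambda$ is a Guichard surface if for some (and in fact any) enveloped sphere congruence $V$ there is $\chi^V\in\Omega^1(\Lambda\wedge\Lambda^{(1)})$ such that $d^V_t:=\mathcal{D}^V+t\mathcal{N}^V+(t^2-1)\chi^V$ is flat for all $t\in\mathbb{R}$. Its quadratic differential, independent of the choice of $V$, is $q^\Lambda(X,Y)=2\,\mathrm{tr}(\Lambda\to\Lambda,\ \sigma\mapsto\chi^V_X\mathcal{D}^V_Y\sigma)+\mathrm{tr}(\mathcal{N}^V_X\circ\mathcal{N}^V_Y|_{V^\perp})$. A non-channel Guichard surface means a Guichard surface with $q^\Lambda$ non-degenerate. *)

theory Defs
  imports "HOL-Analysis.Analysis" "HOL-Computational_Algebra.Polynomial"
begin

section \<open>Linear algebra\<close>

text \<open>Sylvester's indices of inertia of the quadratic form \<open>v \<mapsto> b v v\<close> on a subspace \<open>W\<close>.\<close>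

definition pos_index :: "('a::euclidean_space \<Rightarrow> 'a \<Rightarrow> real) \<Rightarrow> 'a set \<Rightarrow> nat" where
  "pos_index b W = Max {dim P | P. subspace P \<and> P \<subseteq> W \<and> (\<forall>v\<in>P - {0}. b v v > 0)}"

definition signature :: "('a::euclidean_space \<Rightarrow> 'a \<Rightarrow> real) \<Rightarrow> 'a set \<Rightarrow> nat \<times> nat" where
  "signature b W = (pos_index b W, pos_index (\<lambda>v w. - b v w) W)"

definition nondegenerate :: "('a::real_vector \<Rightarrow> 'a \<Rightarrow> real) \<Rightarrow> bool" where
  "nondegenerate b \<longleftrightarrow> (\<forall>v. v \<noteq> 0 \<longrightarrow> (\<exists>w. b v w \<noteq> 0))"

text \<open>Trace of an endomorphism \<open>T\<close> of the finite-dimensional subspace \<open>W\<close>; it does not depend on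
  the chosen basis, and only the restriction of \<open>T\<close> to \<open>W\<close> matters.\<close>

definition trace_on :: "'a::real_vector set \<Rightarrow> ('a \<Rightarrow> 'a) \<Rightarrow> real" where
  "trace_on W T = (let B = (SOME B. independent B \<and> span B = W) in \<Sum>b\<in>B. representation B (T b) b)"

text \<open>A 6-dimensional real vector space with a non-degenerate symmetric bilinear form of signature
  \<open>(4, 2)\<close>: the \<open>e i\<close> form a basis that is orthonormal for the form.  The inner product and norm of
  the underlying Euclidean space only provide the topology.\<close>

class r42 = euclidean_space +
  fixes form :: "'a \<Rightarrow> 'a \<Rightarrow> real"
  assumes form_add: "form (u + v) w = form u w + form v w"
    and form_scaleR: "form (c *\<^sub>R v) w = c * form v w"
    and form_commute: "form v w = form w v"
    and form_signature: "\<exists>e. (\<forall>i<(6::nat). \<forall>j<6.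
        form (e i) (e j) = (if i \<noteq> j then 0 else if i < 4 then 1 else - 1)) \<and>
      (\<forall>v. \<exists>a. v = (\<Sum>i<6. a i *\<^sub>R e i))"

definition orth :: "'v::r42 set \<Rightarrow> 'v set" where
  "orth W = {v. \<forall>w\<in>W. form w v = 0}"

text \<open>Orthogonal projection onto a subspace on which the form is non-degenerate.\<close>

definition oproj :: "'v::r42 set \<Rightarrow> 'v \<Rightarrow> 'v" where
  "oproj W v = (THE w. w \<in> W \<and> v - w \<in> orth W)"

definition lightlike :: "'v::r42 \<Rightarrow> bool" where
  "lightlike v \<longleftrightarrow> v \<noteq> 0 \<and> form v v = 0"

definition isotropic :: "'v::r42 set \<Rightarrow> bool" where
  "isotropic W \<longleftrightarrow> (\<forall>v\<in>W. \<forall>w\<in>W. form v w = 0)"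

text \<open>Elements of \<open>\<wedge>\<^sup>2\<real>\<^sup>4\<^sup>,\<^sup>2\<close> are identified with skew endomorphisms.\<close>

definition wedge :: "'v::r42 \<Rightarrow> 'v \<Rightarrow> 'v \<Rightarrow>\<^sub>L 'v" where
  "wedge a b = Blinfun (\<lambda>c. form a c *\<^sub>R b - form b c *\<^sub>R a)"

lemma wedge_apply: "blinfun_apply (wedge a b) c = form a c *\<^sub>R b - form b c *\<^sub>R a"
proof -
  have lin: "linear (form x)" for x :: 'a
    by (rule linearI) (simp_all add: form_commute[of x] form_add form_scaleR)
  have "bounded_linear (\<lambda>c. form a c *\<^sub>R b - form b c *\<^sub>R a)"
    by (intro bounded_linear_sub bounded_linear_scaleR_const)
      (use lin linear_conv_bounded_linear in blast)+
  then show ?thesis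
    by (simp add: wedge_def bounded_linear_Blinfun_apply)
qed

definition wedge_space :: "'v::r42 set \<Rightarrow> 'v set \<Rightarrow> ('v \<Rightarrow>\<^sub>L 'v) set" where
  "wedge_space U W = span {wedge a b | a b. a \<in> U \<and> b \<in> W}"

text \<open>For an orthogonal decomposition \<open>\<real>\<^sup>4\<^sup>,\<^sup>2 = U \<oplus> W\<close>: the component in \<open>U \<and> W\<close> with respect
  to \<open>\<wedge>\<^sup>2\<real>\<^sup>4\<^sup>,\<^sup>2 = \<wedge>\<^sup>2U \<oplus> (U \<and> W) \<oplus> \<wedge>\<^sup>2W\<close>.\<close>

definition mixed_component :: "'v::r42 set \<Rightarrow> 'v set \<Rightarrow> ('v \<Rightarrow>\<^sub>L 'v) \<Rightarrow> 'v \<Rightarrow>\<^sub>L 'v" where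
  "mixed_component U W A =
    (THE C. C \<in> wedge_space U W \<and> A - C \<in> span (wedge_space U U \<union> wedge_space W W))"


section \<open>Smooth surfaces\<close>

primrec Ck_on :: "nat \<Rightarrow> 'a::real_normed_vector set \<Rightarrow> ('a \<Rightarrow> 'b::real_normed_vector) \<Rightarrow> bool" where
  "Ck_on 0 U g \<longleftrightarrow> continuous_on U g"
| "Ck_on (Suc k) U g \<longleftrightarrow>
    (\<forall>x\<in>U. g differentiable (at x)) \<and> (\<forall>v. Ck_on k U (\<lambda>x. frechet_derivative g (at x) v))"

text \<open>To be used on open subsets of finite-dimensional spaces only.\<close>

definition smooth_on :: "'a::real_normed_vector set \<Rightarrow> ('a \<Rightarrow> 'b::real_normed_vector) \<Rightarrow> bool" where
  "smooth_on U g \<longleftrightarrow> (\<forall>k. Ck_on k U g)"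

text \<open>A smooth 2-manifold is the universe of a type of the following class.  A chart is a pair of
  its domain \<open>U\<close> and a map \<open>\<phi>\<close> whose values outside \<open>U\<close> are irrelevant; \<open>\<phi>\<close> is a homeomorphism from \<open>U\<close> onto an open subset
  of the plane, which is expressed through open sets.\<close>

class smooth_surface = t2_space + second_countable_topology +
  fixes atlas :: "('a set \<times> ('a \<Rightarrow> real^2)) set"
  assumes chart_homeomorphism: "(U, \<phi>) \<in> atlas \<Longrightarrow>
      open U \<and> inj_on \<phi> U \<and> (\<forall>W\<subseteq>U. open W \<longleftrightarrow> open (\<phi> ` W))"
    and atlas_cover: "\<exists>(U, \<phi>)\<in>atlas. x \<in> U"
    and atlas_compatible: "(U, \<phi>) \<in> atlas \<Longrightarrow> (U', \<phi>') \<in> atlas \<Longrightarrow>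
      smooth_on (\<phi> ` (U \<inter> U')) (\<phi>' \<circ> inv_into U \<phi>)"

type_synonym 'm chart = "'m set \<times> ('m \<Rightarrow> real^2)"

definition chart_inv :: "'m chart \<Rightarrow> real^2 \<Rightarrow> 'm" where
  "chart_inv c = inv_into (fst c) (snd c)"

definition smooth_map_on :: "'m::smooth_surface set \<Rightarrow> ('m \<Rightarrow> 'b::real_normed_vector) \<Rightarrow> bool" where
  "smooth_map_on U \<sigma> \<longleftrightarrow> (\<forall>c\<in>atlas. smooth_on (snd c ` (fst c \<inter> U)) (\<sigma> \<circ> chart_inv c))"

abbreviation smooth_map :: "('m::smooth_surface \<Rightarrow> 'b::real_normed_vector) \<Rightarrow> bool" where
  "smooth_map \<equiv> smooth_map_on UNIV"

text \<open>The tangent space at every point \<open>x\<close> is modelled on the type \<^typ>\<open>real^2\<close>, via the differential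
  of a preferred chart \<open>chart_at x\<close>.  As the preferred chart varies with \<open>x\<close>, in general
  discontinuously, smoothness of vector fields and of 1-forms is expressed through their components
  with respect to the charts of the atlas.\<close>

definition chart_at :: "'m::smooth_surface \<Rightarrow> 'm chart" where
  "chart_at x = (SOME c. c \<in> atlas \<and> x \<in> fst c)"

text \<open>The derivative \<open>d\<^sub>X \<sigma>\<close> at \<open>x\<close>, for \<open>X\<close> a tangent vector at \<open>x\<close>.\<close>

definition tderiv :: "('m::smooth_surface \<Rightarrow> 'b::real_normed_vector) \<Rightarrow> 'm \<Rightarrow> real^2 \<Rightarrow> 'b" where
  "tderiv \<sigma> x X = frechet_derivative (\<sigma> \<circ> chart_inv (chart_at x)) (at (snd (chart_at x) x)) X"

text \<open>The coordinate vector field on \<open>fst c\<close> that has constant components \<open>e\<close> in the chart \<open>c\<close>.\<close>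

definition coord_field :: "'m::smooth_surface chart \<Rightarrow> real^2 \<Rightarrow> 'm \<Rightarrow> real^2" where
  "coord_field c e x = frechet_derivative (snd (chart_at x) \<circ> chart_inv c) (at (snd c x)) e"

definition smooth_vector_field :: "('m::smooth_surface \<Rightarrow> real^2) \<Rightarrow> bool" where
  "smooth_vector_field X \<longleftrightarrow> (\<forall>c\<in>atlas. smooth_map_on (fst c) (\<lambda>x. tderiv (snd c) x (X x)))"

definition smooth_one_form ::
    "('m::smooth_surface \<Rightarrow> real^2 \<Rightarrow> 'b::real_normed_vector) \<Rightarrow> bool" where
  "smooth_one_form \<eta> \<longleftrightarrow> (\<forall>x. linear (\<eta> x)) \<and>
    (\<forall>c\<in>atlas. \<forall>e. smooth_map_on (fst c) (\<lambda>x. \<eta> x (coord_field c e x)))"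

text \<open>\<open>d\<eta> = 0\<close>, evaluated on (commuting) coordinate vector fields.\<close>

definition closed_one_form ::
    "('m::smooth_surface \<Rightarrow> real^2 \<Rightarrow> 'b::real_normed_vector) \<Rightarrow> bool" where
  "closed_one_form \<eta> \<longleftrightarrow> (\<forall>c\<in>atlas. \<forall>x\<in>fst c. \<forall>e e'.
    tderiv (\<lambda>y. \<eta> y (coord_field c e' y)) x (coord_field c e x) =
    tderiv (\<lambda>y. \<eta> y (coord_field c e y)) x (coord_field c e' x))"

text \<open>A connection \<open>\<nabla>\<close> on the trivial bundle maps a section \<open>\<sigma>\<close> to \<open>(x, X) \<mapsto> \<nabla>\<^sub>X \<sigma>\<close>.  It is flat if
  its curvature vanishes; on coordinate vector fields the curvature is the commutator of
  covariant derivatives.\<close>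

definition flat ::
    "(('m::smooth_surface \<Rightarrow> 'b::real_normed_vector) \<Rightarrow> 'm \<Rightarrow> real^2 \<Rightarrow> 'b) \<Rightarrow> bool" where
  "flat D \<longleftrightarrow> (\<forall>c\<in>atlas. \<forall>x\<in>fst c. \<forall>\<sigma>. smooth_map \<sigma> \<longrightarrow> (\<forall>e e'.
    D (\<lambda>y. D \<sigma> y (coord_field c e' y)) x (coord_field c e x) =
    D (\<lambda>y. D \<sigma> y (coord_field c e y)) x (coord_field c e' x)))"


section \<open>Subbundles and their sections\<close>

definition smooth_subbundle :: "nat \<Rightarrow> ('m::smooth_surface \<Rightarrow> 'v::euclidean_space set) \<Rightarrow> bool" where
  "smooth_subbundle k W \<longleftrightarrow> (\<forall>x. subspace (W x) \<and> dim (W x) = k) \<and>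
    (\<forall>x. \<exists>U s. open U \<and> x \<in> U \<and> (\<forall>i<k. smooth_map_on U (s i)) \<and>
      (\<forall>y\<in>U. W y = span {s i y | i. i < (k::nat)}))"

definition sections ::
    "('m::smooth_surface \<Rightarrow> 'b::real_normed_vector set) \<Rightarrow> ('m \<Rightarrow> 'b) set" where
  "sections W = {\<sigma>. smooth_map \<sigma> \<and> (\<forall>x. \<sigma> x \<in> W x)}"

text \<open>Some section with prescribed value \<open>v \<in> W x\<close> at \<open>x\<close>.  It is only used in expressions that do
  not depend on the choice.\<close>

definition section_through ::
    "('m::smooth_surface \<Rightarrow> 'b::real_normed_vector set) \<Rightarrow> 'm \<Rightarrow> 'b \<Rightarrow> 'm \<Rightarrow> 'b" where
  "section_through W x v = (SOME \<sigma>. \<sigma> \<in> sections W \<and> \<sigma> x = v)"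

text \<open>The fibres of \<open>W\<^sup>(\<^sup>1\<^sup>)\<close>.\<close>

definition derived ::
    "('m::smooth_surface \<Rightarrow> 'b::real_normed_vector set) \<Rightarrow> 'm \<Rightarrow> 'b set" where
  "derived W x = span ({\<sigma> x | \<sigma>. \<sigma> \<in> sections W} \<union> {tderiv \<sigma> x X | \<sigma> X. \<sigma> \<in> sections W})"


section \<open>Legendre maps\<close>

definition legendre_map :: "('m::smooth_surface \<Rightarrow> 'v::r42 set) \<Rightarrow> bool" where
  "legendre_map f \<longleftrightarrow>
    smooth_subbundle 2 f \<and> (\<forall>x. isotropic (f x)) \<and>
    (\<forall>x. derived f x \<subseteq> orth (f x)) \<and>
    (\<forall>x X. X \<noteq> 0 \<longrightarrow> \<not> (\<forall>\<sigma>\<in>sections f. tderiv \<sigma> x X \<in> f x))"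

definition curvature_space ::
    "('m::smooth_surface \<Rightarrow> 'v::r42 set) \<Rightarrow> 'm \<Rightarrow> 'v set \<Rightarrow> (real^2) set" where
  "curvature_space f x s = {X. \<forall>\<sigma>\<in>sections f. \<sigma> x \<in> s \<longrightarrow> tderiv \<sigma> x X \<in> f x}"

definition curvature_sphere ::
    "('m::smooth_surface \<Rightarrow> 'v::r42 set) \<Rightarrow> 'm \<Rightarrow> 'v set \<Rightarrow> bool" where
  "curvature_sphere f x s \<longleftrightarrow> subspace s \<and> dim s = 1 \<and> s \<subseteq> f x \<and>
    (\<exists>T. subspace T \<and> T \<noteq> {0} \<and> T \<subseteq> curvature_space f x s)"

definition curvature_sphere_pair ::
    "('m::smooth_surface \<Rightarrow> 'v::r42 set) \<Rightarrow> ('m \<Rightarrow> 'v set) \<Rightarrow> ('m \<Rightarrow> 'v set) \<Rightarrow> bool" where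
  "curvature_sphere_pair f s\<^sub>1 s\<^sub>2 \<longleftrightarrow> smooth_subbundle 1 s\<^sub>1 \<and> smooth_subbundle 1 s\<^sub>2 \<and>
    (\<forall>x. s\<^sub>1 x \<noteq> s\<^sub>2 x \<and> {s. curvature_sphere f x s} = {s\<^sub>1 x, s\<^sub>2 x})"

definition umbilic_free :: "('m::smooth_surface \<Rightarrow> 'v::r42 set) \<Rightarrow> bool" where
  "umbilic_free f \<longleftrightarrow> (\<exists>s\<^sub>1 s\<^sub>2. curvature_sphere_pair f s\<^sub>1 s\<^sub>2)"

text \<open>The span of \<open>\<sigma>\<close>, \<open>d\<^sub>Y \<sigma>\<close>, \<open>d\<^sub>Y d\<^sub>Y \<sigma>\<close> for sections \<open>\<sigma>\<close> of \<open>s\<close> and \<open>Y\<close> of \<open>T\<close>.  For line bundles \<open>s\<close>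
  and \<open>T\<close> it is already spanned by these for one pair \<open>\<sigma>\<close>, \<open>Y\<close> without zeros near the point.\<close>

definition second_osculating ::
    "('m::smooth_surface \<Rightarrow> 'v::r42 set) \<Rightarrow> ('m \<Rightarrow> (real^2) set) \<Rightarrow> 'm \<Rightarrow> 'v set" where
  "second_osculating s T x = span (\<Union>\<sigma>\<in>sections s. \<Union>Y\<in>{Y. smooth_vector_field Y \<and> (\<forall>y. Y y \<in> T y)}.
    {\<sigma> x, tderiv \<sigma> x (Y x), tderiv (\<lambda>y. tderiv \<sigma> y (Y y)) x (Y x)})"


section \<open>\<open>\<Omega>\<close>-surfaces and their middle pencil\<close>

text \<open>\<open>q(X, Y) = tr(\<sigma> \<mapsto> \<eta>(X) d\<^sub>Y \<sigma> : f \<rightarrow> f)\<close>.\<close>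

definition omega_q :: "('m::smooth_surface \<Rightarrow> 'v::r42 set) \<Rightarrow> ('m \<Rightarrow> real^2 \<Rightarrow> 'v \<Rightarrow>\<^sub>L 'v) \<Rightarrow>
    'm \<Rightarrow> real^2 \<Rightarrow> real^2 \<Rightarrow> real" where
  "omega_q f \<eta> x X Y =
    trace_on (f x) (\<lambda>v. blinfun_apply (\<eta> x X) (tderiv (section_through f x v) x Y))"

definition gauge_potential ::
    "('m::smooth_surface \<Rightarrow> 'v::r42 set) \<Rightarrow> ('m \<Rightarrow> real^2 \<Rightarrow> 'v \<Rightarrow>\<^sub>L 'v) \<Rightarrow> bool" where
  "gauge_potential f \<eta> \<longleftrightarrow>
    smooth_one_form \<eta> \<and> (\<forall>x X. \<eta> x X \<in> wedge_space (f x) (orth (f x))) \<and>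
    closed_one_form \<eta> \<and>
    (\<forall>x X Y. \<eta> x X o\<^sub>L \<eta> x Y = \<eta> x Y o\<^sub>L \<eta> x X) \<and>
    (\<exists>x X Y. omega_q f \<eta> x X Y \<noteq> 0)"

text \<open>The last conjunct is the standing assumption that \<open>q\<close> has constant signature.  It is imposed on
  each connected subset, hence on all of the surface if the surface is connected.\<close>

definition omega_surface ::
    "('m::smooth_surface \<Rightarrow> 'v::r42 set) \<Rightarrow> ('m \<Rightarrow> real^2 \<Rightarrow> 'v \<Rightarrow>\<^sub>L 'v) \<Rightarrow> bool" where
  "omega_surface f \<eta> \<longleftrightarrow> legendre_map f \<and> gauge_potential f \<eta> \<and>
    (\<exists>U. open U \<and> closure U = UNIV \<and> (\<forall>x\<in>U. nondegenerate (omega_q f \<eta> x))) \<and>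
    (\<forall>C. connected C \<longrightarrow>
      (\<forall>x\<in>C. \<forall>y\<in>C. signature (omega_q f \<eta> x) UNIV = signature (omega_q f \<eta> y) UNIV))"

definition gauge_orbit :: "('m::smooth_surface \<Rightarrow> 'v::r42 set) \<Rightarrow> ('m \<Rightarrow> real^2 \<Rightarrow> 'v \<Rightarrow>\<^sub>L 'v) \<Rightarrow>
    ('m \<Rightarrow> real^2 \<Rightarrow> 'v \<Rightarrow>\<^sub>L 'v) set" where
  "gauge_orbit f \<eta> =
    {\<lambda>x X. \<eta> x X - tderiv \<tau> x X | \<tau>. \<tau> \<in> sections (\<lambda>x. wedge_space (f x) (f x))}"

definition middle_potential :: "('m::smooth_surface \<Rightarrow> 'v::r42 set) \<Rightarrow>
    ('m \<Rightarrow> real^2 \<Rightarrow> 'v \<Rightarrow>\<^sub>L 'v) \<Rightarrow> ('m \<Rightarrow> real^2 \<Rightarrow> 'v \<Rightarrow>\<^sub>L 'v) \<Rightarrow> bool" where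
  "middle_potential f \<eta> \<mu> \<longleftrightarrow> \<mu> \<in> gauge_orbit f \<eta> \<and>
    (\<exists>s\<^sub>1 s\<^sub>2. curvature_sphere_pair f s\<^sub>1 s\<^sub>2 \<and>
      (let S\<^sub>1 = second_osculating s\<^sub>1 (\<lambda>x. curvature_space f x (s\<^sub>2 x));
           S\<^sub>2 = second_osculating s\<^sub>2 (\<lambda>x. curvature_space f x (s\<^sub>1 x))
       in \<forall>x X. mixed_component (S\<^sub>1 x) (S\<^sub>2 x) (\<mu> x X) \<in> wedge_space (f x) (f x)))"

text \<open>A polynomial of degree at most \<open>n\<close> with coefficients \<open>p 0, \<dots>, p n\<close> in \<open>\<Gamma>\<real>\<^sup>4\<^sup>,\<^sup>2\<close>, at parameter \<open>t\<close>.\<close>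

definition section_poly :: "nat \<Rightarrow> (nat \<Rightarrow> 'm \<Rightarrow> 'v::real_vector) \<Rightarrow> real \<Rightarrow> 'm \<Rightarrow> 'v" where
  "section_poly n p t x = (\<Sum>k\<le>n. t ^ k *\<^sub>R p k x)"

definition polynomial_conserved_quantity ::
    "('m::smooth_surface \<Rightarrow> real^2 \<Rightarrow> 'v::r42 \<Rightarrow>\<^sub>L 'v) \<Rightarrow> nat \<Rightarrow> (nat \<Rightarrow> 'm \<Rightarrow> 'v) \<Rightarrow> bool" where
  "polynomial_conserved_quantity \<mu> n p \<longleftrightarrow>
    (\<forall>k. smooth_map (p k)) \<and> p n \<noteq> (\<lambda>_. 0) \<and> (\<forall>k>n. p k = (\<lambda>_. 0)) \<and>
    (\<forall>t x X. tderiv (section_poly n p t) x X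
      + t *\<^sub>R blinfun_apply (\<mu> x X) (section_poly n p t x) = 0)"

text \<open>With respect to the gauge potential \<open>\<eta>\<close>.\<close>

definition special_omega_surface :: "nat \<Rightarrow> ('m::smooth_surface \<Rightarrow> 'v::r42 set) \<Rightarrow>
    ('m \<Rightarrow> real^2 \<Rightarrow> 'v \<Rightarrow>\<^sub>L 'v) \<Rightarrow> bool" where
  "special_omega_surface n f \<eta> \<longleftrightarrow> umbilic_free f \<and> omega_surface f \<eta> \<and>
    (\<exists>\<mu> p. middle_potential f \<eta> \<mu> \<and> polynomial_conserved_quantity \<mu> n p)"


section \<open>Guichard surfaces\<close>

definition sphere_congruence :: "'v::r42 \<Rightarrow> ('m::smooth_surface \<Rightarrow> 'v set) \<Rightarrow> bool" where
  "sphere_congruence \<pp> V \<longleftrightarrow> smooth_subbundle 4 V \<and>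
    (\<forall>x. V x \<subseteq> orth {\<pp>} \<and> signature form (V x) = (3, 1))"

text \<open>A smooth map into \<open>\<P>(\<L> \<inter> \<langle>\<pp>\<rangle>\<^sup>\<bottom>)\<close>, viewed as a line bundle.\<close>

definition light_cone_map :: "'v::r42 \<Rightarrow> ('m::smooth_surface \<Rightarrow> 'v set) \<Rightarrow> bool" where
  "light_cone_map \<pp> \<Lambda> \<longleftrightarrow> smooth_subbundle 1 \<Lambda> \<and>
    (\<forall>x. \<Lambda> x \<subseteq> orth {\<pp>} \<and> (\<forall>v\<in>\<Lambda> x - {0}. lightlike v))"

definition envelops :: "('m::smooth_surface \<Rightarrow> 'v::r42 set) \<Rightarrow> ('m \<Rightarrow> 'v set) \<Rightarrow> bool" where
  "envelops \<Lambda> V \<longleftrightarrow> (\<forall>x. derived \<Lambda> x \<subseteq> V x)"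

text \<open>The sum of the connections induced by \<open>d\<close> on \<open>V\<close> and \<open>V\<^sup>\<bottom>\<close>, and the remaining part
  \<open>d - \<D>\<^sup>V\<close>.  The latter is tensorial, so it may be evaluated on constant sections.\<close>

definition split_conn :: "('m::smooth_surface \<Rightarrow> 'v::r42 set) \<Rightarrow> ('m \<Rightarrow> 'v) \<Rightarrow> 'm \<Rightarrow> real^2 \<Rightarrow> 'v" where
  "split_conn V \<sigma> x X =
    oproj (V x) (tderiv (\<lambda>y. oproj (V y) (\<sigma> y)) x X) +
    oproj (orth (V x)) (tderiv (\<lambda>y. oproj (orth (V y)) (\<sigma> y)) x X)"

definition split_form :: "('m::smooth_surface \<Rightarrow> 'v::r42 set) \<Rightarrow> 'm \<Rightarrow> real^2 \<Rightarrow> 'v \<Rightarrow> 'v" where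
  "split_form V x X v = tderiv (\<lambda>_. v) x X - split_conn V (\<lambda>_. v) x X"

definition guichard_conn :: "('m::smooth_surface \<Rightarrow> 'v::r42 set) \<Rightarrow> ('m \<Rightarrow> real^2 \<Rightarrow> 'v \<Rightarrow>\<^sub>L 'v) \<Rightarrow>
    real \<Rightarrow> ('m \<Rightarrow> 'v) \<Rightarrow> 'm \<Rightarrow> real^2 \<Rightarrow> 'v" where
  "guichard_conn V \<xi> t \<sigma> x X = split_conn V \<sigma> x X + t *\<^sub>R split_form V x X (\<sigma> x)
    + (t\<^sup>2 - 1) *\<^sub>R blinfun_apply (\<xi> x X) (\<sigma> x)"

text \<open>\<open>V\<close> and \<open>\<xi>\<close> exhibit \<open>\<Lambda>\<close> as a Guichard surface in the conformal geometry of \<open>\<langle>\<pp>\<rangle>\<^sup>\<bottom>\<close>.\<close>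

definition guichard_data :: "'v::r42 \<Rightarrow> ('m::smooth_surface \<Rightarrow> 'v set) \<Rightarrow> ('m \<Rightarrow> 'v set) \<Rightarrow>
    ('m \<Rightarrow> real^2 \<Rightarrow> 'v \<Rightarrow>\<^sub>L 'v) \<Rightarrow> bool" where
  "guichard_data \<pp> \<Lambda> V \<xi> \<longleftrightarrow> light_cone_map \<pp> \<Lambda> \<and> sphere_congruence \<pp> V \<and> envelops \<Lambda> V \<and>
    smooth_one_form \<xi> \<and> (\<forall>x X. \<xi> x X \<in> wedge_space (\<Lambda> x) (derived \<Lambda> x)) \<and>
    (\<forall>t. flat (guichard_conn V \<xi> t))"

definition guichard_q :: "('m::smooth_surface \<Rightarrow> 'v::r42 set) \<Rightarrow> ('m \<Rightarrow> 'v set) \<Rightarrow>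
    ('m \<Rightarrow> real^2 \<Rightarrow> 'v \<Rightarrow>\<^sub>L 'v) \<Rightarrow> 'm \<Rightarrow> real^2 \<Rightarrow> real^2 \<Rightarrow> real" where
  "guichard_q \<Lambda> V \<xi> x X Y =
    2 * trace_on (\<Lambda> x)
      (\<lambda>v. blinfun_apply (\<xi> x X) (split_conn V (section_through \<Lambda> x v) x Y)) +
    trace_on (orth (V x)) (\<lambda>v. split_form V x X (split_form V x Y v))"

definition non_channel_guichard_surface ::
    "'v::r42 \<Rightarrow> ('m::smooth_surface \<Rightarrow> 'v set) \<Rightarrow> bool" where
  "non_channel_guichard_surface \<pp> \<Lambda> \<longleftrightarrow>
    (\<exists>V \<xi>. guichard_data \<pp> \<Lambda> V \<xi> \<and> (\<forall>x. nondegenerate (guichard_q \<Lambda> V \<xi> x)))"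

end

theory Submission
  imports Defs
begin

text \<open>Let \<open>X\<close> and \<open>Y\<close> span the curvature spaces of the spheres \<open>s1\<close> and \<open>s2\<close>.  A potential \<open>\<mu>\<close> is the middle one if
  and only if it maps \<open>d\<^sub>Y s1\<close> to \<open>s1\<close> and \<open>d\<^sub>X s2\<close> to \<open>s2\<close>.  For a conserved quantity \<open>p + t p1\<close>, the coefficient \<open>p1\<close>
  is a null vector with \<open>\<mu> p1 = 0\<close>, hence lies in \<open>f\<close> as \<open>q\<close> is non-degenerate, and \<open>(p, p1)\<close> is locally constant.
  Scale \<open>p1\<close> and \<open>\<mu>\<close> by \<open>\<alpha> / (p, p1)\<close>, \<open>\<alpha> = (p, p)\<close>, to \<open>F\<close> and \<open>\<rho>\<close>; then \<open>V = \<langle>p, F\<rangle>\<^sup>\<bottom>\<close> is an enveloped sphere congruence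
  with normal \<open>\<nu> = p - F\<close>, and \<open>\<xi> = (\<rho> + \<alpha>\<^sup>-\<^sup>1 F \<and> dF) / 2\<close> satisfies \<open>d\<xi> = \<alpha>\<^sup>-\<^sup>1 dF \<and> dF\<close>, which amounts to flatness of all
  connections of the Guichard family.

  Conversely, given Guichard data, \<open>\<eta> = 2 \<xi> - \<alpha>\<^sup>-\<^sup>1 F \<and> dF\<close> has to be closed for a suitable section \<open>F\<close> of \<open>f\<close> with
  \<open>(p, F) = \<alpha>\<close>.  Where \<open>\<Lambda>\<close> is immersed, \<open>F\<close> is the section of \<open>f \<inter> V\<^sup>\<bottom>\<close>.  On open sets where \<open>\<Lambda>\<close> is the curvature sphere
  \<open>s2\<close>, it is the section of \<open>s1\<close>: there the second osculating bundles are parallel, so that \<open>d\<^sub>X F = 0\<close> and \<open>d\<nu>\<close> has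
  rank 1.  Both choices are given by one smooth formula.  If \<open>\<tau>\<close> gauges \<open>\<eta>\<close> to the middle potential, then
  \<open>p + t (F + \<tau> p)\<close> is conserved.\<close>

section \<open>Calculus of smooth maps\<close>

text \<open>The curvature of the Guichard family is a polynomial in t, and its vanishing yields
  d\<xi> = - \<kappa>^-1 d\<nu> \<and> d\<nu> with \<kappa> = (\<nu>, \<nu>), whereas d(F \<and> dF)
  = 2 dF \<and> dF. Hence \<eta> is closed as soon as \<kappa>^-1 d\<nu> \<and> d\<nu> + \<alpha>^-1
  dF \<and> dF = 0. This balance holds for two unrelated reasons: dF = \<epsilon> d\<nu> with
  \<epsilon>^2 \<kappa> = - \<alpha> where \<Lambda> is immersed, and the vanishing of both terms
  where \<Lambda> is a curvature sphere. The obstacle is the border between the two regimes: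
  immersed points need not be dense, and choices of F made separately on the pieces have no reason
  to fit together smoothly. The surface is therefore covered by the closure of the immersed points,
  to which identities extend by continuity, and two open sets on which one fixed curvature sphere is
  orthogonal to p. The roles of the two curvature spheres are symmetric, so facts are proved for one
  of them and transferred by exchanging \<sigma>1, X with \<sigma>2, Y.\<close>

lemma Ck_on_subset: "Ck_on k U g \<Longrightarrow> W \<subseteq> U \<Longrightarrow> Ck_on k W g"
  by (induction k arbitrary: g) (auto intro: continuous_on_subset)

text \<open>On an open set equal maps have equal germs, hence equal
  \<open>frechet_derivative\<close>. Later smoothness proofs use this to replace a map by a formula
  that is valid on \<open>U\<close> only.\<close>

lemma Ck_on_cong:
  assumes "open U" "\<And>x. x \<in> U \<Longrightarrow> g x = h x" and "Ck_on k U g"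
  shows "Ck_on k U h" using assms(2,3)
proof (induction k arbitrary: g h)
  case 0
  then show ?case using continuous_on_cong by fastforce
next
  case (Suc k)
  have d: "(h has_derivative frechet_derivative g (at x)) (at x)" if "x \<in> U" for x
    using Suc.prems that assms(1) frechet_derivative_works
    by (intro has_derivative_transform_within_open[of g _ _ UNIV U h]) auto
  have eq: "frechet_derivative h (at x) = frechet_derivative g (at x)" if "x \<in> U" for x
    using d[OF that] frechet_derivative_at by metis
  show ?case
    using d eq Suc.prems Suc.IH[of "\<lambda>x. frechet_derivative g (at x) v" "\<lambda>x. frechet_derivative h (at x) v" for v]
    by (auto simp: differentiable_def)
qed

lemma Ck_on_continuous: "Ck_on k U g \<Longrightarrow> continuous_on U g"
  by (cases k) (auto intro!: continuous_at_imp_continuous_on differentiable_imp_continuous_within)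

lemma Ck_on_Suc: "Ck_on (Suc k) U g \<Longrightarrow> Ck_on k U g"
proof (induction k arbitrary: g)
  case 0
  then show ?case using Ck_on_continuous by (metis Ck_on.simps(1))
qed auto

lemma Ck_on_SucI:
  assumes "open U" "\<And>x. x \<in> U \<Longrightarrow> (g has_derivative g' x) (at x)"
    and "\<And>v. Ck_on k U (\<lambda>x. g' x v)"
  shows "Ck_on (Suc k) U g"
proof -
  have "frechet_derivative g (at x) = g' x" if "x \<in> U" for x
    using assms(2)[OF that] frechet_derivative_at by metis
  then show ?thesis using assms by (auto simp: differentiable_def intro: Ck_on_cong[OF assms(1) _ assms(3)])
qed

lemma Ck_on_has_derivative:
  "Ck_on (Suc k) U g \<Longrightarrow> x \<in> U \<Longrightarrow> (g has_derivative frechet_derivative g (at x)) (at x)"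
  using frechet_derivative_works by auto

lemma Ck_on_local:
  assumes "\<And>x. x \<in> U \<Longrightarrow> \<exists>W. open W \<and> x \<in> W \<and> Ck_on k W g"
  shows "Ck_on k U g" using assms
proof (induction k arbitrary: g)
  case 0
  then show ?case
    by (simp add: continuous_at_imp_continuous_on) (meson continuous_at_imp_continuous_on continuous_on_eq_continuous_at)
next
  case (Suc k)
  then show ?case by (simp; meson)
qed

lemma Ck_on_const: "Ck_on k U (\<lambda>_. a)" by (induction k arbitrary: a) auto

lemma Ck_on_bounded_linear:
  assumes "bounded_linear f" "open U" "Ck_on k U g"
  shows "Ck_on k U (\<lambda>x. f (g x))" using assms(3)
proof (induction k arbitrary: g)
  case 0
  then show ?case using assms(1) by (simp add: bounded_linear.continuous_on)
next
  case (Suc k)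
  show ?case
    by (rule Ck_on_SucI[OF assms(2) bounded_linear.has_derivative[OF assms(1) Ck_on_has_derivative[OF Suc.prems]]])
      (use Suc in auto)
qed

lemma Ck_on_add:
  assumes "open U" "Ck_on k U g" "Ck_on k U h"
  shows "Ck_on k U (\<lambda>x. g x + h x)" using assms(2,3)
proof (induction k arbitrary: g h)
  case 0
  then show ?case by (simp add: continuous_on_add)
next
  case (Suc k)
  show ?case by (rule Ck_on_SucI[OF assms(1) has_derivative_add[OF Ck_on_has_derivative[OF Suc.prems(1)]
          Ck_on_has_derivative[OF Suc.prems(2)]]]) (use Suc in auto)
qed

lemma Ck_on_bilinear:
  assumes "bounded_bilinear B" "open U" "Ck_on k U g" "Ck_on k U h"
  shows "Ck_on k U (\<lambda>x. B (g x) (h x))" using assms(3,4)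
proof (induction k arbitrary: g h)
  case 0
  then show ?case by (simp add: assms(1) bounded_bilinear.continuous_on)
next
  case (Suc k)
  show ?case
    by (rule Ck_on_SucI[OF assms(2) bounded_bilinear.FDERIV[OF assms(1) Ck_on_has_derivative[OF Suc.prems(1)]
          Ck_on_has_derivative[OF Suc.prems(2)]]])
      (use Suc Ck_on_Suc[OF Suc.prems(1)] Ck_on_Suc[OF Suc.prems(2)] in \<open>auto intro!: Ck_on_add assms(2)\<close>)
qed

lemma Ck_on_sum:
  assumes "open U" "\<And>i. i \<in> I \<Longrightarrow> Ck_on k U (g i)"
  shows "Ck_on k U (\<lambda>x. \<Sum>i\<in>I. g i x)"
  using assms(2) by (induction I rule: infinite_finite_induct) (auto intro: Ck_on_const Ck_on_add[OF assms(1)])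

text \<open>Differentiation lowers the exponent by one and multiplies by a smooth factor, so the
  induction runs over all exponents at once. Inverses and the inverse square root that normalises
  \<open>\<nu>\<close> both come from here.\<close>

lemma Ck_on_powr:
  fixes g :: "'a::real_normed_vector \<Rightarrow> real"
  assumes "open U" "Ck_on k U g" "\<And>x. x \<in> U \<Longrightarrow> g x > 0"
  shows "Ck_on k U (\<lambda>x. g x powr a)" using assms(2,3)
proof (induction k arbitrary: a)
  case 0
  then show ?case by (fastforce intro!: continuous_intros)
next
  case (Suc k)
  have "((\<lambda>x. g x powr a) has_derivative (\<lambda>h. frechet_derivative g (at x) h * (a * g x powr (a - 1)))) (at x)"
    if "x \<in> U" for x
    using has_derivative_powr[OF Ck_on_has_derivative[OF Suc.prems(1) that] has_derivative_const, of a]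
      Suc.prems(2)[OF that] that by (simp add: powr_diff field_simps)
  then show ?case by (rule Ck_on_SucI[OF assms(1)])
      (use Suc.IH[of "a - 1"] Suc.prems Ck_on_Suc[OF Suc.prems(1)] in
        \<open>auto intro!: Ck_on_bilinear[OF bounded_bilinear_mult assms(1)] Ck_on_const\<close>)
qed

lemma Ck_on_compose:
  fixes \<phi> :: "'a::real_normed_vector \<Rightarrow> 'b::euclidean_space"
  assumes "open U" "Ck_on k U \<phi>" "open V" "Ck_on k V h" "\<phi> ` U \<subseteq> V"
  shows "Ck_on k U (h \<circ> \<phi>)" using assms(2,4)
proof (induction k arbitrary: h)
  case 0
  then show ?case using assms(5) by (metis Ck_on.simps(1) continuous_on_compose continuous_on_subset)
next
  case (Suc k)
  \<comment> \<open>The chain rule, expanded in the basis: the direction enters only through scalar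
    coefficients, so the induction hypothesis applies to each partial derivative of \<open>h\<close>
    along \<phi>.\<close>
  define g' where "g' x v = (\<Sum>b\<in>Basis. (frechet_derivative \<phi> (at x) v \<bullet> b) *\<^sub>R frechet_derivative h (at (\<phi> x)) b)" for x v
  have d: "(h \<circ> \<phi> has_derivative g' x) (at x)" if "x \<in> U" for x
  proof -
    have 1: "(h has_derivative frechet_derivative h (at (\<phi> x))) (at (\<phi> x))"
      using Ck_on_has_derivative[OF Suc.prems(2)] that assms(5) by blast
    then have lin: "linear (frechet_derivative h (at (\<phi> x)))" using has_derivative_linear by blast
    have eq: "g' x v = frechet_derivative h (at (\<phi> x)) (frechet_derivative \<phi> (at x) v)" for v unfolding g'_def
      by (subst (3) euclidean_representation[symmetric])
        (simp only: linear_sum[OF lin] linear_scale[OF lin])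
    show ?thesis using diff_chain_at[OF Ck_on_has_derivative[OF Suc.prems(1) that] 1] eq
      by (simp add: o_def) (metis (no_types, lifting) ext)
  qed
  have h': "Ck_on k U (\<lambda>x. frechet_derivative h (at (\<phi> x)) b)" for b
    using Suc.IH[OF Ck_on_Suc[OF Suc.prems(1)], of "\<lambda>y. frechet_derivative h (at y) b"] Suc.prems(2)
    by (simp add: o_def)
  show ?case unfolding g'_def by (rule Ck_on_SucI[OF assms(1) d[unfolded g'_def]])
      (use h' Suc Ck_on_Suc[OF Suc.prems(1)] in \<open>auto intro!: Ck_on_sum assms(1) Ck_on_bilinear[OF bounded_bilinear_scaleR]
         Ck_on_bounded_linear[OF bounded_linear_inner_left] simp: o_def\<close>)
qed

text \<open>Both iterated derivatives are approximated by the second difference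
  \<open>g (x + h u + h v) - g (x + h u) - g (x + h v) + g x\<close>, divided by \<open>h\<^sup>2\<close>.\<close>

lemma second_difference_bound:
  fixes g :: "'a::real_normed_vector \<Rightarrow> 'b::real_normed_vector"
  assumes h: "h > 0"
    and d1: "\<And>s t. 0 \<le> s \<Longrightarrow> s \<le> h \<Longrightarrow> 0 \<le> t \<Longrightarrow> t \<le> h \<Longrightarrow> g differentiable (at (x + s *\<^sub>R u + t *\<^sub>R v))"
    and d2: "\<And>s t. 0 \<le> s \<Longrightarrow> s \<le> h \<Longrightarrow> 0 \<le> t \<Longrightarrow> t \<le> h \<Longrightarrow>
      (\<lambda>y. frechet_derivative g (at y) u) differentiable (at (x + s *\<^sub>R u + t *\<^sub>R v))"
    and e: "\<And>s t. 0 \<le> s \<Longrightarrow> s \<le> h \<Longrightarrow> 0 \<le> t \<Longrightarrow> t \<le> h \<Longrightarrow>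
      norm (frechet_derivative (\<lambda>y. frechet_derivative g (at y) u) (at (x + s *\<^sub>R u + t *\<^sub>R v)) v - w) \<le> e"
  shows "norm (g (x + h *\<^sub>R u + h *\<^sub>R v) - g (x + h *\<^sub>R u) - g (x + h *\<^sub>R v) + g x - (h * h) *\<^sub>R w) \<le> e * h * h"
proof -
  define G where "G y = frechet_derivative g (at y) u" for y
  have lin: "linear (frechet_derivative g (at (x + s *\<^sub>R u + t *\<^sub>R v)))" if "0 \<le> s" "s \<le> h" "0 \<le> t" "t \<le> h" for s t
    using linear_frechet_derivative d1 that by blast
  have linG: "linear (frechet_derivative G (at (x + s *\<^sub>R u + t *\<^sub>R v)))" if "0 \<le> s" "s \<le> h" "0 \<le> t" "t \<le> h" for s t
    using linear_frechet_derivative d2 that unfolding G_def by blast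
  have dg: "((\<lambda>s. g (x + s *\<^sub>R u + t *\<^sub>R v)) has_derivative (\<lambda>r. r *\<^sub>R G (x + s *\<^sub>R u + t *\<^sub>R v))) (at s within {0..h})"
    if "0 \<le> s" "s \<le> h" "0 \<le> t" "t \<le> h" for s t
    by (rule has_derivative_eq_rhs[OF has_derivative_compose[of "\<lambda>s. x + s *\<^sub>R u + t *\<^sub>R v" "\<lambda>r. r *\<^sub>R u" s "{0..h}" g,
          OF _ d1[OF that, unfolded frechet_derivative_works]]])
      (auto intro!: derivative_eq_intros simp: G_def linear_scale[OF lin[OF that]])
  have dG: "((\<lambda>t. G (x + s *\<^sub>R u + t *\<^sub>R v)) has_derivative
      (\<lambda>r. r *\<^sub>R frechet_derivative G (at (x + s *\<^sub>R u + t *\<^sub>R v)) v)) (at t within {0..h})"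
    if "0 \<le> s" "s \<le> h" "0 \<le> t" "t \<le> h" for s t
    by (rule has_derivative_eq_rhs[OF has_derivative_compose[of "\<lambda>t. x + s *\<^sub>R u + t *\<^sub>R v" "\<lambda>r. r *\<^sub>R v" t "{0..h}" G,
          OF _ d2[OF that, folded G_def, unfolded frechet_derivative_works]]])
      (auto intro!: derivative_eq_intros simp: linear_scale[OF linG[OF that]])
  have e0: "0 \<le> e" using e[of 0 0] h norm_ge_zero order_trans less_imp_le by blast
  have b1: "norm (G (x + s *\<^sub>R u + h *\<^sub>R v) - G (x + s *\<^sub>R u) - h *\<^sub>R w) \<le> e * h" if "0 \<le> s" "s \<le> h" for s
  proof -
    \<comment> \<open>Mean value inequality in \<open>t\<close> at fixed \<open>s\<close>, after
      removal of the expected linear part. The second \<open>k\<close> below repeats the argument in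
      \<open>s\<close>.\<close>
    define k where "k t = G (x + s *\<^sub>R u + t *\<^sub>R v) - t *\<^sub>R w" for t
    have "norm (k h - k 0) \<le> e * norm (h - 0)"
    proof (rule differentiable_bound[of "{0..h}" k])
      fix t assume t: "t \<in> {0..h}"
      show "(k has_derivative (\<lambda>r. r *\<^sub>R (frechet_derivative G (at (x + s *\<^sub>R u + t *\<^sub>R v)) v - w))) (at t within {0..h})"
        unfolding k_def scaleR_diff_right
        using t that by (intro has_derivative_diff dG) (auto intro!: derivative_eq_intros)
      show "onorm (\<lambda>r. r *\<^sub>R (frechet_derivative G (at (x + s *\<^sub>R u + t *\<^sub>R v)) v - w)) \<le> e"
        using e[of s t] t that e0 by (intro onorm_le) (auto simp: G_def[abs_def] mult.commute[of e] intro!: mult_left_mono)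
    qed (use h in auto)
    then show ?thesis using h by (simp add: k_def algebra_simps)
  qed
  define k where "k s = g (x + s *\<^sub>R u + h *\<^sub>R v) - g (x + s *\<^sub>R u + 0 *\<^sub>R v) - s *\<^sub>R h *\<^sub>R w" for s
  have "norm (k h - k 0) \<le> (e * h) * norm (h - 0)"
  proof (rule differentiable_bound[of "{0..h}" k])
    fix s assume s: "s \<in> {0..h}"
    show "(k has_derivative (\<lambda>r. r *\<^sub>R (G (x + s *\<^sub>R u + h *\<^sub>R v) - G (x + s *\<^sub>R u + 0 *\<^sub>R v) - h *\<^sub>R w))) (at s within {0..h})"
      unfolding k_def scaleR_diff_right
      using s h by (intro has_derivative_diff dg) (auto intro!: derivative_eq_intros)
    show "onorm (\<lambda>r. r *\<^sub>R (G (x + s *\<^sub>R u + h *\<^sub>R v) - G (x + s *\<^sub>R u + 0 *\<^sub>R v) - h *\<^sub>R w)) \<le> e * h"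
      using b1[of s] s e0 h by (intro onorm_le) (auto simp: mult.commute[of "e * h"] intro!: mult_left_mono)
  qed (use h in auto)
  then show ?thesis using h by (simp add: k_def algebra_simps)
qed

lemma Ck_on_second_derivative_commute:
  assumes "open U" "x \<in> U" "Ck_on 2 U g"
  shows "frechet_derivative (\<lambda>y. frechet_derivative g (at y) u) (at x) v =
    frechet_derivative (\<lambda>y. frechet_derivative g (at y) v) (at x) u" (is "?a = ?b")
proof (rule ccontr)
  define D where "D u v y = frechet_derivative (\<lambda>y. frechet_derivative g (at y) u) (at y) v" for u v y
  assume "?a \<noteq> ?b"
  \<comment> \<open>Each iterated derivative is within \<open>e\<close> of the same second
    difference quotient, so the two differ by at most \<open>2 * e\<close>, less than the gap
    \<open>3 * e\<close>.\<close>
  define e where "e = norm (?a - ?b) / 3"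
  have e: "e > 0" using \<open>?a \<noteq> ?b\<close> by (simp add: e_def)
  have C: "Ck_on (Suc (Suc 0)) U g" using assms(3) by (simp add: numeral_2_eq_2)
  have cD: "continuous_on U (D u v)" for u v using C unfolding D_def by simp
  have "\<exists>r>0. \<forall>y. norm (y - x) < r \<longrightarrow> y \<in> U \<and> norm (D u v y - D u v x) \<le> e \<and> norm (D v u y - D v u x) \<le> e"
  proof -
    have "isCont (D u v) x" "isCont (D v u) x" using cD assms continuous_on_eq_continuous_at by blast+
    then have "\<exists>r>0. \<forall>y. norm (y - x) < r \<longrightarrow> norm (D u v y - D u v x) < e"
      "\<exists>r>0. \<forall>y. norm (y - x) < r \<longrightarrow> norm (D v u y - D v u x) < e"
      using e by (simp_all add: continuous_at_eps_delta dist_norm)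
    then obtain r1 r2 where "r1 > 0" "\<forall>y. norm (y - x) < r1 \<longrightarrow> norm (D u v y - D u v x) < e"
      "r2 > 0" "\<forall>y. norm (y - x) < r2 \<longrightarrow> norm (D v u y - D v u x) < e" by blast
    moreover have "\<exists>r3>0. \<forall>y. norm (y - x) < r3 \<longrightarrow> y \<in> U"
      using assms(1,2) unfolding open_dist by (simp add: dist_norm)
    then obtain r3 where "r3 > 0" "\<forall>y. norm (y - x) < r3 \<longrightarrow> y \<in> U" by blast
    ultimately show ?thesis by (intro exI[of _ "min r1 (min r2 r3)"]) (auto simp: less_imp_le)
  qed
  then obtain r where r: "r > 0" "\<And>y. norm (y - x) < r \<Longrightarrow> y \<in> U \<and> norm (D u v y - D u v x) \<le> e \<and> norm (D v u y - D v u x) \<le> e"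
    by blast
  \<comment> \<open>Keeps the whole parallelogram of the second difference inside the ball of radius
    \<open>r\<close>; the summand 1 keeps the denominator positive when both directions
    vanish.\<close>
  define h where "h = r / (2 * (norm u + norm v + 1))"
  have h: "h > 0" using r(1) by (simp add: h_def add_nonneg_pos)
  have near: "norm (x + s *\<^sub>R u + t *\<^sub>R v - x) < r" if "0 \<le> s" "s \<le> h" "0 \<le> t" "t \<le> h" for s t
  proof -
    have "norm (x + s *\<^sub>R u + t *\<^sub>R v - x) \<le> s * norm u + t * norm v"
      using norm_triangle_ineq[of "s *\<^sub>R u" "t *\<^sub>R v"] that by simp
    also have "\<dots> \<le> h * norm u + h * norm v" using that by (intro add_mono mult_right_mono) auto
    also have "\<dots> \<le> h * (norm u + norm v + 1)" using h by (simp add: algebra_simps)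
    also have "\<dots> < r"
    proof -
      define K where "K = norm u + norm v + 1"
      have "K \<noteq> 0" unfolding K_def by (smt (verit) norm_ge_zero)
      then have "h * K = r / 2" by (simp add: h_def flip: K_def)
      then show ?thesis using r(1) by (simp add: K_def)
    qed
    finally show ?thesis .
  qed
  have near': "norm (x + s *\<^sub>R v + t *\<^sub>R u - x) < r" if "0 \<le> s" "s \<le> h" "0 \<le> t" "t \<le> h" for s t
    using near[of t s] that by (simp add: algebra_simps)
  have "norm (g (x + h *\<^sub>R u + h *\<^sub>R v) - g (x + h *\<^sub>R u) - g (x + h *\<^sub>R v) + g x - (h * h) *\<^sub>R D u v x) \<le> e * h * h"
    by (rule second_difference_bound[OF h]) (use r(2) near C in \<open>auto simp: D_def\<close>)
  moreover have "norm (g (x + h *\<^sub>R v + h *\<^sub>R u) - g (x + h *\<^sub>R v) - g (x + h *\<^sub>R u) + g x - (h * h) *\<^sub>R D v u x) \<le> e * h * h"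
    by (rule second_difference_bound[OF h]) (use r(2) near' C in \<open>auto simp: D_def\<close>)
  moreover have "(h * h) *\<^sub>R (D v u x - D u v x) =
      (g (x + h *\<^sub>R u + h *\<^sub>R v) - g (x + h *\<^sub>R u) - g (x + h *\<^sub>R v) + g x - (h * h) *\<^sub>R D u v x) -
      (g (x + h *\<^sub>R v + h *\<^sub>R u) - g (x + h *\<^sub>R v) - g (x + h *\<^sub>R u) + g x - (h * h) *\<^sub>R D v u x)"
    by (simp add: algebra_simps)
  ultimately have "norm ((h * h) *\<^sub>R (D v u x - D u v x)) \<le> e * h * h + e * h * h"
    by (simp only: order_trans[OF norm_triangle_ineq4 add_mono])
  moreover have "norm ((h * h) *\<^sub>R (D v u x - D u v x)) = (h * h) * norm (D v u x - D u v x)" by simp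
  moreover have "e * h * h + e * h * h = (h * h) * (2 * e)" by (simp add: algebra_simps)
  ultimately have "(h * h) * norm (D v u x - D u v x) \<le> (h * h) * (2 * e)" by (simp only:)
  then have "norm (D v u x - D u v x) \<le> 2 * e" by (rule mult_left_le_imp_le) (use h in simp)
  moreover have "norm (D v u x - D u v x) = 3 * e" by (simp add: e_def D_def norm_minus_commute)
  ultimately show False using e by simp
qed

section \<open>Calculus on surfaces\<close>

context
  fixes c :: "'m::smooth_surface chart"
  assumes c: "c \<in> atlas"
begin

lemma open_chart: "open (fst c)" and inj_chart: "inj_on (snd c) (fst c)"
  and open_chart_image: "W \<subseteq> fst c \<Longrightarrow> open (snd c ` W) \<longleftrightarrow> open W"
  using chart_homeomorphism[of "fst c" "snd c"] c by auto

lemma chart_inv_chart [simp]: "x \<in> fst c \<Longrightarrow> chart_inv c (snd c x) = x" by (simp add: chart_inv_def inj_chart)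

lemma open_chart_image_Int: "open U \<Longrightarrow> open (snd c ` (fst c \<inter> U))"
  using open_chart_image[of "fst c \<inter> U"] open_chart by auto

lemma smooth_transition:
  assumes "c' \<in> atlas"
  shows "smooth_on (snd c ` (fst c \<inter> fst c')) (snd c' \<circ> chart_inv c)"
  using atlas_compatible[of "fst c" "snd c" "fst c'" "snd c'"] assms c by (simp add: chart_inv_def)

end

lemma chart_at: "chart_at x \<in> atlas" "x \<in> fst (chart_at x)"
proof -
  have "\<exists>c. c \<in> atlas \<and> x \<in> fst c" using atlas_cover[of x] by auto
  from someI_ex[OF this] show "chart_at x \<in> atlas" "x \<in> fst (chart_at x)" by (simp_all add: chart_at_def)
qed

lemma smooth_onD: "smooth_on U g \<Longrightarrow> Ck_on k U g" by (simp add: smooth_on_def)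

text \<open>Transition maps are smooth, so one chart whose domain contains \<open>U\<close> decides
  smoothness in all charts.\<close>

lemma smooth_chartI:
  assumes c: "c \<in> atlas" and U: "open U" "U \<subseteq> fst c" and s: "smooth_on (snd c ` U) (g \<circ> chart_inv c)"
  shows "smooth_map_on U g" unfolding smooth_map_on_def smooth_on_def
proof (intro ballI allI)
  fix c' :: "'a chart" and k assume c': "c' \<in> atlas"
  let ?W = "snd c' ` (fst c' \<inter> U)"
  have o: "open ?W" "open (snd c ` U)"
    using open_chart_image_Int[OF c' U(1)] open_chart_image[OF c U(2)] U(1) by auto
  have "Ck_on k ?W (snd c \<circ> chart_inv c')"
    by (rule Ck_on_subset[OF smooth_onD[OF smooth_transition[OF c' c]]]) (use U in auto)
  moreover have "(snd c \<circ> chart_inv c') ` ?W \<subseteq> snd c ` U" using c' by auto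
  ultimately have "Ck_on k ?W ((g \<circ> chart_inv c) \<circ> (snd c \<circ> chart_inv c'))"
    using Ck_on_compose[OF o(1) _ o(2) smooth_onD[OF s]] by blast
  then show "Ck_on k ?W (g \<circ> chart_inv c')" by (rule Ck_on_cong[OF o(1), rotated]) (use c c' U(2) in auto)
qed

lemma smooth_chartD:
  assumes "c \<in> atlas" "U \<subseteq> fst c" "smooth_map_on U g"
  shows "smooth_on (snd c ` U) (g \<circ> chart_inv c)" using assms by (auto simp: smooth_map_on_def Int_absorb1)

lemma smooth_subset: "smooth_map_on U g \<Longrightarrow> W \<subseteq> U \<Longrightarrow> smooth_map_on W g" unfolding smooth_map_on_def smooth_on_def
  by (meson Ck_on_subset Int_mono image_mono order_refl)

lemma smooth_local:
  assumes "\<And>x. x \<in> U \<Longrightarrow> \<exists>W. open W \<and> x \<in> W \<and> smooth_map_on W g"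
  shows "smooth_map_on U g" unfolding smooth_map_on_def smooth_on_def
proof (intro ballI allI Ck_on_local)
  fix c :: "'a chart" and k y assume c: "c \<in> atlas" and "y \<in> snd c ` (fst c \<inter> U)"
  then obtain x where x: "x \<in> fst c" "x \<in> U" "y = snd c x" by auto
  obtain W where W: "open W" "x \<in> W" "smooth_map_on W g" using assms[OF x(2)] by blast
  show "\<exists>V. open V \<and> y \<in> V \<and> Ck_on k V (g \<circ> chart_inv c)" using open_chart_image_Int[OF c W(1)] W x c
    by (intro exI[of _ "snd c ` (fst c \<inter> W)"]) (auto simp: smooth_map_on_def smooth_on_def)
qed

lemma smooth_pointwise:
  assumes "\<And>x. x \<in> U \<Longrightarrow> \<exists>W. open W \<and> x \<in> W \<and> smooth_map_on (W \<inter> U) g" "open U"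
  shows "smooth_map_on U g" by (rule smooth_local) (metis assms IntI open_Int)

lemma smooth_cong:
  assumes "open U" "\<And>x. x \<in> U \<Longrightarrow> g x = h x" "smooth_map_on U g"
  shows "smooth_map_on U h" unfolding smooth_map_on_def smooth_on_def
proof (intro ballI allI)
  fix c :: "'a chart" and k assume c: "c \<in> atlas"
  show "Ck_on k (snd c ` (fst c \<inter> U)) (h \<circ> chart_inv c)"
    by (rule Ck_on_cong[OF open_chart_image_Int[OF c assms(1)], of "g \<circ> chart_inv c"])
      (use c assms in \<open>auto simp: smooth_map_on_def smooth_on_def\<close>)
qed

lemma smooth_const: "smooth_map_on U (\<lambda>_. a)"
  by (auto simp: smooth_map_on_def smooth_on_def o_def Ck_on_const)

lemma smooth_bounded_linear:
  assumes "bounded_linear f" "open U" "smooth_map_on U g"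
  shows "smooth_map_on U (\<lambda>x. f (g x))"
  using assms Ck_on_bounded_linear[OF assms(1) open_chart_image_Int[OF _ assms(2)]]
  by (fastforce simp: smooth_map_on_def smooth_on_def o_def)

lemma smooth_bilinear:
  assumes "bounded_bilinear B" "open U" "smooth_map_on U g" "smooth_map_on U h"
  shows "smooth_map_on U (\<lambda>x. B (g x) (h x))"
  using assms Ck_on_bilinear[OF assms(1) open_chart_image_Int[OF _ assms(2)]]
  by (fastforce simp: smooth_map_on_def smooth_on_def o_def)

lemma smooth_sum:
  assumes "open U" "\<And>i. i \<in> I \<Longrightarrow> smooth_map_on U (g i)"
  shows "smooth_map_on U (\<lambda>x. \<Sum>i\<in>I. g i x)"
  using assms(2) Ck_on_sum[OF open_chart_image_Int[OF _ assms(1)], of _ I]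
  by (fastforce simp: smooth_map_on_def smooth_on_def o_def)

lemma smooth_add:
  assumes "open U" "smooth_map_on U g" "smooth_map_on U h"
  shows "smooth_map_on U (\<lambda>x. g x + h x)" using assms Ck_on_add[OF open_chart_image_Int[OF _ assms(1)]]
  by (fastforce simp: smooth_map_on_def smooth_on_def o_def)

lemmas smooth_minus = smooth_bounded_linear[OF bounded_linear_minus[OF bounded_linear_ident]]
lemmas smooth_scaleR = smooth_bilinear[OF bounded_bilinear_scaleR]
lemmas smooth_mult = smooth_bilinear[OF bounded_bilinear_mult]
lemmas smooth_inner = smooth_bilinear[OF bounded_bilinear_inner]

lemma smooth_diff:
  assumes "open U" "smooth_map_on U g" "smooth_map_on U h"
  shows "smooth_map_on U (\<lambda>x. g x - h x)" using smooth_add[OF assms(1,2) smooth_minus[OF assms(1,3)]] by simp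

lemma smooth_powr:
  fixes g :: "'m::smooth_surface \<Rightarrow> real"
  assumes "open U" "smooth_map_on U g" "\<And>x. x \<in> U \<Longrightarrow> g x > 0"
  shows "smooth_map_on U (\<lambda>x. g x powr a)" unfolding smooth_map_on_def smooth_on_def
proof (intro ballI allI)
  fix c :: "'m chart" and k assume c: "c \<in> atlas"
  show "Ck_on k (snd c ` (fst c \<inter> U)) ((\<lambda>x. g x powr a) \<circ> chart_inv c)"
    using Ck_on_powr[OF open_chart_image_Int[OF c assms(1)], of k "g \<circ> chart_inv c" a] assms c
    by (fastforce simp: smooth_map_on_def smooth_on_def o_def)
qed

lemma smooth_inverse:
  fixes g :: "'m::smooth_surface \<Rightarrow> real"
  assumes "open U" "smooth_map_on U g" "\<And>x. x \<in> U \<Longrightarrow> g x \<noteq> 0"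
  shows "smooth_map_on U (\<lambda>x. inverse (g x))"
proof -
  \<comment> \<open>\<open>powr\<close> wants a positive base while \<open>g\<close> may be
    negative, so 1/g is written as g times the power -1 of its square.\<close>
  have "smooth_map_on U (\<lambda>x. g x * (g x * g x) powr (-1))"
    using assms by (intro smooth_mult smooth_powr) (simp_all flip: power2_eq_square)
  moreover have "g x * (g x * g x) powr (-1) = inverse (g x)" if "x \<in> U" for x
    using assms(3)[OF that] by (simp add: powr_minus field_simps)
  ultimately show ?thesis by (rule smooth_cong[OF assms(1), rotated])
qed

lemma smooth_divide:
  fixes g :: "'m::smooth_surface \<Rightarrow> real"
  assumes "open U" "smooth_map_on U h" "smooth_map_on U g" "\<And>x. x \<in> U \<Longrightarrow> g x \<noteq> 0"
  shows "smooth_map_on U (\<lambda>x. h x / g x)"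
  unfolding divide_inverse using assms by (intro smooth_mult smooth_inverse)

lemmas smooth_intros = smooth_const smooth_scaleR smooth_mult smooth_inner
  smooth_sum smooth_add smooth_diff smooth_minus smooth_divide

lemma smooth_continuous:
  assumes "open U" "smooth_map_on U g"
  shows "continuous_on U g"
proof (intro continuous_at_imp_continuous_on ballI)
  fix x assume x: "x \<in> U"
  define c where "c = chart_at x"
  define W where "W = fst c \<inter> U"
  have c: "c \<in> atlas" "x \<in> fst c" using chart_at by (auto simp: c_def)
  have oW: "open W" using assms(1) open_chart[OF c(1)] by (auto simp: W_def)
  have "continuous_on (snd c ` W) (g \<circ> chart_inv c)"
    using assms(2) c(1) smooth_onD[of _ _ 0] by (fastforce simp: smooth_map_on_def W_def)
  moreover have "continuous_on W (snd c)"
  proof (subst continuous_on_open_vimage[OF oW], intro allI impI)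
    fix B :: "(real^2) set" assume B: "open B"
    have "snd c ` (snd c -` B \<inter> W) = B \<inter> snd c ` W" by auto
    moreover have "open (B \<inter> snd c ` W)" using B open_chart_image[OF c(1), of W] oW by (auto simp: W_def)
    ultimately show "open (snd c -` B \<inter> W)"
      using open_chart_image[OF c(1), of "snd c -` B \<inter> W"] by (auto simp: W_def)
  qed
  ultimately have "continuous_on W ((g \<circ> chart_inv c) \<circ> snd c)" by (rule continuous_on_compose[rotated])
  then have "continuous_on W g"
    by (rule continuous_on_cong[THEN iffD1, rotated 2]) (use c in \<open>auto simp: W_def\<close>)
  then show "isCont g x" using oW x c(2) continuous_on_eq_continuous_at by (auto simp: W_def)
qed

subsection \<open>Directional derivatives\<close>

lemma smooth_map_has_derivative:
  assumes "open U" "smooth_map_on U g" "x \<in> U" "c \<in> atlas" "x \<in> fst c"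
  shows "((g \<circ> chart_inv c) has_derivative frechet_derivative (g \<circ> chart_inv c) (at (snd c x))) (at (snd c x))"
  by (rule Ck_on_has_derivative[of 0 "snd c ` (fst c \<inter> U)"], rule smooth_onD)
    (use assms in \<open>auto simp: smooth_map_on_def\<close>)

lemma tderiv_has_derivative:
  assumes "open U" "smooth_map_on U g" "x \<in> U"
  shows "((g \<circ> chart_inv (chart_at x)) has_derivative tderiv g x) (at (snd (chart_at x) x))"
  using smooth_map_has_derivative[OF assms chart_at] by (simp add: tderiv_def[abs_def])

lemma tderivI:
  assumes "((g \<circ> chart_inv (chart_at x)) has_derivative D) (at (snd (chart_at x) x))"
  shows "tderiv g x X = D X" using frechet_derivative_at[OF assms] by (simp add: tderiv_def)

lemma tderiv_linear:
  assumes "open U" "smooth_map_on U g" "x \<in> U"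
  shows "linear (tderiv g x)" using tderiv_has_derivative[OF assms] has_derivative_linear by blast

lemma tderiv_cong:
  assumes "open U" "x \<in> U" "smooth_map_on U g" "\<And>y. y \<in> U \<Longrightarrow> g y = h y"
  shows "tderiv h x X = tderiv g x X"
proof (rule tderivI)
  let ?c = "chart_at x"
  show "((h \<circ> chart_inv ?c) has_derivative tderiv g x) (at (snd ?c x))"
    by (rule has_derivative_transform_within_open[OF tderiv_has_derivative[OF assms(1,3,2)]
          open_chart_image_Int[OF chart_at(1) assms(1)]]) (use assms chart_at[of x] in auto)
qed

lemma tderiv_const [simp]: "tderiv (\<lambda>_. a) x X = 0" by (simp add: tderiv_def o_def)

lemma tderiv_bounded_linear:
  assumes "bounded_linear f" "open U" "smooth_map_on U g" "x \<in> U"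
  shows "tderiv (\<lambda>y. f (g y)) x X = f (tderiv g x X)"
  using bounded_linear.has_derivative[OF assms(1) tderiv_has_derivative[OF assms(2-4)]]
  by (intro tderivI) (simp add: o_def)

lemma tderiv_bilinear:
  assumes "bounded_bilinear B" "open U" "smooth_map_on U g" "smooth_map_on U h" "x \<in> U"
  shows "tderiv (\<lambda>y. B (g y) (h y)) x X = B (g x) (tderiv h x X) + B (tderiv g x X) (h x)"
  using bounded_bilinear.FDERIV[OF assms(1) tderiv_has_derivative[OF assms(2,3,5)] tderiv_has_derivative[OF assms(2,4,5)]]
    chart_at[of x] by (intro tderivI) (simp add: o_def)

lemma tderiv_add:
  assumes "open U" "smooth_map_on U g" "smooth_map_on U h" "x \<in> U"
  shows "tderiv (\<lambda>y. g y + h y) x X = tderiv g x X + tderiv h x X"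
  using has_derivative_add[OF tderiv_has_derivative[OF assms(1,2,4)] tderiv_has_derivative[OF assms(1,3,4)]]
  by (intro tderivI) (simp add: o_def)

lemma tderiv_diff:
  assumes "open U" "smooth_map_on U g" "smooth_map_on U h" "x \<in> U"
  shows "tderiv (\<lambda>y. g y - h y) x X = tderiv g x X - tderiv h x X"
  using has_derivative_diff[OF tderiv_has_derivative[OF assms(1,2,4)] tderiv_has_derivative[OF assms(1,3,4)]]
  by (intro tderivI) (simp add: o_def)

lemma tderiv_sum:
  assumes "open U" "\<And>i. i \<in> I \<Longrightarrow> smooth_map_on U (g i)" "x \<in> U"
  shows "tderiv (\<lambda>y. \<Sum>i\<in>I. g i y) x X = (\<Sum>i\<in>I. tderiv (g i) x X)"
  using has_derivative_sum[of I, OF tderiv_has_derivative[OF assms(1) assms(2) assms(3)]]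
  by (intro tderivI) (simp add: o_def)

lemmas tderiv_scaleR = tderiv_bilinear[OF bounded_bilinear_scaleR]
lemmas tderiv_scaleR_right = tderiv_bounded_linear[OF bounded_linear_scaleR_right]

text \<open>Chain rule through the transition map to the preferred chart. It removes the
  discontinuously varying \<open>chart_at\<close> from all later computations: along coordinate
  fields of \<open>c\<close>, \<open>tderiv\<close> is the partial derivative in
  \<open>c\<close>.\<close>

lemma tderiv_chart:
  assumes U: "open U" "smooth_map_on U g" "x \<in> U" and c: "c \<in> atlas" "x \<in> fst c"
  shows "tderiv g x (coord_field c e x) = frechet_derivative (g \<circ> chart_inv c) (at (snd c x)) e"
proof -
  let ?c = "chart_at x"
  let ?t = "snd ?c \<circ> chart_inv c"
  let ?W = "snd c ` (fst c \<inter> (U \<inter> fst ?c))"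
  have W: "open ?W" "snd c x \<in> ?W"
    using open_chart_image_Int[OF c(1) open_Int[OF U(1) open_chart[OF chart_at(1)[of x]]]] U(3) c chart_at[of x] by auto
  have t: "(?t has_derivative (\<lambda>e. coord_field c e x)) (at (snd c x))"
    using Ck_on_has_derivative[of 0 ?W ?t "snd c x"] W
      Ck_on_subset[OF smooth_onD[OF smooth_transition[OF c(1) chart_at(1), of x], of "Suc 0"], of ?W]
    by (auto simp: coord_field_def[abs_def])
  have "?t (snd c x) = snd ?c x" using c by simp
  then have "((g \<circ> chart_inv ?c) \<circ> ?t has_derivative tderiv g x \<circ> (\<lambda>e. coord_field c e x)) (at (snd c x))"
    using diff_chain_at[OF t] tderiv_has_derivative[OF U] by simp
  then have "(g \<circ> chart_inv c has_derivative tderiv g x \<circ> (\<lambda>e. coord_field c e x)) (at (snd c x))"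
    by (rule has_derivative_transform_within_open[OF _ W]) (use c chart_at(1)[of x] in auto)
  from frechet_derivative_at[OF this, THEN fun_cong, of e] show ?thesis by simp
qed

lemma smooth_chart: "c \<in> atlas \<Longrightarrow> smooth_map_on (fst c) (snd c)"
proof (rule smooth_chartI[of c])
  assume c: "c \<in> atlas"
  have "Ck_on k (snd c ` fst c) (snd c \<circ> chart_inv c)" for k
  proof (rule Ck_on_cong[of _ "\<lambda>x. x"])
    show "Ck_on k (snd c ` fst c) (\<lambda>x. x)"
      by (cases k) (auto simp: Ck_on_const frechet_derivative_id[unfolded id_def])
  qed (use open_chart_image[OF c, of "fst c"] open_chart[OF c] c in auto)
  then show "smooth_on (snd c ` fst c) (snd c \<circ> chart_inv c)" by (simp add: smooth_on_def)
qed (use open_chart[of c] in auto)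

lemma tderiv_chart_coord_field:
  assumes c: "c \<in> atlas" "x \<in> fst c"
  shows "tderiv (snd c) x (coord_field c e x) = e"
proof -
  have "frechet_derivative (snd c \<circ> chart_inv c) (at (snd c x)) = frechet_derivative (\<lambda>y. y) (at (snd c x))"
    by (rule sym, rule frechet_derivative_transform_within_open[where X = "snd c ` fst c"])
      (use c open_chart_image[OF c(1), of "fst c"] open_chart[OF c(1)] in auto)
  then show ?thesis using tderiv_chart[OF open_chart[OF c(1)] smooth_chart[OF c(1)] c(2) c, of e]
    by (simp add: frechet_derivative_id[unfolded id_def])
qed

lemma coord_field_linear:
  assumes c: "c \<in> atlas" "x \<in> fst c"
  shows "linear (\<lambda>e. coord_field c e x)"
proof -
  let ?c = "chart_at x"
  have "coord_field c e x = tderiv (snd ?c) x (coord_field c e x)" for e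
    using smooth_map_has_derivative[OF open_chart smooth_chart, OF chart_at(1) chart_at(1) chart_at(2) c]
      tderiv_chart[OF open_chart smooth_chart, OF chart_at(1) chart_at(1) chart_at(2) c]
    by (simp add: coord_field_def)
  then have "(\<lambda>e. coord_field c e x) = frechet_derivative (snd ?c \<circ> chart_inv c) (at (snd c x))"
    by (auto simp: coord_field_def)
  then show ?thesis
    using smooth_map_has_derivative[OF open_chart smooth_chart, OF chart_at(1) chart_at(1) chart_at(2) c]
      has_derivative_linear by metis
qed

lemma coord_field_tderiv_chart:
  assumes c: "c \<in> atlas" "x \<in> fst c"
  shows "coord_field c (tderiv (snd c) x X) x = X"
proof -
  have "inj (\<lambda>e. coord_field c e x)" using tderiv_chart_coord_field[OF c] by (metis injI)
  then have "surj (\<lambda>e. coord_field c e x)"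
    using linear_injective_imp_surjective[OF coord_field_linear[OF c]] by blast
  then obtain e where "X = coord_field c e x" by auto
  then show ?thesis using tderiv_chart_coord_field[OF c] by simp
qed

lemma smooth_coord_deriv:
  assumes "open U" "smooth_map_on U g" "c \<in> atlas" "U \<subseteq> fst c"
  shows "smooth_map_on U (\<lambda>x. tderiv g x (coord_field c e x))"
proof (rule smooth_chartI[OF assms(3,1,4)])
  have s: "smooth_on (snd c ` U) (g \<circ> chart_inv c)" using smooth_chartD assms by blast
  have "Ck_on k (snd c ` U) ((\<lambda>x. tderiv g x (coord_field c e x)) \<circ> chart_inv c)" for k
  proof (rule Ck_on_cong)
    show "Ck_on k (snd c ` U) (\<lambda>y. frechet_derivative (g \<circ> chart_inv c) (at y) e)"
      using smooth_onD[OF s, of "Suc k"] by simp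
  qed (use assms open_chart_image[OF assms(3)] tderiv_chart[OF assms(1,2) _ assms(3)] in auto)
  then show "smooth_on (snd c ` U) ((\<lambda>x. tderiv g x (coord_field c e x)) \<circ> chart_inv c)"
    by (simp add: smooth_on_def)
qed

lemma coord_deriv_commute:
  assumes U: "open U" "smooth_map_on U g" "x \<in> U" and c: "c \<in> atlas" "x \<in> fst c"
  shows "tderiv (\<lambda>y. tderiv g y (coord_field c e y)) x (coord_field c e' x) =
    tderiv (\<lambda>y. tderiv g y (coord_field c e' y)) x (coord_field c e x)"
proof -
  let ?W = "U \<inter> fst c"
  let ?V = "snd c ` ?W"
  have W: "open ?W" "x \<in> ?W" "?W \<subseteq> fst c" "smooth_map_on ?W g"
    using U c open_chart[OF c(1)] smooth_subset[OF U(2), of ?W] by auto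
  have V: "open ?V" "snd c x \<in> ?V" using open_chart_image[OF c(1), of ?W] W by auto
  have C: "Ck_on 2 ?V (g \<circ> chart_inv c)" using smooth_chartD[OF c(1) W(3,4)] by (rule smooth_onD)
  have "tderiv (\<lambda>y. tderiv g y (coord_field c e y)) x (coord_field c e' x) =
      frechet_derivative (\<lambda>y. frechet_derivative (g \<circ> chart_inv c) (at y) e) (at (snd c x)) e'" for e e'
  proof -
    let ?G = "(\<lambda>y. tderiv g y (coord_field c e y)) \<circ> chart_inv c"
    have s: "smooth_map_on ?W (\<lambda>y. tderiv g y (coord_field c e y))"
      using smooth_coord_deriv[OF W(1,4) c(1) W(3)] .
    have "frechet_derivative ?G (at (snd c x)) =
        frechet_derivative (\<lambda>y. frechet_derivative (g \<circ> chart_inv c) (at y) e) (at (snd c x))"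
    proof (rule frechet_derivative_transform_within_open[OF _ V])
      show "?G differentiable at (snd c x)"
        using smooth_map_has_derivative[OF W(1) s W(2) c] differentiable_def by blast
    qed (use W c tderiv_chart[OF W(1,4) _ c(1)] in auto)
    then show ?thesis using tderiv_chart[OF W(1) s W(2) c] by simp
  qed
  then show ?thesis using Ck_on_second_derivative_commute[OF V C] by simp
qed

subsection \<open>Vector fields\<close>

text \<open>Localised \<open>smooth_vector_field\<close>: a curvature direction has a smooth
  representative without zeros only locally in general, since a line bundle may be twisted.\<close>

definition smooth_field_on :: "'m::smooth_surface set \<Rightarrow> ('m \<Rightarrow> real^2) \<Rightarrow> bool" where
  "smooth_field_on U X \<longleftrightarrow> (\<forall>c\<in>atlas. smooth_map_on (fst c \<inter> U) (\<lambda>x. tderiv (snd c) x (X x)))"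

lemma smooth_field_on_subset: "smooth_field_on U X \<Longrightarrow> W \<subseteq> U \<Longrightarrow> smooth_field_on W X"
  unfolding smooth_field_on_def by (meson Int_mono order_refl smooth_subset)

lemma tderiv_coords:
  assumes U: "open U" "smooth_map_on U g" "x \<in> U" and c: "c \<in> atlas" "x \<in> fst c"
  shows "tderiv g x X = (\<Sum>b\<in>Basis. (tderiv (snd c) x X \<bullet> b) *\<^sub>R tderiv g x (coord_field c b x))"
proof -
  have lin: "linear (\<lambda>e. tderiv g x (coord_field c e x))"
    using linear_compose[OF coord_field_linear[OF c] tderiv_linear[OF U]] by (simp add: o_def)
  have "tderiv g x X = tderiv g x (coord_field c (tderiv (snd c) x X) x)"
    by (simp add: coord_field_tderiv_chart[OF c])
  also have "\<dots> = tderiv g x (coord_field c (\<Sum>b\<in>Basis. (tderiv (snd c) x X \<bullet> b) *\<^sub>R b) x)"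
    by (simp add: euclidean_representation)
  also have "\<dots> = (\<Sum>b\<in>Basis. (tderiv (snd c) x X \<bullet> b) *\<^sub>R tderiv g x (coord_field c b x))"
    by (simp only: linear_sum[OF lin] linear_scale[OF lin])
  finally show ?thesis .
qed

lemma smooth_field_deriv:
  assumes "open U" "smooth_map_on U g" "smooth_field_on U X"
  shows "smooth_map_on U (\<lambda>x. tderiv g x (X x))"
proof (rule smooth_pointwise[OF _ assms(1)])
  fix x assume "x \<in> U"
  define c where "c = chart_at x"
  have c: "c \<in> atlas" "x \<in> fst c" using chart_at by (auto simp: c_def)
  let ?W = "fst c \<inter> U"
  have W: "open ?W" using assms(1) open_chart[OF c(1)] by auto
  have "smooth_map_on ?W (\<lambda>x. \<Sum>b\<in>Basis. (tderiv (snd c) x (X x) \<bullet> b) *\<^sub>R tderiv g x (coord_field c b x))"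
    using assms c W smooth_subset[OF assms(2), of ?W]
    by (intro smooth_intros smooth_coord_deriv[OF W]) (auto simp: smooth_field_on_def)
  then have "smooth_map_on ?W (\<lambda>x. tderiv g x (X x))" by (rule smooth_cong[OF W, rotated])
      (use tderiv_coords[OF assms(1,2) _ c(1)] in auto)
  then show "\<exists>W. open W \<and> x \<in> W \<and> smooth_map_on (W \<inter> U) (\<lambda>x. tderiv g x (X x))" using open_chart c by blast
qed

lemma smooth_field_onI:
  assumes "open U" "\<And>x. x \<in> U \<Longrightarrow> \<exists>c W u. c \<in> atlas \<and> open W \<and> x \<in> W \<and> W \<subseteq> fst c \<and> smooth_map_on W u \<and>
    (\<forall>y\<in>W. X y = coord_field c (u y) y)"
  shows "smooth_field_on U X" unfolding smooth_field_on_def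
proof (intro ballI smooth_local)
  fix c' :: "'a chart" and x assume c': "c' \<in> atlas" and x: "x \<in> fst c' \<inter> U"
  obtain c W u where cW: "c \<in> atlas \<and> open W \<and> x \<in> W \<and> W \<subseteq> fst c \<and> smooth_map_on W u \<and>
      (\<forall>y\<in>W. X y = coord_field c (u y) y)" using assms(2)[OF IntD2[OF x]] by (elim exE)
  then have c: "c \<in> atlas" and W: "open W" "x \<in> W" "W \<subseteq> fst c" "smooth_map_on W u"
    "\<And>y. y \<in> W \<Longrightarrow> X y = coord_field c (u y) y" by auto
  let ?W = "W \<inter> fst c'"
  have oW: "open ?W" and s: "smooth_map_on ?W (snd c')" and u: "smooth_map_on ?W u"
    using W(1) open_chart[OF c'] smooth_subset[OF smooth_chart[OF c']] smooth_subset[OF W(4)] by auto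
  have "smooth_map_on ?W (\<lambda>y. \<Sum>b\<in>Basis. (u y \<bullet> b) *\<^sub>R tderiv (snd c') y (coord_field c b y))"
    using oW s u W(3) c by (intro smooth_intros smooth_coord_deriv) auto
  then have "smooth_map_on ?W (\<lambda>y. tderiv (snd c') y (X y))" by (rule smooth_cong[OF oW, rotated])
      (use W c tderiv_coords[OF oW s _ c] tderiv_chart_coord_field[OF c] in \<open>auto simp: subset_iff\<close>)
  then show "\<exists>W. open W \<and> x \<in> W \<and> smooth_map_on W (\<lambda>x. tderiv (snd c') x (X x))" using oW x W(2) by blast
qed

lemma smooth_field_scaleR:
  assumes U: "open U" and h: "smooth_map_on U h" and X: "smooth_field_on U X"
  shows "smooth_field_on U (\<lambda>x. h x *\<^sub>R X x)" unfolding smooth_field_on_def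
proof
  fix c :: "'a chart" assume c: "c \<in> atlas"
  have o: "open (fst c \<inter> U)" using open_chart[OF c] U by auto
  have "smooth_map_on (fst c \<inter> U) (\<lambda>x. h x *\<^sub>R tderiv (snd c) x (X x))"
    using X c o smooth_subset[OF h] by (intro smooth_scaleR) (auto simp: smooth_field_on_def)
  then show "smooth_map_on (fst c \<inter> U) (\<lambda>x. tderiv (snd c) x (h x *\<^sub>R X x))"
    by (rule smooth_cong[OF o, rotated])
      (use tderiv_linear[OF open_chart[OF c] smooth_chart[OF c]] linear_scale in fastforce)
qed

text \<open>\<open>Z\<close> is the value at \<open>x\<close> of the Lie bracket. The second order
  terms are symmetric in the two directions and cancel; what remains are derivatives of the
  components of the fields.\<close>

lemma commutator:
  assumes U: "open U" "smooth_map_on U g" "x \<in> U" and X: "smooth_field_on U X" and Y: "smooth_field_on U Y"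
  obtains Z where "tderiv (\<lambda>y. tderiv g y (Y y)) x (X x) = tderiv (\<lambda>y. tderiv g y (X y)) x (Y x) + tderiv g x Z"
proof -
  define c where "c = chart_at x"
  have c: "c \<in> atlas" "x \<in> fst c" using chart_at by (auto simp: c_def)
  define W where "W = fst c \<inter> U"
  have W: "open W" "x \<in> W" "smooth_map_on W g" "W \<subseteq> fst c"
    using U c open_chart[OF c(1)] smooth_subset[OF U(2), of W] by (auto simp: W_def)
  define D where "D Z y = tderiv (snd c) y (Z y)" for Z y
  have sD: "smooth_map_on W (D X)" "smooth_map_on W (D Y)"
    using X Y c by (auto simp: smooth_field_on_def D_def[abs_def] W_def)
  have lin: "linear (\<lambda>e. tderiv g x (coord_field c e x))"
    using linear_compose[OF coord_field_linear[OF c] tderiv_linear[OF U]] by (simp add: o_def)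
  let ?d = "\<lambda>b y. tderiv g y (coord_field c b y)"
  have sd: "smooth_map_on W (?d b)" for b by (rule smooth_coord_deriv[OF W(1,3) c(1) W(4)])
  have eq: "tderiv (\<lambda>y. tderiv g y (P y)) x (Q x) = (\<Sum>b\<in>Basis. \<Sum>b'\<in>Basis.
      ((D P x \<bullet> b) * (D Q x \<bullet> b')) *\<^sub>R tderiv (?d b) x (coord_field c b' x)) + ?d (tderiv (D P) x (Q x)) x"
    if P: "smooth_map_on W (D P)" for P Q
  proof -
    have s1: "smooth_map_on W (\<lambda>y. D P y \<bullet> b)" for b by (intro smooth_intros P W)
    have 1: "smooth_map_on W (\<lambda>y. \<Sum>b\<in>Basis. (D P y \<bullet> b) *\<^sub>R ?d b y)" by (intro smooth_intros sd P W)
    have "tderiv (\<lambda>y. tderiv g y (P y)) x (Q x) = tderiv (\<lambda>y. \<Sum>b\<in>Basis. (D P y \<bullet> b) *\<^sub>R ?d b y) x (Q x)"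
      by (rule tderiv_cong[OF W(1,2) 1]) (use tderiv_coords[OF W(1,3) _ c(1)] W(4) in \<open>auto simp: D_def\<close>)
    also have "\<dots> = (\<Sum>b\<in>Basis. (D P x \<bullet> b) *\<^sub>R tderiv (?d b) x (Q x) + (tderiv (D P) x (Q x) \<bullet> b) *\<^sub>R ?d b x)"
      by (subst tderiv_sum[OF W(1) _ W(2)])
        (auto intro!: smooth_intros sd P W sum.cong simp: tderiv_scaleR[OF W(1) s1 sd W(2)]
          tderiv_bounded_linear[OF bounded_linear_inner_left W(1) P W(2)])
    also have "\<dots> = (\<Sum>b\<in>Basis. (D P x \<bullet> b) *\<^sub>R tderiv (?d b) x (Q x)) + ?d (tderiv (D P) x (Q x)) x"
      unfolding sum.distrib by (subst (2) euclidean_representation[symmetric, of "tderiv (D P) x (Q x)"])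
        (simp only: linear_sum[OF lin] linear_scale[OF lin])
    also have "(\<Sum>b\<in>Basis. (D P x \<bullet> b) *\<^sub>R tderiv (?d b) x (Q x)) = (\<Sum>b\<in>Basis. \<Sum>b'\<in>Basis.
      ((D P x \<bullet> b) * (D Q x \<bullet> b')) *\<^sub>R tderiv (?d b) x (coord_field c b' x))"
      by (intro sum.cong refl, subst tderiv_coords[OF W(1) sd W(2) c, of _ "Q x"])
        (simp add: scaleR_sum_right D_def)
    finally show ?thesis .
  qed
  have "(\<Sum>b\<in>Basis. \<Sum>b'\<in>Basis. ((D X x \<bullet> b) * (D Y x \<bullet> b')) *\<^sub>R tderiv (?d b) x (coord_field c b' x)) =
      (\<Sum>b\<in>Basis. \<Sum>b'\<in>Basis. ((D Y x \<bullet> b) * (D X x \<bullet> b')) *\<^sub>R tderiv (?d b) x (coord_field c b' x))"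
    by (subst sum.swap) (auto intro!: sum.cong simp: coord_deriv_commute[OF U c] mult.commute)
  then have "tderiv (\<lambda>y. tderiv g y (Y y)) x (X x) = tderiv (\<lambda>y. tderiv g y (X y)) x (Y x) +
      tderiv g x (coord_field c (tderiv (D Y) x (X x)) x - coord_field c (tderiv (D X) x (Y x)) x)"
    unfolding eq[OF sD(1)] eq[OF sD(2)] linear_diff[OF tderiv_linear[OF U]] by simp
  then show ?thesis by (rule that)
qed

text \<open>Uniqueness on overlaps makes the choice of a local solution at each point harmless: near
  every point the diagonal \<open>g y y\<close> coincides with one smooth local solution. Both the
  middle gauge and the section \<open>F\<close> are globalised this way.\<close>

lemma gluing:
  assumes "\<And>x. \<exists>U g. open U \<and> x \<in> U \<and> smooth_map_on U g \<and> good U g"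
    and "\<And>U g W h y. open U \<Longrightarrow> open W \<Longrightarrow> smooth_map_on U g \<Longrightarrow> smooth_map_on W h \<Longrightarrow>
      good U g \<Longrightarrow> good W h \<Longrightarrow> y \<in> U \<Longrightarrow> y \<in> W \<Longrightarrow> g y = h y"
  obtains G where "smooth_map G"
    and "\<And>x. \<exists>U g. open U \<and> x \<in> U \<and> smooth_map_on U g \<and> good U g \<and> (\<forall>y\<in>U. G y = g y)"
proof -
  have "\<forall>x. \<exists>U g. open U \<and> x \<in> U \<and> smooth_map_on U g \<and> good U g" using assms(1) by (rule allI)
  then obtain u g where ug: "open (u x)" "x \<in> u x" "smooth_map_on (u x) (g x)" "good (u x) (g x)" for x
    unfolding choice_iff by blast
  have eq: "g y y = g x y" if "y \<in> u x" for x y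
    by (rule assms(2)[of "u y" "u x" "g y" "g x" y]) (use ug that in simp_all)
  show ?thesis
  proof
    show "smooth_map (\<lambda>y. g y y)"
    proof (rule smooth_local)
      fix x
      have "smooth_map_on (u x) (\<lambda>y. g y y)" by (rule smooth_cong[of _ "g x"]) (use ug eq in auto)
      then show "\<exists>W. open W \<and> x \<in> W \<and> smooth_map_on W (\<lambda>y. g y y)" using ug(1,2)[of x] by blast
    qed
    show "\<exists>U h. open U \<and> x \<in> U \<and> smooth_map_on U h \<and> good U h \<and> (\<forall>y\<in>U. g y y = h y)" for x
      using ug[of x] eq by (intro exI[of _ "u x"] exI[of _ "g x"]) simp
  qed
qed

section \<open>Linear algebra of the form\<close>

lemma bounded_bilinear_form: "bounded_bilinear (form :: 'v::r42 \<Rightarrow> 'v \<Rightarrow> real)"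
proof -
  have "bilinear (form :: 'v \<Rightarrow> 'v \<Rightarrow> real)" unfolding bilinear_def
    by (auto intro!: linearI simp: form_add form_scaleR form_commute[of _ "_ + _"] form_commute[of _ "_ *\<^sub>R _"])
      (simp_all add: form_commute)
  then show ?thesis by (simp add: bilinear_conv_bounded_bilinear)
qed

interpretation form: bounded_bilinear "form :: 'v::r42 \<Rightarrow> 'v \<Rightarrow> real" by (rule bounded_bilinear_form)

lemmas form_simps = form.add_left form.add_right form.scaleR_left form.scaleR_right form.diff_left form.diff_right
  form.minus_left form.minus_right form.zero_left form.zero_right

definition basis42 :: "nat \<Rightarrow> 'v::r42" where
  "basis42 = (SOME e. (\<forall>i<6. \<forall>j<6. form (e i) (e j) = (if i \<noteq> j then 0 else if i < 4 then 1 else - 1)) \<and>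
    (\<forall>v. \<exists>a. v = (\<Sum>i<6. a i *\<^sub>R e i)))"

lemma basis42:
  defines "e \<equiv> basis42 :: nat \<Rightarrow> 'v::r42"
  shows "\<And>i j. i < 6 \<Longrightarrow> j < 6 \<Longrightarrow> form (e i) (e j) = (if i \<noteq> j then 0 else if i < 4 then 1 else - 1)"
    and "\<And>I. I \<subseteq> {..<6} \<Longrightarrow> dim (span (e ` I)) = card I" and "span (e ` {..<6}) = UNIV"
    and "\<And>I v. I \<subseteq> {..<6} \<Longrightarrow> v \<in> span (e ` I) \<Longrightarrow> \<exists>a. v = (\<Sum>i\<in>I. a i *\<^sub>R e i)"
    and "\<And>I a j. I \<subseteq> {..<6} \<Longrightarrow> j \<in> I \<Longrightarrow> form (\<Sum>i\<in>I. a i *\<^sub>R e i) (e j) = a j * form (e j) (e j)"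
proof -
  have *: "(\<forall>i<6. \<forall>j<6. form (e i) (e j) = (if i \<noteq> j then 0 else if i < 4 then 1 else - 1)) \<and>
      (\<forall>v. \<exists>a. v = (\<Sum>i<6. a i *\<^sub>R e i))" unfolding e_def basis42_def by (rule someI_ex[OF form_signature])
  show e: "form (e i) (e j) = (if i \<noteq> j then 0 else if i < 4 then 1 else - 1)" if "i < 6" "j < 6" for i j
    using * that by blast
  have inj: "inj_on e {..<6}"
  proof (rule inj_onI, rule ccontr)
    fix i j assume "i \<in> {..<6}" "j \<in> {..<6}" "e i = e j" "i \<noteq> j"
    then show False using e[of i j] e[of i i] by (auto split: if_splits)
  qed
  show coeff: "form (\<Sum>i\<in>I. a i *\<^sub>R e i) (e j) = a j * form (e j) (e j)" if "I \<subseteq> {..<6}" "j \<in> I" for a I j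
  proof -
    have "form (\<Sum>i\<in>I. a i *\<^sub>R e i) (e j) = (\<Sum>i\<in>I. if i = j then a j * form (e j) (e j) else 0)"
      using that by (auto simp: form.sum_left form.scaleR_left e subset_iff intro!: sum.cong)
    then show ?thesis using that(2) finite_subset[OF that(1)] by simp
  qed
  have ind: "independent (e ` I)" if I: "I \<subseteq> {..<6}" for I
  proof (rule independent_if_scalars_zero)
    have fI: "finite I" using I finite_subset by blast
    then show "finite (e ` I)" by simp
    fix f x assume s: "(\<Sum>x\<in>e ` I. f x *\<^sub>R x) = 0" and "x \<in> e ` I"
    then obtain j where j: "j \<in> I" "x = e j" by auto
    have "(\<Sum>i\<in>I. f (e i) *\<^sub>R e i) = 0" using s by (simp add: sum.reindex[OF inj_on_subset[OF inj I]])
    then have "form (\<Sum>i\<in>I. f (e i) *\<^sub>R e i) (e j) = 0" by (simp add: form_simps)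
    then have "f (e j) * form (e j) (e j) = 0" using coeff[OF I j(1), of "\<lambda>i. f (e i)"] by simp
    then show "f x = 0" using j I e[of j j] by (auto split: if_splits)
  qed
  show "span (e ` {..<6}) = UNIV"
  proof -
    have "v \<in> span (e ` {..<6})" for v
    proof -
      obtain a where v: "v = (\<Sum>i<6. a i *\<^sub>R e i)" using * by blast
      show ?thesis unfolding v by (intro span_sum span_scale span_base) auto
    qed
    then show ?thesis by blast
  qed
  show "dim (span (e ` I)) = card I" if "I \<subseteq> {..<6}" for I
    using dim_span_eq_card_independent[OF ind[OF that]] card_image[OF inj_on_subset[OF inj that]] by simp
  show "\<exists>a. v = (\<Sum>i\<in>I. a i *\<^sub>R e i)" if I: "I \<subseteq> {..<6}" and v: "v \<in> span (e ` I)" for I v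
  proof -
    have fI: "finite (e ` I)" using I finite_subset by blast
    obtain u where "v = (\<Sum>x\<in>e ` I. u x *\<^sub>R x)" using v unfolding span_finite[OF fI] by auto
    then show ?thesis by (intro exI[of _ "\<lambda>i. u (e i)"]) (simp add: sum.reindex[OF inj_on_subset[OF inj I]])
  qed
qed

lemma DIM_r42: "DIM('v::r42) = 6"
proof -
  define e :: "nat \<Rightarrow> 'v" where "e = basis42"
  note b = basis42[where 'v = 'v, folded e_def]
  note e = b(1) and d = b(2) and u = b(3) and s = b(4) and co = b(5)
  have "dim (span (e ` {..<6})) = card {..<6::nat}" by (rule d) simp
  then have "dim (UNIV :: 'v set) = 6" by (simp only: u card_lessThan)
  then show ?thesis by simp
qed

lemma positive_subspace_exists: "\<exists>P :: 'v::r42 set. subspace P \<and> dim P = 4 \<and> (\<forall>v\<in>P. v \<noteq> 0 \<longrightarrow> form v v > 0)"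
proof -
  define e :: "nat \<Rightarrow> 'v" where "e = basis42"
  note b = basis42[where 'v = 'v, folded e_def]
  note e = b(1) and d = b(2) and u = b(3) and s = b(4) and co = b(5)
  have "form v v > 0" if v: "v \<in> span (e ` {..<4})" "v \<noteq> 0" for v
  proof -
    obtain a where a: "v = (\<Sum>i<4. a i *\<^sub>R e i)" using s[of "{..<4}" v] v by auto
    have "form v (e j) = a j" if "j < 4" for j using co[of "{..<4}" j a] that e[of j j] by (auto simp: a)
    then have eq: "form v v = (\<Sum>j<4. a j * a j)" by (subst (2) a) (simp add: form.sum_right form.scaleR_right)
    obtain j where j: "j < 4" "a j \<noteq> 0"
      using v(2) a by (metis (no_types, lifting) lessThan_iff scaleR_zero_left sum.neutral)
    have "0 < a j * a j" using j by (metis not_real_square_gt_zero)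
    also have "\<dots> \<le> (\<Sum>j<4. a j * a j)" using j by (intro member_le_sum) auto
    finally show ?thesis using eq by simp
  qed
  then show ?thesis using d[of "{..<4}"] by (intro exI[of _ "span (e ` {..<4})"]) auto
qed

text \<open>Such a subspace meets a positive definite 4-space only in 0, and the dimensions add up
  to at most 6.\<close>

lemma seminegative_dim:
  fixes Q :: "'v::r42 set"
  assumes "subspace Q" "\<And>v. v \<in> Q \<Longrightarrow> form v v \<le> 0"
  shows "dim Q \<le> 2"
proof -
  obtain P :: "'v set" where P: "subspace P" "dim P = 4" "\<And>v. v \<in> P \<Longrightarrow> v \<noteq> 0 \<Longrightarrow> form v v > 0"
    using positive_subspace_exists by blast
  have "Q \<inter> P \<subseteq> {0}" using assms(2) P(3) by force
  then have "dim (Q \<inter> P) = 0" by (simp add: dim_eq_0)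
  then have "dim {x + y |x y. x \<in> Q \<and> y \<in> P} = dim Q + 4"
    using dim_sums_Int[OF assms(1) P(1)] P(2) by linarith
  moreover have "dim {x + y |x y. x \<in> Q \<and> y \<in> P} \<le> 6"
    using dim_subset_UNIV[of "{x + y |x y. x \<in> Q \<and> y \<in> P}"] by (simp add: DIM_r42)
  ultimately show ?thesis by simp
qed

lemma form_nondegenerate:
  fixes v :: "'v::r42"
  assumes "\<And>w. form v w = 0"
  shows "v = 0"
proof -
  define e :: "nat \<Rightarrow> 'v" where "e = basis42"
  note b = basis42[where 'v = 'v, folded e_def]
  note e = b(1) and d = b(2) and u = b(3) and s = b(4) and co = b(5)
  obtain a where a: "v = (\<Sum>i<6. a i *\<^sub>R e i)" using s[of "{..<6}" v] u by auto
  have "a j = 0" if "j < 6" for j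
  proof -
    have "a j * form (e j) (e j) = 0" using co[of "{..<6}" j a] that assms[of "e j"] by (simp add: a)
    then show ?thesis using e[OF that that] by (auto split: if_splits)
  qed
  then show ?thesis by (simp add: a)
qed

text \<open>Index lowering: it converts the form into the Euclidean inner product, so that dimension
  formulas and projections of Euclidean spaces become available for \<open>orth\<close>.\<close>

definition lower :: "'v::r42 \<Rightarrow> 'v" where
  "lower v = (\<Sum>b\<in>Basis. form v b *\<^sub>R b)"

lemma lower_inner: "lower v \<bullet> w = form v w" by (subst (2) euclidean_representation[of w, symmetric])
    (simp add: lower_def inner_sum_left form.sum_right form.scaleR_right inner_commute[of w] mult.commute)

lemma linear_lower: "linear lower"
  by (rule linearI) (simp_all add: lower_def form_simps algebra_simps sum.distrib scaleR_sum_right)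

lemma inj_lower: "inj lower" unfolding linear_injective_0[OF linear_lower]
  by (metis form_nondegenerate inner_zero_left lower_inner)

lemma bij_lower: "bij lower"
  using inj_lower linear_injective_imp_surjective[OF linear_lower inj_lower] by (simp add: bij_def)

section \<open>Orthogonal complements and non-degenerate subspaces\<close>

lemma subspace_orth [simp]: "subspace (orth W)" by (auto simp: subspace_def orth_def form_simps)

lemma orth_span: "orth (span W) = orth W"
proof
  show "orth W \<subseteq> orth (span W)"
  proof
    fix v assume "v \<in> orth W"
    then have "W \<subseteq> {w. form w v = 0}" by (auto simp: orth_def)
    moreover have "subspace {w. form w v = 0}" by (auto simp: subspace_def form_simps)
    ultimately show "v \<in> orth (span W)" unfolding orth_def using span_minimal by blast
  qed
qed (auto simp: orth_def span_base)

lemma orth_antimono: "W \<subseteq> W' \<Longrightarrow> orth W' \<subseteq> orth W" by (auto simp: orth_def)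

lemma orthD: "v \<in> orth W \<Longrightarrow> w \<in> W \<Longrightarrow> form w v = 0" "v \<in> orth W \<Longrightarrow> w \<in> W \<Longrightarrow> form v w = 0"
  by (auto simp: orth_def form_commute)

lemma notin_span_orth:
  fixes u :: "'v::r42"
  assumes "form u u \<noteq> 0" "\<And>w. w \<in> S \<Longrightarrow> form u w = 0"
  shows "u \<notin> span S"
proof
  assume "u \<in> span S"
  moreover have "S \<subseteq> orth {u}" using assms(2) by (auto simp: orth_def)
  then have "span S \<subseteq> orth {u}" by (rule span_minimal) (rule subspace_orth)
  ultimately show False using assms(1) by (auto simp: orth_def)
qed

lemma dim_orth:
  fixes W :: "'v::r42 set"
  assumes "subspace W"
  shows "dim (orth W) + dim W = 6"
proof -
  have "lower ` orth W = {y. \<forall>x\<in>W. orthogonal x y}"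
  proof (intro equalityI subsetI)
    fix y assume y: "y \<in> {y. \<forall>x\<in>W. orthogonal x y}"
    obtain v where "y = lower v" using bij_lower by (metis bij_pointE)
    then show "y \<in> lower ` orth W"
      using y by (auto simp: orth_def orthogonal_def inner_commute[of _ "lower v"] lower_inner form_commute)
  qed (auto simp: orth_def orthogonal_def inner_commute[of _ "lower v" for v] lower_inner form_commute)
  moreover have "dim (lower ` orth W) = dim (orth W)"
    using dim_image_eq[OF linear_lower] inj_lower by (metis inj_on_subset subset_UNIV)
  moreover have "dim {y \<in> UNIV. \<forall>x\<in>W. orthogonal x y} + dim W = dim (UNIV :: 'v set)"
    using dim_subspace_orthogonal_to_vectors[OF assms subspace_UNIV] by simp
  ultimately show ?thesis by (simp add: DIM_r42)
qed

lemma orth_orth: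
  fixes W :: "'v::r42 set"
  assumes "subspace W"
  shows "orth (orth W) = W"
proof -
  have "W \<subseteq> orth (orth W)" by (auto simp: orth_def form_commute)
  moreover have "dim (orth (orth W)) = dim W"
    using dim_orth[OF assms] dim_orth[OF subspace_orth[of W]] by simp
  ultimately show ?thesis using subspace_dim_equal[OF assms subspace_orth, of "orth W"] by simp
qed

definition nondeg :: "'v::r42 set \<Rightarrow> bool" where
  "nondeg W \<longleftrightarrow> subspace W \<and> (\<forall>v\<in>W. (\<forall>w\<in>W. form v w = 0) \<longrightarrow> v = 0)"

lemma nondeg_orth: "nondeg W \<Longrightarrow> nondeg (orth W)"
  unfolding nondeg_def using orth_orth[of W] subspace_orth[of W] by (auto simp: orth_def form_commute)

lemma nondeg_decomposition:
  assumes "nondeg W"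
  obtains a b where "a \<in> W" "b \<in> orth W" "v = a + b"
proof -
  have W: "subspace W" "W \<inter> orth W \<subseteq> {0}" using assms by (auto simp: nondeg_def orth_def form_commute)
  let ?S = "{x + y |x y. x \<in> W \<and> y \<in> orth W}"
  have "dim (W \<inter> orth W) = 0" using W(2) by (simp add: dim_eq_0)
  then have "dim ?S = 6" using dim_sums_Int[OF W(1) subspace_orth, of W] dim_orth[OF W(1)] by linarith
  moreover have "subspace ?S" using subspace_sums[OF W(1) subspace_orth] .
  ultimately have "?S = UNIV" by (intro subspace_dim_equal) (auto simp: DIM_r42)
  then show ?thesis using that by blast
qed

lemma oproj_eqI:
  assumes "nondeg W" "w \<in> W" "v - w \<in> orth W"
  shows "oproj W v = w" unfolding oproj_def
proof (rule the_equality)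
  fix w' assume w': "w' \<in> W \<and> v - w' \<in> orth W"
  have "w' - w \<in> W" using w' assms by (auto simp: nondeg_def subspace_diff)
  moreover have "w' - w \<in> orth W" using subspace_diff[OF subspace_orth assms(3), of "v - w'"] w' by simp
  ultimately have "w' - w = 0" using assms(1) by (auto simp: nondeg_def orth_def form_commute)
  then show "w' = w" by simp
qed (use assms in auto)

lemma oproj:
  assumes "nondeg W"
  shows "oproj W v \<in> W" "v - oproj W v \<in> orth W"
proof -
  obtain a b where ab: "a \<in> W" "b \<in> orth W" "v = a + b" using nondeg_decomposition[OF assms] .
  then have "oproj W v = a" using assms by (intro oproj_eqI) auto
  then show "oproj W v \<in> W" "v - oproj W v \<in> orth W" using ab by auto
qed

lemma oproj_orth: "nondeg W \<Longrightarrow> oproj (orth W) v = v - oproj W v"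
  by (rule oproj_eqI[OF nondeg_orth]) (auto simp: oproj orth_orth nondeg_def)

text \<open>If \<open>v\<close> were non-positive and outside \<open>f\<close>, then
  \<open>f\<close> and \<open>v\<close> would span a 3-space without positive vectors, which
  signature (4,2) excludes. So the form is positive definite on \<open>orth f\<close> modulo
  \<open>f\<close>, and derivatives of sections of \<open>f\<close> are outside \<open>f\<close>
  exactly when their norm is positive.\<close>

lemma isotropic_orth_nonneg:
  fixes f :: "'v::r42 set"
  assumes f: "subspace f" "dim f = 2" "isotropic f" and v: "v \<in> orth f"
  shows "form v v \<ge> 0" "form v v = 0 \<Longrightarrow> v \<in> f"
proof -
  have *: "v \<in> f" if "form v v \<le> 0"
  proof (rule ccontr)
    assume "v \<notin> f"
    then have "dim (span (insert v f)) = 3"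
      using f by (metis (no_types) dim_insert dim_span eval_nat_numeral(3) Suc_eq_plus1 span_eq_iff)
    moreover have "dim (span (insert v f)) \<le> 2"
    proof (rule seminegative_dim[OF subspace_span])
      fix w assume "w \<in> span (insert v f)"
      then obtain k where "w - k *\<^sub>R v \<in> span f" using span_breakdown_eq by blast
      then obtain a where a: "a \<in> f" "w = a + k *\<^sub>R v" using f(1) span_eq_iff by (metis diff_add_cancel)
      have "form w w = k * k * form v v" using a f(3) orthD[OF v] by (auto simp: form_simps isotropic_def)
      then show "form w w \<le> 0" using that by (simp add: mult_nonneg_nonpos)
    qed
    ultimately show False by simp
  qed
  show "form v v = 0 \<Longrightarrow> v \<in> f" using * by simp
  show "form v v \<ge> 0"
  proof (rule ccontr)
    assume "\<not> form v v \<ge> 0"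
    then have "form v v \<le> 0" "v \<in> f" using * by auto
    then show False using f(3) \<open>\<not> form v v \<ge> 0\<close> by (simp add: isotropic_def)
  qed
qed

subsection \<open>Skew endomorphisms\<close>

definition skew :: "('v::r42 \<Rightarrow>\<^sub>L 'v) \<Rightarrow> bool" where
  "skew A \<longleftrightarrow> (\<forall>v w. form (A v) w = - form v (A w))"

lemma skewD: "skew A \<Longrightarrow> form (A v) w = - form v (A w)" by (simp add: skew_def)

lemma skew_self: "skew A \<Longrightarrow> form (A v) v = 0" "skew A \<Longrightarrow> form v (A v) = 0"
  using skewD[of A v v] by (simp_all add: form_commute)

lemmas blinfun_simps = blinfun.bilinear_simps

lemma subspace_skew: "subspace {A. skew A}" by (auto simp: subspace_def skew_def blinfun_simps form_simps)

lemma skew_wedge: "skew (wedge a b)" by (simp add: skew_def wedge_apply form_simps form_commute mult.commute)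

lemma skew_wedge_space: "A \<in> wedge_space U W \<Longrightarrow> skew A"
  using span_minimal[OF _ subspace_skew, of "{wedge a b |a b. a \<in> U \<and> b \<in> W}"] skew_wedge
  unfolding wedge_space_def by blast

lemma bounded_bilinear_wedge: "bounded_bilinear (wedge :: 'v::r42 \<Rightarrow> 'v \<Rightarrow> 'v \<Rightarrow>\<^sub>L 'v)"
proof -
  have "bilinear (wedge :: 'v \<Rightarrow> 'v \<Rightarrow> 'v \<Rightarrow>\<^sub>L 'v)" unfolding bilinear_def
    by (auto intro!: linearI blinfun_eqI simp: wedge_apply form_simps blinfun_simps algebra_simps)
  then show ?thesis by (simp add: bilinear_conv_bounded_bilinear)
qed

interpretation wedge: bounded_bilinear "wedge :: 'v::r42 \<Rightarrow> 'v \<Rightarrow> 'v \<Rightarrow>\<^sub>L 'v" by (rule bounded_bilinear_wedge)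

lemma wedge_self [simp]: "wedge a a = 0" by (rule blinfun_eqI) (simp add: wedge_apply)

lemma wedge_swap: "wedge a b = - wedge b a" by (rule blinfun_eqI) (simp add: wedge_apply blinfun_simps)

lemma subspace_wedge_space [simp]: "subspace (wedge_space U W)" by (simp add: wedge_space_def)

lemma wedge_in_wedge_space: "a \<in> U \<Longrightarrow> b \<in> W \<Longrightarrow> wedge a b \<in> wedge_space U W"
  unfolding wedge_space_def by (rule span_base) blast

lemma wedge_in_wedge_space': "a \<in> U \<Longrightarrow> b \<in> W \<Longrightarrow> wedge b a \<in> wedge_space U W"
  by (subst wedge_swap) (intro subspace_neg subspace_wedge_space wedge_in_wedge_space)

lemma wedge_space_induct:
  assumes "A \<in> wedge_space U W" "subspace {A. P A}" "\<And>a b. a \<in> U \<Longrightarrow> b \<in> W \<Longrightarrow> P (wedge a b)"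
  shows "P A" using span_minimal[OF _ assms(2), of "{wedge a b |a b. a \<in> U \<and> b \<in> W}"] assms(1,3)
  unfolding wedge_space_def by blast

lemma wedge_space_mono: "U \<subseteq> U' \<Longrightarrow> W \<subseteq> W' \<Longrightarrow> wedge_space U W \<subseteq> wedge_space U' W'"
  unfolding wedge_space_def by (rule span_mono) blast

lemma wedge_space_kills:
  assumes "A \<in> wedge_space U W" "v \<in> orth U" "v \<in> orth W"
  shows "A v = 0" using assms(1)
proof (rule wedge_space_induct)
  show "subspace {A :: 'a \<Rightarrow>\<^sub>L 'a. A v = 0}" by (auto simp: subspace_def blinfun_simps)
qed (use orthD(1)[OF assms(2)] orthD(1)[OF assms(3)] in \<open>simp add: wedge_apply\<close>)

lemma wedge_space_range:
  assumes "A \<in> wedge_space U W" "subspace S" "U \<subseteq> S" "W \<subseteq> S"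
  shows "A v \<in> S" using assms(1)
proof (rule wedge_space_induct)
  show "subspace {A :: 'a \<Rightarrow>\<^sub>L 'a. A v \<in> S}" using assms(2) by (auto simp: subspace_def blinfun_simps)
qed (use assms in \<open>auto simp: wedge_apply intro!: subspace_diff subspace_scale\<close>)

lemma skew_in_wedge_space:
  fixes A :: "'v::r42 \<Rightarrow>\<^sub>L 'v"
  assumes "skew A"
  shows "A \<in> wedge_space UNIV UNIV"
proof -
  define e :: "nat \<Rightarrow> 'v" where "e = basis42"
  note b = basis42[where 'v = 'v, folded e_def]
  note e = b(1) and d = b(2) and u = b(3) and s = b(4) and co = b(5)
  let ?k = "\<lambda>i::nat. if i < 4 then 1 else - 1 :: real"
  have rep: "v = (\<Sum>i<6. (?k i * form (e i) v) *\<^sub>R e i)" for v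
  proof -
    obtain a where a: "v = (\<Sum>i<6. a i *\<^sub>R e i)" using s[of "{..<6}" v] u by auto
    have "form (e j) v = ?k j * a j" if "j < 6" for j
      using co[of "{..<6}" j a] that e[of j j] unfolding form_commute[of "e j" v] by (simp add: a)
    then show ?thesis by (intro trans[OF a]) (auto intro!: sum.cong)
  qed
  \<comment> \<open>Each \<open>wedge (e i) (e j)\<close> occurs twice in the sum of the
    \<open>wedge (e i) (A (e i))\<close>, whence the factor 1/2; \<open>?k i\<close> is the sign of
    the norm of \<open>e i\<close>.\<close>
  have "(1/2) *\<^sub>R (\<Sum>i<6. ?k i *\<^sub>R wedge (e i) (A (e i))) = A"
  proof (rule blinfun_eqI)
    fix v
    have "(\<Sum>i<6. ?k i *\<^sub>R (form (e i) v *\<^sub>R A (e i))) = A v"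
      by (subst (2) rep[of v]) (simp add: blinfun.sum_right blinfun.scaleR_right)
    moreover have "(\<Sum>i<6. ?k i *\<^sub>R (form (A (e i)) v *\<^sub>R e i)) = - A v"
      by (subst rep[of "- A v"]) (simp add: skewD[OF assms] form_simps mult.commute)
    ultimately have "(\<Sum>i<6. ?k i *\<^sub>R (wedge (e i) (A (e i)) v)) = A v + A v"
      by (simp only: wedge_apply scaleR_diff_right sum_subtractf diff_minus_eq_add)
    then show "blinfun_apply ((1/2) *\<^sub>R (\<Sum>i<6. ?k i *\<^sub>R wedge (e i) (A (e i)))) v = A v"
      by (simp add: blinfun.scaleR_left blinfun.sum_left scaleR_2[symmetric] del: scaleR_left.add)
  qed
  moreover have "(1/2) *\<^sub>R (\<Sum>i<6. ?k i *\<^sub>R wedge (e i) (A (e i))) \<in> wedge_space UNIV UNIV"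
    by (intro subspace_scale subspace_sum subspace_wedge_space wedge_in_wedge_space) auto
  ultimately show ?thesis by simp
qed

text \<open>If \<open>A\<close> preserves the flag \<open>0 \<le> \<langle>\<sigma>\<rangle> \<le> \<langle>\<sigma>\<rangle>\<^sup>\<bottom>\<close>, lowering it by one step, it is \<open>\<sigma> \<and> A v\<close> for any \<open>v\<close> dual to \<open>\<sigma>\<close>.\<close>

lemma skew_eq_wedge:
  assumes A: "skew A" and k: "\<And>u. form \<sigma> u = 0 \<Longrightarrow> \<exists>k. A u = k *\<^sub>R \<sigma>" and v: "form \<sigma> v = 1"
  shows "A = wedge \<sigma> (A v)"
proof (rule blinfun_eqI)
  fix w
  define u where "u = w - form \<sigma> w *\<^sub>R v"
  obtain k where k: "A u = k *\<^sub>R \<sigma>" using k[of u] v by (auto simp: u_def form_simps)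
  have "k = form (A u) v" using k v by (simp add: form_simps)
  also have "\<dots> = - form w (A v)" by (simp add: skewD[OF A] u_def form_simps skew_self[OF A])
  finally have "A u = - form w (A v) *\<^sub>R \<sigma>" using k by simp
  then show "A w = wedge \<sigma> (A v) w" by (simp add: u_def wedge_apply blinfun_simps form_commute algebra_simps)
qed

subsection \<open>Mixed components\<close>

locale orthogonal_splitting =
  fixes S1 S2 :: "'v::r42 set"
  assumes S1: "subspace S1" and S2: "subspace S2" and perp: "\<And>u v. u \<in> S1 \<Longrightarrow> v \<in> S2 \<Longrightarrow> form u v = 0"
    and total: "\<And>v. \<exists>a\<in>S1. \<exists>b\<in>S2. v = a + b"
begin

lemma S1_Int_S2: "v \<in> S1 \<Longrightarrow> v \<in> S2 \<Longrightarrow> v = 0"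
proof (rule form_nondegenerate)
  fix w assume v: "v \<in> S1" "v \<in> S2"
  obtain a b where "a \<in> S1" "b \<in> S2" "w = a + b" using total by blast
  then show "form v w = 0" using perp[of v b] perp[of a v] v by (simp add: form_simps form_commute[of v a])
qed

text \<open>Mixed elements exchange the two summands, the elements of the other two components
  preserve them. The difference of two candidates for \<open>mixed_component\<close> does both,
  hence is 0.\<close>

lemma mixed_maps:
  assumes "C \<in> wedge_space S1 S2"
  shows "v \<in> S1 \<Longrightarrow> C v \<in> S2" "v \<in> S2 \<Longrightarrow> C v \<in> S1"
proof -
  show "C v \<in> S2" if "v \<in> S1" using assms
  proof (rule wedge_space_induct)
    show "subspace {A :: 'v \<Rightarrow>\<^sub>L 'v. A v \<in> S2}" using S2 by (auto simp: subspace_def blinfun_simps)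
  qed (use that perp S2 in \<open>auto simp: wedge_apply form_commute[of _ v] intro!: subspace_scale\<close>)
  show "C v \<in> S1" if "v \<in> S2" using assms
  proof (rule wedge_space_induct)
    show "subspace {A :: 'v \<Rightarrow>\<^sub>L 'v. A v \<in> S1}" using S1 by (auto simp: subspace_def blinfun_simps)
  qed (use that perp S1 in \<open>auto simp: wedge_apply intro!: subspace_neg subspace_scale\<close>)
qed

lemma pure_maps:
  assumes "D \<in> span (wedge_space S1 S1 \<union> wedge_space S2 S2)"
  shows "v \<in> S1 \<Longrightarrow> D v \<in> S1" "v \<in> S2 \<Longrightarrow> D v \<in> S2"
proof -
  have o: "S2 \<subseteq> orth S1" "S1 \<subseteq> orth S2" using perp by (auto simp: orth_def form_commute[of "_ :: 'v" "w :: 'v" for w]) (metis form_commute)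
  show "D v \<in> S1" if "v \<in> S1"
  proof -
    have "wedge_space S1 S1 \<union> wedge_space S2 S2 \<subseteq> {D :: 'v \<Rightarrow>\<^sub>L 'v. D v \<in> S1}"
      using wedge_space_range[OF _ S1] wedge_space_kills[of _ S2 S2 v] o that subspace_0[OF S1] by fastforce
    moreover have "subspace {A :: 'v \<Rightarrow>\<^sub>L 'v. A v \<in> S1}" using S1 by (auto simp: subspace_def blinfun_simps)
    ultimately show ?thesis using span_minimal assms by blast
  qed
  show "D v \<in> S2" if "v \<in> S2"
  proof -
    have "wedge_space S1 S1 \<union> wedge_space S2 S2 \<subseteq> {D :: 'v \<Rightarrow>\<^sub>L 'v. D v \<in> S2}"
      using wedge_space_range[OF _ S2] wedge_space_kills[of _ S1 S1 v] o that subspace_0[OF S2] by fastforce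
    moreover have "subspace {A :: 'v \<Rightarrow>\<^sub>L 'v. A v \<in> S2}" using S2 by (auto simp: subspace_def blinfun_simps)
    ultimately show ?thesis using span_minimal assms by blast
  qed
qed

lemma mixed_component_eqI:
  assumes "C \<in> wedge_space S1 S2" "A - C \<in> span (wedge_space S1 S1 \<union> wedge_space S2 S2)"
  shows "mixed_component S1 S2 A = C" unfolding mixed_component_def
proof (rule the_equality)
  fix C' assume C': "C' \<in> wedge_space S1 S2 \<and> A - C' \<in> span (wedge_space S1 S1 \<union> wedge_space S2 S2)"
  have m: "C' - C \<in> wedge_space S1 S2" using C' assms by (simp add: subspace_diff)
  have p: "C' - C \<in> span (wedge_space S1 S1 \<union> wedge_space S2 S2)"
    using span_diff[OF assms(2), of "A - C'"] C' by simp
  have "(C' - C) v = 0" for v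
  proof -
    obtain a b where "a \<in> S1" "b \<in> S2" "v = a + b" using total by blast
    then show ?thesis
      using S1_Int_S2[OF pure_maps(1)[OF p] mixed_maps(1)[OF m], of a] S1_Int_S2[OF mixed_maps(2)[OF m] pure_maps(2)[OF p], of b]
      by (simp add: blinfun.add_right)
  qed
  then show "C' = C" by (metis blinfun_eqI eq_iff_diff_eq_0 zero_blinfun.rep_eq)
qed (use assms in auto)

lemma mixed_component:
  assumes "skew A"
  shows "mixed_component S1 S2 A \<in> wedge_space S1 S2"
    "A - mixed_component S1 S2 A \<in> span (wedge_space S1 S1 \<union> wedge_space S2 S2)"
proof -
  let ?M = "wedge_space S1 S2" and ?P = "span (wedge_space S1 S1 \<union> wedge_space S2 S2)"
  have "\<exists>C\<in>?M. A - C \<in> ?P" using skew_in_wedge_space[OF assms]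
  proof (rule wedge_space_induct)
    have eq: "{A. \<exists>C\<in>?M. A - C \<in> ?P} = {x + y |x y. x \<in> ?M \<and> y \<in> ?P}" by (force simp: algebra_simps)
    show "subspace {A. \<exists>C\<in>?M. A - C \<in> ?P}" unfolding eq by (intro subspace_sums) auto
    fix a b :: 'v
    obtain a1 a2 b1 b2 where ab: "a1 \<in> S1" "a2 \<in> S2" "a = a1 + a2" "b1 \<in> S1" "b2 \<in> S2" "b = b1 + b2"
      using total[of a] total[of b] by blast
    have "wedge a1 b2 + wedge a2 b1 \<in> ?M"
      using ab by (intro subspace_add subspace_wedge_space wedge_in_wedge_space wedge_in_wedge_space')
    moreover have "wedge a1 b1 + wedge a2 b2 \<in> ?P"
      using ab by (intro span_add span_base UnI1[OF wedge_in_wedge_space] UnI2[OF wedge_in_wedge_space])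
    moreover have "wedge a b - (wedge a1 b2 + wedge a2 b1) = wedge a1 b1 + wedge a2 b2"
      by (simp add: ab wedge.add_left wedge.add_right)
    ultimately show "\<exists>C\<in>?M. wedge a b - C \<in> ?P" by metis
  qed
  then obtain C where C: "C \<in> ?M" "A - C \<in> ?P" by blast
  then show "mixed_component S1 S2 A \<in> ?M" "A - mixed_component S1 S2 A \<in> ?P"
    using mixed_component_eqI by auto
qed

end

subsection \<open>Traces\<close>

text \<open>Expanding the chosen basis \<open>B\<close> and the given basis \<open>C\<close> in each
  other turns both traces into the same double sum. \<open>T\<close> may be linear on
  \<open>W\<close> only, since in the applications it contains \<open>section_through\<close>, whose
  values off \<open>W\<close> are arbitrary; \<open>T'\<close> is a linear map of the whole space
  that agrees with it on \<open>W\<close>.\<close>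

lemma trace_on_eq:
  fixes W :: "'a::real_vector set"
  assumes C: "independent C" "finite C" "span C = W" and T': "linear T'" and T: "\<And>v. v \<in> W \<Longrightarrow> T v = T' v"
    and W: "\<And>v. v \<in> W \<Longrightarrow> T v \<in> W"
  shows "trace_on W T = (\<Sum>u\<in>C. representation C (T u) u)"
proof -
  define B where "B = (SOME B. independent B \<and> span B = W)"
  have B: "independent B" "span B = W"
    using someI_ex[of "\<lambda>B. independent B \<and> span B = W"] C unfolding B_def by blast+
  have fB: "finite B" using C B independent_span_bound[OF C(2) B(1)] span_superset[of B] by blast
  have CW: "C \<subseteq> W" and BW: "B \<subseteq> W" using C(3) B(2) span_superset by blast+
  have repC: "(\<Sum>u\<in>C. representation C v u *\<^sub>R u) = v" if "v \<in> W" for v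
    using sum_representation_eq[OF C(1) _ C(2) order_refl] that C(3) by simp
  have lT: "T v = (\<Sum>u\<in>C. representation C v u *\<^sub>R T u)" if "v \<in> W" for v
  proof -
    have "T' v = T' (\<Sum>u\<in>C. representation C v u *\<^sub>R u)" using repC[OF that] by simp
    also have "\<dots> = (\<Sum>u\<in>C. representation C v u *\<^sub>R T' u)" by (simp add: linear_sum[OF T'] linear_scale[OF T'])
    finally show ?thesis using T that CW by (auto intro!: sum.cong)
  qed
  have rB: "representation B (\<Sum>u\<in>C. k u *\<^sub>R w u) b = (\<Sum>u\<in>C. k u * representation B (w u) b)"
    if "\<And>u. u \<in> C \<Longrightarrow> w u \<in> W" for k w b
    using that B C(2) by (subst representation_sum) (auto simp: representation_scale span_scale)
  have rC: "representation C (\<Sum>b\<in>B. k b *\<^sub>R w b) u = (\<Sum>b\<in>B. k b * representation C (w b) u)"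
    if "\<And>b. b \<in> B \<Longrightarrow> w b \<in> W" for k w u
    using that C fB by (subst representation_sum) (auto simp: representation_scale span_scale)
  have "trace_on W T = (\<Sum>b\<in>B. representation B (T b) b)" by (simp add: trace_on_def B_def Let_def)
  also have "\<dots> = (\<Sum>b\<in>B. \<Sum>u\<in>C. representation C b u * representation B (T u) b)"
  proof (rule sum.cong)
    fix b assume b: "b \<in> B"
    show "representation B (T b) b = (\<Sum>u\<in>C. representation C b u * representation B (T u) b)"
      by (subst lT) (use b BW CW W in \<open>auto intro!: rB\<close>)
  qed simp
  also have "\<dots> = (\<Sum>u\<in>C. \<Sum>b\<in>B. representation B (T u) b * representation C b u)"
    by (subst sum.swap) (simp add: mult.commute)
  also have "\<dots> = (\<Sum>u\<in>C. representation C (T u) u)"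
  proof (rule sum.cong)
    fix u assume u: "u \<in> C"
    have "T u = (\<Sum>b\<in>B. representation B (T u) b *\<^sub>R b)"
      using sum_representation_eq[OF B(1) _ fB order_refl, of "T u"] W u CW B by auto
    then show "(\<Sum>b\<in>B. representation B (T u) b * representation C b u) = representation C (T u) u"
      using rC[of "\<lambda>b. b" "representation B (T u)" u] BW by (metis subsetD)
  qed simp
  finally show ?thesis .
qed

lemma trace_on_1:
  fixes a :: "'a::real_vector"
  assumes "a \<noteq> 0" "W = span {a}" "linear T'" "\<And>v. v \<in> W \<Longrightarrow> T v = T' v" "T a = k *\<^sub>R a"
  shows "trace_on W T = k"
proof -
  have ind: "independent {a}" using assms(1) by simp
  have W: "T v \<in> W" if "v \<in> W" for v
  proof -
    from that obtain r where "v = r *\<^sub>R a" unfolding assms(2) span_singleton by blast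
    then have "T v = r *\<^sub>R T a" using assms(2-4) that linear_scale by (metis span_base singletonI)
    then show ?thesis using assms(2,5) by (simp add: span_base span_scale)
  qed
  have "trace_on W T = representation {a} (k *\<^sub>R a) a"
    using trace_on_eq[OF ind _ assms(2)[symmetric] assms(3,4) W] assms(5) by simp
  also have "\<dots> = k * representation {a} a a"
    by (simp only: representation_scale[OF ind span_base[OF singletonI]])
  finally show ?thesis using representation_basis[OF ind] by simp
qed

lemma trace_on_2:
  fixes a :: "'a::real_vector"
  assumes ind: "independent {a, b}" and ab: "a \<noteq> b" and W: "W = span {a, b}" and T': "linear T'"
    and T: "\<And>v. v \<in> W \<Longrightarrow> T v = T' v" and Ta: "T a = k1 *\<^sub>R a + l1 *\<^sub>R b" and Tb: "T b = l2 *\<^sub>R a + k2 *\<^sub>R b"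
  shows "trace_on W T = k1 + k2"
proof -
  have in_W: "a \<in> W" "b \<in> W" by (simp_all add: W span_base)
  have WW: "T v \<in> W" if "v \<in> W" for v
  proof -
    have "\<exists>r s. v = r *\<^sub>R a + s *\<^sub>R b"
      using that unfolding W by (auto simp: span_insert span_singleton algebra_simps)
    then obtain r s where "v = r *\<^sub>R a + s *\<^sub>R b" by blast
    then have "T v = r *\<^sub>R T a + s *\<^sub>R T b"
      using T that in_W by (simp add: linear_add[OF T'] linear_scale[OF T'])
    then show ?thesis using W by (simp add: Ta Tb in_W span_base span_scale span_add)
  qed
  have r: "representation {a, b} (k *\<^sub>R a + l *\<^sub>R b) u = k * representation {a, b} a u + l * representation {a, b} b u" for k l u
    by (simp add: representation_add[OF ind] representation_scale[OF ind] span_base span_scale)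
  have "trace_on W T = (\<Sum>u\<in>{a, b}. representation {a, b} (T u) u)"
    using trace_on_eq[OF ind _ W[symmetric] T' T WW] by simp
  also have "\<dots> = k1 + k2" using ab representation_basis[OF ind] by (simp add: Ta Tb r)
  finally show ?thesis .
qed

subsection \<open>Signatures\<close>

lemma pos_index_eqI:
  fixes b :: "'a::euclidean_space \<Rightarrow> 'a \<Rightarrow> real"
  assumes "subspace P" "P \<subseteq> W" "\<And>v. v \<in> P \<Longrightarrow> v \<noteq> 0 \<Longrightarrow> b v v > 0" "dim P = k"
    and "\<And>P. subspace P \<Longrightarrow> P \<subseteq> W \<Longrightarrow> (\<And>v. v \<in> P \<Longrightarrow> v \<noteq> 0 \<Longrightarrow> b v v > 0) \<Longrightarrow> dim P \<le> k"
  shows "pos_index b W = k" unfolding pos_index_def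
proof (rule Max_eqI)
  show "finite {dim P |P. subspace P \<and> P \<subseteq> W \<and> (\<forall>v\<in>P - {0}. 0 < b v v)}"
    by (rule finite_subset[of _ "{..DIM('a)}"]) (auto intro: dim_subset_UNIV)
qed (use assms in auto)

lemma pos_index_attained:
  fixes b :: "'a::euclidean_space \<Rightarrow> 'a \<Rightarrow> real"
  assumes "subspace W"
  obtains P where "subspace P" "P \<subseteq> W" "\<And>v. v \<in> P \<Longrightarrow> v \<noteq> 0 \<Longrightarrow> b v v > 0" "dim P = pos_index b W"
proof -
  let ?S = "{dim P |P. subspace P \<and> P \<subseteq> W \<and> (\<forall>v\<in>P - {0}. 0 < b v v)}"
  have "finite ?S" by (rule finite_subset[of _ "{..DIM('a)}"]) (auto intro: dim_subset_UNIV)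
  moreover have "?S \<noteq> {}" using subspace_0[OF assms] by (auto intro!: exI[of _ "{0}"])
  ultimately have "pos_index b W \<in> ?S" unfolding pos_index_def by (rule Max_in)
  then show ?thesis using that by auto
qed

lemma signature_3_1:
  fixes V :: "'v::r42 set"
  assumes V: "subspace V" "dim V = 4" "signature form V = (3, 1)"
  shows "nondeg V"
    and "u \<in> V \<Longrightarrow> w \<in> V \<Longrightarrow> form u u = 0 \<Longrightarrow> form w w = 0 \<Longrightarrow> form u w = 0 \<Longrightarrow> w \<noteq> 0 \<Longrightarrow> \<exists>k. u = k *\<^sub>R w"
proof -
  obtain P where P: "subspace P" "P \<subseteq> V" "\<And>v. v \<in> P \<Longrightarrow> v \<noteq> 0 \<Longrightarrow> form v v > 0" "dim P = 3"
    using pos_index_attained[OF V(1), of form] V(3) by (auto simp: signature_def)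
  obtain N where N: "subspace N" "N \<subseteq> V" "\<And>v. v \<in> N \<Longrightarrow> v \<noteq> 0 \<Longrightarrow> form v v < 0" "dim N = 1"
    using pos_index_attained[OF V(1), of "\<lambda>v w. - form v w"] V(3) by (auto simp: signature_def)
  have "P \<inter> N \<subseteq> {0}" using P(3) N(3) by force
  then have "dim (P \<inter> N) = 0" by (simp add: dim_eq_0)
  then have "dim {x + y |x y. x \<in> P \<and> y \<in> N} = 4" using dim_sums_Int[OF P(1) N(1)] P(4) N(4) by linarith
  moreover have "{x + y |x y. x \<in> P \<and> y \<in> N} \<subseteq> V" using P(2) N(2) V(1) subspace_add by blast
  ultimately have eq: "{x + y |x y. x \<in> P \<and> y \<in> N} = V"
    using V(1,2) by (intro subspace_dim_equal subspace_sums[OF P(1) N(1)]) auto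
  show "nondeg V" unfolding nondeg_def
  proof (intro conjI ballI impI V(1))
    fix v assume "v \<in> V" and o: "\<forall>w\<in>V. form v w = 0"
    then obtain a b where ab: "a \<in> P" "b \<in> N" "v = a + b" using eq by blast
    have "form v a = 0" "form v b = 0" using o ab P(2) N(2) by auto
    then have "form a a = form b b" using ab(3) by (simp add: form_simps form_commute)
    then have "a = 0 \<and> b = 0" using P(3)[OF ab(1)] N(3)[OF ab(2)] by (cases "a = 0"; cases "b = 0") (auto simp: form_simps)
    then show "v = 0" using ab by simp
  qed
  show "\<exists>k. u = k *\<^sub>R w" if u: "u \<in> V" "w \<in> V" "form u u = 0" "form w w = 0" "form u w = 0" "w \<noteq> 0"
  proof -
    obtain a b where ab: "a \<in> P" "b \<in> N" "w = a + b" using eq u(2) by blast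
    obtain a' b' where ab': "a' \<in> P" "b' \<in> N" "u = a' + b'" using eq u(1) by blast
    have "b \<noteq> 0"
    proof
      assume "b = 0"
      then have "w \<in> P" using ab by simp
      then show False using P(3)[of w] u by simp
    qed
    moreover obtain n where n: "n \<in> N" "n \<noteq> 0" using \<open>b \<noteq> 0\<close> ab by blast
    have "span {b} = N"
      using \<open>b \<noteq> 0\<close> ab N by (intro subspace_dim_equal) (auto intro: span_minimal[THEN subsetD])
    then obtain k where k: "b' = k *\<^sub>R b" using ab'(2) by (auto simp: span_singleton)
    \<comment> \<open>The negative part is a line, so a multiple of \<open>w\<close> removes the
      negative part of \<open>u\<close>; the remainder is a null vector of the positive definite
      \<open>P\<close>, hence 0.\<close>
    have "u - k *\<^sub>R w = a' - k *\<^sub>R a" using k ab ab' by (simp add: algebra_simps)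
    then have "u - k *\<^sub>R w \<in> P" using subspace_diff[OF P(1) ab'(1) subspace_scale[OF P(1) ab(1)]] by simp
    moreover have "form (u - k *\<^sub>R w) (u - k *\<^sub>R w) = 0"
      using u by (simp add: form_simps form_commute[of w u])
    ultimately have "u - k *\<^sub>R w = 0" using P(3) by fastforce
    then show ?thesis by (auto intro: exI[of _ k])
  qed
qed

lemma seminegative_dim_le_1:
  fixes Q :: "'v::r42 set"
  assumes m: "form m m < 0" and Q: "subspace Q" "\<And>v. v \<in> Q \<Longrightarrow> form m v = 0" "\<And>v. v \<in> Q \<Longrightarrow> form v v \<le> 0"
  shows "dim Q \<le> 1"
proof -
  have "m \<notin> span Q" using m Q by (metis order_less_irrefl span_eq_iff)
  then have "dim (insert m Q) = dim Q + 1" by (simp add: dim_insert)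
  moreover have "dim (span (insert m Q)) \<le> 2"
  proof (rule seminegative_dim[OF subspace_span])
    fix w assume "w \<in> span (insert m Q)"
    then obtain k where "w - k *\<^sub>R m \<in> span Q" using span_breakdown_eq by blast
    then obtain a where a: "a \<in> Q" "w = a + k *\<^sub>R m" using Q(1) span_eq_iff by (metis diff_add_cancel)
    have "form w w = form a a + k * k * form m m"
      using a Q(2)[OF a(1)] by (simp add: form_simps form_commute[of a m])
    moreover have "k * k * form m m \<le> 0" using m by (simp add: mult_nonneg_nonpos)
    ultimately show "form w w \<le> 0" using Q(3)[OF a(1)] by simp
  qed
  ultimately show ?thesis by simp
qed

lemma dim_span_2: "independent {a, b} \<Longrightarrow> a \<noteq> b \<Longrightarrow> dim (span {a, b :: 'a::euclidean_space}) = 2"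
  using dim_span_eq_card_independent[of "{a, b}"] by simp

text \<open>The Gram determinant of \<open>p\<close> and \<open>F\<close> is - \<alpha>^2, so their
  plane has signature (1,1) and its complement (3,1). The null vector \<open>\<sigma>\<close>
  supplies a negative vector of the complement and shows that the complement is not positive
  definite.\<close>

lemma signature_orth:
  fixes p F :: "'v::r42"
  assumes "form p p = \<alpha>" "\<alpha> \<noteq> 0" "form p F = \<alpha>" "form F F = 0"
    and \<sigma>: "\<sigma> \<in> orth {p, F}" "\<sigma> \<noteq> 0" "form \<sigma> \<sigma> = 0"
  shows "orth (orth {p, F}) = span {p, F}" "nondeg (orth {p, F})" "dim (orth {p, F}) = 4"
    "signature form (orth {p, F}) = (3, 1)" "independent {p, F}" "p \<noteq> F"
proof -
  let ?V = "orth {p, F}"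
  show pF: "p \<noteq> F" using assms by auto
  have "F \<notin> span {p}"
  proof
    assume "F \<in> span {p}"
    then obtain k where "F = k *\<^sub>R p" by (auto simp: span_singleton)
    then show False using assms by (auto simp: form_simps)
  qed
  moreover have "p \<noteq> 0" using assms(1,2) by (auto simp: form_simps)
  moreover have "p \<notin> span {F}"
  proof
    assume "p \<in> span {F}"
    then obtain k where "p = k *\<^sub>R F" by (auto simp: span_singleton)
    then show False using assms by (auto simp: form_simps)
  qed
  ultimately show ind: "independent {p, F}" using pF assms by (auto simp: independent_insert form_simps)
  show oo: "orth ?V = span {p, F}" using orth_orth[of "span {p, F}"] by (simp add: orth_span)
  have d2: "dim (span {p, F}) = 2" using dim_span_2[OF ind pF] .
  show d4: "dim ?V = 4" using dim_orth[of "span {p, F}"] d2 by (simp add: orth_span)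
  show nd: "nondeg ?V" unfolding nondeg_def
  proof (intro conjI ballI impI subspace_orth)
    fix v assume v: "v \<in> ?V" and o: "\<forall>w\<in>?V. form v w = 0"
    then have "v \<in> span {p, F}" unfolding oo[symmetric] by (auto simp: orth_def form_commute)
    then obtain a b where ab: "v = a *\<^sub>R p + b *\<^sub>R F" by (auto simp: span_insert span_singleton algebra_simps)
    have "form p v = 0" "form F v = 0" using v by (auto simp: orth_def)
    then have "a * \<alpha> + b * \<alpha> = 0" "a * \<alpha> = 0" using assms by (simp_all add: ab form_simps form_commute[of F p])
    then show "v = 0" using assms(2) ab by simp
  qed
  \<comment> \<open>The norms of \<open>p\<close> and \<open>p - F\<close> are \<alpha> and -
    \<alpha>, so one of them is negative. Orthogonality to it limits seminegative subspaces of the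
    complement to dimension 1.\<close>
  obtain m where m: "form m m < 0" "m \<in> span {p, F}"
  proof (cases "\<alpha> < 0")
    case True
    then show ?thesis using that[of p] assms by (simp add: span_base)
  next
    case False
    then show ?thesis using that[of "p - F"] assms by (simp add: span_base span_diff form_simps form_commute[of F p])
  qed
  have mV: "form m v = 0" if "v \<in> ?V" for v using m(2) that oo orthD by blast
  have neg: "dim Q \<le> 1" if "subspace Q" "Q \<subseteq> ?V" "\<And>v. v \<in> Q \<Longrightarrow> form v v \<le> 0" for Q
    using seminegative_dim_le_1[OF m(1) that(1)] mV that by blast
  obtain v where v: "v \<in> ?V" "form \<sigma> v \<noteq> 0" using nd \<sigma> unfolding nondeg_def by blast
  \<comment> \<open>Adding a multiple of the null vector \<open>\<sigma>\<close> changes the norm of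
    \<open>v\<close> affinely; this multiple makes it -1.\<close>
  define n where "n = v + ((- 1 - form v v) / (2 * form \<sigma> v)) *\<^sub>R \<sigma>"
  have nV: "n \<in> ?V" using v \<sigma> by (simp add: n_def subspace_add subspace_scale)
  have nn: "form n n = - 1" using v(2) \<sigma>(3) by (simp add: n_def form_simps form_commute[of v \<sigma>] field_simps)
  have "pos_index (\<lambda>v w. - form v w) ?V = 1"
  proof (rule pos_index_eqI[of "span {n}"])
    show "span {n} \<subseteq> ?V" using nV by (simp add: span_minimal)
    show "dim (span {n}) = 1" using nn by (auto simp: dim_eq_0 form_simps)
    show "- form v v > 0" if "v \<in> span {n}" "v \<noteq> 0" for v
      using that nn by (auto simp: span_singleton form_simps zero_less_mult_iff)
    show "dim P \<le> 1" if "subspace P" "P \<subseteq> ?V" "\<And>v. v \<in> P \<Longrightarrow> v \<noteq> 0 \<Longrightarrow> 0 < - form v v" for P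
      by (rule neg) (use that in \<open>auto simp: form_simps less_imp_le intro: less_imp_le\<close>, metis form_simps(9) less_imp_le neg_0_less_iff_less order_refl)
  qed simp
  moreover have "pos_index form ?V = 3"
  proof (rule pos_index_eqI[of "orth {p, F, n}"])
    show "orth {p, F, n} \<subseteq> ?V" by (auto simp: orth_def)
    have nspan: "n \<notin> span {p, F}"
    proof
      assume "n \<in> span {p, F}"
      then have "form n n = 0" using nV oo orthD by blast
      then show False using nn by simp
    qed
    then have "dim (insert n {p, F}) = 3" using d2 by (simp add: dim_insert)
    moreover have "insert n {p, F} = {p, F, n}" by auto
    ultimately have "dim (span {p, F, n}) = 3" by simp
    then show "dim (orth {p, F, n}) = 3" using dim_orth[of "span {p, F, n}"] by (simp add: orth_span)
    show "form u u > 0" if u: "u \<in> orth {p, F, n}" "u \<noteq> 0" for u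
    proof (rule ccontr)
      assume "\<not> form u u > 0"
      then have uu: "form u u \<le> 0" by simp
      have un: "form u n = 0" using u by (auto simp: orth_def form_commute)
      have "u \<noteq> n" using un nn by auto
      have "n \<notin> span {u}"
      proof
        assume "n \<in> span {u}"
        then obtain k where "n = k *\<^sub>R u" by (auto simp: span_singleton)
        then have "form n n = form (k *\<^sub>R u) n" by (rule arg_cong[of _ _ "\<lambda>x. form x n"])
        then have "form n n = 0" using un by (simp add: form_simps)
        then show False using nn by simp
      qed
      then have "dim (insert n {u}) = 2" using u(2) by (simp add: dim_insert)
      then have "dim (span {n, u}) = 2" by simp
      moreover have "dim (span {n, u}) \<le> 1"
      proof (rule neg)
        show "span {n, u} \<subseteq> ?V" using nV u by (intro span_minimal subspace_orth) (auto simp: orth_def)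
        fix w assume "w \<in> span {n, u}"
        then obtain a b where "w = a *\<^sub>R n + b *\<^sub>R u" by (auto simp: span_insert span_singleton algebra_simps)
        then have "form w w = b * b * form u u - a * a"
          using nn un by (simp add: form_simps form_commute[of n u])
        moreover have "b * b * form u u \<le> 0" using uu by (simp add: mult_nonneg_nonpos)
        ultimately show "form w w \<le> 0" by (smt (verit) zero_le_square)
      qed simp
      ultimately show False by simp
    qed
    show "dim P \<le> 3" if P: "subspace P" "P \<subseteq> ?V" "\<And>v. v \<in> P \<Longrightarrow> v \<noteq> 0 \<Longrightarrow> 0 < form v v" for P
    proof (rule ccontr)
      assume "\<not> dim P \<le> 3"
      then have "P = ?V" using P(1,2) d4 by (intro subspace_dim_equal) auto
      then show False using P(3)[of \<sigma>] \<sigma> by simp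
    qed
  qed simp
  ultimately show "signature form ?V = (3, 1)" by (simp add: signature_def)
qed

section \<open>Subbundles\<close>

text \<open>Euclidean orthogonal projection onto a fibre. The form has no orthogonal projection onto
  the isotropic fibres of \<open>f\<close>; the Euclidean one always exists and extends any vector
  \<open>v\<close> of a fibre to the smooth global section
  \<open>\<lambda>y. eproj (W y) v\<close>.\<close>

definition eproj :: "'a::euclidean_space set \<Rightarrow> 'a \<Rightarrow> 'a" where
  "eproj W v = (THE w. w \<in> W \<and> (\<forall>u\<in>W. u \<bullet> (v - w) = 0))"

lemma eproj_eqI:
  assumes W: "subspace W" "w \<in> W" "\<And>u. u \<in> W \<Longrightarrow> u \<bullet> (v - w) = 0"
  shows "eproj W v = w" unfolding eproj_def
proof (rule the_equality)
  fix w' assume w': "w' \<in> W \<and> (\<forall>u\<in>W. u \<bullet> (v - w') = 0)"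
  have "w - w' \<in> W" using w' W by (auto intro: subspace_diff)
  then have "(w - w') \<bullet> (v - w') = 0" "(w - w') \<bullet> (v - w) = 0" using w' W(3) by auto
  then have "(w - w') \<bullet> (w - w') = 0" by (simp add: inner_diff_right)
  then show "w' = w" by simp
qed (use assms in auto)

lemma eproj:
  assumes "subspace W"
  shows "eproj W v \<in> W" "u \<in> W \<Longrightarrow> u \<bullet> (v - eproj W v) = 0"
proof -
  obtain y z where yz: "y \<in> span W" "\<And>w. w \<in> span W \<Longrightarrow> orthogonal z w" "v = y + z"
    using orthogonal_subspace_decomp_exists[of W v] by metis
  then have "eproj W v = y"
    using assms by (intro eproj_eqI) (auto simp: span_eq_iff[THEN iffD2] orthogonal_def inner_commute)
  then show "eproj W v \<in> W" "u \<in> W \<Longrightarrow> u \<bullet> (v - eproj W v) = 0"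
    using yz assms by (auto simp: span_eq_iff[THEN iffD2] orthogonal_def inner_commute)
qed

lemma eproj_id: "subspace W \<Longrightarrow> v \<in> W \<Longrightarrow> eproj W v = v" by (rule eproj_eqI) auto

lemma linear_eproj:
  assumes "subspace W"
  shows "linear (eproj W)"
proof (rule linearI)
  note e = eproj(1)[OF assms] and i = eproj(2)[OF assms]
  show "eproj W (u + v) = eproj W u + eproj W v" for u v
  proof (rule eproj_eqI[OF assms subspace_add[OF assms e e]])
    fix w assume "w \<in> W"
    from i[OF this, of u] i[OF this, of v] show "w \<bullet> (u + v - (eproj W u + eproj W v)) = 0"
      by (simp add: inner_diff_right inner_add_right)
  qed
  show "eproj W (k *\<^sub>R v) = k *\<^sub>R eproj W v" for k v
  proof (rule eproj_eqI[OF assms subspace_scale[OF assms e]])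
    fix w assume "w \<in> W"
    from i[OF this, of v] show "w \<bullet> (k *\<^sub>R v - k *\<^sub>R eproj W v) = 0" by (simp add: inner_diff_right)
  qed
qed

lemma linear_Basis_expansion:
  assumes "linear L"
  shows "L v = (\<Sum>b\<in>Basis. (v \<bullet> b) *\<^sub>R L b)"
  by (subst (1) euclidean_representation[of v, symmetric]) (simp only: linear_sum[OF assms] linear_scale[OF assms])

text \<open>One Gram-Schmidt step, with \<open>r\<close> the part of the new vector orthogonal to
  \<open>W\<close>.\<close>

lemma eproj_insert:
  assumes "subspace W" and r: "r = s - eproj W s" "r \<noteq> 0"
  shows "eproj (span (insert s W)) v = eproj W v + ((r \<bullet> v) / (r \<bullet> r)) *\<^sub>R r"
proof (rule eproj_eqI[OF subspace_span])
  let ?w = "eproj W v + ((r \<bullet> v) / (r \<bullet> r)) *\<^sub>R r"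
  have rs: "r \<in> span (insert s W)" unfolding r using eproj(1)[OF assms(1)] by (intro span_diff span_base) auto
  show "?w \<in> span (insert s W)"
    using rs eproj(1)[OF assms(1), of v] by (intro span_add span_scale) (auto intro: span_base)
  have rW: "u \<bullet> r = 0" if "u \<in> W" for u unfolding r using eproj(2)[OF assms(1) that] .
  fix u assume "u \<in> span (insert s W)"
  then obtain k where k: "u - k *\<^sub>R s \<in> span W" using span_breakdown_eq by blast
  define a where "a = u - k *\<^sub>R s + k *\<^sub>R eproj W s"
  have a: "a \<in> W" "u = a + k *\<^sub>R r"
    using k subspace_add[OF assms(1) _ subspace_scale[OF assms(1) eproj(1)[OF assms(1)]], of "u - k *\<^sub>R s"] span_eq_iff[THEN iffD2, OF assms(1)]
    by (auto simp: a_def r algebra_simps)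
  have "r \<bullet> eproj W v = 0" using rW[OF eproj(1)[OF assms(1)]] by (simp add: inner_commute)
  then have "r \<bullet> (v - ?w) = 0" using r(2) by (simp add: inner_diff_right inner_add_right)
  moreover have "a \<bullet> (v - ?w) = 0"
    using eproj(2)[OF assms(1) a(1), of v] rW[OF a(1)] by (simp add: inner_diff_right inner_add_right)
  ultimately show "u \<bullet> (v - ?w) = 0" by (simp add: a(2) inner_add_left)
qed

text \<open>Independence of an ordered family in the triangular form that matches Gram-Schmidt;
  distinctness of the members is built in.\<close>

definition lin_indep :: "nat \<Rightarrow> (nat \<Rightarrow> 'a::real_vector) \<Rightarrow> bool" where
  "lin_indep k s \<longleftrightarrow> (\<forall>j<k. s j \<notin> span (s ` {..<j}))"

lemma dim_lin_indep: "lin_indep k s \<Longrightarrow> dim (span (s ` {..<k})) = k" for s :: "nat \<Rightarrow> 'a::euclidean_space"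
  by (induction k) (auto simp: lin_indep_def lessThan_Suc dim_insert)

lemma lin_indep_dim:
  fixes s :: "nat \<Rightarrow> 'a::euclidean_space"
  assumes "dim (span (s ` {..<k})) = k"
  shows "lin_indep k s" unfolding lin_indep_def
proof (intro allI impI notI)
  fix j assume j: "j < k" and "s j \<in> span (s ` {..<j})"
  from this(2) have "s j \<in> span (s ` ({..<k} - {j}))"
  proof (rule set_mp[OF span_mono[OF image_mono], rotated])
    show "{..<j} \<subseteq> {..<k} - {j}" using j by auto
  qed
  then have "span (insert (s j) (s ` ({..<k} - {j}))) = span (s ` ({..<k} - {j}))" by (rule span_redundant)
  moreover have "insert (s j) (s ` ({..<k} - {j})) = s ` {..<k}" using j by auto
  ultimately have "k = dim (s ` ({..<k} - {j}))" using assms by (metis dim_span)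
  also have "\<dots> \<le> card (s ` ({..<k} - {j}))" by (rule dim_le_card') simp
  also have "\<dots> \<le> card ({..<k} - {j})" by (rule card_image_le) simp
  finally show False using j by simp
qed

lemma smooth_eproj_span:
  fixes s :: "nat \<Rightarrow> 'm::smooth_surface \<Rightarrow> 'a::euclidean_space"
  assumes U: "open U" and s: "\<And>i. i < k \<Longrightarrow> smooth_map_on U (s i)" and ind: "\<And>y. y \<in> U \<Longrightarrow> lin_indep k (\<lambda>i. s i y)"
  shows "smooth_map_on U (\<lambda>y. eproj (span ((\<lambda>i. s i y) ` {..<k})) v)" using s ind
proof (induction k arbitrary: v)
  case 0
  have "eproj {0} v = 0" by (rule eproj_eqI) auto
  then show ?case by (simp add: smooth_const)
next
  case (Suc k)
  define W where "W y = span ((\<lambda>i. s i y) ` {..<k})" for y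
  define r where "r y = s k y - eproj (W y) (s k y)" for y
  have IH: "smooth_map_on U (\<lambda>y. eproj (W y) v)" for v
    unfolding W_def using Suc by (intro Suc.IH) (auto simp: lin_indep_def)
  have sW: "subspace (W y)" for y by (simp add: W_def)
  have sk: "smooth_map_on U (s k)" by (rule Suc.prems(1)) simp
  have "smooth_map_on U (\<lambda>y. s k y - (\<Sum>b\<in>Basis. (s k y \<bullet> b) *\<^sub>R eproj (W y) b))"
    by (intro smooth_intros U IH sk)
  then have r: "smooth_map_on U r" unfolding r_def linear_Basis_expansion[OF linear_eproj[OF sW], symmetric] .
  have r0: "r y \<noteq> 0" if "y \<in> U" for y
    using Suc.prems(2)[OF that] eproj(1)[OF sW, of y "s k y"] by (auto simp: lin_indep_def r_def W_def)
  have "smooth_map_on U (\<lambda>y. eproj (W y) v + ((r y \<bullet> v) / (r y \<bullet> r y)) *\<^sub>R r y)"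
    by (intro smooth_intros U IH r) (use r0 in auto)
  then show ?case
  proof (rule smooth_cong[OF U, rotated])
    fix y assume "y \<in> U"
    have "span ((\<lambda>i. s i y) ` {..<Suc k}) = span (insert (s k y) (W y))"
      unfolding W_def lessThan_Suc image_insert by (simp add: span_insert span_span)
    then show "eproj (W y) v + ((r y \<bullet> v) / (r y \<bullet> r y)) *\<^sub>R r y = eproj (span ((\<lambda>i. s i y) ` {..<Suc k})) v"
      using eproj_insert[OF sW r_def[of y] r0[OF \<open>y \<in> U\<close>]] by simp
  qed
qed

text \<open>Independence says that all Gram-Schmidt remainders are non-zero, an open condition
  because they depend smoothly on the point.\<close>

lemma lin_indep_open:
  fixes s :: "nat \<Rightarrow> 'm::smooth_surface \<Rightarrow> 'a::euclidean_space"
  assumes U: "open U" "x \<in> U" and s: "\<And>i. i < k \<Longrightarrow> smooth_map_on U (s i)" and ind: "lin_indep k (\<lambda>i. s i x)"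
  shows "\<exists>W. open W \<and> x \<in> W \<and> W \<subseteq> U \<and> (\<forall>y\<in>W. lin_indep k (\<lambda>i. s i y))" using s ind
proof (induction k)
  case 0
  then show ?case using U by (auto simp: lin_indep_def)
next
  case (Suc k)
  then obtain W where W: "open W" "x \<in> W" "W \<subseteq> U" "\<And>y. y \<in> W \<Longrightarrow> lin_indep k (\<lambda>i. s i y)"
    by (auto simp: lin_indep_def)
  define P where "P y = span ((\<lambda>i. s i y) ` {..<k})" for y
  have sP: "subspace (P y)" for y by (simp add: P_def)
  define r where "r y = s k y - eproj (P y) (s k y)" for y
  have sW: "smooth_map_on W (s i)" if "i < Suc k" for i
    using Suc.prems(1)[OF that] W(3) smooth_subset by blast
  have IH: "smooth_map_on W (\<lambda>y. eproj (P y) v)" for v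
    unfolding P_def using sW W(4) by (intro smooth_eproj_span W(1)) auto
  have sk: "smooth_map_on W (s k)" by (rule sW) simp
  have "smooth_map_on W (\<lambda>y. s k y - (\<Sum>b\<in>Basis. (s k y \<bullet> b) *\<^sub>R eproj (P y) b))"
    by (intro smooth_intros W(1) IH sk)
  then have "smooth_map_on W r" unfolding r_def linear_Basis_expansion[OF linear_eproj[OF sP], symmetric] .
  then have "continuous_on W r" using smooth_continuous[OF W(1)] by blast
  then have o: "open (r -` (- {0}) \<inter> W)" using continuous_on_open_vimage[OF W(1)] by blast
  have iff: "s k y \<notin> P y \<longleftrightarrow> r y \<noteq> 0" for y
    unfolding r_def using eproj(1)[OF sP, of y "s k y"] eproj_id[OF sP, of "s k y" y] by auto
  have "lin_indep (Suc k) (\<lambda>i. s i y)" if "y \<in> r -` (- {0}) \<inter> W" for y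
    using that W(4)[of y] iff[of y] by (auto simp: lin_indep_def P_def less_Suc_eq)
  moreover have "x \<in> r -` (- {0}) \<inter> W" using iff[of x] Suc.prems(2) W(2) by (auto simp: lin_indep_def P_def)
  ultimately show ?case using o W(3) by blast
qed

section \<open>Projections onto the fibres of a subbundle and derivatives of its sections\<close>

context
  fixes k and W :: "'m::smooth_surface \<Rightarrow> 'v::euclidean_space set"
  assumes W: "smooth_subbundle k W"
begin

lemma subspace_fibre: "subspace (W x)" and dim_fibre: "dim (W x) = k"
  using W by (auto simp: smooth_subbundle_def)

lemma smooth_eproj: "smooth_map (\<lambda>x. eproj (W x) v)"
proof (rule smooth_local)
  fix x
  obtain U s where U: "open U" "x \<in> U" "\<And>i. i < k \<Longrightarrow> smooth_map_on U (s i)"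
    "\<And>y. y \<in> U \<Longrightarrow> W y = span {s i y | i. i < k}" using W unfolding smooth_subbundle_def by meson
  have img: "{s i y | i. i < k} = (\<lambda>i. s i y) ` {..<k}" for y by auto
  have "smooth_map_on U (\<lambda>y. eproj (span ((\<lambda>i. s i y) ` {..<k})) v)"
  proof (rule smooth_eproj_span[OF U(1,3)])
    fix y assume "y \<in> U"
    then show "lin_indep k (\<lambda>i. s i y)"
      using U(4)[of y] dim_fibre[of y] by (intro lin_indep_dim) (simp only: img)
  qed
  then have "smooth_map_on U (\<lambda>y. eproj (W y) v)"
    by (rule smooth_cong[OF U(1), rotated]) (simp only: U(4) img)
  then show "\<exists>U. open U \<and> x \<in> U \<and> smooth_map_on U (\<lambda>x. eproj (W x) v)" using U(1,2) by blast
qed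

lemma eproj_section: "(\<lambda>y. eproj (W y) v) \<in> sections W"
  using smooth_eproj eproj(1)[OF subspace_fibre] by (auto simp: sections_def)

lemma eproj_fibre: "v \<in> W x \<Longrightarrow> eproj (W x) v = v" by (rule eproj_id[OF subspace_fibre])

lemma section_through:
  assumes "v \<in> W x"
  shows "section_through W x v \<in> sections W" "section_through W x v x = v"
  using someI[of "\<lambda>\<sigma>. \<sigma> \<in> sections W \<and> \<sigma> x = v" "\<lambda>y. eproj (W y) v"] eproj_section eproj_fibre[OF assms]
  by (auto simp: section_through_def)

lemma linear_tderiv_eproj: "linear (\<lambda>v. tderiv (\<lambda>y. eproj (W y) v) x X)"
proof (rule linearI)
  note l = linear_eproj[OF subspace_fibre]
  show "tderiv (\<lambda>y. eproj (W y) (u + v)) x X = tderiv (\<lambda>y. eproj (W y) u) x X + tderiv (\<lambda>y. eproj (W y) v) x X" for u v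
    unfolding linear_add[OF l] by (rule tderiv_add[OF open_UNIV smooth_eproj smooth_eproj UNIV_I])
  show "tderiv (\<lambda>y. eproj (W y) (k *\<^sub>R v)) x X = k *\<^sub>R tderiv (\<lambda>y. eproj (W y) v) x X" for k v
    unfolding linear_scale[OF l] by (rule tderiv_scaleR_right[OF open_UNIV smooth_eproj UNIV_I])
qed

text \<open>Differentiating both occurrences of \<open>y\<close> in
  \<open>\<sigma> y = eproj (W y) (\<sigma> y)\<close> separates a term that depends only on the
  value \<open>\<sigma> x\<close> from one in the fibre. So derivatives modulo \<open>W\<close> are
  tensorial, and the global sections of the definitions may be traded for local ones.\<close>

lemma tderiv_local_section:
  assumes U: "open U" "x \<in> U" and \<sigma>: "smooth_map_on U \<sigma>" "\<And>y. y \<in> U \<Longrightarrow> \<sigma> y \<in> W y"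
  shows "tderiv \<sigma> x X = tderiv (\<lambda>y. eproj (W y) (\<sigma> x)) x X + eproj (W x) (tderiv \<sigma> x X)"
proof -
  have P: "smooth_map_on U (\<lambda>y. eproj (W y) v)" for v by (rule smooth_subset[OF smooth_eproj]) simp
  have s: "smooth_map_on U (\<lambda>y. \<sigma> y \<bullet> b)" for b by (intro smooth_intros U \<sigma>)
  have "smooth_map_on U (\<lambda>y. \<Sum>b\<in>Basis. (\<sigma> y \<bullet> b) *\<^sub>R eproj (W y) b)" by (intro smooth_intros U P \<sigma>)
  then have "tderiv \<sigma> x X = tderiv (\<lambda>y. \<Sum>b\<in>Basis. (\<sigma> y \<bullet> b) *\<^sub>R eproj (W y) b) x X"
    by (rule tderiv_cong[OF U(1,2)])
      (simp add: linear_Basis_expansion[OF linear_eproj[OF subspace_fibre], symmetric] eproj_fibre \<sigma>)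
  also have "\<dots> = (\<Sum>b\<in>Basis. (\<sigma> x \<bullet> b) *\<^sub>R tderiv (\<lambda>y. eproj (W y) b) x X + (tderiv \<sigma> x X \<bullet> b) *\<^sub>R eproj (W x) b)"
    by (subst tderiv_sum[OF U(1) _ U(2)])
      (auto intro!: smooth_intros U P \<sigma> sum.cong simp: tderiv_scaleR[OF U(1) s P U(2)]
        tderiv_bounded_linear[OF bounded_linear_inner_left U(1) \<sigma>(1) U(2)])
  also have "\<dots> = tderiv (\<lambda>y. eproj (W y) (\<sigma> x)) x X + eproj (W x) (tderiv \<sigma> x X)" unfolding sum.distrib
    by (simp only: linear_Basis_expansion[OF linear_eproj[OF subspace_fibre], symmetric]
        linear_Basis_expansion[OF linear_tderiv_eproj, symmetric])
  finally show ?thesis .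
qed

lemma tderiv_local_sections_diff:
  assumes U: "open U" "x \<in> U" and \<sigma>: "smooth_map_on U \<sigma>" "\<And>y. y \<in> U \<Longrightarrow> \<sigma> y \<in> W y"
    and U': "open U'" "x \<in> U'" and \<sigma>': "smooth_map_on U' \<sigma>'" "\<And>y. y \<in> U' \<Longrightarrow> \<sigma>' y \<in> W y" and eq: "\<sigma> x = \<sigma>' x"
  shows "tderiv \<sigma> x X - tderiv \<sigma>' x X \<in> W x"
proof -
  have "tderiv \<sigma> x X - tderiv \<sigma>' x X = eproj (W x) (tderiv \<sigma> x X) - eproj (W x) (tderiv \<sigma>' x X)"
    using tderiv_local_section[OF U \<sigma>, of X] tderiv_local_section[OF U' \<sigma>', of X] eq
    by (metis add_diff_cancel_left)
  then show ?thesis using eproj(1)[OF subspace_fibre] by (simp add: subspace_diff[OF subspace_fibre])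
qed

lemma fibre_subset_derived: "W x \<subseteq> derived W x"
proof
  fix v assume "v \<in> W x"
  then have "v \<in> {\<sigma> x |\<sigma>. \<sigma> \<in> sections W}"
    using eproj_section[of v] eproj_fibre by (auto intro!: exI[of _ "\<lambda>y. eproj (W y) v"])
  then show "v \<in> derived W x" unfolding derived_def by (intro span_base) blast
qed

lemma tderiv_in_derived:
  assumes U: "open U" "x \<in> U" and \<sigma>: "smooth_map_on U \<sigma>" "\<And>y. y \<in> U \<Longrightarrow> \<sigma> y \<in> W y"
  shows "tderiv \<sigma> x X \<in> derived W x"
proof -
  have "tderiv (\<lambda>y. eproj (W y) (\<sigma> x)) x X \<in> derived W x"
    unfolding derived_def using eproj_section by (intro span_base) blast
  moreover have "eproj (W x) (tderiv \<sigma> x X) \<in> derived W x"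
    using fibre_subset_derived eproj(1)[OF subspace_fibre] by blast
  ultimately show ?thesis by (subst tderiv_local_section[OF U \<sigma>]) (auto simp: derived_def intro: span_add)
qed

lemma derived_minimal:
  assumes "subspace S" "W x \<subseteq> S" "\<And>\<sigma> X. \<sigma> \<in> sections W \<Longrightarrow> tderiv \<sigma> x X \<in> S"
  shows "derived W x \<subseteq> S"
  unfolding derived_def by (rule span_minimal) (use assms in \<open>auto simp: sections_def\<close>)

end

lemma subspace_derived: "subspace (derived W x)" by (simp add: derived_def)

text \<open>A smooth family of maps onto the fibres that fix them suffices: the images of a basis of
  the fibre at \<open>x\<close> stay independent near \<open>x\<close>, hence span the nearby
  fibres.\<close>

lemma smooth_subbundleI:
  fixes W :: "'m::smooth_surface \<Rightarrow> 'v::euclidean_space set"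
  assumes Q: "\<And>x v. Q x v \<in> W x" "\<And>x v. v \<in> W x \<Longrightarrow> Q x v = v"
    and W: "\<And>x. subspace (W x)" "\<And>x. dim (W x) = k" and s: "\<And>v. smooth_map (\<lambda>x. Q x v)"
  shows "smooth_subbundle k W" unfolding smooth_subbundle_def
proof (intro conjI allI W)
  fix x
  obtain B where B: "B \<subseteq> W x" "independent B" "W x \<subseteq> span B" "card B = k"
    using basis_exists[of "W x"] W(2) by metis
  then have fB: "finite B" using independent_imp_finite by blast
  obtain b where b: "b ` {..<k} = B" using B(4) fB ex_bij_betw_nat_finite[OF fB] by (auto simp: bij_betw_def atLeast0LessThan)
  have "span (b ` {..<k}) = W x" using b B W(1) span_minimal by blast
  then have "lin_indep k b" using W(2) lin_indep_dim by metis
  moreover have "lin_indep k (\<lambda>i. Q x (b i))"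
  proof -
    have "Q x (b i) = b i" if "i < k" for i using Q(2)[of "b i" x] B(1) b that by blast
    moreover have "(\<lambda>i. Q x (b i)) ` {..<j} = b ` {..<j}" if "j < k" for j
      using calculation that by (intro image_cong) auto
    ultimately show ?thesis using \<open>lin_indep k b\<close> by (simp add: lin_indep_def)
  qed
  ultimately obtain U where U: "open U" "x \<in> U" "\<And>y. y \<in> U \<Longrightarrow> lin_indep k (\<lambda>i. Q y (b i))"
    using lin_indep_open[OF open_UNIV UNIV_I, of k "\<lambda>i x. Q x (b i)" x, OF s] by blast
  have "W y = span {Q y (b i) |i. i < k}" if "y \<in> U" for y
  proof -
    have "{Q y (b i) |i. i < k} = (\<lambda>i. Q y (b i)) ` {..<k}" by auto
    moreover have "span ((\<lambda>i. Q y (b i)) ` {..<k}) = W y" using dim_lin_indep[OF U(3)[OF that]] W Q(1)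
      by (intro subspace_dim_equal span_minimal) auto
    ultimately show ?thesis by simp
  qed
  then show "\<exists>U s. open U \<and> x \<in> U \<and> (\<forall>i<k. smooth_map_on U (s i)) \<and> (\<forall>y\<in>U. W y = span {s i y |i. i < k})"
    using U(1,2) s smooth_subset[OF s] by (intro exI[of _ U] exI[of _ "\<lambda>i x. Q x (b i)"]) auto
qed

lemma smooth_line_bundleI:
  fixes W :: "'m::smooth_surface \<Rightarrow> 'v::euclidean_space set"
  assumes "\<And>x. \<exists>U \<sigma>. open U \<and> x \<in> U \<and> smooth_map_on U \<sigma> \<and> (\<forall>y\<in>U. \<sigma> y \<noteq> 0 \<and> W y = span {\<sigma> y})"
  shows "smooth_subbundle 1 W" unfolding smooth_subbundle_def
proof (intro conjI allI)
  fix x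
  obtain U \<sigma> where U: "open U" "x \<in> U" "smooth_map_on U \<sigma>" "\<And>y. y \<in> U \<Longrightarrow> \<sigma> y \<noteq> 0" "\<And>y. y \<in> U \<Longrightarrow> W y = span {\<sigma> y}"
    using assms[of x] by blast
  show "subspace (W x)" "dim (W x) = 1" using U(4,5)[OF U(2)] by (auto simp: dim_eq_0)
  have "{\<sigma> y |i::nat. i < 1} = {\<sigma> y}" for y by auto
  then show "\<exists>U s. open U \<and> x \<in> U \<and> (\<forall>i<1. smooth_map_on U (s i)) \<and> (\<forall>y\<in>U. W y = span {s i y |i. i < (1::nat)})"
    using U by (intro exI[of _ U] exI[of _ "\<lambda>_. \<sigma>"]) simp
qed

lemma line_bundle_section:
  assumes "smooth_subbundle 1 W"
  obtains U \<sigma> where "open U" "x \<in> U" "smooth_map_on U \<sigma>" "\<And>y. y \<in> U \<Longrightarrow> \<sigma> y \<noteq> 0" "\<And>y. y \<in> U \<Longrightarrow> W y = span {\<sigma> y}"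
proof -
  obtain U s where U: "open U" "x \<in> U" "\<And>i. i < 1 \<Longrightarrow> smooth_map_on U (s i)"
    "\<And>y. y \<in> U \<Longrightarrow> W y = span {s i y | i. i < (1::nat)}" using assms unfolding smooth_subbundle_def by meson
  have eq: "{s i y | i. i < (1::nat)} = {s 0 y}" for y by auto
  have "s 0 y \<noteq> 0" if "y \<in> U" for y using U(4)[OF that] dim_fibre[OF assms, of y] by (auto simp: eq)
  then show ?thesis using that[of U "s 0"] U eq by simp
qed

lemmas smooth_form = smooth_bilinear[OF bounded_bilinear_form]
lemmas smooth_wedge = smooth_bilinear[OF bounded_bilinear_wedge]
lemmas smooth_apply = smooth_bilinear[OF bounded_bilinear_blinfun_apply]
lemmas tderiv_form = tderiv_bilinear[OF bounded_bilinear_form]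
lemmas tderiv_wedge = tderiv_bilinear[OF bounded_bilinear_wedge]
lemmas tderiv_apply = tderiv_bilinear[OF bounded_bilinear_blinfun_apply]

lemma tderiv_form_eq:
  assumes "open U" "x \<in> U" "smooth_map_on U g" "smooth_map_on U h" "\<And>y. y \<in> U \<Longrightarrow> form (g y) (h y) = c"
  shows "form (tderiv g x X) (h x) = - form (g x) (tderiv h x X)"
proof -
  have "tderiv (\<lambda>y. form (g y) (h y)) x X = tderiv (\<lambda>_. c) x X"
    by (rule tderiv_cong[OF assms(1,2) smooth_const]) (simp add: assms(5))
  then show ?thesis using tderiv_form[OF assms(1,3,4,2), of X] by simp
qed

section \<open>Curvature spheres\<close>

definition along :: "('m::smooth_surface \<Rightarrow> real^2) \<Rightarrow> ('m \<Rightarrow> 'b::real_normed_vector) \<Rightarrow> 'm \<Rightarrow> 'b" where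
  "along X g x = tderiv g x (X x)"

lemma smooth_along: "open U \<Longrightarrow> smooth_map_on U g \<Longrightarrow> smooth_field_on U X \<Longrightarrow> smooth_map_on U (along X g)"
  unfolding along_def[abs_def] by (rule smooth_field_deriv)

lemma plane_basis:
  fixes u v :: "real^2"
  assumes "u \<noteq> 0" "v \<notin> span {u}"
  obtains a b where "z = a *\<^sub>R u + b *\<^sub>R v"
proof -
  have "dim (span (insert v {u})) = 2" using assms by (simp add: dim_insert)
  then have "span (insert v {u}) = UNIV" by (intro subspace_dim_equal) auto
  then obtain b where "z - b *\<^sub>R v \<in> span {u}" using span_breakdown_eq[of z v "{u}"] by auto
  then obtain a where "z - b *\<^sub>R v = a *\<^sub>R u" by (auto simp: span_singleton)
  then have "z = a *\<^sub>R u + b *\<^sub>R v" by (simp add: algebra_simps)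
  then show ?thesis by (rule that)
qed

lemma two_lines:
  fixes a b :: "'a::euclidean_space"
  assumes "a \<noteq> 0" "span {a} \<noteq> span {b}" "b \<noteq> 0" and W: "subspace W" "dim W = 2" "a \<in> W" "b \<in> W"
  shows "W = span {a, b}" "independent {a, b}" "a \<noteq> b"
proof -
  show ab: "a \<noteq> b" using assms(2) by auto
  have "a \<notin> span {b}"
  proof
    assume "a \<in> span {b}"
    then have "span {a} \<subseteq> span {b}" by (simp add: span_minimal)
    then have "span {a} = span {b}" using assms(1,3) by (intro subspace_dim_equal) auto
    then show False using assms by simp
  qed
  moreover have "independent {b}" using assms(3) by simp
  ultimately show ind: "independent {a, b}" using ab by (simp add: independent_insert)
  have "span {a, b} = W" using dim_span_2[OF ind ab] W by (intro subspace_dim_equal span_minimal) auto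
  then show "W = span {a, b}" ..
qed

section \<open>Legendre maps with an ordered pair of curvature spheres\<close>

locale legendre_pair =
  fixes f :: "'m::smooth_surface \<Rightarrow> 'v::r42 set" and s1 s2 :: "'m \<Rightarrow> 'v set"
  assumes legendre: "legendre_map f" and pair: "curvature_sphere_pair f s1 s2"
begin

abbreviation slice :: "'v \<Rightarrow> 'm \<Rightarrow> 'v set" where "slice p \<equiv> \<lambda>x. f x \<inter> orth {p}"

lemma swap: "legendre_pair f s2 s1"
  using legendre pair by (auto simp: legendre_pair_def curvature_sphere_pair_def insert_commute)

lemma f_bundle: "smooth_subbundle 2 f" and isotropic_f: "isotropic (f x)"
  using legendre by (auto simp: legendre_map_def)

lemma bundle_s: "smooth_subbundle 1 s1" "smooth_subbundle 1 s2"
  and s_neq: "s1 x \<noteq> s2 x" and sphere_iff: "curvature_sphere f x s \<longleftrightarrow> s = s1 x \<or> s = s2 x"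
  using pair by (auto simp: curvature_sphere_pair_def set_eq_iff)

lemma subspace_f: "subspace (f x)" and dim_f: "dim (f x) = 2"
  by (rule subspace_fibre[OF f_bundle], rule dim_fibre[OF f_bundle])

lemma f_orth: "f x \<subseteq> orth (f x)" using isotropic_f by (auto simp: isotropic_def orth_def)

lemma s_subset: "s1 x \<subseteq> f x" "s2 x \<subseteq> f x" using sphere_iff[of x] by (auto simp: curvature_sphere_def)

lemma tderiv_section_orth:
  assumes "open U" "x \<in> U" "smooth_map_on U \<sigma>" "\<And>y. y \<in> U \<Longrightarrow> \<sigma> y \<in> f y"
  shows "tderiv \<sigma> x X \<in> orth (f x)"
  using tderiv_in_derived[OF f_bundle assms] legendre by (auto simp: legendre_map_def)

lemma immersion:
  assumes "X \<noteq> 0"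
  obtains \<sigma> where "\<sigma> \<in> sections f" "tderiv \<sigma> x X \<notin> f x"
  using legendre assms unfolding legendre_map_def by meson

text \<open>\<open>curvature_space\<close> tests global sections; a local section has the same
  derivative modulo \<open>f\<close> as the global section obtained by projecting the constant
  \<open>\<sigma> x\<close>.\<close>

lemma curvature_space_tderiv:
  assumes "X \<in> curvature_space f x s" "open U" "x \<in> U" "smooth_map_on U \<sigma>" "\<And>y. y \<in> U \<Longrightarrow> \<sigma> y \<in> f y" "\<sigma> x \<in> s"
  shows "tderiv \<sigma> x X \<in> f x"
proof -
  let ?\<sigma> = "\<lambda>y. eproj (f y) (\<sigma> x)"
  have fx: "\<sigma> x \<in> f x" using assms by blast
  have "?\<sigma> x = \<sigma> x" by (rule eproj_fibre[OF f_bundle fx])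
  then have "tderiv ?\<sigma> x X \<in> f x"
    using assms(1,6) eproj_section[OF f_bundle, of "\<sigma> x"] by (auto simp: curvature_space_def)
  moreover have "tderiv \<sigma> x X - tderiv ?\<sigma> x X \<in> f x"
    using \<open>?\<sigma> x = \<sigma> x\<close> smooth_eproj[OF f_bundle] eproj(1)[OF subspace_f] assms
    by (intro tderiv_local_sections_diff[OF f_bundle assms(2-5) open_UNIV UNIV_I]) auto
  ultimately show ?thesis using subspace_add[OF subspace_f] by force
qed

lemma curvature_spaceI:
  assumes "open U" "x \<in> U" "smooth_map_on U \<sigma>" "\<And>y. y \<in> U \<Longrightarrow> \<sigma> y \<in> f y" "tderiv \<sigma> x X \<in> f x" "s \<subseteq> span {\<sigma> x}"
  shows "X \<in> curvature_space f x s" unfolding curvature_space_def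
proof (intro CollectI ballI impI)
  fix \<tau> assume \<tau>: "\<tau> \<in> sections f" "\<tau> x \<in> s"
  then obtain k where k: "\<tau> x = k *\<^sub>R \<sigma> x" using assms(6) by (auto simp: span_singleton)
  have "tderiv \<tau> x X - tderiv (\<lambda>y. k *\<^sub>R \<sigma> y) x X \<in> f x" using \<tau> assms k subspace_scale[OF subspace_f]
    by (intro tderiv_local_sections_diff[OF f_bundle open_UNIV UNIV_I _ _ assms(1,2)])
      (auto simp: sections_def intro!: smooth_intros)
  moreover have "tderiv (\<lambda>y. k *\<^sub>R \<sigma> y) x X \<in> f x"
    using tderiv_scaleR_right[OF assms(1,3,2)] assms(5) subspace_scale[OF subspace_f] by simp
  ultimately show "tderiv \<tau> x X \<in> f x" using subspace_add[OF subspace_f] by force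
qed

lemma subspace_curvature_space: "subspace (curvature_space f x s)"
proof -
  have "linear (tderiv \<sigma> x)" if "\<sigma> \<in> sections f" for \<sigma>
    using that tderiv_linear[OF open_UNIV _ UNIV_I] by (auto simp: sections_def)
  then show ?thesis unfolding subspace_def curvature_space_def
    using subspace_0[OF subspace_f] subspace_add[OF subspace_f] subspace_scale[OF subspace_f]
    by (auto simp: linear_0 linear_add linear_scale)
qed

lemma curvature_space_nonzero: "\<exists>X. X \<noteq> 0 \<and> X \<in> curvature_space f x (s1 x)"
proof -
  have "curvature_sphere f x (s1 x)" using sphere_iff by blast
  then obtain T where "subspace T" "T \<noteq> {0}" "T \<subseteq> curvature_space f x (s1 x)"
    by (auto simp: curvature_sphere_def)
  then show ?thesis using subspace_0 by blast
qed

lemma fibre_split: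
  assumes "v \<in> f x"
  obtains a b where "a \<in> s1 x" "b \<in> s2 x" "v = a + b"
proof -
  obtain U1 \<sigma>1 where 1: "x \<in> U1" "\<And>y. y \<in> U1 \<Longrightarrow> \<sigma>1 y \<noteq> 0" "\<And>y. y \<in> U1 \<Longrightarrow> s1 y = span {\<sigma>1 y}"
    using line_bundle_section[OF bundle_s(1), of x] by metis
  obtain U2 \<sigma>2 where 2: "x \<in> U2" "\<And>y. y \<in> U2 \<Longrightarrow> \<sigma>2 y \<noteq> 0" "\<And>y. y \<in> U2 \<Longrightarrow> s2 y = span {\<sigma>2 y}"
    using line_bundle_section[OF bundle_s(2), of x] by metis
  note l = 1(3)[OF 1(1)] 2(3)[OF 2(1)]
  have "span {\<sigma>1 x} \<noteq> span {\<sigma>2 x}" using s_neq[of x] l by simp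
  moreover have "\<sigma>1 x \<in> f x" "\<sigma>2 x \<in> f x" using s_subset[of x] l by (auto simp: span_base subset_iff)
  ultimately have "f x = span {\<sigma>1 x, \<sigma>2 x}"
    by (rule two_lines(1)[OF 1(2)[OF 1(1)] _ 2(2)[OF 2(1)] subspace_f dim_f])
  then have "\<exists>k l. v = k *\<^sub>R \<sigma>1 x + l *\<^sub>R \<sigma>2 x"
    using assms by (auto simp: span_insert span_singleton algebra_simps)
  then obtain k m where "v = k *\<^sub>R \<sigma>1 x + m *\<^sub>R \<sigma>2 x" by blast
  then show ?thesis by (intro that) (simp_all add: l span_base span_scale)
qed

text \<open>\<open>f\<close> is the sum of the two spheres, so a direction in both curvature spaces
  would move no section out of \<open>f\<close>, against the immersion condition of a Legendre
  map.\<close>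

lemma curvature_spaces_disjoint:
  assumes "X \<in> curvature_space f x (s1 x)" "X \<in> curvature_space f x (s2 x)"
  shows "X = 0"
proof (rule ccontr)
  assume "X \<noteq> 0"
  then obtain \<sigma> where \<sigma>: "\<sigma> \<in> sections f" "tderiv \<sigma> x X \<notin> f x" using immersion by metis
  then have "\<sigma> x \<in> f x" by (auto simp: sections_def)
  then obtain a b where ab: "a \<in> s1 x" "b \<in> s2 x" "\<sigma> x = a + b" by (rule fibre_split)
  let ?P = "\<lambda>v y. eproj (f y) v"
  have fx: "a \<in> f x" "b \<in> f x" using ab s_subset by auto
  have "tderiv (?P a) x X \<in> f x" "tderiv (?P b) x X \<in> f x"
    using curvature_space_tderiv[OF assms(1) open_UNIV UNIV_I smooth_eproj[OF f_bundle] eproj(1)[OF subspace_f], of a]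
      curvature_space_tderiv[OF assms(2) open_UNIV UNIV_I smooth_eproj[OF f_bundle] eproj(1)[OF subspace_f], of b]
      ab fx eproj_fibre[OF f_bundle] by auto
  then have "tderiv (?P (\<sigma> x)) x X \<in> f x"
    unfolding ab(3) linear_add[OF linear_tderiv_eproj[OF f_bundle]] by (rule subspace_add[OF subspace_f])
  moreover have "tderiv \<sigma> x X = tderiv (?P (\<sigma> x)) x X + eproj (f x) (tderiv \<sigma> x X)"
    using \<sigma>(1) by (intro tderiv_local_section[OF f_bundle open_UNIV UNIV_I]) (auto simp: sections_def)
  ultimately show False using \<sigma>(2) eproj(1)[OF subspace_f] subspace_add[OF subspace_f] by metis
qed

text \<open>At \<open>x\<close> a direction of the other curvature space moves
  \<open>\<sigma>\<close> out of \<open>f\<close>. Extended as a coordinate direction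
  \<open>e\<close>, it yields a reference derivative \<open>w\<close> whose norm is non-zero nearby,
  and the curvature space of \<open>s1\<close> becomes the kernel of the linear form
  \<open>l\<close> that pairs derivatives of \<open>\<sigma>\<close> with \<open>w\<close>.\<close>

lemma curvature_field:
  obtains U X where "open U" "x \<in> U" "smooth_field_on U X" "\<And>y. y \<in> U \<Longrightarrow> X y \<noteq> 0"
    "\<And>y. y \<in> U \<Longrightarrow> X y \<in> curvature_space f y (s1 y)"
proof -
  obtain U0 \<sigma> where U0: "open U0" "x \<in> U0" "smooth_map_on U0 \<sigma>" "\<And>y. y \<in> U0 \<Longrightarrow> \<sigma> y \<noteq> 0"
    "\<And>y. y \<in> U0 \<Longrightarrow> s1 y = span {\<sigma> y}" using line_bundle_section[OF bundle_s(1)] by blast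
  define c where "c = chart_at x"
  have c: "c \<in> atlas" "x \<in> fst c" using chart_at by (auto simp: c_def)
  define U1 where "U1 = U0 \<inter> fst c"
  have U1: "open U1" "x \<in> U1" "U1 \<subseteq> fst c" "U1 \<subseteq> U0" using U0 c open_chart[OF c(1)] by (auto simp: U1_def)
  have \<sigma>: "smooth_map_on U1 \<sigma>" "\<And>y. y \<in> U1 \<Longrightarrow> \<sigma> y \<in> f y"
    using U0 U1 smooth_subset s_subset span_base by (blast, metis insertI1 subsetD)
  obtain Z where Z: "Z \<noteq> 0" "Z \<in> curvature_space f x (s2 x)"
    using legendre_pair.curvature_space_nonzero[OF swap] by blast
  define e where "e = tderiv (snd c) x Z"
  define w where "w y = tderiv \<sigma> y (coord_field c e y)" for y
  have w: "smooth_map_on U1 w" unfolding w_def by (rule smooth_coord_deriv[OF U1(1) \<sigma>(1) c(1) U1(3)])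
  have w_orth: "w y \<in> orth (f y)" if "y \<in> U1" for y
    unfolding w_def by (rule tderiv_section_orth[OF U1(1) that \<sigma>])
  have T: "Z' \<in> curvature_space f y (s1 y)" if "tderiv \<sigma> y Z' \<in> f y" "y \<in> U1" for y Z'
    using curvature_spaceI[OF U1(1) that(2) \<sigma> that(1)] U0(5) U1(4) that(2) by blast
  have "w x \<notin> f x"
  proof
    assume "w x \<in> f x"
    then have "tderiv \<sigma> x Z \<in> f x" by (simp add: w_def e_def coord_field_tderiv_chart[OF c])
    then have "Z \<in> curvature_space f x (s1 x)" by (rule T[OF _ U1(2)])
    then show False using Z curvature_spaces_disjoint by blast
  qed
  then have wx: "form (w x) (w x) \<noteq> 0"
    using isotropic_orth_nonneg(2)[OF subspace_f dim_f isotropic_f w_orth[OF U1(2)]] by blast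
  define U where "U = (\<lambda>y. form (w y) (w y)) -` (- {0}) \<inter> U1"
  have U: "open U" "x \<in> U" "U \<subseteq> U1" using continuous_on_open_vimage[OF U1(1), THEN iffD1, rule_format, OF
        smooth_continuous[OF U1(1) smooth_form[OF U1(1) w w]], of "- {0}"] wx U1(2) by (auto simp: U_def)
  have c': "y \<in> fst c" if "y \<in> U" for y using that U U1 by blast
  define l where "l b y = form (tderiv \<sigma> y (coord_field c b y)) (w y)" for b y
  \<comment> \<open>The kernel of a linear form on the plane: its coefficients, rotated by a right
    angle.\<close>
  define u where "u y = l (axis 2 1) y *\<^sub>R axis 1 1 - l (axis 1 1) y *\<^sub>R (axis 2 1 :: real^2)" for y
  define X where "X y = coord_field c (u y) y" for y
  have "smooth_map_on U1 (l b)" for b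
    unfolding l_def by (intro smooth_form U1(1) w smooth_coord_deriv[OF U1(1) \<sigma>(1) c(1) U1(3)])
  then have "smooth_map_on U1 u" unfolding u_def by (intro smooth_intros U1(1))
  then have "smooth_map_on U u" using U(3) smooth_subset by blast
  then have "smooth_field_on U X"
    using c(1) U U1(3) by (intro smooth_field_onI U(1) exI[of _ c] exI[of _ U] exI[of _ u]) (auto simp: X_def)
  moreover have lin: "linear (\<lambda>b. l b y)" if "y \<in> U" for y
  proof -
    have "linear (\<lambda>b. tderiv \<sigma> y (coord_field c b y))"
      using linear_compose[OF coord_field_linear[OF c(1) c'[OF that]] tderiv_linear[OF U1(1) \<sigma>(1)]] that U by (auto simp: o_def)
    from linear_add[OF this] linear_scale[OF this] show ?thesis
      by (intro linearI) (simp_all add: l_def form_simps)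
  qed
  have l_expand: "l b y = (b $ 1) * l (axis 1 1) y + (b $ 2) * l (axis 2 1) y" if "y \<in> U" for b y
  proof -
    have "b = (b $ 1) *\<^sub>R axis 1 1 + (b $ 2) *\<^sub>R axis 2 1" by (simp add: vec_eq_iff forall_2 axis_def)
    then show ?thesis using linear_add[OF lin[OF that]] linear_scale[OF lin[OF that]] by (metis real_scaleR_def)
  qed
  moreover have "X y \<noteq> 0" if y: "y \<in> U" for y
  proof
    assume "X y = 0"
    then have "u y = tderiv (snd c) y 0" using tderiv_chart_coord_field[OF c(1) c'[OF y], of "u y"] by (simp add: X_def)
    then have "u y = 0"
      using linear_0[OF tderiv_linear[OF open_chart[OF c(1)] smooth_chart[OF c(1)] c'[OF y]]] by simp
    then have "u y $ 1 = 0" "u y $ 2 = 0" by simp_all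
    then have "l (axis 2 1) y = 0" "l (axis 1 1) y = 0" by (simp_all add: u_def axis_def)
    then have "l e y = 0" using l_expand[OF y, of e] by simp
    then show False using y by (simp add: l_def U_def w_def)
  qed
  moreover have "X y \<in> curvature_space f y (s1 y)" if y: "y \<in> U" for y
  proof -
    have y1: "y \<in> U1" using y U by blast
    obtain X1 where X1: "X1 \<noteq> 0" "X1 \<in> curvature_space f y (s1 y)" using curvature_space_nonzero by blast
    let ?W = "coord_field c e y"
    have wf: "w y \<notin> f y" using y isotropic_f by (auto simp: U_def isotropic_def)
    have "\<sigma> y \<in> s1 y" using U0(5) U1(4) y1 by (auto simp: span_base)
    note d1 = curvature_space_tderiv[OF _ U1(1) y1 \<sigma> this]
    have "?W \<notin> span {X1}"
    proof
      assume "?W \<in> span {X1}"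
      then have "?W \<in> curvature_space f y (s1 y)"
        using X1(2) subspace_curvature_space span_minimal[of "{X1}"] by blast
      then show False using d1 wf by (simp add: w_def)
    qed
    then obtain a b where ab: "X y = a *\<^sub>R X1 + b *\<^sub>R ?W" using plane_basis[OF X1(1)] by blast
    note tl = tderiv_linear[OF U1(1) \<sigma>(1) y1]
    have "form (tderiv \<sigma> y (X y)) (w y) = l (u y) y" by (simp add: l_def X_def)
    also have "\<dots> = 0" using l_expand[OF y, of "u y"] by (simp add: u_def axis_def)
    also have "form (tderiv \<sigma> y (X y)) (w y) = a * form (tderiv \<sigma> y X1) (w y) + b * form (w y) (w y)"
      by (simp add: ab linear_add[OF tl] linear_scale[OF tl] form_simps flip: w_def)
    also have "form (tderiv \<sigma> y X1) (w y) = 0" using d1[OF X1(2)] w_orth[OF y1] orthD by blast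
    finally have "b = 0" using y by (auto simp: U_def)
    then show ?thesis using ab X1(2) subspace_scale[OF subspace_curvature_space] by simp
  qed
  ultimately show ?thesis using that U by blast
qed

text \<open>\<open>second_osculating\<close> quantifies over global vector fields, so for each point
  one is needed that is non-zero there. A field without any zeros need not exist, as the line bundle
  may be twisted; zeros away from \<open>x\<close> do no harm.\<close>

lemma spanning_vector_field:
  obtains X :: "'m \<Rightarrow> real^2" where "smooth_vector_field X" "\<And>y. X y \<in> curvature_space f y (s1 y)" "X x \<noteq> 0"
proof -
  let ?P = "\<lambda>b y. eproj (f y) b"
  \<comment> \<open>A positive definite quadratic form in \<open>Z\<close>, by the immersion
    condition. It makes \<open>h\<close> below homogeneous of degree 0 in \<open>Z\<close>, so that
    \<open>X\<close> does not depend on which non-zero vector of the curvature line is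
    picked.\<close>
  define N where "N (y :: 'm) Z = (\<Sum>b\<in>Basis. tderiv (?P b) y Z \<bullet> tderiv (?P b) y Z)" for y Z
  have tl: "linear (tderiv (?P b) y)" for b y
    by (rule tderiv_linear[OF open_UNIV smooth_eproj[OF f_bundle] UNIV_I])
  have ex: "\<exists>b\<in>Basis. tderiv (?P b) y Z \<noteq> 0" if Z: "Z \<noteq> 0" for y Z
  proof (rule ccontr)
    assume "\<not> ?thesis"
    then have "tderiv (?P v) y Z = 0" for v
      by (subst linear_Basis_expansion[OF linear_tderiv_eproj[OF f_bundle]]) simp
    then have "tderiv \<sigma> y Z \<in> f y" if "\<sigma> \<in> sections f" for \<sigma>
      using tderiv_local_section[OF f_bundle open_UNIV UNIV_I, of \<sigma> y Z] that eproj(1)[OF subspace_f]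
      by (auto simp: sections_def) metis
    then show False using immersion[OF Z] by metis
  qed
  have N0: "N y Z \<noteq> 0" if Z: "Z \<noteq> 0" for y Z
  proof -
    obtain b where b: "b \<in> Basis" "tderiv (?P b) y Z \<noteq> 0" using ex[OF Z] by blast
    have "0 < tderiv (?P b) y Z \<bullet> tderiv (?P b) y Z" using b by simp
    also have "\<dots> \<le> N y Z" unfolding N_def using b(1) by (intro member_le_sum) auto
    finally show ?thesis by simp
  qed
  obtain X0 where X0: "X0 \<noteq> 0" "X0 \<in> curvature_space f x (s1 x)" using curvature_space_nonzero by blast
  obtain b where b: "b \<in> Basis" "tderiv (?P b) x X0 \<noteq> 0" using ex[OF X0(1)] by blast
  define a where "a = tderiv (?P b) x X0"
  define h where "h (y :: 'm) Z = ((a \<bullet> tderiv (?P b) y Z) / N y Z) *\<^sub>R Z" for y Z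
  define X where "X y = h y (SOME Z. Z \<noteq> 0 \<and> Z \<in> curvature_space f y (s1 y))" for y
  have some: "(SOME Z. Z \<noteq> 0 \<and> Z \<in> curvature_space f y (s1 y)) \<noteq> 0 \<and>
      (SOME Z. Z \<noteq> 0 \<and> Z \<in> curvature_space f y (s1 y)) \<in> curvature_space f y (s1 y)" for y
    by (rule someI_ex[OF curvature_space_nonzero])
  have h_scale: "h y (k *\<^sub>R Z) = h y Z" if "k \<noteq> 0" for k y Z
    using that by (simp add: h_def N_def linear_scale[OF tl] sum_distrib_left[symmetric] mult.assoc[symmetric])
  have X_eq: "X y = h y Z" if "Z \<noteq> 0" "Z \<in> curvature_space f y (s1 y)" for y Z
  proof -
    define Z' where "Z' = (SOME Z. Z \<noteq> 0 \<and> Z \<in> curvature_space f y (s1 y))"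
    have Z': "Z' \<noteq> 0" "Z' \<in> curvature_space f y (s1 y)" using some[of y] by (auto simp: Z'_def)
    have "Z' \<in> span {Z}"
    proof (rule ccontr)
      assume nin: "Z' \<notin> span {Z}"
      have "W \<in> curvature_space f y (s1 y)" for W
        using plane_basis[OF that(1) nin, of W] that Z' subspace_add[OF subspace_curvature_space]
          subspace_scale[OF subspace_curvature_space] by metis
      moreover obtain W where "W \<noteq> 0" "W \<in> curvature_space f y (s2 y)"
        using legendre_pair.curvature_space_nonzero[OF swap] by blast
      ultimately show False using curvature_spaces_disjoint by blast
    qed
    then obtain k where "Z' = k *\<^sub>R Z" by (auto simp: span_singleton)
    moreover then have "k \<noteq> 0" using Z' by auto
    ultimately show ?thesis using h_scale by (simp add: X_def flip: Z'_def)
  qed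
  have "smooth_vector_field X" unfolding smooth_vector_field_def
  proof (intro ballI smooth_local)
    fix c :: "'m chart" and y assume c: "c \<in> atlas" "y \<in> fst c"
    obtain U Z where U: "open U" "y \<in> U" "smooth_field_on U Z" "\<And>y. y \<in> U \<Longrightarrow> Z y \<noteq> 0"
      "\<And>y. y \<in> U \<Longrightarrow> Z y \<in> curvature_space f y (s1 y)" using curvature_field by blast
    have sP: "smooth_map_on U (\<lambda>y. tderiv (?P b) y (Z y))" for b
      using smooth_subset[OF smooth_eproj[OF f_bundle]] by (intro smooth_field_deriv U) auto
    have "smooth_field_on U (\<lambda>y. ((a \<bullet> tderiv (?P b) y (Z y)) / N y (Z y)) *\<^sub>R Z y)"
      using N0 U(4) by (intro smooth_field_scaleR U smooth_intros sP) (auto simp: N_def intro!: smooth_intros sP U)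
    then have "smooth_map_on (fst c \<inter> U) (\<lambda>y. tderiv (snd c) y (((a \<bullet> tderiv (?P b) y (Z y)) / N y (Z y)) *\<^sub>R Z y))"
      using c by (auto simp: smooth_field_on_def)
    then have "smooth_map_on (fst c \<inter> U) (\<lambda>y. tderiv (snd c) y (X y))" by (rule smooth_cong[rotated 2])
        (use U c open_chart[OF c(1)] X_eq[OF U(4) U(5), unfolded h_def] in auto)
    then show "\<exists>W. open W \<and> y \<in> W \<and> smooth_map_on W (\<lambda>x. tderiv (snd c) x (X x))"
      using U c open_chart[OF c(1)] by (intro exI[of _ "fst c \<inter> U"]) auto
  qed
  moreover have "X y \<in> curvature_space f y (s1 y)" for y
    using some[of y] subspace_scale[OF subspace_curvature_space] by (simp add: X_def h_def)
  moreover have "X x \<noteq> 0" using X_eq[OF X0] N0[OF X0(1)] b X0 by (simp add: h_def a_def)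
  ultimately show ?thesis using that by blast
qed

end

text \<open>The indices are crosswise: \<open>X\<close> spans the curvature direction of
  \<open>s1\<close>, so d_X \<sigma>1 stays in \<open>f\<close>, and the derivative of
  \<open>\<sigma>1\<close> that leaves \<open>f\<close> is \<open>e1\<close>, taken along
  \<open>Y\<close>.\<close>

locale curvature_frame = legendre_pair f s1 s2
  for f :: "'m::smooth_surface \<Rightarrow> 'v::r42 set" and s1 s2 :: "'m \<Rightarrow> 'v set" +
  fixes U :: "'m set" and \<sigma>1 \<sigma>2 :: "'m \<Rightarrow> 'v" and X Y :: "'m \<Rightarrow> real^2"
  assumes U: "open U" and smooth_\<sigma>: "smooth_map_on U \<sigma>1" "smooth_map_on U \<sigma>2"
    and s1: "\<And>x. x \<in> U \<Longrightarrow> s1 x = span {\<sigma>1 x}" and s2: "\<And>x. x \<in> U \<Longrightarrow> s2 x = span {\<sigma>2 x}"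
    and nz: "\<And>x. x \<in> U \<Longrightarrow> \<sigma>1 x \<noteq> 0" "\<And>x. x \<in> U \<Longrightarrow> \<sigma>2 x \<noteq> 0"
    and XY: "smooth_field_on U X" "smooth_field_on U Y"
    and X: "\<And>x. x \<in> U \<Longrightarrow> X x \<noteq> 0" "\<And>x. x \<in> U \<Longrightarrow> X x \<in> curvature_space f x (s1 x)"
    and Y: "\<And>x. x \<in> U \<Longrightarrow> Y x \<noteq> 0" "\<And>x. x \<in> U \<Longrightarrow> Y x \<in> curvature_space f x (s2 x)"
begin

abbreviation "e1 \<equiv> along Y \<sigma>1"
abbreviation "e2 \<equiv> along X \<sigma>2"

lemma frame_swap: "curvature_frame f s2 s1 U \<sigma>2 \<sigma>1 Y X"
  using swap U smooth_\<sigma> s1 s2 nz XY X Y by (auto simp: curvature_frame_def curvature_frame_axioms_def)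

lemma smooth_e: "smooth_map_on U e1" and smooth_z: "smooth_map_on U (along Y e1)"
  by (intro smooth_along U smooth_\<sigma> XY)+

lemma section_\<sigma>: "x \<in> U \<Longrightarrow> \<sigma>1 x \<in> f x" "x \<in> U \<Longrightarrow> \<sigma>2 x \<in> f x" using s1 s2 s_subset span_base by blast+

end

section \<open>Orthogonality relations of the moving frame\<close>

context curvature_frame
begin

context
  fixes x assumes x: "x \<in> U"
begin

lemma f_span: "f x = span {\<sigma>1 x, \<sigma>2 x}" and indep: "independent {\<sigma>1 x, \<sigma>2 x}" and neq: "\<sigma>1 x \<noteq> \<sigma>2 x"
proof -
  have "span {\<sigma>1 x} \<noteq> span {\<sigma>2 x}" using s_neq[of x] s1[OF x] s2[OF x] by simp
  from two_lines[OF nz(1)[OF x] this nz(2)[OF x] subspace_f dim_f section_\<sigma>[OF x]]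
  show "f x = span {\<sigma>1 x, \<sigma>2 x}" "independent {\<sigma>1 x, \<sigma>2 x}" "\<sigma>1 x \<noteq> \<sigma>2 x" .
qed

lemma f_expand:
  assumes "v \<in> f x"
  obtains a b where "v = a *\<^sub>R \<sigma>1 x + b *\<^sub>R \<sigma>2 x"
proof -
  have "\<exists>a b. v = a *\<^sub>R \<sigma>1 x + b *\<^sub>R \<sigma>2 x"
    using assms unfolding f_span by (auto simp: span_insert span_singleton algebra_simps)
  then show ?thesis using that by blast
qed

lemma XY_basis:
  obtains a b where "Z = a *\<^sub>R X x + b *\<^sub>R Y x"
proof -
  have "Y x \<notin> span {X x}"
  proof
    assume "Y x \<in> span {X x}"
    then have "Y x \<in> curvature_space f x (s1 x)"
      using span_minimal[of "{X x}", OF _ subspace_curvature_space] X(2)[OF x] by blast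
    then show False using curvature_spaces_disjoint Y x by blast
  qed
  then show ?thesis using plane_basis[OF X(1)[OF x]] that by blast
qed

lemma orth_fI: "form (\<sigma>1 x) v = 0 \<Longrightarrow> form (\<sigma>2 x) v = 0 \<Longrightarrow> v \<in> orth (f x)"
  unfolding f_span orth_span by (auto simp: orth_def)

lemma tderiv_X_\<sigma>1: "along X \<sigma>1 x \<in> f x" unfolding along_def
  by (rule curvature_space_tderiv[OF X(2)[OF x] U x smooth_\<sigma>(1) section_\<sigma>(1)]) (simp_all add: s1[OF x] span_base)

lemma e_orth: "e1 x \<in> orth (f x)"
  unfolding along_def by (rule tderiv_section_orth[OF U x smooth_\<sigma>(1) section_\<sigma>(1)])

lemma e_notin: "e1 x \<notin> f x"
proof
  assume "e1 x \<in> f x"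
  then have "Y x \<in> curvature_space f x (s1 x)"
    by (intro curvature_spaceI[OF U x smooth_\<sigma>(1) section_\<sigma>(1)]) (simp_all add: s1[OF x] along_def)
  then show False using curvature_spaces_disjoint Y x by blast
qed

lemma e_pos: "form (e1 x) (e1 x) > 0"
  using isotropic_orth_nonneg[OF subspace_f dim_f isotropic_f e_orth] e_notin by force

lemma f_perp: "v \<in> f x \<Longrightarrow> w \<in> orth (f x) \<Longrightarrow> form v w = 0" "v \<in> f x \<Longrightarrow> w \<in> orth (f x) \<Longrightarrow> form w v = 0"
  using orthD by blast+

lemma commute_XY:
  assumes "smooth_map_on U g"
  obtains a b where "along X (along Y g) x = along Y (along X g) x + a *\<^sub>R along X g x + b *\<^sub>R along Y g x"
proof -
  obtain Z where Z: "tderiv (\<lambda>y. tderiv g y (Y y)) x (X x) = tderiv (\<lambda>y. tderiv g y (X y)) x (Y x) + tderiv g x Z"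
    by (rule commutator[OF U assms x XY])
  obtain a b where "Z = a *\<^sub>R X x + b *\<^sub>R Y x" by (rule XY_basis)
  then have "tderiv g x Z = a *\<^sub>R along X g x + b *\<^sub>R along Y g x"
    by (simp add: along_def linear_add[OF tderiv_linear[OF U assms x]] linear_scale[OF tderiv_linear[OF U assms x]])
  then show ?thesis using that[of a b] Z by (simp add: along_def[abs_def] add.assoc)
qed

lemma along_form:
  assumes "smooth_map_on U g" "smooth_map_on U h" "\<And>y. y \<in> U \<Longrightarrow> form (g y) (h y) = k"
  shows "form (along Z g x) (h x) = - form (g x) (along Z h x)"
  unfolding along_def by (rule tderiv_form_eq[OF U x assms])

end

text \<open>Moving a derivative turns (e1, e2) into - (\<sigma>1, d_Y d_X \<sigma>2). Commuting the
  fields and moving it back gives (d_X \<sigma>1, d_Y \<sigma>2), whose entries both lie in the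
  isotropic \<open>f\<close>.\<close>

lemma e_e: assumes x: "x \<in> U" shows "form (e1 x) (e2 x) = 0"
proof -
  have 0: "form (\<sigma>1 y) (e2 y) = 0" if "y \<in> U" for y
    using f_perp(1)[OF that section_\<sigma>(1)[OF that] curvature_frame.e_orth[OF frame_swap that]] .
  have p0: "form (\<sigma>1 y) (along Y \<sigma>2 y) = 0" if "y \<in> U" for y
    using isotropic_f[of y] section_\<sigma>(1)[OF that] curvature_frame.tderiv_X_\<sigma>1[OF frame_swap that] by (auto simp: isotropic_def)
  have s: "smooth_map_on U e2" "smooth_map_on U (along Y \<sigma>2)" by (intro smooth_along U smooth_\<sigma> XY)+
  obtain a b where ab: "along X (along Y \<sigma>2) x = along Y e2 x + a *\<^sub>R e2 x + b *\<^sub>R along Y \<sigma>2 x"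
    by (rule commute_XY[OF x smooth_\<sigma>(2)])
  have "form (e1 x) (e2 x) = - form (\<sigma>1 x) (along Y e2 x)" by (rule along_form[OF x smooth_\<sigma>(1) s(1) 0])
  also have "\<dots> = - form (\<sigma>1 x) (along X (along Y \<sigma>2) x)" using 0[OF x] p0[OF x] ab by (simp add: form_simps)
  also have "\<dots> = form (along X \<sigma>1 x) (along Y \<sigma>2 x)" using along_form[OF x smooth_\<sigma>(1) s(2) p0, of X] by simp
  also have "\<dots> = 0"
    using isotropic_f[of x] tderiv_X_\<sigma>1[OF x] curvature_frame.tderiv_X_\<sigma>1[OF frame_swap x] by (auto simp: isotropic_def)
  finally show ?thesis .
qed

lemma e_orth_f: "x \<in> U \<Longrightarrow> v \<in> f x \<Longrightarrow> form (e1 x) v = 0" using f_perp(2) e_orth by blast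

lemma z_\<sigma>:
  assumes x: "x \<in> U"
  shows "form (\<sigma>1 x) (along Y e1 x) = - form (e1 x) (e1 x)"
    "form (\<sigma>2 x) (along Y e1 x) = 0"
proof -
  have "form (e1 x) (e1 x) = - form (\<sigma>1 x) (along Y e1 x)"
    using e_orth_f section_\<sigma> by (intro along_form[OF x smooth_\<sigma>(1) smooth_e]) (simp add: form_commute)
  then show "form (\<sigma>1 x) (along Y e1 x) = - form (e1 x) (e1 x)" by simp
  have "form (along Y \<sigma>2 x) (e1 x) = - form (\<sigma>2 x) (along Y e1 x)"
    using e_orth_f section_\<sigma> by (intro along_form[OF x smooth_\<sigma>(2) smooth_e]) (simp add: form_commute)
  moreover have "form (along Y \<sigma>2 x) (e1 x) = 0"
    using e_orth_f[OF x curvature_frame.tderiv_X_\<sigma>1[OF frame_swap x]] by (simp add: form_commute)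
  ultimately show "form (\<sigma>2 x) (along Y e1 x) = 0" by simp
qed

text \<open>For the pairing with \<open>e2\<close>: up to multiples of d_X \<sigma>1 and
  \<open>e1\<close>, d_X e1 is d_Y (d_X \<sigma>1), the derivative of a section of \<open>f\<close>.
  The outer derivative moves to d_Y e2, which is orthogonal to \<open>f\<close>.\<close>

lemma along_X_e:
  assumes x: "x \<in> U"
  shows "along X e1 x \<in> orth (f x)" "form (along X e1 x) (e2 x) = 0"
proof -
  have s: "smooth_map_on U e2" "smooth_map_on U (along X \<sigma>1)" "smooth_map_on U (along Y \<sigma>2)"
    by (intro smooth_along U smooth_\<sigma> XY)+
  have Xs1: "along X \<sigma>1 y \<in> f y" if "y \<in> U" for y by (rule tderiv_X_\<sigma>1[OF that])
  have "form (along X e1 x) (\<sigma>1 x) = - form (e1 x) (along X \<sigma>1 x)"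
    using e_orth_f section_\<sigma> by (intro along_form[OF x smooth_e smooth_\<sigma>(1)]) simp
  moreover have "form (along X e1 x) (\<sigma>2 x) = - form (e1 x) (e2 x)"
    using e_orth_f section_\<sigma> by (intro along_form[OF x smooth_e smooth_\<sigma>(2)]) simp
  ultimately show "along X e1 x \<in> orth (f x)"
    using e_e[OF x] e_orth_f[OF x Xs1[OF x]] by (intro orth_fI x) (simp_all add: form_commute)
  have Ye2: "along Y e2 x \<in> orth (f x)"
  proof -
    have e2: "form (e2 y) v = 0" if "y \<in> U" "v \<in> f y" for y v
      using curvature_frame.e_orth_f[OF frame_swap] that .
    have "form (along Y e2 x) (\<sigma>1 x) = - form (e2 x) (e1 x)"
      using e2 section_\<sigma> by (intro along_form[OF x s(1) smooth_\<sigma>(1)]) simp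
    moreover have "form (along Y e2 x) (\<sigma>2 x) = - form (e2 x) (along Y \<sigma>2 x)"
      using e2 section_\<sigma> by (intro along_form[OF x s(1) smooth_\<sigma>(2)]) simp
    ultimately show ?thesis using e_e[OF x] e2[OF x curvature_frame.tderiv_X_\<sigma>1[OF frame_swap x]]
      by (intro orth_fI x) (simp_all add: form_commute)
  qed
  obtain a b where ab: "along X e1 x = along Y (along X \<sigma>1) x + a *\<^sub>R along X \<sigma>1 x + b *\<^sub>R e1 x"
    by (rule commute_XY[OF x smooth_\<sigma>(1)])
  have "form (along Y (along X \<sigma>1) x) (e2 x) = - form (along X \<sigma>1 x) (along Y e2 x)"
    using Xs1 curvature_frame.e_orth_f[OF frame_swap] by (intro along_form[OF x s(2) s(1)]) (simp add: form_commute)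
  also have "\<dots> = 0" using f_perp(1)[OF x Xs1[OF x] Ye2] by simp
  finally show "form (along X e1 x) (e2 x) = 0"
    using ab e_e[OF x] curvature_frame.e_orth_f[OF frame_swap x Xs1[OF x]] by (simp add: form_simps form_commute)
qed

text \<open>\<open>f\<close>, \<open>e1\<close> and \<open>e2\<close> span the 4-dimensional
  \<open>orth f\<close>, and \<open>e1\<close>, \<open>e2\<close> are orthogonal of positive norm,
  so orthogonality to both leaves only \<open>f\<close>.\<close>

lemma orth_f_expand:
  assumes x: "x \<in> U" and v: "v \<in> orth (f x)" "form v (e1 x) = 0" "form v (e2 x) = 0"
  shows "v \<in> f x"
proof -
  let ?e1 = "e1 x" and ?e2 = "e2 x"
  have e2: "?e2 \<in> orth (f x)" "form ?e2 ?e2 > 0" "?e2 \<notin> f x"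
    using curvature_frame.e_orth[OF frame_swap x] curvature_frame.e_pos[OF frame_swap x] curvature_frame.e_notin[OF frame_swap x] .
  have e1: "?e1 \<in> orth (f x)" "form ?e1 ?e1 > 0" "?e1 \<notin> f x" using e_orth[OF x] e_pos[OF x] e_notin[OF x] .
  have "?e1 \<notin> span (insert ?e2 (f x))"
  proof
    assume "?e1 \<in> span (insert ?e2 (f x))"
    then obtain k where "?e1 - k *\<^sub>R ?e2 \<in> f x" using span_breakdown_eq span_eq_iff subspace_f by metis
    then have "form ?e1 (?e1 - k *\<^sub>R ?e2) = 0" using f_perp(2)[OF x] e1(1) by blast
    then show False using e1(2) e_e[OF x] by (simp add: form_simps)
  qed
  then have "dim (span (insert ?e1 (insert ?e2 (f x)))) = 4"
    using e2(3) dim_f[of x] subspace_f[of x] by (simp add: dim_insert span_eq_iff[THEN iffD2])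
  moreover have "dim (orth (f x)) = 4" using dim_orth[OF subspace_f, of x] dim_f[of x] by simp
  ultimately have eq: "span (insert ?e1 (insert ?e2 (f x))) = orth (f x)"
    using e1(1) e2(1) f_orth by (intro subspace_dim_equal span_minimal) auto
  then have "v \<in> span (insert ?e1 (insert ?e2 (f x)))" using v(1) by simp
  then obtain k where "v - k *\<^sub>R ?e1 \<in> span (insert ?e2 (f x))" using span_breakdown_eq by blast
  then obtain l where "v - k *\<^sub>R ?e1 - l *\<^sub>R ?e2 \<in> f x" using span_breakdown_eq span_eq_iff subspace_f by metis
  then obtain a where a: "a \<in> f x" "v = a + k *\<^sub>R ?e1 + l *\<^sub>R ?e2"
    by (metis add_diff_cancel_left' diff_add_cancel diff_diff_eq add.assoc)
  have "k = 0" "l = 0"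
    using v(2,3) e1(2) e2(2) e_e[OF x] a(2) f_perp(1)[OF x a(1) e1(1)] f_perp(1)[OF x a(1) e2(1)]
    by (auto simp: form_simps form_commute[of ?e2 ?e1])
  then show ?thesis using a by simp
qed

lemma z_e: assumes x: "x \<in> U" shows "form (along Y e1 x) (e2 x) = 0"
proof -
  have "form (along Y e1 x) (e2 x) = - form (e1 x) (along Y e2 x)"
    by (rule along_form[OF x smooth_e curvature_frame.smooth_e[OF frame_swap] e_e])
  then show ?thesis using curvature_frame.along_X_e(2)[OF frame_swap x] by (simp add: form_commute)
qed

text \<open>The exchange of derivatives of \<open>e_e\<close>, one order higher. The remaining term
  (d_X e1, d_Y e2) vanishes because d_X e1 is a multiple of \<open>e1\<close> modulo
  \<open>f\<close>, and d_Y e2 is orthogonal to both.\<close>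

lemma z_z: assumes x: "x \<in> U" shows "form (along Y e1 x) (along X e2 x) = 0"
proof -
  note e2 = curvature_frame.smooth_e[OF frame_swap]
  have Xe1: "smooth_map_on U (along X e1)" by (intro smooth_along U smooth_e XY)
  have "form (along X (along Y e1) x) (e2 x) =
      - form (along Y e1 x) (along X e2 x)" by (rule along_form[OF x smooth_z e2 z_e])
  moreover obtain a b where ab: "along X (along Y e1) x =
      along Y (along X e1) x + a *\<^sub>R along X e1 x + b *\<^sub>R along Y e1 x" by (rule commute_XY[OF x smooth_e])
  have "form (along Y (along X e1) x) (e2 x) =
      - form (along X e1 x) (along Y e2 x)" by (rule along_form[OF x Xe1 e2 along_X_e(2)])
  moreover have "form (along X e1 x) (along Y e2 x) = 0"
  proof -
    let ?u = "along X e1 x" and ?v = "along Y e2 x" and ?e = "e1 x"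
    define k where "k = form ?u ?e / form ?e ?e"
    have "?u - k *\<^sub>R ?e \<in> f x" using along_X_e[OF x] e_orth[OF x] e_e[OF x] e_pos[OF x]
      by (intro orth_f_expand[OF x] subspace_diff subspace_scale subspace_orth) (auto simp: form_simps k_def)
    then have "form (?u - k *\<^sub>R ?e) ?v = 0"
      using f_perp(1)[OF x] curvature_frame.along_X_e(1)[OF frame_swap x] by blast
    then show ?thesis
      using curvature_frame.along_X_e(2)[OF frame_swap x] by (simp add: form_simps form_commute)
  qed
  ultimately show ?thesis using along_X_e(2)[OF x] z_e[OF x] ab by (simp add: form_simps)
qed

lemma dim_splitting:
  assumes x: "x \<in> U"
  shows "dim (span {\<sigma>1 x, e1 x, along Y e1 x}) = 3"
proof -
  let ?e = "e1 x" and ?z = "along Y e1 x"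
  have e0: "form ?e (\<sigma>1 x) = 0" "form (\<sigma>1 x) (\<sigma>1 x) = 0" "form (\<sigma>1 x) ?e = 0"
    using e_orth_f[OF x] section_\<sigma>[OF x] isotropic_f by (auto simp: isotropic_def form_commute)
  have "?e \<notin> span {\<sigma>1 x}" using e_notin[OF x] section_\<sigma>(1)[OF x] subspace_f span_minimal[of "{\<sigma>1 x}" "f x"] by blast
  moreover have "?z \<notin> span {?e, \<sigma>1 x}"
  proof
    assume "?z \<in> span {?e, \<sigma>1 x}"
    then have "form (\<sigma>1 x) ?z = 0"
      using e0 span_minimal[OF _ subspace_orth, of "{?e, \<sigma>1 x}" "{\<sigma>1 x}"] by (auto simp: orth_def)
    then show False using z_\<sigma>(1)[OF x] e_pos[OF x] by simp
  qed
  ultimately have "dim (insert ?z (insert ?e {\<sigma>1 x})) = 3" using nz(1)[OF x] by (simp add: dim_insert)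
  moreover have "insert ?z (insert ?e {\<sigma>1 x}) = {\<sigma>1 x, ?e, ?z}" by auto
  ultimately show ?thesis by simp
qed

lemma splitting:
  assumes x: "x \<in> U"
  shows "orthogonal_splitting (span {\<sigma>1 x, e1 x, along Y e1 x})
    (span {\<sigma>2 x, e2 x, along X e2 x})"
    and "orth (span {\<sigma>1 x, e1 x, along Y e1 x}) = span {\<sigma>2 x, e2 x, along X e2 x}"
proof -
  let ?e1 = "e1 x" and ?z1 = "along Y e1 x"
  let ?e2 = "e2 x" and ?z2 = "along X e2 x"
  let ?S1 = "span {\<sigma>1 x, ?e1, ?z1}" and ?S2 = "span {\<sigma>2 x, ?e2, ?z2}"
  note sw = frame_swap
  have perp: "?S2 \<subseteq> orth ?S1"
  proof -
    have "form (\<sigma>1 x) (\<sigma>2 x) = 0" using isotropic_f section_\<sigma>[OF x] by (auto simp: isotropic_def)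
    moreover have "form (\<sigma>1 x) ?e2 = 0" "form ?e1 (\<sigma>2 x) = 0"
      using e_orth_f[OF x] curvature_frame.e_orth_f[OF sw x] section_\<sigma>[OF x] by (auto simp: form_commute)
    moreover have "form ?e1 ?z2 = 0" using curvature_frame.z_e[OF sw x] by (simp add: form_commute)
    ultimately have "{\<sigma>2 x, ?e2, ?z2} \<subseteq> orth ?S1"
      using e_e[OF x] z_\<sigma>(2)[OF x] curvature_frame.z_\<sigma>(2)[OF sw x] z_e[OF x] z_z[OF x]
      unfolding orth_span by (auto simp: orth_def form_commute[of ?z1 "\<sigma>2 x"])
    then show ?thesis by (rule span_minimal[OF _ subspace_orth])
  qed
  have d1: "dim ?S1 = 3" by (rule dim_splitting[OF x])
  have d2: "dim ?S2 = 3" by (rule curvature_frame.dim_splitting[OF sw x])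
  show o: "orth ?S1 = ?S2" using perp d2 dim_orth[of ?S1] d1 by (intro subspace_dim_equal[symmetric]) auto
  show "orthogonal_splitting ?S1 ?S2"
  proof
    show "form u v = 0" if "u \<in> ?S1" "v \<in> ?S2" for u v using perp that orthD by blast
    fix v
    let ?g = "form ?e1 ?e1"
    have g: "?g \<noteq> 0" using e_pos[OF x] by simp
    have e0: "form ?e1 (\<sigma>1 x) = 0" "form (\<sigma>1 x) (\<sigma>1 x) = 0" "form (\<sigma>1 x) ?e1 = 0"
      using e_orth_f[OF x] section_\<sigma>[OF x] isotropic_f by (auto simp: isotropic_def form_commute)
    \<comment> \<open>The Gram matrix of \<open>\<sigma>1 x\<close>, \<open>?e1\<close>,
      \<open>?z1\<close> is triangular about the antidiagonal, which carries - ?g, ?g, - ?g; the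
      coefficients of the projection follow by back substitution.\<close>
    define c where "c = - form (\<sigma>1 x) v / ?g"
    define b where "b = (form ?e1 v - c * form ?e1 ?z1) / ?g"
    define a where "a = - (form ?z1 v - b * form ?e1 ?z1 - c * form ?z1 ?z1) / ?g"
    define w where "w = a *\<^sub>R \<sigma>1 x + b *\<^sub>R ?e1 + c *\<^sub>R ?z1"
    have "w \<in> ?S1" unfolding w_def by (intro span_add span_scale span_base) auto
    moreover have "v - w \<in> orth ?S1"
    proof -
      have zs: "form ?z1 (\<sigma>1 x) = - ?g" "form ?z1 ?e1 = form ?e1 ?z1"
        using z_\<sigma>(1)[OF x] by (simp_all add: form_commute)
      have "form (\<sigma>1 x) (v - w) = 0" using g e0 z_\<sigma>(1)[OF x] by (simp add: w_def form_simps c_def)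
      moreover have "form ?e1 (v - w) = 0" using g e0 by (simp add: w_def form_simps b_def)
      moreover have "form ?z1 (v - w) = 0" using g zs by (simp add: w_def form_simps a_def)
      ultimately show ?thesis unfolding orth_span by (simp add: orth_def)
    qed
    ultimately show "\<exists>a\<in>?S1. \<exists>b\<in>?S2. v = a + b" unfolding o by (intro bexI[of _ w] bexI[of _ "v - w"]) auto
  qed auto
qed

end

lemma (in legendre_pair) curvature_frame_exists:
  obtains U \<sigma>1 \<sigma>2 X Y where "curvature_frame f s1 s2 U \<sigma>1 \<sigma>2 X Y" "x \<in> U"
proof -
  interpret sw: legendre_pair f s2 s1 by (rule swap)
  obtain A \<sigma>1 where A: "open A" "x \<in> A" "smooth_map_on A \<sigma>1" "\<And>y. y \<in> A \<Longrightarrow> \<sigma>1 y \<noteq> 0" "\<And>y. y \<in> A \<Longrightarrow> s1 y = span {\<sigma>1 y}"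
    using line_bundle_section[OF bundle_s(1), of x] by blast
  obtain B \<sigma>2 where B: "open B" "x \<in> B" "smooth_map_on B \<sigma>2" "\<And>y. y \<in> B \<Longrightarrow> \<sigma>2 y \<noteq> 0" "\<And>y. y \<in> B \<Longrightarrow> s2 y = span {\<sigma>2 y}"
    using line_bundle_section[OF bundle_s(2), of x] by blast
  obtain C X where C: "open C" "x \<in> C" "smooth_field_on C X" "\<And>y. y \<in> C \<Longrightarrow> X y \<noteq> 0" "\<And>y. y \<in> C \<Longrightarrow> X y \<in> curvature_space f y (s1 y)"
    using curvature_field[of x] by blast
  obtain D Y where D: "open D" "x \<in> D" "smooth_field_on D Y" "\<And>y. y \<in> D \<Longrightarrow> Y y \<noteq> 0" "\<And>y. y \<in> D \<Longrightarrow> Y y \<in> curvature_space f y (s2 y)"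
    using sw.curvature_field[of x] by blast
  let ?U = "A \<inter> B \<inter> C \<inter> D"
  have "smooth_map_on ?U \<sigma>1" "smooth_map_on ?U \<sigma>2" "smooth_field_on ?U X" "smooth_field_on ?U Y"
    by (rule smooth_subset[OF A(3)], blast) (rule smooth_subset[OF B(3)], blast,
      rule smooth_field_on_subset[OF C(3)], blast, rule smooth_field_on_subset[OF D(3)], blast)
  then have "curvature_frame f s1 s2 ?U \<sigma>1 \<sigma>2 X Y"
    by (intro curvature_frame.intro curvature_frame_axioms.intro legendre_pair_axioms)
      (auto intro!: A(1,4,5) B(1,4,5) C(1,4,5) D(1,4,5))
  then show ?thesis using that A B C D by blast
qed

section \<open>The second osculating bundles in a frame\<close>

context curvature_frame
begin

lemma line_section:
  assumes \<sigma>: "smooth_map_on U \<sigma>" "\<And>y. y \<in> U \<Longrightarrow> \<sigma> y \<in> s1 y"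
  obtains h where "smooth_map_on U h" "\<And>y. y \<in> U \<Longrightarrow> \<sigma> y = h y *\<^sub>R \<sigma>1 y"
proof
  show "smooth_map_on U (\<lambda>y. (\<sigma> y \<bullet> \<sigma>1 y) / (\<sigma>1 y \<bullet> \<sigma>1 y))"
    by (intro smooth_intros U \<sigma> smooth_\<sigma>) (use nz in auto)
  fix y assume y: "y \<in> U"
  then obtain k where "\<sigma> y = k *\<^sub>R \<sigma>1 y" using \<sigma>(2)[OF y] s1[OF y] by (auto simp: span_singleton)
  then show "\<sigma> y = ((\<sigma> y \<bullet> \<sigma>1 y) / (\<sigma>1 y \<bullet> \<sigma>1 y)) *\<^sub>R \<sigma>1 y" using nz(1)[OF y] by simp
qed

lemma curvature_space_span:
  assumes "x \<in> U" "Z \<in> curvature_space f x (s2 x)"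
  obtains k where "Z = k *\<^sub>R Y x"
proof -
  obtain a b where ab: "Z = a *\<^sub>R X x + b *\<^sub>R Y x" by (rule XY_basis[OF assms(1)])
  interpret sw: legendre_pair f s2 s1 by (rule swap)
  have "Z - b *\<^sub>R Y x \<in> curvature_space f x (s2 x)"
    using assms Y(2) by (intro subspace_diff subspace_scale subspace_curvature_space)
  then have "a *\<^sub>R X x \<in> curvature_space f x (s2 x)" using ab by simp
  moreover have "a *\<^sub>R X x \<in> curvature_space f x (s1 x)"
    using assms X(2) by (intro subspace_scale subspace_curvature_space)
  ultimately have "a *\<^sub>R X x = 0" using curvature_spaces_disjoint by blast
  then have "Z = b *\<^sub>R Y x" using ab by simp
  then show ?thesis by (rule that)
qed

text \<open>Locally every section is h \<sigma>1 and every field k Y, and by the Leibniz rule the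
  passage to them changes the jet by a triangular matrix with diagonal h, h k, h k^2. It is
  invertible for a section and a field that do not vanish at \<open>x\<close>.\<close>

lemma second_osculating_eq:
  assumes x: "x \<in> U"
  shows "second_osculating s1 (\<lambda>x. curvature_space f x (s2 x)) x =
    span {\<sigma>1 x, e1 x, along Y e1 x}" (is "?S = span ?B")
proof -
  let ?e = "e1" and ?z = "along Y e1"
  have jet: "\<exists>h k a b c. \<sigma> x = h *\<^sub>R \<sigma>1 x \<and> Y' x = k *\<^sub>R Y x \<and> tderiv \<sigma> x (Y' x) = a *\<^sub>R \<sigma>1 x + (h * k) *\<^sub>R ?e x \<and>
      tderiv (\<lambda>y. tderiv \<sigma> y (Y' y)) x (Y' x) = b *\<^sub>R \<sigma>1 x + c *\<^sub>R ?e x + (h * k * k) *\<^sub>R ?z x"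
    if \<sigma>: "\<sigma> \<in> sections s1" and Y': "smooth_vector_field Y'" "\<And>y. Y' y \<in> curvature_space f y (s2 y)" for \<sigma> Y'
  proof -
    have s: "smooth_map_on U \<sigma>" "\<And>y. \<sigma> y \<in> s1 y" using \<sigma> smooth_subset by (auto simp: sections_def)
    obtain h where h: "smooth_map_on U h" "\<And>y. y \<in> U \<Longrightarrow> \<sigma> y = h y *\<^sub>R \<sigma>1 y" using line_section[OF s] by blast
    define C where "C = chart_at x"
    have C: "C \<in> atlas" "x \<in> fst C" using chart_at by (auto simp: C_def)
    define W where "W = fst C \<inter> U"
    have W: "open W" "x \<in> W" "W \<subseteq> U" using C x U open_chart[OF C(1)] by (auto simp: W_def)
    define u where "u y = tderiv (snd C) y (Y y)" for y
    define u' where "u' y = tderiv (snd C) y (Y' y)" for y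
    have u: "smooth_map_on W u" using XY(2) C by (auto simp: u_def[abs_def] smooth_field_on_def W_def)
    have "smooth_map_on (fst C) u'" using Y'(1) C by (simp add: u'_def[abs_def] smooth_vector_field_def)
    then have u': "smooth_map_on W u'" by (rule smooth_subset) (simp add: W_def)
    have u0: "u y \<noteq> 0" if "y \<in> W" for y
    proof
      assume "u y = 0"
      have "linear (\<lambda>e. coord_field C e y)" using that C by (intro coord_field_linear) (auto simp: W_def)
      then have "coord_field C (u y) y = 0" using \<open>u y = 0\<close> linear_0 by metis
      then have "Y y = 0" using coord_field_tderiv_chart[OF C(1), of y "Y y"] that by (simp add: u_def W_def)
      then show False using Y(1) that W(3) by blast
    qed
    define k where "k y = (u' y \<bullet> u y) / (u y \<bullet> u y)" for y
    have k: "smooth_map_on W k" unfolding k_def using u0 by (intro smooth_intros W u u') auto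
    have Yk: "Y' y = k y *\<^sub>R Y y" if y: "y \<in> W" for y
    proof -
      obtain r where r: "Y' y = r *\<^sub>R Y y" using curvature_space_span[OF _ Y'(2)] y W(3) by blast
      have "linear (tderiv (snd C) y)"
        using y by (intro tderiv_linear[OF open_chart[OF C(1)] smooth_chart[OF C(1)]]) (auto simp: W_def)
      then have "u' y = r *\<^sub>R u y" by (simp add: u_def u'_def r linear_scale)
      then have "k y = r" using u0[OF y] by (simp add: k_def)
      then show ?thesis using r by simp
    qed
    note sub = smooth_subset[OF _ W(3)]
    have sY: "smooth_field_on W Y" by (rule smooth_field_on_subset[OF XY(2) W(3)])
    have d: "along Y (\<lambda>y. g y *\<^sub>R w y) y = g y *\<^sub>R along Y w y + along Y g y *\<^sub>R w y"
      if "smooth_map_on W g" "smooth_map_on W w" "y \<in> W" for g and w :: "'m \<Rightarrow> 'v" and y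
      unfolding along_def by (rule tderiv_scaleR[OF W(1) that])
    have h': "smooth_map_on W (along Y h)" by (rule smooth_along[OF W(1) sub[OF h(1)] sY])
    have scale: "tderiv g y (Y' y) = k y *\<^sub>R along Y g y" if "smooth_map_on W g" "y \<in> W" for g :: "'m \<Rightarrow> 'v" and y
      using Yk[OF that(2)] linear_scale[OF tderiv_linear[OF W(1) that]] by (simp add: along_def)
    have 1: "tderiv \<sigma> y (Y' y) = (k y * along Y h y) *\<^sub>R \<sigma>1 y + (k y * h y) *\<^sub>R ?e y" if y: "y \<in> W" for y
    proof -
      have "along Y \<sigma> y = along Y (\<lambda>y. h y *\<^sub>R \<sigma>1 y) y" unfolding along_def using y W h s
        by (intro tderiv_cong[OF W(1)] smooth_scaleR W sub h smooth_\<sigma>) auto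
      then show ?thesis using scale[OF sub[OF s(1)] y] d[OF sub[OF h(1)] sub[OF smooth_\<sigma>(1)] y] by (simp add: algebra_simps)
    qed
    let ?a = "\<lambda>y. k y * along Y h y" and ?b = "\<lambda>y. k y * h y"
    have ab: "smooth_map_on W ?a" "smooth_map_on W ?b" by (intro smooth_intros W k h' sub h)+
    have sg: "smooth_map_on W (\<lambda>y. ?a y *\<^sub>R \<sigma>1 y)" "smooth_map_on W (\<lambda>y. ?b y *\<^sub>R ?e y)"
      by (intro smooth_scaleR ab W sub smooth_\<sigma> smooth_e)+
    let ?g = "\<lambda>y. ?a y *\<^sub>R \<sigma>1 y + ?b y *\<^sub>R ?e y"
    have g: "smooth_map_on W ?g" by (intro smooth_add W sg)
    have "tderiv (\<lambda>y. tderiv \<sigma> y (Y' y)) x (Y' x) = tderiv ?g x (Y' x)"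
      by (rule tderiv_cong[OF W(1,2) g]) (simp add: 1)
    also have "\<dots> = k x *\<^sub>R along Y ?g x" by (rule scale[OF g W(2)])
    also have "along Y ?g x = along Y (\<lambda>y. ?a y *\<^sub>R \<sigma>1 y) x + along Y (\<lambda>y. ?b y *\<^sub>R ?e y) x"
      unfolding along_def by (rule tderiv_add[OF W(1) sg W(2), unfolded along_def])
    also have "\<dots> = (?a x *\<^sub>R ?e x + along Y ?a x *\<^sub>R \<sigma>1 x) + (?b x *\<^sub>R ?z x + along Y ?b x *\<^sub>R ?e x)"
      using d[OF ab(1) sub[OF smooth_\<sigma>(1)] W(2)] d[OF ab(2) sub[OF smooth_e] W(2)] by simp
    finally have 2: "tderiv (\<lambda>y. tderiv \<sigma> y (Y' y)) x (Y' x) = (k x * along Y ?a x) *\<^sub>R \<sigma>1 x +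
        (k x * (?a x + along Y ?b x)) *\<^sub>R ?e x + (h x * k x * k x) *\<^sub>R ?z x" by (simp add: algebra_simps)
    show ?thesis using h(2)[OF x] Yk[OF W(2)] 1[OF W(2)] 2 unfolding mult.commute[of "k x" "h x"] by blast
  qed
  have "?S \<subseteq> span ?B" unfolding second_osculating_def
  proof (rule span_minimal[OF _ subspace_span], clarify)
    fix v \<sigma> Y' assume \<sigma>: "\<sigma> \<in> sections s1" "smooth_vector_field Y'" "\<forall>y. Y' y \<in> curvature_space f y (s2 y)"
      and v: "v \<in> {\<sigma> x, tderiv \<sigma> x (Y' x), tderiv (\<lambda>y. tderiv \<sigma> y (Y' y)) x (Y' x)}"
    have "\<exists>a b c. v = a *\<^sub>R \<sigma>1 x + b *\<^sub>R ?e x + c *\<^sub>R ?z x"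
    proof -
      obtain h k a b c where "\<sigma> x = h *\<^sub>R \<sigma>1 x" "tderiv \<sigma> x (Y' x) = a *\<^sub>R \<sigma>1 x + (h * k) *\<^sub>R ?e x"
        "tderiv (\<lambda>y. tderiv \<sigma> y (Y' y)) x (Y' x) = b *\<^sub>R \<sigma>1 x + c *\<^sub>R ?e x + (h * k * k) *\<^sub>R ?z x"
        using jet[OF \<sigma>(1,2)] \<sigma>(3) by blast
      then show ?thesis using v
        by (elim insertE) (metis add.right_neutral scaleR_zero_left, metis add.right_neutral scaleR_zero_left, blast, blast)
    qed
    then obtain a b c where "v = a *\<^sub>R \<sigma>1 x + b *\<^sub>R ?e x + c *\<^sub>R ?z x" by blast
    then show "v \<in> span ?B" by (simp add: span_add span_scale span_base)
  qed
  moreover have "?B \<subseteq> ?S"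
  proof -
    interpret sw: legendre_pair f s2 s1 by (rule swap)
    obtain Y' where Y': "smooth_vector_field Y'" "\<And>y. Y' y \<in> curvature_space f y (s2 y)" "Y' x \<noteq> 0"
      by (rule sw.spanning_vector_field[of x]) blast
    define \<sigma> where "\<sigma> y = eproj (s1 y) (\<sigma>1 x)" for y
    have \<sigma>: "\<sigma> \<in> sections s1" unfolding \<sigma>_def by (rule eproj_section[OF bundle_s(1)])
    have \<sigma>x: "\<sigma> x = \<sigma>1 x" unfolding \<sigma>_def by (rule eproj_fibre[OF bundle_s(1)]) (simp add: s1[OF x] span_base)
    obtain h k a b c where J: "\<sigma> x = h *\<^sub>R \<sigma>1 x" "Y' x = k *\<^sub>R Y x" "tderiv \<sigma> x (Y' x) = a *\<^sub>R \<sigma>1 x + (h * k) *\<^sub>R ?e x"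
        "tderiv (\<lambda>y. tderiv \<sigma> y (Y' y)) x (Y' x) = b *\<^sub>R \<sigma>1 x + c *\<^sub>R ?e x + (h * k * k) *\<^sub>R ?z x"
      using jet[OF \<sigma> Y'(1,2)] by blast
    have "(h - 1) *\<^sub>R \<sigma>1 x = 0" using J(1) \<sigma>x by (simp add: algebra_simps)
    then have h: "h = 1" using nz(1)[OF x] by simp
    have k: "k \<noteq> 0" using J(2) Y'(3) by auto
    have in_S: "w \<in> ?S" if "w \<in> {\<sigma> x, tderiv \<sigma> x (Y' x), tderiv (\<lambda>y. tderiv \<sigma> y (Y' y)) x (Y' x)}" for w
      unfolding second_osculating_def using that \<sigma> Y'(1,2) by (intro span_base) blast
    have sS: "subspace ?S" by (simp add: second_osculating_def)
    have 1: "\<sigma>1 x \<in> ?S" using in_S[of "\<sigma> x"] \<sigma>x by simp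
    have "(1 / k) *\<^sub>R (tderiv \<sigma> x (Y' x) - a *\<^sub>R \<sigma>1 x) \<in> ?S"
      by (intro subspace_scale subspace_diff sS 1 in_S) simp
    then have 2: "?e x \<in> ?S" using k h by (simp add: J(3))
    have "(1 / (k * k)) *\<^sub>R (tderiv (\<lambda>y. tderiv \<sigma> y (Y' y)) x (Y' x) - b *\<^sub>R \<sigma>1 x - c *\<^sub>R ?e x) \<in> ?S"
      by (intro subspace_scale subspace_diff sS 1 2 in_S) simp
    then have "?z x \<in> ?S" using k h by (simp add: J(4))
    then show ?thesis using 1 2 by blast
  qed
  then have "span ?B \<subseteq> ?S" by (rule span_minimal) (simp add: second_osculating_def)
  ultimately show ?thesis by blast
qed

end

section \<open>Potentials\<close>

text \<open>The elements of \<open>f \<and> f\<^sup>\<bottom>\<close>, as endomorphisms lowering the flag \<open>0 \<le> f \<le> f\<^sup>\<bottom> \<le> \<real>\<^sup>4\<^sup>,\<^sup>2\<close>.\<close>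

definition lowers :: "'v::r42 set \<Rightarrow> ('v \<Rightarrow>\<^sub>L 'v) \<Rightarrow> bool" where
  "lowers W A \<longleftrightarrow> skew A \<and> (\<forall>v\<in>W. A v = 0) \<and> (\<forall>v\<in>orth W. A v \<in> W)"

lemma lowersD:
  assumes "lowers W A"
  shows "skew A" "v \<in> W \<Longrightarrow> A v = 0" "v \<in> orth W \<Longrightarrow> A v \<in> W" "A v \<in> orth W"
proof -
  show *: "skew A" "v \<in> W \<Longrightarrow> A v = 0" "v \<in> orth W \<Longrightarrow> A v \<in> W" using assms by (auto simp: lowers_def)
  show "A v \<in> orth W"
    using assms by (auto simp: orth_def lowers_def form_commute[of _ "A v"] skewD form_simps)
qed

lemma lowers_wedge_space:
  assumes W: "subspace W" "isotropic W" and A: "A \<in> wedge_space W (orth W)"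
  shows "lowers W A" unfolding lowers_def
proof (intro conjI ballI)
  show "skew A" by (rule skew_wedge_space[OF A])
  show "A v = 0" if "v \<in> W" for v
    using that W by (intro wedge_space_kills[OF A]) (auto simp: orth_orth, auto simp: orth_def isotropic_def)
  show "A v \<in> W" if v: "v \<in> orth W" for v using A
  proof (rule wedge_space_induct)
    show "subspace {A :: 'a \<Rightarrow>\<^sub>L 'a. A v \<in> W}" using W(1) by (auto simp: subspace_def blinfun_simps)
    show "wedge a b v \<in> W" if "a \<in> W" "b \<in> orth W" for a b
      using that v W(1) orthD[OF v] by (simp add: wedge_apply subspace_neg subspace_scale)
  qed
qed

definition ext_deriv :: "'m::smooth_surface chart \<Rightarrow> ('m \<Rightarrow> real^2 \<Rightarrow> 'b::real_normed_vector) \<Rightarrow> 'm \<Rightarrow> real^2 \<Rightarrow> real^2 \<Rightarrow> 'b" where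
  "ext_deriv c \<eta> x e e' = tderiv (\<lambda>y. \<eta> y (coord_field c e' y)) x (coord_field c e x) -
    tderiv (\<lambda>y. \<eta> y (coord_field c e y)) x (coord_field c e' x)"

lemma closed_iff_ext_deriv:
  "closed_one_form \<eta> \<longleftrightarrow> (\<forall>c\<in>atlas. \<forall>x\<in>fst c. \<forall>e e'. ext_deriv c \<eta> x e e' = 0)"
  by (simp add: closed_one_form_def ext_deriv_def)

lemma smooth_one_form_coord:
  "smooth_one_form \<eta> \<Longrightarrow> c \<in> atlas \<Longrightarrow> U \<subseteq> fst c \<Longrightarrow> smooth_map_on U (\<lambda>y. \<eta> y (coord_field c e y))"
  unfolding smooth_one_form_def using smooth_subset by blast

lemma smooth_one_form_linear: "smooth_one_form \<eta> \<Longrightarrow> linear (\<eta> x)" by (simp add: smooth_one_form_def)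

context
  fixes \<eta> :: "'m::smooth_surface \<Rightarrow> real^2 \<Rightarrow> 'v::r42 \<Rightarrow>\<^sub>L 'v" and c :: "'m chart" and U x
  assumes \<eta>: "smooth_one_form \<eta>" and c: "c \<in> atlas" "x \<in> fst c" and U: "open U" "x \<in> U"
begin

lemma chart_nbhd: "open (U \<inter> fst c)" "x \<in> U \<inter> fst c" using open_chart[OF c(1)] c U by auto

lemma tderiv_form_apply:
  assumes "smooth_map_on U g"
  shows "tderiv (\<lambda>y. \<eta> y (coord_field c e y) (g y)) x Z =
    \<eta> x (coord_field c e x) (tderiv g x Z) + tderiv (\<lambda>y. \<eta> y (coord_field c e y)) x Z (g x)"
    and "smooth_map_on (U \<inter> fst c) (\<lambda>y. \<eta> y (coord_field c e y) (g y))"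
proof -
  have s: "smooth_map_on (U \<inter> fst c) (\<lambda>y. \<eta> y (coord_field c e y))" "smooth_map_on (U \<inter> fst c) g"
    using smooth_one_form_coord[OF \<eta> c(1)] smooth_subset[OF assms] by auto
  show "tderiv (\<lambda>y. \<eta> y (coord_field c e y) (g y)) x Z =
    \<eta> x (coord_field c e x) (tderiv g x Z) + tderiv (\<lambda>y. \<eta> y (coord_field c e y)) x Z (g x)"
    by (rule tderiv_apply[OF chart_nbhd(1) s chart_nbhd(2)])
  show "smooth_map_on (U \<inter> fst c) (\<lambda>y. \<eta> y (coord_field c e y) (g y))"
    by (rule smooth_apply[OF chart_nbhd(1) s])
qed

text \<open>Differentiating \<open>\<eta> y Z (g y) = 0\<close> trades the derivative of the form
  for algebraic terms in the derivative of \<open>g\<close>. Equations for the exterior derivative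
  are mostly exploited in this shape.\<close>

lemma ext_deriv_annihilator:
  assumes g: "smooth_map_on U g" "\<And>y Z. y \<in> U \<Longrightarrow> \<eta> y Z (g y) = 0"
  shows "ext_deriv c \<eta> x e e' (g x) = \<eta> x (coord_field c e x) (tderiv g x (coord_field c e' x)) -
    \<eta> x (coord_field c e' x) (tderiv g x (coord_field c e x))"
proof -
  have "tderiv (\<lambda>y. \<eta> y (coord_field c e y)) x Z (g x) = - \<eta> x (coord_field c e x) (tderiv g x Z)" for e Z
  proof -
    have "tderiv (\<lambda>y. \<eta> y (coord_field c e y) (g y)) x Z = tderiv (\<lambda>_. 0) x Z"
      by (rule tderiv_cong[OF U smooth_const]) (simp add: g(2))
    then show ?thesis
      using tderiv_form_apply(1)[OF g(1), of e Z] by (metis add.commute eq_neg_iff_add_eq_0 tderiv_const)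
  qed
  then show ?thesis by (simp add: ext_deriv_def blinfun_simps)
qed

lemma ext_deriv_pairing:
  assumes g: "smooth_map_on U g" "smooth_map_on U h" "\<And>y Z. y \<in> U \<Longrightarrow> form (\<eta> y Z (g y)) (h y) = 0"
    and Z_def: "Z = coord_field c e x" and W_def: "W = coord_field c e' x"
  shows "form (ext_deriv c \<eta> x e e' (g x)) (h x) =
    form (\<eta> x Z (tderiv g x W)) (h x) + form (\<eta> x Z (g x)) (tderiv h x W)
    - form (\<eta> x W (tderiv g x Z)) (h x) - form (\<eta> x W (g x)) (tderiv h x Z)"
proof -
  have "form (tderiv (\<lambda>y. \<eta> y (coord_field c e y)) x Z' (g x)) (h x) =
      - form (\<eta> x (coord_field c e x) (tderiv g x Z')) (h x) - form (\<eta> x (coord_field c e x) (g x)) (tderiv h x Z')" for e Z'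
  proof -
    have "form (tderiv (\<lambda>y. \<eta> y (coord_field c e y) (g y)) x Z') (h x) =
        - form (\<eta> x (coord_field c e x) (g x)) (tderiv h x Z')" using smooth_subset[OF g(2)] g(3)
      by (intro tderiv_form_eq[OF chart_nbhd tderiv_form_apply(2)[OF g(1)]]) auto
    then show ?thesis by (simp add: tderiv_form_apply(1)[OF g(1)] form_simps)
  qed
  from this[of e' Z] this[of e W] show ?thesis
    by (simp add: ext_deriv_def blinfun_simps form_simps Z_def W_def)
qed

end

lemma tangent_coord:
  assumes "c \<in> atlas" "x \<in> fst c"
  obtains e where "Z = coord_field c e x" using coord_field_tderiv_chart[OF assms, of Z] by metis

lemma closed_annihilator:
  fixes \<eta> :: "'m::smooth_surface \<Rightarrow> real^2 \<Rightarrow> 'v::r42 \<Rightarrow>\<^sub>L 'v"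
  assumes \<eta>: "smooth_one_form \<eta>" "closed_one_form \<eta>" and U: "open U" "x \<in> U"
    and g: "smooth_map_on U g" "\<And>y Z. y \<in> U \<Longrightarrow> \<eta> y Z (g y) = 0"
  shows "\<eta> x Z (tderiv g x W) = \<eta> x W (tderiv g x Z)"
proof -
  have c: "chart_at x \<in> atlas" "x \<in> fst (chart_at x)" using chart_at by auto
  obtain e e' where "Z = coord_field (chart_at x) e x" "W = coord_field (chart_at x) e' x"
    using tangent_coord[OF c] by metis
  then show ?thesis
    using ext_deriv_annihilator[OF \<eta>(1) c U g, of e e'] \<eta>(2) c by (simp add: closed_iff_ext_deriv)
qed

lemma closed_pairing:
  fixes \<eta> :: "'m::smooth_surface \<Rightarrow> real^2 \<Rightarrow> 'v::r42 \<Rightarrow>\<^sub>L 'v"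
  assumes \<eta>: "smooth_one_form \<eta>" "closed_one_form \<eta>" and U: "open U" "x \<in> U"
    and g: "smooth_map_on U g" "smooth_map_on U h" "\<And>y Z. y \<in> U \<Longrightarrow> form (\<eta> y Z (g y)) (h y) = 0"
  shows "form (\<eta> x Z (tderiv g x W)) (h x) + form (\<eta> x Z (g x)) (tderiv h x W) =
    form (\<eta> x W (tderiv g x Z)) (h x) + form (\<eta> x W (g x)) (tderiv h x Z)"
proof -
  have c: "chart_at x \<in> atlas" "x \<in> fst (chart_at x)" using chart_at by auto
  obtain e e' where "Z = coord_field (chart_at x) e x" "W = coord_field (chart_at x) e' x"
    using tangent_coord[OF c] by metis
  then show ?thesis
    using ext_deriv_pairing[OF \<eta>(1) c U g refl refl, of e e'] \<eta>(2) c by (simp add: closed_iff_ext_deriv form_simps)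
qed

definition sections_on :: "'m::smooth_surface set \<Rightarrow> ('m \<Rightarrow> 'b::real_normed_vector set) \<Rightarrow> ('m \<Rightarrow> 'b) set" where
  "sections_on U W = {\<sigma>. smooth_map_on U \<sigma> \<and> (\<forall>x\<in>U. \<sigma> x \<in> W x)}"

lemma sections_on_section: "\<sigma> \<in> sections W \<Longrightarrow> \<sigma> \<in> sections_on U W"
  using smooth_subset by (auto simp: sections_def sections_on_def)

text \<open>Working form of a gauge potential: its values are described by their action on the flag
  of \<open>f\<close>, and their commutation is recovered from closedness in
  \<open>f_potential_commute\<close>.\<close>

definition f_potential :: "('m::smooth_surface \<Rightarrow> 'v::r42 set) \<Rightarrow> ('m \<Rightarrow> real^2 \<Rightarrow> 'v \<Rightarrow>\<^sub>L 'v) \<Rightarrow> bool" where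
  "f_potential f \<eta> \<longleftrightarrow> smooth_one_form \<eta> \<and> closed_one_form \<eta> \<and> (\<forall>x X. lowers (f x) (\<eta> x X))"

lemma (in legendre_pair) gauge_potential_f_potential: "gauge_potential f \<eta> \<Longrightarrow> f_potential f \<eta>"
  using lowers_wedge_space[OF subspace_f isotropic_f] by (auto simp: gauge_potential_def f_potential_def)

lemma closed_tderiv:
  assumes "smooth_map \<tau>"
  shows "smooth_one_form (tderiv \<tau>)" "closed_one_form (tderiv \<tau>)"
proof -
  show "smooth_one_form (tderiv \<tau>)" unfolding smooth_one_form_def
    using tderiv_linear[OF open_UNIV assms UNIV_I] smooth_subset[OF assms]
    by (auto intro!: smooth_coord_deriv open_chart)
  show "closed_one_form (tderiv \<tau>)" unfolding closed_one_form_def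
    using coord_deriv_commute[OF open_UNIV assms UNIV_I] by blast
qed

lemma smooth_one_form_diff:
  assumes "smooth_one_form \<eta>" "smooth_one_form \<theta>"
  shows "smooth_one_form (\<lambda>x X. \<eta> x X - \<theta> x X)"
  using assms by (auto simp: smooth_one_form_def linear_compose_sub intro!: smooth_diff open_chart)

lemma ext_deriv_diff:
  assumes "smooth_one_form \<eta>" "smooth_one_form \<theta>" "c \<in> atlas" "x \<in> fst c"
  shows "ext_deriv c (\<lambda>x X. \<eta> x X - \<theta> x X) x e e' = ext_deriv c \<eta> x e e' - ext_deriv c \<theta> x e e'"
  using assms by (simp add: ext_deriv_def tderiv_diff[OF open_chart _ _ assms(4)] smooth_one_form_coord)

lemma smooth_one_form_add:
  assumes "smooth_one_form \<eta>" "smooth_one_form \<theta>"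
  shows "smooth_one_form (\<lambda>x X. \<eta> x X + \<theta> x X)"
  using assms by (auto simp: smooth_one_form_def linear_compose_add intro!: smooth_add open_chart)

lemma ext_deriv_add:
  assumes "smooth_one_form \<eta>" "smooth_one_form \<theta>" "c \<in> atlas" "x \<in> fst c"
  shows "ext_deriv c (\<lambda>x X. \<eta> x X + \<theta> x X) x e e' = ext_deriv c \<eta> x e e' + ext_deriv c \<theta> x e e'"
  using assms by (simp add: ext_deriv_def tderiv_add[OF open_chart _ _ assms(4)] smooth_one_form_coord)

lemma smooth_one_form_scaleR:
  assumes "smooth_map k" "smooth_one_form \<eta>"
  shows "smooth_one_form (\<lambda>x X. k x *\<^sub>R \<eta> x X)" unfolding smooth_one_form_def
proof (intro conjI allI ballI)
  show "linear (\<lambda>X. k x *\<^sub>R \<eta> x X)" for x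
    using smooth_one_form_linear[OF assms(2)] by (rule linear_compose_scale_right)
  show "smooth_map_on (fst c) (\<lambda>x. k x *\<^sub>R \<eta> x (coord_field c e x))" if "c \<in> atlas" for c e
    using that smooth_one_form_coord[OF assms(2) that order_refl] smooth_subset[OF assms(1)]
    by (intro smooth_scaleR open_chart) auto
qed

lemma ext_deriv_scaleR:
  assumes k: "smooth_map k" "\<And>X. tderiv k x X = 0" and \<eta>: "smooth_one_form \<eta>" and c: "c \<in> atlas" "x \<in> fst c"
  shows "ext_deriv c (\<lambda>x X. k x *\<^sub>R \<eta> x X) x e e' = k x *\<^sub>R ext_deriv c \<eta> x e e'"
  using assms smooth_subset[OF k(1) subset_UNIV]
  by (simp add: ext_deriv_def tderiv_scaleR[OF open_chart[OF c(1)] _ smooth_one_form_coord[OF \<eta> c(1) order_refl] c(2)]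
      scaleR_diff_right)

subsection \<open>The quadratic differential\<close>

text \<open>\<open>section_through\<close> may be exchanged for the local sections \<open>a\<close>
  and \<open>b\<close>: the derivatives of two sections with the same value differ by an element of
  \<open>f\<close>, which \<open>\<eta>\<close> annihilates.\<close>

lemma (in legendre_pair) omega_q_trace:
  assumes U: "open U" "x \<in> U" and a: "smooth_map_on U a" "\<And>y. y \<in> U \<Longrightarrow> a y \<in> f y"
    and b: "smooth_map_on U b" "\<And>y. y \<in> U \<Longrightarrow> b y \<in> f y"
    and ind: "independent {a x, b x}" "a x \<noteq> b x" "f x = span {a x, b x}" and \<eta>: "lowers (f x) (\<eta> x Z)"
    and T: "\<eta> x Z (tderiv a x W) = k1 *\<^sub>R a x + l1 *\<^sub>R b x" "\<eta> x Z (tderiv b x W) = l2 *\<^sub>R a x + k2 *\<^sub>R b x"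
  shows "omega_q f \<eta> x Z W = k1 + k2"
proof -
  let ?T = "\<lambda>v. \<eta> x Z (tderiv (section_through f x v) x W)"
  have eq: "?T (\<sigma> x) = \<eta> x Z (tderiv \<sigma> x W)"
    if \<sigma>: "smooth_map_on V \<sigma>" "\<And>y. y \<in> V \<Longrightarrow> \<sigma> y \<in> f y" "open V" "x \<in> V" for \<sigma> V
  proof -
    note st = section_through[OF f_bundle \<sigma>(2)[OF \<sigma>(4)]]
    have "tderiv (section_through f x (\<sigma> x)) x W - tderiv \<sigma> x W \<in> f x"
      using st by (intro tderiv_local_sections_diff[OF f_bundle open_UNIV UNIV_I _ _ \<sigma>(3,4,1,2)]) (auto simp: sections_def)
    then have "\<eta> x Z (tderiv (section_through f x (\<sigma> x)) x W - tderiv \<sigma> x W) = 0" by (rule lowersD(2)[OF \<eta>])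
    then show ?thesis by (simp add: blinfun.diff_right)
  qed
  have lin: "linear (\<lambda>v. \<eta> x Z (tderiv (\<lambda>y. eproj (f y) v) x W))"
    using linear_compose[OF linear_tderiv_eproj[OF f_bundle] bounded_linear.linear[OF blinfun.bounded_linear_right]]
    by (simp add: o_def)
  have P: "?T v = \<eta> x Z (tderiv (\<lambda>y. eproj (f y) v) x W)" if "v \<in> f x" for v
    using eq[of UNIV "\<lambda>y. eproj (f y) v"] smooth_eproj[OF f_bundle] eproj(1)[OF subspace_f] eproj_fibre[OF f_bundle that] by simp
  show ?thesis unfolding omega_q_def by (rule trace_on_2[OF ind lin P]) (use eq[OF a U] eq[OF b U] T in auto)
qed

lemma pos_index_orthogonal_basis:
  fixes b :: "real^2 \<Rightarrow> real^2 \<Rightarrow> real"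
  assumes b: "bilinear b" and uv: "u \<noteq> 0" "v \<notin> span {u}" and o: "b u v = 0" "b v u = 0"
  shows "pos_index b UNIV = of_bool (b u u > 0) + of_bool (b v v > 0)"
proof -
  have lin: "\<And>y. linear (\<lambda>x. b x y)" "\<And>x. linear (b x)" using b by (auto simp: bilinear_def)
  have val: "b (r *\<^sub>R u + s *\<^sub>R v) (r *\<^sub>R u + s *\<^sub>R v) = r * r * b u u + s * s * b v v" for r s
    using o by (simp add: linear_add[OF lin(1)] linear_add[OF lin(2)] linear_scale[OF lin(1)] linear_scale[OF lin(2)])
  have ex: "\<exists>r s. z = r *\<^sub>R u + s *\<^sub>R v" for z using plane_basis[OF uv, of z] by metis
  have b0: "b 0 0 = 0" using linear_0[OF lin(2)] by simp
  have le2: "dim P \<le> 2" for P :: "(real^2) set" using dim_subset_UNIV[of P] by simp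
  have one: "pos_index b UNIV = 1" if pos: "b p p > 0" and m: "b m m \<le> 0" "m \<noteq> 0" for p m
  proof (rule pos_index_eqI[of "span {p}"])
    have "p \<noteq> 0" using pos b0 by auto
    then show "dim (span {p}) = 1" by simp
    show "b w w > 0" if w: "w \<in> span {p}" "w \<noteq> 0" for w
    proof -
      obtain k where "w = k *\<^sub>R p" using w by (auto simp: span_singleton)
      then have "k \<noteq> 0" "b w w = (k * k) * b p p"
        using w(2) by (auto simp: linear_scale[OF lin(1)] linear_scale[OF lin(2)])
      then show ?thesis using pos by (simp only: zero_less_mult_iff) auto
    qed
    show "dim P \<le> 1" if P: "subspace P" "\<And>v. v \<in> P \<Longrightarrow> v \<noteq> 0 \<Longrightarrow> 0 < b v v" for P
    proof (rule ccontr)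
      assume "\<not> dim P \<le> 1"
      then have "P = UNIV" using le2[of P] P(1) by (intro subspace_dim_equal) auto
      then show False using P(2)[of m] m by auto
    qed
  qed auto
  have v0: "v \<noteq> 0" using uv span_0 by auto
  consider "b u u > 0" "b v v > 0" | "b u u > 0" "b v v \<le> 0" | "b u u \<le> 0" "b v v > 0" | "b u u \<le> 0" "b v v \<le> 0" by linarith
  then show ?thesis
  proof cases
    case 1
    have "pos_index b UNIV = 2"
    proof (rule pos_index_eqI[of UNIV])
      fix w :: "real^2" assume "w \<noteq> 0"
      obtain r s where rs: "w = r *\<^sub>R u + s *\<^sub>R v" using ex by blast
      have "r \<noteq> 0 \<or> s \<noteq> 0" using rs \<open>w \<noteq> 0\<close> by auto
      moreover have "0 \<le> r * r * b u u" "0 \<le> s * s * b v v" using 1 by auto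
      moreover have "r \<noteq> 0 \<Longrightarrow> 0 < r * r * b u u" "s \<noteq> 0 \<Longrightarrow> 0 < s * s * b v v"
        using 1 by (auto simp: zero_less_mult_iff)
      ultimately show "0 < b w w" unfolding rs val by force
    qed (use le2 in auto)
    then show ?thesis using 1 by simp
  next
    case 2
    then show ?thesis using one[of u v] v0 by simp
  next
    case 3
    then show ?thesis using one[of v u] uv by simp
  next
    case 4
    have "pos_index b UNIV = 0"
    proof (rule pos_index_eqI[of "{0}"])
      fix P assume P: "subspace P" "\<And>v. v \<in> P \<Longrightarrow> v \<noteq> 0 \<Longrightarrow> 0 < b v v"
      have "w = 0" if w: "w \<in> P" for w
      proof (rule ccontr)
        assume "w \<noteq> 0"
        obtain r s where rs: "w = r *\<^sub>R u + s *\<^sub>R v" using ex by blast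
        have "r * r * b u u \<le> 0" "s * s * b v v \<le> 0" using 4 by (auto simp: mult_nonneg_nonpos)
        then show False using P(2)[OF w \<open>w \<noteq> 0\<close>] unfolding rs val by linarith
      qed
      then show "dim P \<le> 0" by (auto simp: subset_iff)
    qed auto
    then show ?thesis using 4 by simp
  qed
qed

context curvature_frame
begin

abbreviation "g1 x \<equiv> form (e1 x) (e1 x)"
abbreviation "g2 x \<equiv> form (e2 x) (e2 x)"
abbreviation "z1 \<equiv> along Y e1"
abbreviation "z2 \<equiv> along X e2"

lemma e_pos2: "x \<in> U \<Longrightarrow> g2 x > 0" and e_orth2: "x \<in> U \<Longrightarrow> e2 x \<in> orth (f x)"
  and z_\<sigma>2: "x \<in> U \<Longrightarrow> form (\<sigma>2 x) (z2 x) = - g2 x" "x \<in> U \<Longrightarrow> form (\<sigma>1 x) (z2 x) = 0"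
  and along_Y_\<sigma>2: "x \<in> U \<Longrightarrow> along Y \<sigma>2 x \<in> f x"
  and smooth_e2: "smooth_map_on U e2"
  using curvature_frame.e_pos[OF frame_swap] curvature_frame.e_orth[OF frame_swap]
    curvature_frame.z_\<sigma>[OF frame_swap] curvature_frame.tderiv_X_\<sigma>1[OF frame_swap] curvature_frame.smooth_e[OF frame_swap] by auto

lemma f_coeffs:
  assumes x: "x \<in> U" and v: "v \<in> f x"
  shows "v = (- form v (z1 x) / g1 x) *\<^sub>R \<sigma>1 x + (- form v (z2 x) / g2 x) *\<^sub>R \<sigma>2 x"
proof -
  obtain a b where v: "v = a *\<^sub>R \<sigma>1 x + b *\<^sub>R \<sigma>2 x" by (rule f_expand[OF x v])
  have "form v (z1 x) = - a * g1 x" "form v (z2 x) = - b * g2 x"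
    using z_\<sigma>[OF x] z_\<sigma>2[OF x] by (simp_all add: v form_simps)
  then show ?thesis using e_pos[OF x] e_pos2[OF x] v by simp
qed

lemma orth_f_coeffs:
  assumes x: "x \<in> U" and v: "v \<in> orth (f x)"
  obtains a k l where "a \<in> f x" "v = a + k *\<^sub>R e1 x + l *\<^sub>R e2 x"
proof -
  define k where "k = form v (e1 x) / g1 x"
  define l where "l = form v (e2 x) / g2 x"
  have "v - k *\<^sub>R e1 x - l *\<^sub>R e2 x \<in> f x" using e_pos[OF x] e_pos2[OF x] e_e[OF x]
    by (intro orth_f_expand[OF x] subspace_diff subspace_scale subspace_orth v e_orth[OF x] e_orth2[OF x])
      (simp_all add: form_simps k_def l_def form_commute[of "e2 x" "e1 x"])
  from that[OF this, of k l] show ?thesis by simp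
qed

lemma omega_q_eq:
  assumes x: "x \<in> U" and \<eta>: "lowers (f x) (\<eta> x Z)"
  shows "omega_q f \<eta> x Z W = - form (\<eta> x Z (tderiv \<sigma>1 x W)) (z1 x) / g1 x - form (\<eta> x Z (tderiv \<sigma>2 x W)) (z2 x) / g2 x"
proof -
  have "tderiv \<sigma>1 x W \<in> orth (f x)" by (rule tderiv_section_orth[OF U x smooth_\<sigma>(1) section_\<sigma>(1)])
  moreover have "tderiv \<sigma>2 x W \<in> orth (f x)" by (rule tderiv_section_orth[OF U x smooth_\<sigma>(2) section_\<sigma>(2)])
  ultimately have "\<eta> x Z (tderiv \<sigma>1 x W) \<in> f x" "\<eta> x Z (tderiv \<sigma>2 x W) \<in> f x"
    by (simp_all add: lowersD(3)[OF \<eta>])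
  then show ?thesis
    using omega_q_trace[of U x \<sigma>1 \<sigma>2 \<eta> Z W, OF U x smooth_\<sigma>(1) section_\<sigma>(1) smooth_\<sigma>(2) section_\<sigma>(2) indep[OF x] neq[OF x]
        f_span[OF x] \<eta> f_coeffs[OF x] f_coeffs[OF x]] by simp
qed

context
  fixes \<eta> and x :: 'm
  assumes \<eta>: "f_potential f \<eta>" and x: "x \<in> U"
begin

lemma pot: "smooth_one_form \<eta>" "closed_one_form \<eta>" "lowers (f y) (\<eta> y Z)"
  using \<eta> by (auto simp: f_potential_def)

text \<open>Closedness applied to \<eta> \<sigma>1 = 0 gives \<eta>(X) d_Y \<sigma>1 = \<eta>(Y) d_X
  \<sigma>1, and the right side is 0 because d_X \<sigma>1 lies in \<open>f\<close>. With its mirror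
  image this diagonalises q in the frame X, Y.\<close>

lemma potential_X_e: "\<eta> x (X x) (e1 x) = 0"
proof -
  have "\<eta> x (X x) (tderiv \<sigma>1 x (Y x)) = \<eta> x (Y x) (tderiv \<sigma>1 x (X x))"
    by (rule closed_annihilator[OF pot(1,2) U x smooth_\<sigma>(1)]) (rule lowersD(2)[OF pot(3) section_\<sigma>(1)])
  also have "\<dots> = 0" using lowersD(2)[OF pot(3) tderiv_X_\<sigma>1[OF x]] by (simp add: along_def)
  finally show ?thesis by (simp add: along_def)
qed

lemma bilinear_omega_q: "bilinear (omega_q f \<eta> x)" unfolding bilinear_def
proof (intro conjI allI)
  note l\<eta> = smooth_one_form_linear[OF pot(1), of x]
  note t1 = tderiv_linear[OF U smooth_\<sigma>(1) x] and t2 = tderiv_linear[OF U smooth_\<sigma>(2) x]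
  show "linear (\<lambda>Z. omega_q f \<eta> x Z W)" for W unfolding omega_q_eq[where \<eta> = \<eta>, OF x pot(3)]
    by (rule linearI) (simp_all add: linear_add[OF l\<eta>] linear_scale[OF l\<eta>] blinfun_simps form_simps add_divide_distrib diff_divide_distrib right_diff_distrib)
  show "linear (omega_q f \<eta> x Z)" for Z unfolding omega_q_eq[where \<eta> = \<eta>, OF x pot(3), abs_def]
    by (rule linearI) (simp_all add: linear_add[OF t1] linear_scale[OF t1] linear_add[OF t2] linear_scale[OF t2]
        blinfun_simps form_simps add_divide_distrib diff_divide_distrib right_diff_distrib)
qed

end

lemma potential_Y_e: "f_potential f \<eta> \<Longrightarrow> x \<in> U \<Longrightarrow> \<eta> x (Y x) (e2 x) = 0"
  by (rule curvature_frame.potential_X_e[OF frame_swap])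

context
  fixes \<eta> and x :: 'm
  assumes \<eta>: "f_potential f \<eta>" and x: "x \<in> U"
begin

lemma omega_q_XY:
  "omega_q f \<eta> x (X x) (Y x) = 0" "omega_q f \<eta> x (Y x) (X x) = 0"
  "omega_q f \<eta> x (X x) (X x) = - form (\<eta> x (X x) (e2 x)) (z2 x) / g2 x"
  "omega_q f \<eta> x (Y x) (Y x) = - form (\<eta> x (Y x) (e1 x)) (z1 x) / g1 x"
proof -
  note q = omega_q_eq[where \<eta> = \<eta>, OF x pot(3)[OF \<eta> x]]
  have 0: "\<eta> x Z (tderiv \<sigma>1 x (X x)) = 0" "\<eta> x Z (tderiv \<sigma>2 x (Y x)) = 0" for Z
    using lowersD(2)[OF pot(3)[OF \<eta> x]] tderiv_X_\<sigma>1[OF x] along_Y_\<sigma>2[OF x] by (simp_all add: along_def)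
  note XY = potential_X_e[OF \<eta> x] potential_Y_e[OF \<eta> x]
  show "omega_q f \<eta> x (X x) (Y x) = 0" "omega_q f \<eta> x (Y x) (X x) = 0"
    "omega_q f \<eta> x (X x) (X x) = - form (\<eta> x (X x) (e2 x)) (z2 x) / g2 x"
    "omega_q f \<eta> x (Y x) (Y x) = - form (\<eta> x (Y x) (e1 x)) (z1 x) / g1 x"
    using XY 0 by (simp_all add: q along_def form_simps)
qed

lemma Y_notin_X: "Y x \<notin> span {X x}"
proof
  assume "Y x \<in> span {X x}"
  then have "Y x \<in> curvature_space f x (s1 x)"
    using span_minimal[of "{X x}", OF _ subspace_curvature_space] X(2)[OF x] by blast
  then show False using curvature_spaces_disjoint Y x by blast
qed

lemma nondegenerate_omega_q_iff:
  "nondegenerate (omega_q f \<eta> x) \<longleftrightarrow> omega_q f \<eta> x (X x) (X x) \<noteq> 0 \<and> omega_q f \<eta> x (Y x) (Y x) \<noteq> 0"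
proof -
  have lin: "\<And>W. linear (\<lambda>Z. omega_q f \<eta> x Z W)" "\<And>Z. linear (omega_q f \<eta> x Z)"
    using bilinear_omega_q[OF \<eta> x] by (auto simp: bilinear_def)
  have val: "omega_q f \<eta> x (a *\<^sub>R X x + b *\<^sub>R Y x) (a' *\<^sub>R X x + b' *\<^sub>R Y x) =
      a * a' * omega_q f \<eta> x (X x) (X x) + b * b' * omega_q f \<eta> x (Y x) (Y x)" for a b a' b'
    using omega_q_XY(1,2) by (simp add: linear_add[OF lin(1)] linear_add[OF lin(2)] linear_scale[OF lin(1)] linear_scale[OF lin(2)])
  show ?thesis
  proof
    assume nd: "nondegenerate (omega_q f \<eta> x)"
    have *: "\<exists>a' b'. a * a' * omega_q f \<eta> x (X x) (X x) + b * b' * omega_q f \<eta> x (Y x) (Y x) \<noteq> 0"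
      if "a *\<^sub>R X x + b *\<^sub>R Y x \<noteq> 0" for a b
      using nd that val XY_basis[OF x] unfolding nondegenerate_def by metis
    show "omega_q f \<eta> x (X x) (X x) \<noteq> 0 \<and> omega_q f \<eta> x (Y x) (Y x) \<noteq> 0"
      using *[of 1 0] *[of 0 1] X(1)[OF x] Y(1)[OF x] by auto
  next
    assume q: "omega_q f \<eta> x (X x) (X x) \<noteq> 0 \<and> omega_q f \<eta> x (Y x) (Y x) \<noteq> 0"
    show "nondegenerate (omega_q f \<eta> x)" unfolding nondegenerate_def
    proof (intro allI impI)
      fix v :: "real^2" assume "v \<noteq> 0"
      obtain a b where v: "v = a *\<^sub>R X x + b *\<^sub>R Y x" by (rule XY_basis[OF x])
      then have "a \<noteq> 0 \<or> b \<noteq> 0" using \<open>v \<noteq> 0\<close> by auto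
      then have "omega_q f \<eta> x v (1 *\<^sub>R X x + 0 *\<^sub>R Y x) \<noteq> 0 \<or> omega_q f \<eta> x v (0 *\<^sub>R X x + 1 *\<^sub>R Y x) \<noteq> 0"
        unfolding v val using q by auto
      then show "\<exists>w. omega_q f \<eta> x v w \<noteq> 0" by blast
    qed
  qed
qed

lemma signature_omega_q:
  "signature (omega_q f \<eta> x) UNIV =
    (of_bool (omega_q f \<eta> x (X x) (X x) > 0) + of_bool (omega_q f \<eta> x (Y x) (Y x) > 0),
     of_bool (omega_q f \<eta> x (X x) (X x) < 0) + of_bool (omega_q f \<eta> x (Y x) (Y x) < 0))"
proof -
  note b = bilinear_omega_q[OF \<eta> x]
  have b': "bilinear (\<lambda>v w. - omega_q f \<eta> x v w)"
    using b by (auto simp: bilinear_def intro: linear_compose_neg)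
  show ?thesis
    using pos_index_orthogonal_basis[OF b X(1)[OF x] Y_notin_X] pos_index_orthogonal_basis[OF b' X(1)[OF x] Y_notin_X]
      omega_q_XY(1,2) by (simp add: signature_def)
qed

end

lemma potential_values:
  assumes \<eta>: "f_potential f \<eta>" and x: "x \<in> U"
  shows "\<eta> x (X x) (e2 x) \<in> f x" "\<eta> x (Y x) (e1 x) \<in> f x"
  using lowersD(3)[OF pot(3)[OF \<eta> x]] e_orth[OF x] e_orth2[OF x] by auto

lemma frame_subset:
  assumes "open W" "W \<subseteq> U"
  shows "curvature_frame f s1 s2 W \<sigma>1 \<sigma>2 X Y"
proof (unfold_locales)
  show "smooth_map_on W \<sigma>1" "smooth_map_on W \<sigma>2" using smooth_\<sigma> assms(2) smooth_subset by blast+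
  show "smooth_field_on W X" "smooth_field_on W Y" using XY assms(2) smooth_field_on_subset by blast+
qed (use assms s1 s2 nz X Y in blast)+

subsection \<open>Gauge transformations\<close>

context
  fixes \<tau> and x :: 'm and Z :: "real^2"
  assumes \<tau>: "\<tau> \<in> sections_on U (\<lambda>x. wedge_space (f x) (f x))" and x: "x \<in> U"
begin

lemma \<tau>: "smooth_map_on U \<tau>" "y \<in> U \<Longrightarrow> \<tau> y \<in> wedge_space (f y) (f y)" "y \<in> U \<Longrightarrow> skew (\<tau> y)"
  "y \<in> U \<Longrightarrow> v \<in> orth (f y) \<Longrightarrow> \<tau> y v = 0" "y \<in> U \<Longrightarrow> \<tau> y v \<in> f y"
proof -
  show "smooth_map_on U \<tau>" and *: "y \<in> U \<Longrightarrow> \<tau> y \<in> wedge_space (f y) (f y)" using \<tau> by (auto simp: sections_on_def)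
  assume "y \<in> U"
  note * = *[OF this]
  show "skew (\<tau> y)" by (rule skew_wedge_space[OF *])
  show "v \<in> orth (f y) \<Longrightarrow> \<tau> y v = 0" by (rule wedge_space_kills[OF *])
  show "\<tau> y v \<in> f y" by (rule wedge_space_range[OF * subspace_f order_refl order_refl])
qed

lemma tderiv_\<tau>_apply:
  assumes "smooth_map_on U g" "\<And>y. y \<in> U \<Longrightarrow> g y \<in> orth (f y)"
  shows "tderiv \<tau> x Z (g x) = - \<tau> x (tderiv g x Z)"
proof -
  have "tderiv (\<lambda>y. \<tau> y (g y)) x Z = tderiv (\<lambda>_. 0) x Z"
    by (rule tderiv_cong[OF U x smooth_const]) (simp add: \<tau>(4) assms(2))
  then show ?thesis
    using tderiv_apply[OF U \<tau>(1) assms(1) x, of Z] by (metis add.commute eq_neg_iff_add_eq_0 tderiv_const)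
qed

text \<open>Values of \<open>\<tau>\<close> annihilate \<open>orth f\<close>, so d\<tau> v = -
  \<tau> (dv) for sections v of \<open>orth f\<close>. This has values in \<open>f\<close>, and it
  is 0 for sections of \<open>f\<close>, whose derivatives stay in \<open>orth f\<close>.\<close>

lemma lowers_tderiv_\<tau>: "lowers (f x) (tderiv \<tau> x Z)" unfolding lowers_def
proof (intro conjI ballI)
  show "skew (tderiv \<tau> x Z)" unfolding skew_def
  proof (intro allI)
    fix v w
    have bl: "bounded_linear (\<lambda>A :: 'v \<Rightarrow>\<^sub>L 'v. form (A v) w + form v (A w))"
      by (intro bounded_linear_add bounded_linear_compose[OF form.bounded_linear_left]
          bounded_linear_compose[OF form.bounded_linear_right] blinfun.bounded_linear_left)
    have "tderiv (\<lambda>y. form (\<tau> y v) w + form v (\<tau> y w)) x Z = 0"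
      using tderiv_cong[OF U x smooth_const, of 0 "\<lambda>y. form (\<tau> y v) w + form v (\<tau> y w)" Z] skewD[OF \<tau>(3), of _ v w] by simp
    then have "form (tderiv \<tau> x Z v) w + form v (tderiv \<tau> x Z w) = 0"
      using tderiv_bounded_linear[OF bl U \<tau>(1) x, of Z] by simp
    then show "form (tderiv \<tau> x Z v) w = - form v (tderiv \<tau> x Z w)" by simp
  qed
  have \<sigma>: "tderiv \<tau> x Z (\<sigma>1 x) = 0" "tderiv \<tau> x Z (\<sigma>2 x) = 0"
    using tderiv_\<tau>_apply[OF smooth_\<sigma>(1)] tderiv_\<tau>_apply[OF smooth_\<sigma>(2)] section_\<sigma> f_orth \<tau>(4)[OF x]
      tderiv_section_orth[OF U x smooth_\<sigma>(1) section_\<sigma>(1)] tderiv_section_orth[OF U x smooth_\<sigma>(2) section_\<sigma>(2)]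
    by (simp_all add: subset_iff)
  show 0: "tderiv \<tau> x Z v = 0" if "v \<in> f x" for v
    using f_expand[OF x that] \<sigma> by (metis add_0 blinfun.add_right blinfun.scaleR_right scaleR_zero_right)
  show "tderiv \<tau> x Z v \<in> f x" if v: "v \<in> orth (f x)" for v
  proof -
    obtain a k l where akl: "a \<in> f x" "v = a + k *\<^sub>R e1 x + l *\<^sub>R e2 x" by (rule orth_f_coeffs[OF x v])
    then have "tderiv \<tau> x Z v = - (k *\<^sub>R \<tau> x (tderiv e1 x Z)) - l *\<^sub>R \<tau> x (tderiv e2 x Z)"
      using 0[OF akl(1)] tderiv_\<tau>_apply[OF smooth_e e_orth] tderiv_\<tau>_apply[OF smooth_e2 e_orth2]
      by (simp add: blinfun_simps)
    then show ?thesis using \<tau>(5)[OF x] by (simp add: subspace_diff subspace_neg subspace_scale subspace_f)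
  qed
qed

end

lemma tderiv_\<tau>_e:
  assumes \<tau>: "\<tau> \<in> sections_on U (\<lambda>x. wedge_space (f x) (f x))" and x: "x \<in> U"
  shows "tderiv \<tau> x Z (e1 x) = - \<tau> x (tderiv e1 x Z)"
    "tderiv \<tau> x Z (e2 x) = - \<tau> x (tderiv e2 x Z)"
  using tderiv_\<tau>_apply[OF \<tau> x smooth_e e_orth] tderiv_\<tau>_apply[OF \<tau> x smooth_e2 e_orth2] by auto

lemma orth_f_decomposition:
  assumes x: "x \<in> U"
  obtains w a b where "w \<in> orth (f x)" "v = w + a *\<^sub>R z1 x + b *\<^sub>R z2 x"
proof -
  define a b where "a = - form (\<sigma>1 x) v / g1 x" and "b = - form (\<sigma>2 x) v / g2 x"
  show ?thesis
  proof (rule that[of "v - a *\<^sub>R z1 x - b *\<^sub>R z2 x" a b])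
    show "v - a *\<^sub>R z1 x - b *\<^sub>R z2 x \<in> orth (f x)"
      using z_\<sigma>[OF x] z_\<sigma>2[OF x] e_pos[OF x] e_pos2[OF x] by (intro orth_fI[OF x]) (simp_all add: form_simps a_def b_def)
  qed simp
qed

text \<open>\<open>z1\<close> and \<open>z2\<close> span a complement of \<open>orth f\<close> that
  is dual to \<open>f\<close>. By skewness, vanishing on them forces vanishing on
  \<open>orth f\<close> too.\<close>

lemma lowers_eqI:
  assumes x: "x \<in> U" and A: "lowers (f x) A" "A (z1 x) = 0" "A (z2 x) = 0"
  shows "A = 0"
proof (rule blinfun_eqI)
  fix v
  obtain w a b where w: "w \<in> orth (f x)" "v = w + a *\<^sub>R z1 x + b *\<^sub>R z2 x" by (rule orth_f_decomposition[OF x])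
  have "form (A w) (z1 x) = 0" "form (A w) (z2 x) = 0"
    using skewD[OF lowersD(1)[OF A(1)], of w] A(2,3) by (simp_all add: form_simps)
  then have "A w = 0" using f_coeffs[OF x lowersD(3)[OF A(1) w(1)]] by simp
  then show "A v = blinfun_apply 0 v" using A(2,3) by (simp add: w(2) blinfun_simps)
qed

text \<open>The mixed part \<open>C\<close> exchanges \<open>S1\<close> and \<open>S2\<close>, the
  rest \<open>D\<close> preserves them. If \<open>C\<close> comes from the wedge square of
  \<open>f\<close>, it kills \<open>e1\<close>, so A e1 = D e1 lies in the intersection of
  \<open>f\<close> and \<open>S1\<close>, which is \<open>s1\<close>. Conversely the two conditions
  make \<open>C\<close> vanish on the \<sigma> and the e, and skewness then leaves only a multiple
  of \<open>wedge (\<sigma>1 x) (\<sigma>2 x)\<close>.\<close>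

lemma mixed_component_iff:
  assumes x: "x \<in> U" and A: "lowers (f x) A"
  defines "S1 \<equiv> span {\<sigma>1 x, e1 x, z1 x}" and "S2 \<equiv> span {\<sigma>2 x, e2 x, z2 x}"
  shows "mixed_component S1 S2 A \<in> wedge_space (f x) (f x) \<longleftrightarrow> A (e1 x) \<in> s1 x \<and> A (e2 x) \<in> s2 x"
proof -
  let ?e1 = "e1 x" and ?e2 = "e2 x"
  interpret orthogonal_splitting S1 S2 using splitting(1)[OF x] by (simp add: S1_def S2_def)
  define C where "C = mixed_component S1 S2 A"
  define D where "D = A - C"
  have C: "C \<in> wedge_space S1 S2" and D: "D \<in> span (wedge_space S1 S1 \<union> wedge_space S2 S2)"
    using mixed_component[OF lowersD(1)[OF A]] by (simp_all add: C_def D_def)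
  have ACD: "A v = C v + D v" for v by (simp add: D_def blinfun_simps)
  have in_S: "\<sigma>1 x \<in> S1" "?e1 \<in> S1" "z1 x \<in> S1" "\<sigma>2 x \<in> S2" "?e2 \<in> S2" "z2 x \<in> S2"
    by (simp_all add: S1_def S2_def span_base)
  have fS1: "v \<in> s1 x" if v: "v \<in> f x" "v \<in> S1" for v
  proof -
    obtain a b where ab: "v = a *\<^sub>R \<sigma>1 x + b *\<^sub>R \<sigma>2 x" by (rule f_expand[OF x v(1)])
    then have "b *\<^sub>R \<sigma>2 x \<in> S1" using subspace_diff[OF S1 v(2) subspace_scale[OF S1 in_S(1), of a]] by simp
    then have "b *\<^sub>R \<sigma>2 x = 0" using S1_Int_S2 subspace_scale[OF S2 in_S(4)] by blast
    then have "v = a *\<^sub>R \<sigma>1 x" using ab by simp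
    then show ?thesis using s1[OF x] by (simp add: span_base span_scale)
  qed
  have fS2: "v \<in> s2 x" if v: "v \<in> f x" "v \<in> S2" for v
  proof -
    obtain a b where ab: "v = a *\<^sub>R \<sigma>1 x + b *\<^sub>R \<sigma>2 x" by (rule f_expand[OF x v(1)])
    then have "a *\<^sub>R \<sigma>1 x \<in> S2" using subspace_diff[OF S2 v(2) subspace_scale[OF S2 in_S(4), of b]] by simp
    then have "a *\<^sub>R \<sigma>1 x = 0" using S1_Int_S2 subspace_scale[OF S1 in_S(1)] by blast
    then have "v = b *\<^sub>R \<sigma>2 x" using ab by simp
    then show ?thesis using s2[OF x] by (simp add: span_base span_scale)
  qed
  note eo = e_orth[OF x] e_orth2[OF x]
  show ?thesis unfolding C_def[symmetric]
  proof
    assume "C \<in> wedge_space (f x) (f x)"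
    then have "C ?e1 = 0" "C ?e2 = 0" using wedge_space_kills eo by blast+
    then have "A ?e1 = D ?e1" "A ?e2 = D ?e2" using ACD by simp_all
    then show "A ?e1 \<in> s1 x \<and> A ?e2 \<in> s2 x" using fS1 fS2 lowersD(3)[OF A] eo pure_maps[OF D] in_S by metis
  next
    assume As: "A ?e1 \<in> s1 x \<and> A ?e2 \<in> s2 x"
    have s_S: "s1 x \<subseteq> S1" "s2 x \<subseteq> S2"
      using s1[OF x] s2[OF x] span_mono[of "{\<sigma>1 x}"] span_mono[of "{\<sigma>2 x}"] by (auto simp: S1_def S2_def)
    have C1: "C v = 0" if "v \<in> S1" "A v \<in> S1" for v
    proof -
      have "C v = A v - D v" using ACD by simp
      then have "C v \<in> S1" using subspace_diff[OF S1 that(2) pure_maps(1)[OF D that(1)]] by simp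
      then show ?thesis using S1_Int_S2 mixed_maps(1)[OF C that(1)] by blast
    qed
    have C2: "C v = 0" if "v \<in> S2" "A v \<in> S2" for v
    proof -
      have "C v = A v - D v" using ACD by simp
      then have "C v \<in> S2" using subspace_diff[OF S2 that(2) pure_maps(2)[OF D that(1)]] by simp
      then show ?thesis using S1_Int_S2 mixed_maps(2)[OF C that(1)] by blast
    qed
    have Cz: "C (\<sigma>1 x) = 0" "C (\<sigma>2 x) = 0" "C ?e1 = 0" "C ?e2 = 0"
      using C1 C2 in_S As s_S lowersD(2)[OF A] section_\<sigma>[OF x] subspace_0[OF S1] subspace_0[OF S2] by auto
    have skC: "skew C" by (rule skew_wedge_space[OF C])
    have "C (z1 x) \<in> span {\<sigma>2 x, ?e2, z2 x}" using mixed_maps(1)[OF C in_S(3)] by (simp add: S2_def)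
    then have "\<exists>a b c. C (z1 x) = a *\<^sub>R \<sigma>2 x + b *\<^sub>R ?e2 + c *\<^sub>R z2 x"
      by (auto simp: span_insert span_singleton algebra_simps)
    then obtain a b c where abc: "C (z1 x) = a *\<^sub>R \<sigma>2 x + b *\<^sub>R ?e2 + c *\<^sub>R z2 x" by blast
    have fo: "form (\<sigma>2 x) (\<sigma>2 x) = 0" "form ?e2 (\<sigma>2 x) = 0" "form (\<sigma>2 x) ?e2 = 0"
      using section_\<sigma>(2)[OF x] isotropic_f f_perp[OF x _ eo(2)] by (auto simp: isotropic_def)
    have "form (C (z1 x)) (\<sigma>2 x) = 0" "form (C (z1 x)) ?e2 = 0"
      using skewD[OF skC] Cz by (simp_all add: form_simps)
    then have "c = 0" "b = 0"
      using fo z_\<sigma>2(1)[OF x] e_pos2[OF x] by (auto simp: abc form_simps form_commute[of "z2 x" "\<sigma>2 x"])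
    then have Cz1: "C (z1 x) = a *\<^sub>R \<sigma>2 x" using abc by simp
    \<comment> \<open>Makes \<open>E\<close> vanish on \<open>z1 x\<close>, because the pairing of
      \<open>\<sigma>1 x\<close> with \<open>z1 x\<close> is - g1.\<close>
    define k where "k = - a / g1 x"
    define E where "E = C - k *\<^sub>R wedge (\<sigma>1 x) (\<sigma>2 x)"
    have skE: "skew E"
      using skC skew_wedge[of "\<sigma>1 x" "\<sigma>2 x"] subspace_diff[OF subspace_skew] subspace_scale[OF subspace_skew]
      by (auto simp: E_def)
    have fz: "form (\<sigma>1 x) v = 0" "form (\<sigma>2 x) v = 0" if "v \<in> orth (f x)" for v
      using f_perp(1)[OF x section_\<sigma>(1)[OF x] that] f_perp(1)[OF x section_\<sigma>(2)[OF x] that] .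
    have so: "\<sigma>1 x \<in> orth (f x)" "\<sigma>2 x \<in> orth (f x)" using section_\<sigma>[OF x] f_orth by auto
    have E0: "E (\<sigma>1 x) = 0" "E (\<sigma>2 x) = 0" "E ?e1 = 0" "E ?e2 = 0"
      using Cz fz[OF so(1)] fz[OF so(2)] fz[OF eo(1)] fz[OF eo(2)]
      by (simp_all add: E_def blinfun_simps wedge_apply)
    have E1: "E (z1 x) = 0"
      using Cz1 z_\<sigma>[OF x] e_pos[OF x] by (simp add: E_def blinfun_simps wedge_apply k_def)
    have lE: "lowers (f x) E" and Eo: "E v = 0" if "v \<in> orth (f x)" for v
    proof -
      have 0: "E v = 0" if v: "v \<in> orth (f x)" for v
      proof -
        obtain a k l where a: "a \<in> f x" "v = a + k *\<^sub>R ?e1 + l *\<^sub>R ?e2" by (rule orth_f_coeffs[OF x v])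
        obtain b c where "a = b *\<^sub>R \<sigma>1 x + c *\<^sub>R \<sigma>2 x" by (rule f_expand[OF x a(1)])
        then show ?thesis using E0 by (simp add: a(2) blinfun_simps)
      qed
      then show "E v = 0" using that .
      show "lowers (f x) E" using 0 skE f_orth[of x] subspace_0[OF subspace_f] by (auto simp: lowers_def)
    qed
    \<comment> \<open>A skew map that vanishes on a hyperplane is 0: \<open>E\<close> vanishes on
      \<open>orth (f x)\<close> and on \<open>z1 x\<close>, and \<open>E (z2 x)\<close> is
      orthogonal to \<open>z2 x\<close>.\<close>
    have E2: "E (z2 x) = 0"
    proof (rule form_nondegenerate)
      fix w
      obtain v a b where v: "v \<in> orth (f x)" "w = v + a *\<^sub>R z1 x + b *\<^sub>R z2 x" by (rule orth_f_decomposition[OF x])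
      then have "E w = b *\<^sub>R E (z2 x)" using Eo E1 by (simp add: blinfun_simps)
      then show "form (E (z2 x)) w = 0" using skewD[OF skE, of "z2 x" w] skew_self[OF skE] by (simp add: form_simps)
    qed
    have "E = 0" by (rule lowers_eqI[OF x lE[OF so(1)] E1 E2])
    then have "C = k *\<^sub>R wedge (\<sigma>1 x) (\<sigma>2 x)" by (simp add: E_def)
    then show "C \<in> wedge_space (f x) (f x)"
      using section_\<sigma>[OF x] by (simp add: subspace_scale wedge_in_wedge_space)
  qed
qed

end

section \<open>Sphere congruences\<close>

text \<open>Second derivatives of \<open>F\<close> cancel by symmetry, and the two remaining terms
  agree by antisymmetry of the wedge. The resulting 2 is the reason for the 2 in 2 \<xi> -
  \<alpha>^-1 F \<and> dF.\<close>

lemma ext_deriv_wedge: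
  assumes F: "open U" "x \<in> U" "smooth_map_on U F" and c: "c \<in> atlas" "x \<in> fst c"
  shows "ext_deriv c (\<lambda>y Z. wedge (F y) (tderiv F y Z)) x e e' =
    2 *\<^sub>R wedge (tderiv F x (coord_field c e x)) (tderiv F x (coord_field c e' x))"
proof -
  let ?W = "U \<inter> fst c"
  have W: "open ?W" "x \<in> ?W" "?W \<subseteq> fst c" "smooth_map_on ?W F"
    using F c open_chart[OF c(1)] smooth_subset[OF F(3)] by auto
  have d: "smooth_map_on ?W (\<lambda>y. tderiv F y (coord_field c e y))" for e
    by (rule smooth_coord_deriv[OF W(1,4) c(1) W(3)])
  show ?thesis unfolding ext_deriv_def
    by (simp add: tderiv_wedge[OF W(1,4) d W(2)] coord_deriv_commute[OF W(1,4,2) c, of e e'] scaleR_2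
        wedge_swap[of "tderiv F x (coord_field c e' x)" "tderiv F x (coord_field c e x)"])
qed

lemma smooth_one_form_wedge:
  assumes "smooth_map F"
  shows "smooth_one_form (\<lambda>y Z. wedge (F y) (tderiv F y Z))" unfolding smooth_one_form_def
proof (intro conjI allI ballI)
  show "linear (\<lambda>Z. wedge (F x) (tderiv F x Z))" for x
    using linear_compose[OF tderiv_linear[OF open_UNIV assms UNIV_I]
        bounded_linear.linear[OF wedge.bounded_linear_right]] by (simp add: o_def)
  show "smooth_map_on (fst c) (\<lambda>x. wedge (F x) (tderiv F x (coord_field c e x)))" if "c \<in> atlas" for c e
    using smooth_subset[OF assms] that by (intro smooth_wedge open_chart smooth_coord_deriv) auto
qed

text \<open>\<open>\<nu>\<close> is a unit normal, up to the constant factor \<open>\<kappa>\<close>, of the sphere congruence \<open>V\<close> inside \<open>\<langle>p\<rangle>\<^sup>\<bottom>\<close>.\<close>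

locale sphere_normal =
  fixes p :: "'v::r42" and \<alpha> \<kappa> :: real and V :: "'m::smooth_surface \<Rightarrow> 'v set" and Q :: "'m set" and \<nu> :: "'m \<Rightarrow> 'v"
  assumes p: "form p p = \<alpha>" "\<alpha> \<noteq> 0" and \<kappa>: "\<kappa> \<noteq> 0" and Q: "open Q" and \<nu>: "smooth_map_on Q \<nu>"
    and V: "\<And>y. y \<in> Q \<Longrightarrow> V y = orth {p, \<nu> y}"
    and p\<nu>: "\<And>y. y \<in> Q \<Longrightarrow> form p (\<nu> y) = 0" and \<nu>\<nu>: "\<And>y. y \<in> Q \<Longrightarrow> form (\<nu> y) (\<nu> y) = \<kappa>"
begin

lemma orth_V: "y \<in> Q \<Longrightarrow> orth (V y) = span {p, \<nu> y}"
  using orth_orth[of "span {p, \<nu> y}"] by (simp add: V orth_span)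

lemma independent_p\<nu>: assumes "y \<in> Q" shows "independent {p, \<nu> y}" "p \<noteq> \<nu> y"
proof -
  show ne: "p \<noteq> \<nu> y" using p\<nu>[OF assms] p by auto
  have "p \<notin> span {\<nu> y}"
  proof
    assume "p \<in> span {\<nu> y}"
    then obtain k where "p = k *\<^sub>R \<nu> y" by (auto simp: span_singleton)
    then have "form p p = k * form p (\<nu> y)" using form.scaleR_right[of p k "\<nu> y"] by simp
    then show False using p p\<nu>[OF assms] by simp
  qed
  moreover have "\<nu> y \<noteq> 0" using \<nu>\<nu>[OF assms] \<kappa> by (auto simp: form_simps)
  ultimately show "independent {p, \<nu> y}" using ne by (simp add: independent_insert)
qed

lemma nondeg_V: assumes y: "y \<in> Q" shows "nondeg (V y)" unfolding nondeg_def
proof (intro conjI ballI impI)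
  show "subspace (V y)" by (simp add: V y)
  fix v assume v: "v \<in> V y" and "\<forall>w\<in>V y. form v w = 0"
  then have "v \<in> orth (V y)" by (auto simp: orth_def form_commute)
  then have "\<exists>a b. v = a *\<^sub>R p + b *\<^sub>R \<nu> y" by (auto simp: orth_V y span_insert span_singleton algebra_simps)
  then obtain a b where ab: "v = a *\<^sub>R p + b *\<^sub>R \<nu> y" by blast
  have "form p v = 0" "form (\<nu> y) v = 0" using v by (auto simp: V y orth_def)
  then have "a = 0" "b = 0" using p \<kappa> p\<nu>[OF y] \<nu>\<nu>[OF y] by (simp_all add: ab form_simps form_commute[of "\<nu> y" p])
  then show "v = 0" using ab by simp
qed

lemma oproj_V: "y \<in> Q \<Longrightarrow> oproj (V y) v = v - (form p v / \<alpha>) *\<^sub>R p - (form (\<nu> y) v / \<kappa>) *\<^sub>R \<nu> y"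
proof (rule oproj_eqI[OF nondeg_V])
  assume y: "y \<in> Q"
  let ?w = "v - (form p v / \<alpha>) *\<^sub>R p - (form (\<nu> y) v / \<kappa>) *\<^sub>R \<nu> y"
  show "?w \<in> V y" using p \<kappa> p\<nu>[OF y] \<nu>\<nu>[OF y] by (simp add: V y orth_def form_simps form_commute[of "\<nu> y" p])
  show "v - ?w \<in> orth (V y)" by (simp add: orth_V y span_add span_scale span_base)
qed simp

lemma oproj_orth_V: "y \<in> Q \<Longrightarrow> oproj (orth (V y)) v = (form p v / \<alpha>) *\<^sub>R p + (form (\<nu> y) v / \<kappa>) *\<^sub>R \<nu> y"
  using oproj_orth[OF nondeg_V] oproj_V by simp

lemma d\<nu>: "y \<in> Q \<Longrightarrow> form p (tderiv \<nu> y Z) = 0" "y \<in> Q \<Longrightarrow> form (\<nu> y) (tderiv \<nu> y Z) = 0"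
proof -
  assume y: "y \<in> Q"
  show "form p (tderiv \<nu> y Z) = 0"
    using tderiv_form_eq[OF Q y smooth_const \<nu> p\<nu>, of Z] by (simp add: form_simps)
  show "form (\<nu> y) (tderiv \<nu> y Z) = 0" using tderiv_form_eq[OF Q y \<nu> \<nu> \<nu>\<nu>, of Z] by (simp add: form_commute)
qed

text \<open>The tensor N^V in closed form. Only \<open>\<nu>\<close> contributes, since the other
  normal \<open>p\<close> is constant.\<close>

definition N :: "'m \<Rightarrow> real^2 \<Rightarrow> 'v \<Rightarrow>\<^sub>L 'v" where
  "N y Z = (1 / \<kappa>) *\<^sub>R wedge (\<nu> y) (tderiv \<nu> y Z)"

lemma split_conn_eq:
  assumes y: "y \<in> Q" and U: "open U" "y \<in> U" "smooth_map_on U \<sigma>"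
  shows "split_conn V \<sigma> y Z = tderiv \<sigma> y Z - N y Z (\<sigma> y)"
proof -
  let ?W = "Q \<inter> U"
  have W: "open ?W" "y \<in> ?W" using Q U y by auto
  have s: "smooth_map_on ?W \<sigma>" "smooth_map_on ?W \<nu>" using smooth_subset \<nu> U(3) by blast+
  let ?a = "\<lambda>y. form p (\<sigma> y) / \<alpha>" and ?b = "\<lambda>y. form (\<nu> y) (\<sigma> y) / \<kappa>"
  have ab: "smooth_map_on ?W ?a" "smooth_map_on ?W ?b"
    using p(2) \<kappa> by (intro smooth_intros smooth_form W s; simp)+
  have abv: "smooth_map_on ?W (\<lambda>y. ?a y *\<^sub>R p)" "smooth_map_on ?W (\<lambda>y. ?b y *\<^sub>R \<nu> y)"
    by (intro smooth_intros ab s W)+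
  have ta: "tderiv ?a y Z = form p (tderiv \<sigma> y Z) / \<alpha>"
  proof -
    have "bounded_linear (\<lambda>v. form p v / \<alpha>)"
      by (intro bounded_linear_divide[THEN bounded_linear_compose] form.bounded_linear_right)
    from tderiv_bounded_linear[OF this W(1) s(1) W(2)] show ?thesis by simp
  qed
  have tb: "tderiv ?b y Z = (form (\<nu> y) (tderiv \<sigma> y Z) + form (tderiv \<nu> y Z) (\<sigma> y)) / \<kappa>"
    using tderiv_bounded_linear[OF bounded_linear_divide W(1) smooth_form[OF W(1) s(2,1)] W(2), of \<kappa> Z]
      tderiv_form[OF W(1) s(2,1) W(2), of Z] by simp
  have tv: "tderiv (\<lambda>y. ?a y *\<^sub>R p) y Z = tderiv ?a y Z *\<^sub>R p"
      "tderiv (\<lambda>y. ?b y *\<^sub>R \<nu> y) y Z = ?b y *\<^sub>R tderiv \<nu> y Z + tderiv ?b y Z *\<^sub>R \<nu> y"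
    using tderiv_scaleR[OF W(1) ab(1) smooth_const W(2), of p Z] tderiv_scaleR[OF W(1) ab(2) s(2) W(2), of Z] by simp_all
  have "tderiv (\<lambda>y. oproj (V y) (\<sigma> y)) y Z = tderiv (\<lambda>y. \<sigma> y - ?a y *\<^sub>R p - ?b y *\<^sub>R \<nu> y) y Z"
    by (rule tderiv_cong[OF W]) (auto intro!: smooth_diff W s abv simp: oproj_V)
  also have "\<dots> = tderiv \<sigma> y Z - tderiv ?a y Z *\<^sub>R p - (?b y *\<^sub>R tderiv \<nu> y Z + tderiv ?b y Z *\<^sub>R \<nu> y)"
    using tderiv_diff[OF W(1) smooth_diff[OF W(1) s(1) abv(1)] abv(2) W(2)]
      tderiv_diff[OF W(1) s(1) abv(1) W(2)] by (simp add: tv)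
  finally have 1: "tderiv (\<lambda>y. oproj (V y) (\<sigma> y)) y Z =
    tderiv \<sigma> y Z - tderiv ?a y Z *\<^sub>R p - (?b y *\<^sub>R tderiv \<nu> y Z + tderiv ?b y Z *\<^sub>R \<nu> y)" .
  have "tderiv (\<lambda>y. oproj (orth (V y)) (\<sigma> y)) y Z = tderiv (\<lambda>y. ?a y *\<^sub>R p + ?b y *\<^sub>R \<nu> y) y Z"
    by (rule tderiv_cong[OF W]) (auto intro!: smooth_add W abv simp: oproj_orth_V)
  also have "\<dots> = tderiv ?a y Z *\<^sub>R p + (?b y *\<^sub>R tderiv \<nu> y Z + tderiv ?b y Z *\<^sub>R \<nu> y)"
    using tderiv_add[OF W(1) abv W(2)] by (simp add: tv)
  finally have 2: "tderiv (\<lambda>y. oproj (orth (V y)) (\<sigma> y)) y Z =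
    tderiv ?a y Z *\<^sub>R p + (?b y *\<^sub>R tderiv \<nu> y Z + tderiv ?b y Z *\<^sub>R \<nu> y)" .
  note f0 = p\<nu>[OF y] \<nu>\<nu>[OF y] d\<nu>[OF y] p form_commute[of "\<nu> y" p]
  have 3: "oproj (V y) (tderiv (\<lambda>y. oproj (V y) (\<sigma> y)) y Z) =
    tderiv \<sigma> y Z - (form p (tderiv \<sigma> y Z) / \<alpha>) *\<^sub>R p - (form (\<nu> y) (tderiv \<sigma> y Z) / \<kappa>) *\<^sub>R \<nu> y - ?b y *\<^sub>R tderiv \<nu> y Z"
    unfolding 1 oproj_V[OF y] using \<kappa> p(2) f0 by (simp add: form_simps diff_divide_distrib algebra_simps)
  have 4: "oproj (orth (V y)) (tderiv (\<lambda>y. oproj (orth (V y)) (\<sigma> y)) y Z) = tderiv ?a y Z *\<^sub>R p + tderiv ?b y Z *\<^sub>R \<nu> y"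
    unfolding 2 oproj_orth_V[OF y] using \<kappa> p(2) f0 by (simp add: form_simps)
  show ?thesis unfolding split_conn_def 3 4 ta tb
    by (simp add: N_def blinfun_simps wedge_apply form_commute algebra_simps add_divide_distrib)
qed

lemma split_form_eq: "y \<in> Q \<Longrightarrow> split_form V y Z v = N y Z v"
  using split_conn_eq[OF _ open_UNIV UNIV_I smooth_const] by (simp add: split_form_def)

lemma guichard_conn_eq:
  assumes y: "y \<in> Q" and U: "open U" "y \<in> U" "smooth_map_on U \<sigma>"
  shows "guichard_conn V \<xi> t \<sigma> y Z = tderiv \<sigma> y Z + ((t - 1) *\<^sub>R N y Z + (t\<^sup>2 - 1) *\<^sub>R \<xi> y Z) (\<sigma> y)"
  unfolding guichard_conn_def split_conn_eq[OF assms] split_form_eq[OF y]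
  by (simp add: blinfun_simps algebra_simps)

context
  fixes c :: "'m chart" and x :: 'm and e e' Z W :: "real^2" and \<xi> :: "'m \<Rightarrow> real^2 \<Rightarrow> 'v \<Rightarrow>\<^sub>L 'v"
  assumes c: "c \<in> atlas" "x \<in> fst c" and x: "x \<in> Q" and \<xi>: "smooth_one_form \<xi>"
    and Z: "Z = coord_field c e x" and W: "W = coord_field c e' x"
begin

lemma nbhd: "open (Q \<inter> fst c)" "x \<in> Q \<inter> fst c" "Q \<inter> fst c \<subseteq> fst c" using Q open_chart[OF c(1)] c x by auto

lemma smooth_N: "smooth_map_on (Q \<inter> fst c) (\<lambda>y. N y (coord_field c b y))"
  unfolding N_def using smooth_subset[OF \<nu>]
  by (intro smooth_intros smooth_wedge smooth_coord_deriv nbhd(1,3) c(1)) auto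

lemma ext_deriv_N: "ext_deriv c N x e e' = 2 *\<^sub>R ((1 / \<kappa>) *\<^sub>R wedge (tderiv \<nu> x Z) (tderiv \<nu> x W))"
proof -
  have s: "smooth_map_on (Q \<inter> fst c) (\<lambda>y. wedge (\<nu> y) (tderiv \<nu> y (coord_field c e y)))" for e
    using smooth_subset[OF \<nu>] by (intro smooth_wedge smooth_coord_deriv nbhd(1,3) c(1)) auto
  have "ext_deriv c N x e e' = (1 / \<kappa>) *\<^sub>R ext_deriv c (\<lambda>y Z. wedge (\<nu> y) (tderiv \<nu> y Z)) x e e'"
    unfolding ext_deriv_def N_def by (simp only: tderiv_scaleR_right[OF nbhd(1) s nbhd(2)] scaleR_diff_right)
  then show ?thesis using ext_deriv_wedge[OF Q x \<nu> c] by (simp add: Z W)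
qed

lemma commutator_N: "N x Z (N x W v) - N x W (N x Z v) = ((1 / \<kappa>) *\<^sub>R wedge (tderiv \<nu> x Z) (tderiv \<nu> x W)) v"
  using \<kappa> by (simp add: N_def blinfun_simps wedge_apply form_simps d\<nu>[OF x] \<nu>\<nu>[OF x]
      form_commute[of "tderiv \<nu> x _" "\<nu> x"] form_commute[of "tderiv \<nu> x W" "tderiv \<nu> x Z"] algebra_simps)

text \<open>The curvature of d + A with A = (t - 1) N + (t^2 - 1) \<xi>, on constant sections. The
  exterior derivative of \<open>N\<close> is twice, and its commutator once, the same element, so
  their coefficients combine to 2 (t - 1) + (t - 1)^2 = t^2 - 1 and the whole curvature is divisible
  by t^2 - 1.\<close>

lemma curvature_eq:
  "guichard_conn V \<xi> t (\<lambda>y. guichard_conn V \<xi> t (\<lambda>_. v) y (coord_field c e' y)) x Z -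
   guichard_conn V \<xi> t (\<lambda>y. guichard_conn V \<xi> t (\<lambda>_. v) y (coord_field c e y)) x W =
   (t\<^sup>2 - 1) *\<^sub>R (ext_deriv c \<xi> x e e' v + ((1 / \<kappa>) *\<^sub>R wedge (tderiv \<nu> x Z) (tderiv \<nu> x W)) v) +
   ((t - 1) * (t\<^sup>2 - 1)) *\<^sub>R (N x Z (\<xi> x W v) + \<xi> x Z (N x W v) - N x W (\<xi> x Z v) - \<xi> x W (N x Z v)) +
   ((t\<^sup>2 - 1) * (t\<^sup>2 - 1)) *\<^sub>R (\<xi> x Z (\<xi> x W v) - \<xi> x W (\<xi> x Z v))"
proof -
  let ?A = "\<lambda>y e. (t - 1) *\<^sub>R N y (coord_field c e y) + (t\<^sup>2 - 1) *\<^sub>R \<xi> y (coord_field c e y)"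
  note s\<xi> = smooth_one_form_coord[OF \<xi> c(1) nbhd(3)]
  have sN: "smooth_map_on (Q \<inter> fst c) (\<lambda>y. (t - 1) *\<^sub>R N y (coord_field c e y))"
      "smooth_map_on (Q \<inter> fst c) (\<lambda>y. (t\<^sup>2 - 1) *\<^sub>R \<xi> y (coord_field c e y))" for e
    by (intro smooth_intros smooth_N s\<xi> nbhd(1))+
  have sA: "smooth_map_on (Q \<inter> fst c) (\<lambda>y. ?A y e)" for e by (intro smooth_add sN nbhd(1))
  have g: "guichard_conn V \<xi> t (\<lambda>_. v) y (coord_field c e y) = ?A y e v" if "y \<in> Q" for y e
    using guichard_conn_eq[OF that open_UNIV UNIV_I smooth_const] by simp
  have sAv: "smooth_map_on (Q \<inter> fst c) (\<lambda>y. ?A y e v)" for e by (intro smooth_apply nbhd(1) sA smooth_const)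
  have sg: "smooth_map_on (Q \<inter> fst c) (\<lambda>y. guichard_conn V \<xi> t (\<lambda>_. v) y (coord_field c e y))" for e
    by (rule smooth_cong[OF nbhd(1) _ sAv]) (simp add: g)
  have d: "tderiv (\<lambda>y. guichard_conn V \<xi> t (\<lambda>_. v) y (coord_field c e y)) x X = tderiv (\<lambda>y. ?A y e) x X v" for e X
    using tderiv_cong[OF nbhd(1,2) sAv[of e], where h = "\<lambda>y. guichard_conn V \<xi> t (\<lambda>_. v) y (coord_field c e y)" and X = X]
      tderiv_apply[OF nbhd(1) sA[of e] smooth_const nbhd(2), of v X] g by simp
  have dA: "tderiv (\<lambda>y. ?A y e) x X =
      (t - 1) *\<^sub>R tderiv (\<lambda>y. N y (coord_field c e y)) x X + (t\<^sup>2 - 1) *\<^sub>R tderiv (\<lambda>y. \<xi> y (coord_field c e y)) x X" for e X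
    by (simp only: tderiv_add[OF nbhd(1) sN nbhd(2)] tderiv_scaleR_right[OF nbhd(1) smooth_N nbhd(2)]
        tderiv_scaleR_right[OF nbhd(1) s\<xi> nbhd(2)])
  have gg: "guichard_conn V \<xi> t (\<lambda>y. guichard_conn V \<xi> t (\<lambda>_. v) y (coord_field c e y)) x X =
      tderiv (\<lambda>y. ?A y e) x X v + ((t - 1) *\<^sub>R N x X + (t\<^sup>2 - 1) *\<^sub>R \<xi> x X) (?A x e v)" for e X
    using guichard_conn_eq[OF x nbhd(1,2) sg] d g[OF x] by simp
  define K where "K = t - 1"
  define L where "L = t\<^sup>2 - 1"
  have KL: "2 * K + K * K = L" by (simp add: K_def L_def power2_eq_square algebra_simps)
  define a where "a = tderiv (\<lambda>y. N y (coord_field c e' y)) x Z v - tderiv (\<lambda>y. N y (coord_field c e y)) x W v"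
  define b where "b = tderiv (\<lambda>y. \<xi> y (coord_field c e' y)) x Z v - tderiv (\<lambda>y. \<xi> y (coord_field c e y)) x W v"
  have a: "a = 2 *\<^sub>R ((1 / \<kappa>) *\<^sub>R wedge (tderiv \<nu> x Z) (tderiv \<nu> x W)) v" and b: "b = ext_deriv c \<xi> x e e' v"
    using ext_deriv_N by (simp_all add: a_def b_def ext_deriv_def Z W flip: blinfun.diff_left blinfun.scaleR_left)
  have n: "N x Z (N x W v) = N x W (N x Z v) + ((1 / \<kappa>) *\<^sub>R wedge (tderiv \<nu> x Z) (tderiv \<nu> x W)) v" using commutator_N[of v] by (simp add: algebra_simps)
  have "guichard_conn V \<xi> t (\<lambda>y. guichard_conn V \<xi> t (\<lambda>_. v) y (coord_field c e' y)) x Z -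
      guichard_conn V \<xi> t (\<lambda>y. guichard_conn V \<xi> t (\<lambda>_. v) y (coord_field c e y)) x W =
      K *\<^sub>R a + L *\<^sub>R b + (K *\<^sub>R N x Z + L *\<^sub>R \<xi> x Z) ((K *\<^sub>R N x W + L *\<^sub>R \<xi> x W) v)
      - (K *\<^sub>R N x W + L *\<^sub>R \<xi> x W) ((K *\<^sub>R N x Z + L *\<^sub>R \<xi> x Z) v)"
    unfolding gg dA unfolding K_def[symmetric] L_def[symmetric] Z[symmetric] W[symmetric]
    by (simp add: a_def b_def blinfun_simps algebra_simps)
  also have "\<dots> = (2 * K + K * K) *\<^sub>R ((1 / \<kappa>) *\<^sub>R wedge (tderiv \<nu> x Z) (tderiv \<nu> x W)) v + L *\<^sub>R ext_deriv c \<xi> x e e' v +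
      (K * L) *\<^sub>R (N x Z (\<xi> x W v) + \<xi> x Z (N x W v) - N x W (\<xi> x Z v) - \<xi> x W (N x Z v)) +
      (L * L) *\<^sub>R (\<xi> x Z (\<xi> x W v) - \<xi> x W (\<xi> x Z v))"
    unfolding a b by (simp only: blinfun_simps n) (simp add: algebra_simps)
  finally show ?thesis unfolding KL by (simp add: K_def L_def scaleR_add_right)
qed

end

lemma ext_deriv_of_flat:
  fixes \<xi> :: "'m \<Rightarrow> real^2 \<Rightarrow> 'v \<Rightarrow>\<^sub>L 'v"
  assumes \<xi>: "smooth_one_form \<xi>" and flat: "\<And>t. flat (guichard_conn V \<xi> t)"
    and c: "c \<in> atlas" "x \<in> fst c" and x: "x \<in> Q"
  shows "ext_deriv c \<xi> x e e' = - (1 / \<kappa>) *\<^sub>R wedge (tderiv \<nu> x (coord_field c e x)) (tderiv \<nu> x (coord_field c e' x))"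
proof (rule blinfun_eqI)
  fix v
  let ?Z = "coord_field c e x" and ?W = "coord_field c e' x"
  let ?B = "(1 / \<kappa>) *\<^sub>R wedge (tderiv \<nu> x ?Z) (tderiv \<nu> x ?W)"
  define E where "E = ext_deriv c \<xi> x e e' v + ?B v"
  define M where "M = N x ?Z (\<xi> x ?W v) + \<xi> x ?Z (N x ?W v) - N x ?W (\<xi> x ?Z v) - \<xi> x ?W (N x ?Z v)"
  define K where "K = \<xi> x ?Z (\<xi> x ?W v) - \<xi> x ?W (\<xi> x ?Z v)"
  have fl: "guichard_conn V \<xi> t (\<lambda>y. guichard_conn V \<xi> t (\<lambda>_. v) y (coord_field c e' y)) x ?Z =
      guichard_conn V \<xi> t (\<lambda>y. guichard_conn V \<xi> t (\<lambda>_. v) y (coord_field c e y)) x ?W" for t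
    using flat[of t] c smooth_const[of UNIV v] unfolding flat_def by blast
  have R: "(t\<^sup>2 - 1) *\<^sub>R E + ((t - 1) * (t\<^sup>2 - 1)) *\<^sub>R M + ((t\<^sup>2 - 1) * (t\<^sup>2 - 1)) *\<^sub>R K = 0" for t
    using curvature_eq[OF c x \<xi> refl refl, where t = t and v = v and e = e and e' = e'] fl[of t]
    unfolding E_def M_def K_def by simp
  \<comment> \<open>All coefficients vanish at t = 1 and t = -1, so these values give nothing. The
    values 0, 2, 3 give independent equations, and the weights 1/3, 1/24 and 1/3 in the combination
    below eliminate \<open>M\<close> and \<open>K\<close>.\<close>
  have "- E + M + K = 0" using R[of 0] by simp
  moreover have "3 *\<^sub>R E + 3 *\<^sub>R M + 9 *\<^sub>R K = 0" using R[of 2] by simp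
  moreover have "8 *\<^sub>R E + 16 *\<^sub>R M + 64 *\<^sub>R K = 0" using R[of 3] by simp
  ultimately have "(1/3) *\<^sub>R (3 *\<^sub>R E + 3 *\<^sub>R M + 9 *\<^sub>R K) - (1/24) *\<^sub>R (8 *\<^sub>R E + 16 *\<^sub>R M + 64 *\<^sub>R K)
      - (1/3) *\<^sub>R (- E + M + K) = 0" by (simp only: scaleR_zero_right diff_self)
  moreover have "(1/3) *\<^sub>R (3 *\<^sub>R E + 3 *\<^sub>R M + 9 *\<^sub>R K) - (1/24) *\<^sub>R (8 *\<^sub>R E + 16 *\<^sub>R M + 64 *\<^sub>R K)
      - (1/3) *\<^sub>R (- E + M + K) = ((1/3) * 3 - (1/24) * 8 + 1/3) *\<^sub>R E + ((1/3) * 3 - (1/24) * 16 - 1/3) *\<^sub>R M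
      + ((1/3) * 9 - (1/24) * 64 - 1/3) *\<^sub>R K"
    by (simp only: scaleR_add_right scaleR_diff_right scaleR_add_left scaleR_diff_left scaleR_scaleR scaleR_minus_right) (simp add: algebra_simps)
  ultimately have "E = 0" by simp
  then show "ext_deriv c \<xi> x e e' v = (- (1 / \<kappa>) *\<^sub>R wedge (tderiv \<nu> x ?Z) (tderiv \<nu> x ?W)) v"
    by (simp add: E_def blinfun_simps eq_neg_iff_add_eq_0)
qed

text \<open>Three coefficients in \<open>curvature_eq\<close> have to vanish. The outer two are
  assumptions; the mixed one follows because differentiating \<xi> \<nu> = 0 gives \<xi>(Z) d_W
  \<nu> = \<xi>(W) d_Z \<nu>, as d\<xi> = - \<kappa>^-1 d\<nu> \<and> d\<nu> annihilates
  \<nu>.\<close>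

lemma guichard_flatI:
  fixes \<xi> :: "'m \<Rightarrow> real^2 \<Rightarrow> 'v \<Rightarrow>\<^sub>L 'v"
  assumes Q_UNIV: "Q = UNIV" and \<xi>: "smooth_one_form \<xi>"
    and d\<xi>: "\<And>c x e e'. c \<in> atlas \<Longrightarrow> x \<in> fst c \<Longrightarrow> ext_deriv c \<xi> x e e' =
      - (1 / \<kappa>) *\<^sub>R wedge (tderiv \<nu> x (coord_field c e x)) (tderiv \<nu> x (coord_field c e' x))"
    and \<xi>\<nu>: "\<And>x Z. \<xi> x Z (\<nu> x) = 0" and skew: "\<And>x Z. skew (\<xi> x Z)"
    and comm: "\<And>x Z W v. \<xi> x Z (\<xi> x W v) = \<xi> x W (\<xi> x Z v)"
  shows "flat (guichard_conn V \<xi> t)" unfolding flat_def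
proof (intro ballI allI impI)
  fix c :: "'m chart" and x :: 'm and \<sigma> :: "'m \<Rightarrow> 'v" and e e' :: "real^2"
  assume c: "c \<in> atlas" "x \<in> fst c" and \<sigma>: "smooth_map \<sigma>"
  have x: "x \<in> Q" by (simp add: Q_UNIV)
  let ?D = "guichard_conn V \<xi> t"
  let ?A = "\<lambda>y e. (t - 1) *\<^sub>R N y (coord_field c e y) + (t\<^sup>2 - 1) *\<^sub>R \<xi> y (coord_field c e y)"
  note nb = nbhd[OF c x \<xi> refl refl]
  note s\<xi> = smooth_one_form_coord[OF \<xi> c(1) nb(3)]
  have sA: "smooth_map_on (Q \<inter> fst c) (\<lambda>y. ?A y e)" for e
    by (intro smooth_intros smooth_N[OF c x \<xi> refl refl] s\<xi> nb(1))
  have s\<sigma>: "smooth_map_on (Q \<inter> fst c) \<sigma>" by (rule smooth_subset[OF \<sigma>]) simp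
  have sd: "smooth_map_on (Q \<inter> fst c) (\<lambda>y. tderiv \<sigma> y (coord_field c e y))" for e
    by (rule smooth_coord_deriv[OF nb(1) s\<sigma> c(1) nb(3)])
  have sAs: "smooth_map_on (Q \<inter> fst c) (\<lambda>y. ?A y e (\<sigma> y))" for e by (intro smooth_apply nb(1) sA s\<sigma>)
  have g: "?D \<tau> y X = tderiv \<tau> y X + ((t - 1) *\<^sub>R N y X + (t\<^sup>2 - 1) *\<^sub>R \<xi> y X) (\<tau> y)"
    if "smooth_map_on (Q \<inter> fst c) \<tau>" "y \<in> Q \<inter> fst c" for \<tau> y X
    using guichard_conn_eq[OF _ nb(1) that(2,1)] that(2) by blast
  have sD: "smooth_map_on (Q \<inter> fst c) (\<lambda>y. ?D \<sigma> y (coord_field c e y))" for e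
    by (rule smooth_cong[OF nb(1) _ smooth_add[OF nb(1) sd sAs]]) (simp add: g[OF s\<sigma>])
  have tD: "tderiv (\<lambda>y. ?D \<sigma> y (coord_field c e y)) x X =
      tderiv (\<lambda>y. tderiv \<sigma> y (coord_field c e y)) x X + ?A x e (tderiv \<sigma> x X) + tderiv (\<lambda>y. ?A y e) x X (\<sigma> x)" for e X
    using tderiv_cong[OF nb(1,2) smooth_add[OF nb(1) sd[of e] sAs[of e]], where h = "\<lambda>y. ?D \<sigma> y (coord_field c e y)" and X = X]
      tderiv_add[OF nb(1) sd[of e] sAs[of e] nb(2), of X] tderiv_apply[OF nb(1) sA[of e] s\<sigma> nb(2), of X] g[OF s\<sigma>] by simp
  \<comment> \<open>Curvature is tensorial, so \<open>\<sigma>\<close> may be replaced by the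
    constant section with value \<open>\<sigma> x\<close>.\<close>
  have *: "?D (\<lambda>y. ?D \<sigma> y (coord_field c e' y)) x (coord_field c e x) - ?D (\<lambda>y. ?D \<sigma> y (coord_field c e y)) x (coord_field c e' x) =
      ?D (\<lambda>y. ?D (\<lambda>_. \<sigma> x) y (coord_field c e' y)) x (coord_field c e x) -
      ?D (\<lambda>y. ?D (\<lambda>_. \<sigma> x) y (coord_field c e y)) x (coord_field c e' x)"
  proof -
    let ?k = "\<lambda>_ :: 'm. \<sigma> x"
    have sk: "smooth_map_on (Q \<inter> fst c) (\<lambda>y. ?A y e (?k y))" for e
      by (intro smooth_apply nb(1) sA smooth_const)
    have sDk: "smooth_map_on (Q \<inter> fst c) (\<lambda>y. ?D ?k y (coord_field c e y))" for e
      by (rule smooth_cong[OF nb(1) _ sk]) (simp add: g[OF smooth_const])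
    have tDk: "tderiv (\<lambda>y. ?D ?k y (coord_field c e y)) x X = tderiv (\<lambda>y. ?A y e) x X (\<sigma> x)" for e X
      using tderiv_cong[OF nb(1,2) sk[of e], where h = "\<lambda>y. ?D ?k y (coord_field c e y)" and X = X]
        tderiv_apply[OF nb(1) sA[of e] smooth_const nb(2), of "\<sigma> x" X] g[OF smooth_const] by simp
    show ?thesis unfolding g[OF sD nb(2)] g[OF sDk nb(2)] tD tDk g[OF s\<sigma> nb(2)] g[OF smooth_const nb(2)]
      by (simp add: coord_deriv_commute[OF nb(1) s\<sigma> nb(2) c, of e e'] blinfun_simps)
  qed
  let ?Z = "coord_field c e x" and ?W = "coord_field c e' x"
  have "ext_deriv c \<xi> x e e' (\<nu> x) = \<xi> x ?Z (tderiv \<nu> x ?W) - \<xi> x ?W (tderiv \<nu> x ?Z)"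
    by (rule ext_deriv_annihilator[OF \<xi> c Q x \<nu>]) (simp add: \<xi>\<nu>)
  then have sym: "\<xi> x ?Z (tderiv \<nu> x ?W) = \<xi> x ?W (tderiv \<nu> x ?Z)"
    using d\<nu>[OF x] by (simp add: d\<xi>[OF c] blinfun_simps wedge_apply form_commute[of _ "\<nu> x"])
  have "N x ?Z (\<xi> x ?W v) + \<xi> x ?Z (N x ?W v) - N x ?W (\<xi> x ?Z v) - \<xi> x ?W (N x ?Z v) = 0" for v
  proof -
    have 1: "form (\<nu> x) (\<xi> x X v) = 0" for X using skewD[OF skew, of x X "\<nu> x" v] by (simp add: \<xi>\<nu> form_simps)
    have 2: "form (tderiv \<nu> x ?Z) (\<xi> x ?W v) = form (tderiv \<nu> x ?W) (\<xi> x ?Z v)"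
      using skewD[OF skew, of x ?W "tderiv \<nu> x ?Z" v] skewD[OF skew, of x ?Z "tderiv \<nu> x ?W" v] sym by simp
    show ?thesis by (simp add: N_def blinfun_simps wedge_apply 1 2 sym \<xi>\<nu>)
  qed
  then have "?D (\<lambda>y. ?D (\<lambda>_. \<sigma> x) y (coord_field c e' y)) x ?Z = ?D (\<lambda>y. ?D (\<lambda>_. \<sigma> x) y (coord_field c e y)) x ?W"
    using curvature_eq[OF c x \<xi> refl refl, where t = t and v = "\<sigma> x" and e = e and e' = e'] comm
    by (simp add: d\<xi>[OF c] blinfun_simps)
  then show "?D (\<lambda>y. ?D \<sigma> y (coord_field c e' y)) x ?Z = ?D (\<lambda>y. ?D \<sigma> y (coord_field c e y)) x ?W"
    using * by simp
qed

text \<open>\<open>N\<close> annihilates \<Lambda>, so the induced connection and d agree on its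
  sections, and the first trace is \<open>k\<close>. In the second trace \<open>p\<close>
  contributes 0 and \<open>\<nu>\<close> contributes - (d\<nu>, d\<nu>) / \<kappa>.\<close>

lemma guichard_q_eq:
  fixes \<xi> :: "'m \<Rightarrow> real^2 \<Rightarrow> 'v \<Rightarrow>\<^sub>L 'v"
  assumes x: "x \<in> Q" and \<Lambda>: "smooth_subbundle 1 \<Lambda>" "derived \<Lambda> x \<subseteq> V x"
    and U: "open U" "x \<in> U" and \<sigma>: "smooth_map_on U \<sigma>" "\<And>y. y \<in> U \<Longrightarrow> \<sigma> y \<in> \<Lambda> y" "\<sigma> x \<noteq> 0"
    and \<Lambda>V: "\<And>y. y \<in> Q \<Longrightarrow> \<Lambda> y \<subseteq> V y"
    and \<xi>: "\<xi> x Z (\<sigma> x) = 0" and k: "\<xi> x Z (tderiv \<sigma> x W) = k *\<^sub>R \<sigma> x"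
  shows "guichard_q \<Lambda> V \<xi> x Z W = 2 * k - form (tderiv \<nu> x Z) (tderiv \<nu> x W) / \<kappa>"
proof -
  have \<Lambda>x: "\<Lambda> x = span {\<sigma> x}" using \<sigma>(2)[OF U(2)] \<sigma>(3) dim_fibre[OF \<Lambda>(1)] subspace_fibre[OF \<Lambda>(1)]
    by (intro subspace_dim_equal[symmetric] span_minimal) auto
  have d0: "form (\<nu> x) (tderiv \<sigma> x X) = 0" for X
    using tderiv_in_derived[OF \<Lambda>(1) U \<sigma>(1,2)] \<Lambda>(2) V[OF x] by (auto simp: orth_def)
  have n0: "form (\<nu> y) (\<sigma> y) = 0" if "y \<in> Q \<inter> U" for y using \<Lambda>V \<sigma>(2) V that by (auto simp: orth_def)
  have d1: "form (tderiv \<nu> x X) (\<sigma> x) = 0" for X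
    using tderiv_form_eq[of "Q \<inter> U" x \<nu> \<sigma> 0 X] open_Int[OF Q U(1)] U(2) x n0 d0 smooth_subset[OF \<nu>, of "Q \<inter> U"] smooth_subset[OF \<sigma>(1), of "Q \<inter> U"] by simp
  have N\<sigma>: "N x X (\<sigma> x) = 0" for X using n0[of x] d1 x U by (simp add: N_def blinfun_simps wedge_apply)
  have st: "section_through \<Lambda> x v \<in> sections \<Lambda>" "section_through \<Lambda> x v x = v" if "v \<in> \<Lambda> x" for v
    using section_through[OF \<Lambda>(1) that] .
  have kill: "\<xi> x Z v = 0" if "v \<in> \<Lambda> x" for v using that \<xi> by (auto simp: \<Lambda>x span_singleton blinfun_simps)
  have T: "\<xi> x Z (split_conn V (section_through \<Lambda> x v) x W) = \<xi> x Z (tderiv (\<lambda>y. eproj (\<Lambda> y) v) x W)"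
    if v: "v \<in> \<Lambda> x" for v
  proof -
    have s: "smooth_map (section_through \<Lambda> x v)" "\<And>y. section_through \<Lambda> x v y \<in> \<Lambda> y"
      using st(1)[OF v] by (auto simp: sections_def)
    have "N x W v = 0" using v N\<sigma> by (auto simp: \<Lambda>x span_singleton blinfun_simps)
    then have "split_conn V (section_through \<Lambda> x v) x W = tderiv (section_through \<Lambda> x v) x W"
      using split_conn_eq[OF x open_UNIV UNIV_I s(1)] st(2)[OF v] by simp
    moreover have "tderiv (section_through \<Lambda> x v) x W - tderiv (\<lambda>y. eproj (\<Lambda> y) v) x W \<in> \<Lambda> x"
      by (rule tderiv_local_sections_diff[OF \<Lambda>(1) open_UNIV UNIV_I s open_UNIV UNIV_I smooth_eproj[OF \<Lambda>(1)]
          eproj(1)[OF subspace_fibre[OF \<Lambda>(1)]]]) (simp add: st(2)[OF v] eproj_fibre[OF \<Lambda>(1) v])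
    ultimately show ?thesis using kill[of "tderiv (section_through \<Lambda> x v) x W - tderiv (\<lambda>y. eproj (\<Lambda> y) v) x W"]
      by (simp add: blinfun.diff_right)
  qed
  have "\<sigma> x \<in> \<Lambda> x" using \<sigma>(2) U by blast
  have 1: "trace_on (\<Lambda> x) (\<lambda>v. \<xi> x Z (split_conn V (section_through \<Lambda> x v) x W)) = k"
  proof (rule trace_on_1[OF \<sigma>(3) \<Lambda>x _ T])
    show "linear (\<lambda>v. \<xi> x Z (tderiv (\<lambda>y. eproj (\<Lambda> y) v) x W))"
      using linear_compose[OF linear_tderiv_eproj[OF \<Lambda>(1)] bounded_linear.linear[OF blinfun.bounded_linear_right]]
      by (simp add: o_def)
    have "tderiv \<sigma> x W - tderiv (\<lambda>y. eproj (\<Lambda> y) (\<sigma> x)) x W \<in> \<Lambda> x"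
      by (rule tderiv_local_sections_diff[OF \<Lambda>(1) U \<sigma>(1,2) open_UNIV UNIV_I smooth_eproj[OF \<Lambda>(1)]
          eproj(1)[OF subspace_fibre[OF \<Lambda>(1)]]]) (simp_all add: eproj_fibre[OF \<Lambda>(1) \<open>\<sigma> x \<in> \<Lambda> x\<close>])
    then have "\<xi> x Z (tderiv (\<lambda>y. eproj (\<Lambda> y) (\<sigma> x)) x W) = \<xi> x Z (tderiv \<sigma> x W)"
      using kill[of "tderiv \<sigma> x W - tderiv (\<lambda>y. eproj (\<Lambda> y) (\<sigma> x)) x W"] by (simp add: blinfun.diff_right)
    then show "\<xi> x Z (split_conn V (section_through \<Lambda> x (\<sigma> x)) x W) = k *\<^sub>R \<sigma> x"
      using T[OF \<open>\<sigma> x \<in> \<Lambda> x\<close>] k by simp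
  qed
  have 2: "trace_on (orth (V x)) (\<lambda>v. split_form V x Z (split_form V x W v)) = 0 + - form (tderiv \<nu> x Z) (tderiv \<nu> x W) / \<kappa>"
  proof (rule trace_on_2[OF independent_p\<nu>[OF x] orth_V[OF x]])
    show "linear (\<lambda>v. N x Z (N x W v))"
      using linear_compose[OF bounded_linear.linear[OF blinfun.bounded_linear_right] bounded_linear.linear[OF blinfun.bounded_linear_right]]
      by (simp add: o_def)
    show "split_form V x Z (split_form V x W v) = N x Z (N x W v)" for v by (simp add: split_form_eq[OF x])
    note f0 = p\<nu>[OF x] \<nu>\<nu>[OF x] d\<nu>[OF x] form_commute[of "\<nu> x" p] form_commute[of "tderiv \<nu> x _" p] form_commute[of "tderiv \<nu> x _" "\<nu> x"]
    show "split_form V x Z (split_form V x W p) = 0 *\<^sub>R p + 0 *\<^sub>R \<nu> x"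
      using f0 by (simp add: split_form_eq[OF x] N_def blinfun_simps wedge_apply)
    show "split_form V x Z (split_form V x W (\<nu> x)) = 0 *\<^sub>R p + (- form (tderiv \<nu> x Z) (tderiv \<nu> x W) / \<kappa>) *\<^sub>R \<nu> x"
      using f0 \<kappa> by (simp add: split_form_eq[OF x] N_def blinfun_simps wedge_apply)
  qed
  show ?thesis unfolding guichard_q_def 1 2 by simp
qed

end

lemma wedge_space_line:
  assumes A: "A \<in> wedge_space L W" and L: "subspace L" "L \<subseteq> orth L" "W \<subseteq> orth L"
  shows "v \<in> orth L \<Longrightarrow> A v \<in> L" "v \<in> L \<Longrightarrow> A v = 0"
proof -
  show "A v \<in> L" if v: "v \<in> orth L" using A
  proof (rule wedge_space_induct)
    show "subspace {A :: 'a \<Rightarrow>\<^sub>L 'a. A v \<in> L}" using L(1) by (auto simp: subspace_def blinfun_simps)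
    show "wedge a b v \<in> L" if "a \<in> L" "b \<in> W" for a b
      using orthD(1)[OF v that(1)] that L(1) by (simp add: wedge_apply subspace_neg subspace_scale)
  qed
  show "A v = 0" if "v \<in> L"
    using that L orthD(2)[of _ L v] by (intro wedge_space_kills[OF A]) (auto simp: orth_def form_commute)
qed

text \<open>The potential \<open>2 \<xi> - \<alpha>\<^sup>-\<^sup>1 F \<and> dF\<close> ties Guichard data to gauge potentials.\<close>

lemma (in legendre_pair) omega_q_split_potential:
  fixes \<xi> \<eta> :: "'m \<Rightarrow> real^2 \<Rightarrow> 'v \<Rightarrow>\<^sub>L 'v"
  assumes \<alpha>: "\<alpha> \<noteq> 0" and Qx: "open Q" "x \<in> Q" and F: "smooth_map_on Q F" "\<And>y. y \<in> Q \<Longrightarrow> F y \<in> f y"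
    "\<And>y. y \<in> Q \<Longrightarrow> form p (F y) = \<alpha>"
    and \<sigma>: "smooth_map_on Q \<sigma>" "\<And>y. y \<in> Q \<Longrightarrow> \<sigma> y \<in> f y" "\<And>y. y \<in> Q \<Longrightarrow> form p (\<sigma> y) = 0" "\<sigma> x \<noteq> 0"
    and \<xi>: "\<And>v. v \<in> orth (f x) \<Longrightarrow> \<xi> x Z v \<in> span {\<sigma> x}" and k: "\<xi> x Z (tderiv \<sigma> x W) = k *\<^sub>R \<sigma> x"
    and \<eta>: "lowers (f x) (\<eta> x Z)" "\<eta> x Z = 2 *\<^sub>R \<xi> x Z - (1 / \<alpha>) *\<^sub>R wedge (F x) (tderiv F x Z)"
  shows "omega_q f \<eta> x Z W = 2 * k + form (tderiv F x Z) (tderiv F x W) / \<alpha>"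
proof -
  have d\<sigma>: "tderiv \<sigma> x W \<in> orth (f x)" by (rule tderiv_section_orth[OF Qx \<sigma>(1,2)])
  have dF: "tderiv F x X \<in> orth (f x)" for X by (rule tderiv_section_orth[OF Qx F(1,2)])
  have Fperp: "form (F x) v = 0" if "v \<in> orth (f x)" for v using orthD(1)[OF that] F(2)[OF Qx(2)] by blast
  obtain l where l: "\<xi> x Z (tderiv F x W) = l *\<^sub>R \<sigma> x" using \<xi>[OF dF[of W]] by (auto simp: span_singleton)
  have ne: "span {\<sigma> x} \<noteq> span {F x}"
  proof
    assume "span {\<sigma> x} = span {F x}"
    then have "F x \<in> span {\<sigma> x}" by (simp add: span_base)
    then show False using \<sigma>(3)[OF Qx(2)] F(3)[OF Qx(2)] \<alpha> by (auto simp: span_singleton form_simps)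
  qed
  have F0: "F x \<noteq> 0" using F(3)[OF Qx(2)] \<alpha> by (auto simp: form_simps)
  note tl = two_lines[OF \<sigma>(4) ne F0 subspace_f dim_f \<sigma>(2)[OF Qx(2)] F(2)[OF Qx(2)]]
  show ?thesis
  proof (rule omega_q_trace[of Q x \<sigma> F \<eta> Z W])
    show "\<eta> x Z (tderiv \<sigma> x W) = (2 * k) *\<^sub>R \<sigma> x + (form (tderiv F x Z) (tderiv \<sigma> x W) / \<alpha>) *\<^sub>R F x"
      using k Fperp[OF d\<sigma>] by (simp add: \<eta>(2) blinfun_simps wedge_apply)
    show "\<eta> x Z (tderiv F x W) = (2 * l) *\<^sub>R \<sigma> x + (form (tderiv F x Z) (tderiv F x W) / \<alpha>) *\<^sub>R F x"
      using l Fperp[OF dF] by (simp add: \<eta>(2) blinfun_simps wedge_apply)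
  qed (use Qx F \<sigma> tl \<eta>(1) in auto)
qed

text \<open>Both differentials consist of \<open>2 * k\<close>, the contribution of \<xi> on
  \<Lambda>, and a norm of derivatives; the hypothesis on \<epsilon> converts - (d\<nu>, d\<nu>) /
  \<kappa> into (dF, dF) / \<alpha>. It serves both implications: \<epsilon> = -1 when \<nu> = p - F
  is constructed, and a general \<epsilon> when the Guichard data are given.\<close>

lemma (in legendre_pair) omega_q_eq_guichard_q:
  fixes \<xi> \<eta> :: "'m \<Rightarrow> real^2 \<Rightarrow> 'v \<Rightarrow>\<^sub>L 'v"
  assumes sn: "sphere_normal p \<alpha> \<kappa> V Q \<nu>" and x: "x \<in> Q"
    and F: "smooth_map_on Q F" "\<And>y. y \<in> Q \<Longrightarrow> F y \<in> f y" "\<And>y. y \<in> Q \<Longrightarrow> form p (F y) = \<alpha>"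
    and dF: "\<And>Z. tderiv F x Z = \<epsilon> *\<^sub>R tderiv \<nu> x Z" "\<epsilon>\<^sup>2 * \<kappa> = - \<alpha>"
    and \<Lambda>: "smooth_subbundle 1 \<Lambda>" "\<And>y. \<Lambda> y = f y \<inter> orth {p}" "\<And>y. derived \<Lambda> y \<subseteq> V y"
    and \<xi>: "\<And>Z. \<xi> x Z \<in> wedge_space (\<Lambda> x) (derived \<Lambda> x)"
    and \<eta>: "lowers (f x) (\<eta> x Z)" "\<eta> x Z = 2 *\<^sub>R \<xi> x Z - (1 / \<alpha>) *\<^sub>R wedge (F x) (tderiv F x Z)"
  shows "omega_q f \<eta> x Z W = guichard_q \<Lambda> V \<xi> x Z W"
proof -
  interpret sphere_normal p \<alpha> \<kappa> V Q \<nu> by (rule sn)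
  obtain U \<sigma> where U: "open U" "x \<in> U" "smooth_map_on U \<sigma>" "\<And>y. y \<in> U \<Longrightarrow> \<sigma> y \<noteq> 0" "\<And>y. y \<in> U \<Longrightarrow> \<Lambda> y = span {\<sigma> y}"
    using line_bundle_section[OF \<Lambda>(1), of x] by blast
  have \<sigma>: "\<sigma> y \<in> \<Lambda> y" if "y \<in> U" for y using U(5)[OF that] by (simp add: span_base)
  then have \<sigma>f: "\<sigma> y \<in> f y" "form p (\<sigma> y) = 0" if "y \<in> U" for y using \<Lambda>(2) that by (auto simp: orth_def)
  have \<Lambda>f: "\<Lambda> x \<subseteq> f x" using \<Lambda>(2) by blast
  have o: "orth (f x) \<subseteq> orth (\<Lambda> x)" by (rule orth_antimono[OF \<Lambda>f])
  have "derived \<Lambda> x \<subseteq> derived f x"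
    unfolding derived_def using \<Lambda>(2) by (intro span_mono) (auto simp: sections_def)
  then have der: "derived \<Lambda> x \<subseteq> orth (f x)" using legendre by (auto simp: legendre_map_def)
  have L: "subspace (\<Lambda> x)" "\<Lambda> x \<subseteq> orth (\<Lambda> x)" "derived \<Lambda> x \<subseteq> orth (\<Lambda> x)"
    using subspace_fibre[OF \<Lambda>(1)] \<Lambda>f f_orth[of x] o der by auto
  note wl = wedge_space_line[OF \<xi> L]
  have d\<sigma>: "tderiv \<sigma> x W \<in> orth (f x)" by (rule tderiv_section_orth[OF U(1-3) \<sigma>f(1)])
  obtain k where k: "\<xi> x Z (tderiv \<sigma> x W) = k *\<^sub>R \<sigma> x"
    using wl(1)[of "tderiv \<sigma> x W" Z] d\<sigma> o U(5)[OF U(2)] by (auto simp: span_singleton)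
  have \<Lambda>V: "\<Lambda> y \<subseteq> V y" for y using fibre_subset_derived[OF \<Lambda>(1)] \<Lambda>(3) by blast
  have "guichard_q \<Lambda> V \<xi> x Z W = 2 * k - form (tderiv \<nu> x Z) (tderiv \<nu> x W) / \<kappa>"
    by (rule guichard_q_eq[where \<Lambda> = \<Lambda> and \<xi> = \<xi> and Z = Z and \<sigma> = \<sigma>, OF x \<Lambda>(1,3) U(1-3) \<sigma> U(4)[OF U(2)] \<Lambda>V wl(2)[OF \<sigma>[OF U(2)]] k])
  also have "\<dots> = 2 * k + form (tderiv F x Z) (tderiv F x W) / \<alpha>"
  proof -
    have "\<epsilon> * \<epsilon> * \<kappa> = - \<alpha>" using dF(2) by (simp add: power2_eq_square)
    then have "1 / \<kappa> = - (\<epsilon> * \<epsilon> / \<alpha>)" using p(2) \<kappa> by (simp add: field_simps)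
    then have "t / \<kappa> = - (\<epsilon> * \<epsilon> * t / \<alpha>)" for t by (metis mult.commute mult_minus_right times_divide_eq_right mult.right_neutral)
    then show ?thesis by (simp add: dF(1) form_simps mult.assoc)
  qed
  also have "\<dots> = omega_q f \<eta> x Z W"
  proof (rule omega_q_split_potential[of \<alpha> "U \<inter> Q" x F p \<sigma> \<xi>, symmetric, OF p(2)])
    show "\<xi> x Z v \<in> span {\<sigma> x}" if "v \<in> orth (f x)" for v using wl(1)[of v Z] that o U(5)[OF U(2)] by blast
  qed (use U Q x F \<sigma>f k \<eta> smooth_subset in \<open>auto intro: smooth_subset\<close>)
  finally show ?thesis by simp
qed

section \<open>From special surfaces of type 1 to Guichard surfaces\<close>

text \<open>The signature condition in \<open>omega_surface\<close> compares points of connected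
  sets, so small connected neighbourhoods are what makes it usable locally.\<close>

lemma connected_nbhd:
  fixes x :: "'m::smooth_surface"
  assumes "open U" "x \<in> U"
  obtains C where "open C" "connected C" "x \<in> C" "C \<subseteq> U"
proof -
  define c where "c = chart_at x"
  have c: "c \<in> atlas" "x \<in> fst c" using chart_at by (auto simp: c_def)
  define W where "W = fst c \<inter> U"
  have W: "open W" "x \<in> W" "W \<subseteq> fst c" "W \<subseteq> U" using assms c open_chart[OF c(1)] by (auto simp: W_def)
  have "open (snd c ` W)" using open_chart_image[OF c(1) W(3)] W(1) by simp
  then obtain r where r: "r > 0" "ball (snd c x) r \<subseteq> snd c ` W"
    using W(2) by (meson imageI open_contains_ball)
  let ?B = "ball (snd c x) r"
  define C where "C = chart_inv c ` ?B"
  have inv: "chart_inv c y \<in> W" "snd c (chart_inv c y) = y" if y: "y \<in> ?B" for y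
  proof -
    obtain z where "z \<in> W" "y = snd c z" using r(2) y by blast
    then show "chart_inv c y \<in> W" "snd c (chart_inv c y) = y" using chart_inv_chart[OF c(1), of z] W(3) by auto
  qed
  have im: "snd c ` C = ?B" using inv by (force simp: C_def image_iff)
  have CW: "C \<subseteq> W" using inv by (auto simp: C_def)
  have "open C" using open_chart_image[OF c(1), of C] CW W(3) im by auto
  moreover have "connected C" unfolding C_def
  proof (rule connected_continuous_image)
    show "continuous_on ?B (chart_inv c)"
    proof (subst continuous_on_open_vimage[OF open_ball], intro allI impI)
      fix T :: "'m set" assume T: "open T"
      have "chart_inv c -` T \<inter> ?B = snd c ` (T \<inter> C)"
      proof (intro equalityI subsetI)
        fix y assume "y \<in> chart_inv c -` T \<inter> ?B"
        then show "y \<in> snd c ` (T \<inter> C)" using inv(2)[of y] by (intro image_eqI[of _ _ "chart_inv c y"]) (auto simp: C_def)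
      next
        fix y assume "y \<in> snd c ` (T \<inter> C)"
        then obtain z where "y = snd c (chart_inv c z)" "z \<in> ?B" "chart_inv c z \<in> T" by (auto simp: C_def)
        then show "y \<in> chart_inv c -` T \<inter> ?B" using inv(2)[of z] by simp
      qed
      moreover have "open (T \<inter> C)" using T \<open>open C\<close> by auto
      ultimately show "open (chart_inv c -` T \<inter> ?B)"
        using open_chart_image[OF c(1), of "T \<inter> C"] CW W(3) by auto
    qed
  qed simp
  moreover have "x \<in> C" using r(1) c unfolding C_def by (intro image_eqI[of _ _ "snd c x"]) auto
  ultimately show ?thesis using that[of C] CW W(4) by blast
qed

lemma skew_add: "skew A \<Longrightarrow> skew B \<Longrightarrow> skew (A + B)" using subspace_add[OF subspace_skew, of A B] by simp

lemma skew_scaleR: "skew A \<Longrightarrow> skew (k *\<^sub>R A)" using subspace_scale[OF subspace_skew, of A k] by simp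

lemma lowers_diff: "subspace W \<Longrightarrow> lowers W A \<Longrightarrow> lowers W B \<Longrightarrow> lowers W (A - B)"
  using subspace_diff[OF subspace_skew, of A B] by (auto simp: lowers_def blinfun_simps subspace_diff)

lemma lowers_scaleR: "subspace W \<Longrightarrow> lowers W A \<Longrightarrow> lowers W (k *\<^sub>R A)"
  using subspace_scale[OF subspace_skew, of A k] by (auto simp: lowers_def blinfun_simps subspace_scale)

section \<open>Gauge invariance and global non-degeneracy of q\<close>

context legendre_pair
begin

lemma gauge_f_potential:
  assumes \<eta>: "f_potential f \<eta>" and \<tau>: "\<tau> \<in> sections (\<lambda>x. wedge_space (f x) (f x))"
  shows "f_potential f (\<lambda>x X. \<eta> x X - tderiv \<tau> x X)" unfolding f_potential_def
proof (intro conjI allI)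
  have s: "smooth_map \<tau>" using \<tau> by (auto simp: sections_def)
  note e = \<eta>[unfolded f_potential_def]
  show "smooth_one_form (\<lambda>x X. \<eta> x X - tderiv \<tau> x X)"
    using e closed_tderiv[OF s] by (intro smooth_one_form_diff) auto
  show "closed_one_form (\<lambda>x X. \<eta> x X - tderiv \<tau> x X)" unfolding closed_iff_ext_deriv
    using e closed_tderiv[OF s] by (auto simp: ext_deriv_diff) (simp_all add: closed_iff_ext_deriv)
  fix x X
  obtain U \<sigma>1 \<sigma>2 X' Y where fr: "curvature_frame f s1 s2 U \<sigma>1 \<sigma>2 X' Y" "x \<in> U"
    by (rule curvature_frame_exists)
  show "lowers (f x) (\<eta> x X - tderiv \<tau> x X)"
    using e curvature_frame.lowers_tderiv_\<tau>[OF fr(1) sections_on_section[OF \<tau>] fr(2)] by (intro lowers_diff subspace_f) auto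
qed

text \<open>Gauging changes \<eta>(X) e2 by \<tau> z2, whose pairing with z2 vanishes by skewness;
  likewise for \<eta>(Y) e1. These two pairings determine q.\<close>

lemma gauge_omega_q:
  assumes \<eta>: "f_potential f \<eta>" and \<tau>: "\<tau> \<in> sections (\<lambda>x. wedge_space (f x) (f x))"
  shows "omega_q f (\<lambda>x X. \<eta> x X - tderiv \<tau> x X) x = omega_q f \<eta> x"
proof (intro ext)
  fix Z W
  let ?\<mu> = "\<lambda>x X. \<eta> x X - tderiv \<tau> x X"
  obtain U \<sigma>1 \<sigma>2 X Y where "curvature_frame f s1 s2 U \<sigma>1 \<sigma>2 X Y" and x: "x \<in> U"
    by (rule curvature_frame_exists)
  then interpret fr: curvature_frame f s1 s2 U \<sigma>1 \<sigma>2 X Y by simp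
  note \<mu> = gauge_f_potential[OF \<eta> \<tau>]
  have lin: "\<And>W. linear (\<lambda>Z. omega_q f \<eta> x Z W)" "\<And>Z. linear (omega_q f \<eta> x Z)"
    "\<And>W. linear (\<lambda>Z. omega_q f ?\<mu> x Z W)" "\<And>Z. linear (omega_q f ?\<mu> x Z)"
    using fr.bilinear_omega_q[OF \<eta> x] fr.bilinear_omega_q[OF \<mu> x] by (auto simp: bilinear_def)
  have sk: "form (\<tau> x v) v = 0" for v by (rule skew_self[OF fr.\<tau>(3)[OF sections_on_section[OF \<tau>] x x]])
  have "omega_q f ?\<mu> x (X x) (X x) = omega_q f \<eta> x (X x) (X x)"
    using fr.omega_q_XY(3)[OF \<eta> x] fr.omega_q_XY(3)[OF \<mu> x] fr.tderiv_\<tau>_e(2)[OF sections_on_section[OF \<tau>] x, of "X x"] sk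
    by (simp add: blinfun_simps form_simps flip: along_def)
  moreover have "omega_q f ?\<mu> x (Y x) (Y x) = omega_q f \<eta> x (Y x) (Y x)"
    using fr.omega_q_XY(4)[OF \<eta> x] fr.omega_q_XY(4)[OF \<mu> x] fr.tderiv_\<tau>_e(1)[OF sections_on_section[OF \<tau>] x, of "Y x"] sk
    by (simp add: blinfun_simps form_simps flip: along_def)
  moreover obtain a b where Z: "Z = a *\<^sub>R X x + b *\<^sub>R Y x" by (rule fr.XY_basis[OF x])
  moreover obtain c d where W: "W = c *\<^sub>R X x + d *\<^sub>R Y x" by (rule fr.XY_basis[OF x])
  ultimately show "omega_q f ?\<mu> x Z W = omega_q f \<eta> x Z W"
    using fr.omega_q_XY(1,2)[OF \<eta> x] fr.omega_q_XY(1,2)[OF \<mu> x]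
    by (simp add: linear_add[OF lin(1)] linear_add[OF lin(2)] linear_add[OF lin(3)] linear_add[OF lin(4)]
        linear_scale[OF lin(1)] linear_scale[OF lin(2)] linear_scale[OF lin(3)] linear_scale[OF lin(4)])
qed

text \<open>The two entries of the signature add up to the rank of q. It is 2 on a dense set and
  constant on connected neighbourhoods, hence 2 everywhere.\<close>

lemma omega_surface_nondegenerate:
  assumes "omega_surface f \<eta>"
  shows "nondegenerate (omega_q f \<eta> x)"
proof -
  have \<eta>: "f_potential f \<eta>" using assms gauge_potential_f_potential by (auto simp: omega_surface_def)
  have "\<exists>U. open U \<and> closure U = UNIV \<and> (\<forall>x\<in>U. nondegenerate (omega_q f \<eta> x))"
    and const: "connected C \<Longrightarrow> x \<in> C \<Longrightarrow> y \<in> C \<Longrightarrow>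
      signature (omega_q f \<eta> x) UNIV = signature (omega_q f \<eta> y) UNIV" for C x y
    using assms unfolding omega_surface_def by blast+
  then obtain D where D: "closure D = UNIV" "\<And>y. y \<in> D \<Longrightarrow> nondegenerate (omega_q f \<eta> y)" by auto
  obtain U \<sigma>1 \<sigma>2 X Y where "curvature_frame f s1 s2 U \<sigma>1 \<sigma>2 X Y" and x: "x \<in> U"
    by (rule curvature_frame_exists)
  then interpret fr: curvature_frame f s1 s2 U \<sigma>1 \<sigma>2 X Y by simp
  obtain C where C: "open C" "connected C" "x \<in> C" "C \<subseteq> U" by (rule connected_nbhd[OF fr.U x])
  have "C \<inter> D \<noteq> {}" using C D(1) open_Int_closure_eq_empty[of C D] by auto
  then obtain y where y: "y \<in> C" "y \<in> D" by blast
  then have yU: "y \<in> U" using C by blast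
  have sg: "signature (omega_q f \<eta> x) UNIV = signature (omega_q f \<eta> y) UNIV" using const[OF C(2,3) y(1)] .
  have "omega_q f \<eta> y (X y) (X y) \<noteq> 0" "omega_q f \<eta> y (Y y) (Y y) \<noteq> 0"
    using D(2)[OF y(2)] fr.nondegenerate_omega_q_iff[OF \<eta> yU] by auto
  then have "fst (signature (omega_q f \<eta> y) UNIV) + snd (signature (omega_q f \<eta> y) UNIV) = 2"
    unfolding fr.signature_omega_q[OF \<eta> yU] by (auto simp: of_bool_def)
  then have "fst (signature (omega_q f \<eta> x) UNIV) + snd (signature (omega_q f \<eta> x) UNIV) = 2" using sg by simp
  then have "omega_q f \<eta> x (X x) (X x) \<noteq> 0 \<and> omega_q f \<eta> x (Y x) (Y x) \<noteq> 0"
    unfolding fr.signature_omega_q[OF \<eta> x] by (auto simp: of_bool_def split: if_splits)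
  then show ?thesis using fr.nondegenerate_omega_q_iff[OF \<eta> x] by simp
qed

end

context curvature_frame
begin

text \<open>A section of \<open>f \<inter> \<langle>p\<rangle>\<^sup>\<bottom>\<close>.\<close>

definition hyp :: "'v \<Rightarrow> 'm \<Rightarrow> 'v" where
  "hyp p x = form p (\<sigma>2 x) *\<^sub>R \<sigma>1 x - form p (\<sigma>1 x) *\<^sub>R \<sigma>2 x"

lemma smooth_hyp: "smooth_map_on U (hyp p)"
  unfolding hyp_def[abs_def] by (intro smooth_intros smooth_form U smooth_\<sigma>)

lemma hyp_span:
  assumes x: "x \<in> U" and v: "v \<in> f x" "form p v \<noteq> 0"
  shows "hyp p x \<noteq> 0" "slice p x = span {hyp p x}"
proof -
  obtain a b where "v = a *\<^sub>R \<sigma>1 x + b *\<^sub>R \<sigma>2 x" by (rule f_expand[OF x v(1)])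
  then have ne: "form p (\<sigma>1 x) \<noteq> 0 \<or> form p (\<sigma>2 x) \<noteq> 0" using v(2) by (auto simp: form_simps)
  have hf: "hyp p x \<in> slice p x"
    using section_\<sigma>[OF x] by (auto simp: hyp_def orth_def form_simps intro!: subspace_diff subspace_scale subspace_f)
  show h0: "hyp p x \<noteq> 0"
  proof
    assume "hyp p x = 0"
    then have "form (hyp p x) (z1 x) = 0" "form (hyp p x) (z2 x) = 0" by (simp_all add: form_simps)
    then show False using z_\<sigma>[OF x] z_\<sigma>2[OF x] e_pos[OF x] e_pos2[OF x] ne by (auto simp: hyp_def form_simps)
  qed
  have "w \<in> span {hyp p x}" if w: "w \<in> f x" "form p w = 0" for w
  proof -
    obtain c d where cd: "w = c *\<^sub>R \<sigma>1 x + d *\<^sub>R \<sigma>2 x" by (rule f_expand[OF x w(1)])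
    then have 0: "c * form p (\<sigma>1 x) + d * form p (\<sigma>2 x) = 0" using w(2) by (simp add: form_simps)
    show ?thesis
    proof (cases "form p (\<sigma>2 x) = 0")
      case True
      then have "c = 0" using 0 ne by simp
      then have "w = (- d / form p (\<sigma>1 x)) *\<^sub>R hyp p x" using True ne by (simp add: cd hyp_def)
      then show ?thesis by (metis span_base span_scale singletonI)
    next
      case False
      then have "d = - (c / form p (\<sigma>2 x)) * form p (\<sigma>1 x)" using 0 by (simp add: field_simps)
      then have "w = (c / form p (\<sigma>2 x)) *\<^sub>R hyp p x" using False by (simp add: cd hyp_def algebra_simps)
      then show ?thesis by (metis span_base span_scale singletonI)
    qed
  qed
  then have "slice p x \<subseteq> span {hyp p x}" by (auto simp: orth_def)
  moreover have "span {hyp p x} \<subseteq> slice p x"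
    using hf by (intro span_minimal subspace_inter subspace_f subspace_orth) auto
  ultimately show "slice p x = span {hyp p x}" by blast
qed

lemma hyp_f: "x \<in> U \<Longrightarrow> hyp p x \<in> f x" "form p (hyp p x) = 0"
  using section_\<sigma> by (auto simp: hyp_def form_simps intro!: subspace_diff subspace_scale subspace_f)

text \<open>The derivative along \<open>X\<close> of a section of \<Lambda> has an \<open>e2\<close>
  component proportional to (p, \<sigma>1), so \<Lambda> moves in the direction \<open>X\<close>
  exactly where \<open>\<sigma>1\<close> is not orthogonal to \<open>p\<close>.\<close>

lemma along_X_hyp:
  assumes x: "x \<in> U"
  shows "along X (hyp p) x \<in> orth (f x)" "form (along X (hyp p) x) (e1 x) = 0"
    "form (along X (hyp p) x) (e2 x) = - form p (\<sigma>1 x) * g2 x" "form p (along X (hyp p) x) = 0"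
proof -
  show "along X (hyp p) x \<in> orth (f x)"
    unfolding along_def by (rule tderiv_section_orth[OF U x smooth_hyp hyp_f(1)])
  have "form (along X (hyp p) x) (e1 x) = - form (hyp p x) (along X e1 x)"
    using f_perp(1)[OF _ hyp_f(1) e_orth] by (intro along_form[OF x smooth_hyp smooth_e])
  then show "form (along X (hyp p) x) (e1 x) = 0"
    using f_perp(1)[OF x hyp_f(1)[OF x] along_X_e(1)[OF x]] by simp
  have "form (along X (hyp p) x) (e2 x) = - form (hyp p x) (z2 x)"
    using f_perp(1)[OF _ hyp_f(1) e_orth2] by (intro along_form[OF x smooth_hyp smooth_e2])
  then show "form (along X (hyp p) x) (e2 x) = - form p (\<sigma>1 x) * g2 x"
    using z_\<sigma>2[OF x] by (simp add: hyp_def form_simps)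
  show "form p (along X (hyp p) x) = 0"
    using along_form[OF x smooth_const[of U p] smooth_hyp hyp_f(2), of X] by (simp add: along_def form_simps)
qed

text \<open>At points where \<open>\<sigma>1\<close> lies in \<open>\<langle>p\<rangle>\<^sup>\<bottom>\<close> the map \<open>\<Lambda>\<close> is not immersed; there \<open>\<xi>(X)\<close> annihilates \<open>d\<^sub>X \<sigma>2\<close>.\<close>

lemma form_in_derived:
  assumes \<rho>: "f_potential f \<rho>" and mid: "\<And>x Z. x \<in> U \<Longrightarrow> \<rho> x Z (e1 x) \<in> s1 x" "\<And>x Z. x \<in> U \<Longrightarrow> \<rho> x Z (e2 x) \<in> s2 x"
    and p: "form p p = \<alpha>" "\<alpha> \<noteq> 0"
    and F: "smooth_map F" "\<And>y. F y \<in> f y" "\<And>y. form p (F y) = \<alpha>" "\<And>y Z. tderiv F y Z = - \<rho> y Z p"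
    and \<Lambda>: "smooth_subbundle 1 (slice p)" and x: "x \<in> U"
    and \<xi>: "\<xi> = (1/2) *\<^sub>R (\<rho> x (X x) + (1 / \<alpha>) *\<^sub>R wedge (F x) (tderiv F x (X x)))"
  shows "\<xi> v \<in> derived (slice p) x"
proof -
  let ?e1 = "e1 x" and ?e2 = "e2 x" and ?\<Lambda> = "\<lambda>x. slice p x" and ?d = "tderiv F x (X x)"
  have low: "lowers (f y) (\<rho> y Z)" for y Z using \<rho> by (auto simp: f_potential_def)
  note sk\<rho> = lowersD(1)[OF low]
  have F': "smooth_map_on U F" using smooth_subset[OF F(1)] by blast
  have dF: "?d \<in> orth (f x)" by (rule tderiv_section_orth[OF U x F' F(2)])
  have Fp: "form (F x) w = 0" if "w \<in> orth (f x)" for w using f_perp(1)[OF x F(2) that] .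
  have sk: "skew \<xi>" unfolding \<xi> by (intro skew_scaleR skew_add skew_wedge sk\<rho>)
  have \<xi>v: "\<xi> w = (1/2) *\<^sub>R (\<rho> x (X x) w + (1 / \<alpha>) *\<^sub>R (form (F x) w *\<^sub>R ?d - form ?d w *\<^sub>R F x))" for w
    by (simp add: \<xi> blinfun_simps wedge_apply)
  have \<xi>p: "\<xi> p = 0"
  proof -
    have "form ?d p = 0" using skew_self(1)[OF sk\<rho>, of x "X x" p] F(4) by (simp add: form_simps)
    then show ?thesis using F(3,4) p by (simp add: \<xi>v form_commute[of "F x" p])
  qed
  have \<xi>f: "\<xi> w = 0" if "w \<in> f x" for w
    using lowersD(2)[OF low that] f_perp[OF x that dF] f_orth[of x] Fp[of w] that by (auto simp: \<xi>v)
  have de: "form ?d w = form p (\<rho> x (X x) w)" for w using skewD[OF sk\<rho>, of x "X x" p w] F(4) by (simp add: form_simps)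
  have \<xi>e1: "\<xi> ?e1 = 0" using potential_X_e[OF \<rho> x] Fp[OF e_orth[OF x]] by (simp add: \<xi>v de form_simps)
  define w where "w = \<xi> v"
  have w: "w \<in> orth (f x)" "form w ?e1 = 0" "form w p = 0"
    using \<xi>f skewD[OF sk] \<xi>e1 \<xi>p by (auto simp: w_def orth_def form_commute[of _ "\<xi> v"] form_simps)
  have in\<Lambda>: "u \<in> derived ?\<Lambda> x" if "u \<in> orth (f x)" "form u ?e1 = 0" "form u ?e2 = 0" "form u p = 0" for u
    using orth_f_expand[OF x that(1-3)] that(4) fibre_subset_derived[OF \<Lambda>, of x] by (auto simp: orth_def form_commute)
  show ?thesis
  proof (cases "form p (\<sigma>1 x) = 0")
    case False
    \<comment> \<open>A multiple of the derivative of the section of \<Lambda> removes the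
      \<open>e2\<close> component of \<open>w\<close>; what is left lies in \<Lambda>.\<close>
    define k where "k = - form w ?e2 / (form p (\<sigma>1 x) * g2 x)"
    let ?h = "along X (hyp p) x"
    have "w - k *\<^sub>R ?h \<in> derived ?\<Lambda> x" using w along_X_hyp[OF x, of p] False e_pos2[OF x]
      by (intro in\<Lambda> subspace_diff subspace_scale subspace_orth) (auto simp: form_simps k_def form_commute[of _ p])
    moreover have "?h \<in> derived ?\<Lambda> x"
      unfolding along_def using hyp_f by (intro tderiv_in_derived[OF \<Lambda> U x smooth_hyp]) (auto simp: orth_def)
    ultimately have "w - k *\<^sub>R ?h + k *\<^sub>R ?h \<in> derived ?\<Lambda> x"
      by (intro subspace_add subspace_scale subspace_derived)
    then show ?thesis by (simp add: w_def)
  next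
    case True
    \<comment> \<open>(F, z1) is computed through dF = - \<rho> p: the middle condition puts
      \<rho>(Y) e1 into \<open>s1\<close>, which is orthogonal to \<open>p\<close> here. Hence
      \<open>F x\<close> is a multiple of \<open>\<sigma>2\<close>, so is \<xi>(X) e2, and the
      latter is 0 because it is orthogonal to \<open>p\<close> while \<open>\<sigma>2\<close> is
      not.\<close>
    have "form (along Y F x) ?e1 = - form (F x) (z1 x)"
      using Fp f_perp(1)[OF _ F(2) e_orth] by (intro along_form[OF x F' smooth_e])
    moreover have "form (along Y F x) ?e1 = form p (\<rho> x (Y x) ?e1)"
      using skewD[OF sk\<rho>, of x "Y x" p ?e1] F(4) by (simp add: along_def form_simps)
    moreover have "form p (\<rho> x (Y x) ?e1) = 0"
      using mid(1)[OF x, of "Y x"] True by (auto simp: s1[OF x] span_singleton form_simps)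
    ultimately have Fz: "form (F x) (z1 x) = 0" by simp
    then have F2: "F x = (- form (F x) (z2 x) / g2 x) *\<^sub>R \<sigma>2 x" using f_coeffs[OF x F(2)] by simp
    obtain m where m: "\<rho> x (X x) ?e2 = m *\<^sub>R \<sigma>2 x"
      using mid(2)[OF x, of "X x"] by (auto simp: s2[OF x] span_singleton)
    obtain n where n: "F x = n *\<^sub>R \<sigma>2 x" using F2 by blast
    have p2: "form p (\<sigma>2 x) \<noteq> 0" using F(3)[of x] p(2) by (auto simp: n form_simps)
    have "\<xi> ?e2 = (1/2) *\<^sub>R (m *\<^sub>R \<sigma>2 x - (form ?d ?e2 / \<alpha>) *\<^sub>R n *\<^sub>R \<sigma>2 x)"
      using Fp[OF e_orth2[OF x]] n by (simp add: \<xi>v m)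
    then obtain l where l: "\<xi> ?e2 = l *\<^sub>R \<sigma>2 x"
      by (intro that[of "(1/2) * (m - form ?d ?e2 / \<alpha> * n)"]) (simp add: algebra_simps)
    have "form p (\<xi> ?e2) = 0" using skewD[OF sk, of p ?e2] \<xi>p by (simp add: form_simps)
    then have "\<xi> ?e2 = 0" using l p2 by (simp add: form_simps)
    then have "form w ?e2 = 0" using skewD[OF sk, of v ?e2] by (simp add: w_def form_simps)
    then show ?thesis using in\<Lambda> w by (simp add: w_def)
  qed
qed

end

section \<open>Guichard data from a normalised conserved quantity\<close>

context legendre_pair
begin

text \<open>Demanded for all frames at once, so that it can be unfolded with whichever frame is at
  hand; \<open>middle_iff\<close> identifies it with the condition inside
  \<open>middle_potential\<close>.\<close>

definition middle :: "('m \<Rightarrow> real^2 \<Rightarrow> 'v \<Rightarrow>\<^sub>L 'v) \<Rightarrow> bool" where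
  "middle \<mu> \<longleftrightarrow> (\<forall>U \<sigma>1 \<sigma>2 X Y x Z. curvature_frame f s1 s2 U \<sigma>1 \<sigma>2 X Y \<longrightarrow> x \<in> U \<longrightarrow>
    \<mu> x Z (along Y \<sigma>1 x) \<in> s1 x \<and> \<mu> x Z (along X \<sigma>2 x) \<in> s2 x)"

abbreviation mixed :: "'m \<Rightarrow> ('v \<Rightarrow>\<^sub>L 'v) \<Rightarrow> 'v \<Rightarrow>\<^sub>L 'v" where
  "mixed x \<equiv> mixed_component (second_osculating s1 (\<lambda>x. curvature_space f x (s2 x)) x)
    (second_osculating s2 (\<lambda>x. curvature_space f x (s1 x)) x)"

lemma mixed_iff:
  assumes fr: "curvature_frame f s1 s2 U \<sigma>1 \<sigma>2 X Y" "x \<in> U" and A: "lowers (f x) A"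
  shows "mixed x A \<in> wedge_space (f x) (f x) \<longleftrightarrow> A (along Y \<sigma>1 x) \<in> s1 x \<and> A (along X \<sigma>2 x) \<in> s2 x"
  unfolding curvature_frame.second_osculating_eq[OF fr]
    curvature_frame.second_osculating_eq[OF curvature_frame.frame_swap[OF fr(1)] fr(2)]
  by (rule curvature_frame.mixed_component_iff[OF fr A])

lemma middle_iff:
  assumes \<mu>: "\<And>x Z. lowers (f x) (\<mu> x Z)"
  shows "middle \<mu> \<longleftrightarrow> (\<forall>x Z. mixed x (\<mu> x Z) \<in> wedge_space (f x) (f x))"
proof
  assume m: "middle \<mu>"
  show "\<forall>x Z. mixed x (\<mu> x Z) \<in> wedge_space (f x) (f x)"
  proof (intro allI)
    fix x Z
    obtain U \<sigma>1 \<sigma>2 X Y where fr: "curvature_frame f s1 s2 U \<sigma>1 \<sigma>2 X Y" "x \<in> U"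
      by (rule curvature_frame_exists)
    show "mixed x (\<mu> x Z) \<in> wedge_space (f x) (f x)"
      unfolding mixed_iff[OF fr \<mu>] using m[unfolded middle_def, rule_format, OF fr] .
  qed
next
  assume m: "\<forall>x Z. mixed x (\<mu> x Z) \<in> wedge_space (f x) (f x)"
  show "middle \<mu>" unfolding middle_def
  proof (intro allI impI)
    fix U \<sigma>1 \<sigma>2 X Y x Z assume fr: "curvature_frame f s1 s2 U \<sigma>1 \<sigma>2 X Y" "x \<in> U"
    show "\<mu> x Z (along Y \<sigma>1 x) \<in> s1 x \<and> \<mu> x Z (along X \<sigma>2 x) \<in> s2 x"
      using m[rule_format, of x Z] unfolding mixed_iff[OF fr \<mu>] .
  qed
qed

context
  fixes \<rho> :: "'m \<Rightarrow> real^2 \<Rightarrow> 'v \<Rightarrow>\<^sub>L 'v" and p :: 'v and \<alpha> :: real and F :: "'m \<Rightarrow> 'v"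
  assumes \<rho>: "f_potential f \<rho>" "middle \<rho>" and p: "form p p = \<alpha>" "\<alpha> \<noteq> 0"
    and F: "smooth_map F" "\<And>y. F y \<in> f y" "\<And>y. form p (F y) = \<alpha>" "\<And>y Z. tderiv F y Z = - \<rho> y Z p"
begin

lemma line_bundle_f_p: "smooth_subbundle 1 (slice p)"
proof (rule smooth_line_bundleI)
  fix x
  obtain U \<sigma>1 \<sigma>2 X Y where "curvature_frame f s1 s2 U \<sigma>1 \<sigma>2 X Y" and x: "x \<in> U"
    by (rule curvature_frame_exists)
  then interpret fr: curvature_frame f s1 s2 U \<sigma>1 \<sigma>2 X Y by simp
  have "fr.hyp p y \<noteq> 0 \<and> slice p y = span {fr.hyp p y}" if "y \<in> U" for y
    using fr.hyp_span[OF that F(2)[of y]] F(3)[of y] p(2) by simp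
  then show "\<exists>U \<sigma>. open U \<and> x \<in> U \<and> smooth_map_on U \<sigma> \<and> (\<forall>y\<in>U. \<sigma> y \<noteq> 0 \<and> slice p y = span {\<sigma> y})"
    using fr.U x fr.smooth_hyp by blast
qed

definition \<xi> :: "'m \<Rightarrow> real^2 \<Rightarrow> 'v \<Rightarrow>\<^sub>L 'v" where
  "\<xi> x Z = (1/2) *\<^sub>R (\<rho> x Z + (1 / \<alpha>) *\<^sub>R wedge (F x) (tderiv F x Z))"

lemma \<rho>': "smooth_one_form \<rho>" "closed_one_form \<rho>" "lowers (f x) (\<rho> x Z)"
  using \<rho>(1) by (auto simp: f_potential_def)

lemma dF: "tderiv F x Z \<in> orth (f x)" by (rule tderiv_section_orth[OF open_UNIV _ F(1,2)]) simp

lemma F_perp: "w \<in> orth (f x) \<Longrightarrow> form (F x) w = 0" using orthD(1) F(2) by blast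

lemma smooth_\<xi>: "smooth_one_form \<xi>" unfolding \<xi>_def[abs_def]
  by (intro smooth_one_form_scaleR smooth_one_form_add smooth_one_form_wedge smooth_const \<rho>' F)

lemma ext_deriv_\<xi>:
  assumes c: "c \<in> atlas" "x \<in> fst c"
  shows "ext_deriv c \<xi> x e e' = (1 / \<alpha>) *\<^sub>R wedge (tderiv F x (coord_field c e x)) (tderiv F x (coord_field c e' x))"
proof -
  let ?w = "\<lambda>x Z. wedge (F x) (tderiv F x Z)"
  note s = smooth_one_form_wedge[OF F(1)]
  have s2: "smooth_one_form (\<lambda>x Z. (1 / \<alpha>) *\<^sub>R ?w x Z)" by (intro smooth_one_form_scaleR smooth_const s)
  have "ext_deriv c \<xi> x e e' = (1/2) *\<^sub>R ext_deriv c (\<lambda>x Z. \<rho> x Z + (1 / \<alpha>) *\<^sub>R ?w x Z) x e e'"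
    unfolding \<xi>_def[abs_def]
    by (rule ext_deriv_scaleR[OF smooth_const _ smooth_one_form_add[OF \<rho>'(1) s2] c]) simp
  also have "\<dots> = (1/2) *\<^sub>R (1 / \<alpha>) *\<^sub>R ext_deriv c ?w x e e'"
    using \<rho>'(2) c ext_deriv_add[OF \<rho>'(1) s2 c] ext_deriv_scaleR[OF smooth_const _ s c, of "1 / \<alpha>"]
    by (simp add: closed_iff_ext_deriv)
  finally show ?thesis using ext_deriv_wedge[OF open_UNIV UNIV_I F(1) c] by simp
qed

lemma skew_\<xi>: "skew (\<xi> x Z)" unfolding \<xi>_def by (intro skew_scaleR skew_add skew_wedge lowersD(1)[OF \<rho>'(3)])

lemma \<xi>_apply: "\<xi> x Z w = (1/2) *\<^sub>R (\<rho> x Z w + (1 / \<alpha>) *\<^sub>R (form (F x) w *\<^sub>R tderiv F x Z - form (tderiv F x Z) w *\<^sub>R F x))"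
  by (simp add: \<xi>_def blinfun_simps wedge_apply)

text \<open>This is what the added wedge in \<xi> achieves: F \<and> dF maps \<open>p\<close> to
  \<alpha> dF = - \<alpha> \<rho> p, which cancels the value of \<rho> on \<open>p\<close>.\<close>

lemma \<xi>_p: "\<xi> x Z p = 0"
proof -
  have "form (tderiv F x Z) p = 0" using skew_self(1)[OF lowersD(1)[OF \<rho>'(3)], of x Z p] F(4) by (simp add: form_simps)
  then show ?thesis using F(3,4) p by (simp add: \<xi>_apply form_commute[of "F x" p])
qed

lemma \<xi>_f: "w \<in> f x \<Longrightarrow> \<xi> x Z w = 0" and \<xi>_orth: "w \<in> orth (f x) \<Longrightarrow> \<xi> x Z w \<in> slice p x"
proof -
  show "\<xi> x Z w = 0" if w: "w \<in> f x"
    using lowersD(2)[OF \<rho>'(3) w] f_orth[of x] w F_perp[of w x] orthD(2)[OF dF w] by (auto simp: \<xi>_apply)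
  assume w: "w \<in> orth (f x)"
  have "\<xi> x Z w \<in> f x" using lowersD(3)[OF \<rho>'(3) w] F_perp[OF w] F(2)[of x]
    by (auto simp: \<xi>_apply intro!: subspace_scale subspace_diff subspace_f subspace_neg)
  moreover have "form p (\<xi> x Z w) = 0" using skewD[OF skew_\<xi>, of x Z p w] by (simp add: \<xi>_p form_simps)
  ultimately show "\<xi> x Z w \<in> slice p x" by (simp add: orth_def)
qed

lemma \<xi>_derived: "\<xi> x Z v \<in> derived (slice p) x"
proof -
  obtain U \<sigma>1 \<sigma>2 X Y where "curvature_frame f s1 s2 U \<sigma>1 \<sigma>2 X Y" and x: "x \<in> U"
    by (rule curvature_frame_exists)
  then interpret fr: curvature_frame f s1 s2 U \<sigma>1 \<sigma>2 X Y by simp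
  have mid: "\<rho> y Z (along Y \<sigma>1 y) \<in> s1 y" "\<rho> y Z (along X \<sigma>2 y) \<in> s2 y" if "y \<in> U" for y Z
    using \<rho>(2) fr.curvature_frame_axioms that unfolding middle_def by blast+
  have X: "\<xi> x (X x) v \<in> derived (slice p) x"
    by (rule fr.form_in_derived[OF \<rho>(1) mid p F line_bundle_f_p x \<xi>_def])
  have Y: "\<xi> x (Y x) v \<in> derived (slice p) x"
    by (rule curvature_frame.form_in_derived[OF fr.frame_swap \<rho>(1) mid(2,1) p F line_bundle_f_p x \<xi>_def])
  obtain a b where Z: "Z = a *\<^sub>R X x + b *\<^sub>R Y x" by (rule fr.XY_basis[OF x])
  note l = smooth_one_form_linear[OF smooth_\<xi>, of x]
  show ?thesis unfolding Z linear_add[OF l] linear_scale[OF l] using X Y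
    by (simp add: blinfun_simps subspace_add subspace_scale subspace_derived)
qed

lemma \<xi>_wedge:
  obtains \<sigma> where "\<sigma> \<in> slice p x" "\<sigma> \<noteq> 0" "\<And>Z. \<exists>w. \<xi> x Z = wedge \<sigma> w \<and> w \<in> derived (slice p) x \<and> form \<sigma> w = 0"
proof -
  obtain U \<sigma>1 \<sigma>2 X Y where "curvature_frame f s1 s2 U \<sigma>1 \<sigma>2 X Y" and x: "x \<in> U"
    by (rule curvature_frame_exists)
  then interpret fr: curvature_frame f s1 s2 U \<sigma>1 \<sigma>2 X Y by simp
  let ?\<sigma> = "fr.hyp p x"
  have \<sigma>: "?\<sigma> \<noteq> 0" "slice p x = span {?\<sigma>}" using fr.hyp_span[OF x F(2)[of x]] F(3)[of x] p(2) by simp_all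
  then have \<sigma>': "?\<sigma> \<in> f x" "form p ?\<sigma> = 0" using span_base[of ?\<sigma> "{?\<sigma>}"] by (auto simp: orth_def)
  have ne: "span {?\<sigma>} \<noteq> span {F x}"
  proof
    assume "span {?\<sigma>} = span {F x}"
    then have "F x \<in> slice p x" using \<sigma>(2) by (simp add: span_base)
    then show False using F(3)[of x] p(2) by (simp add: orth_def)
  qed
  have F0: "F x \<noteq> 0" using F(3)[of x] p(2) by (auto simp: form_simps)
  have fx: "f x = span {?\<sigma>, F x}" by (rule two_lines(1)[OF \<sigma>(1) ne F0 subspace_f dim_f \<sigma>'(1) F(2)])
  obtain v' where v': "form ?\<sigma> v' \<noteq> 0" using form_nondegenerate[of ?\<sigma>] \<sigma>(1) by blast
  define v where "v = (1 / form ?\<sigma> v') *\<^sub>R v'"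
  have v: "form ?\<sigma> v = 1" using v' by (simp add: v_def form_simps)
  show ?thesis
  proof (rule that[of ?\<sigma>])
    fix Z
    have k: "\<exists>k. \<xi> x Z u = k *\<^sub>R ?\<sigma>" if u: "form ?\<sigma> u = 0" for u
    proof -
      \<comment> \<open>Subtracting a multiple of \<open>p\<close>, which \<xi> annihilates, moves
        \<open>u\<close> into \<open>orth (f x)\<close>, where \<xi> has values in
        \<Lambda>.\<close>
      define a where "a = u - (form (F x) u / \<alpha>) *\<^sub>R p"
      have "form ?\<sigma> a = 0" "form (F x) a = 0"
        using u \<sigma>'(2) F(3)[of x] p(2) form_commute[of ?\<sigma> p] form_commute[of "F x" p] by (simp_all add: a_def form_simps)
      then have "a \<in> orth (f x)" unfolding fx orth_span by (simp add: orth_def)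
      then have "\<xi> x Z a \<in> span {?\<sigma>}" using \<xi>_orth \<sigma>(2) by blast
      moreover have "\<xi> x Z a = \<xi> x Z u" by (simp add: a_def blinfun_simps \<xi>_p)
      ultimately show ?thesis by (auto simp: span_singleton)
    qed
    have "\<xi> x Z = wedge ?\<sigma> (\<xi> x Z v)" by (rule skew_eq_wedge[OF skew_\<xi> k v])
    moreover have "form ?\<sigma> (\<xi> x Z v) = 0"
      using skewD[OF skew_\<xi>, of x Z ?\<sigma> v] \<xi>_f[OF \<sigma>'(1)] by (simp add: form_simps)
    ultimately show "\<exists>w. \<xi> x Z = wedge ?\<sigma> w \<and> w \<in> derived (slice p) x \<and> form ?\<sigma> w = 0"
      using \<xi>_derived by blast
  qed (use \<sigma> span_base[of ?\<sigma> "{?\<sigma>}"] in auto)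
qed

definition V :: "'m \<Rightarrow> 'v set" where "V x = orth {p, F x}"

lemma F_null: "form (F x) (F x) = 0" using F(2) isotropic_f by (auto simp: isotropic_def)

lemma F_commute: "form (F x) p = \<alpha>" using F(3) form_commute[of "F x" p] by simp

lemma f_p_V: "slice p x \<subseteq> V x" using F(2)[of x] isotropic_f[of x] by (auto simp: V_def orth_def isotropic_def)

lemma sphere_congruence_V: "sphere_congruence p V"
proof -
  have \<sigma>: "\<exists>\<sigma>. \<sigma> \<in> V x \<and> \<sigma> \<noteq> 0 \<and> form \<sigma> \<sigma> = 0" for x
  proof -
    obtain \<sigma> where "\<sigma> \<in> slice p x" "\<sigma> \<noteq> 0" by (rule \<xi>_wedge)
    then show ?thesis using f_p_V[of x] isotropic_f[of x] by (auto simp: isotropic_def)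
  qed
  have sig: "dim (V x) = 4" "signature form (V x) = (3, 1)" for x
  proof -
    obtain \<sigma> where s: "\<sigma> \<in> orth {p, F x}" "\<sigma> \<noteq> 0" "form \<sigma> \<sigma> = 0" using \<sigma>[of x] by (auto simp: V_def)
    show "dim (V x) = 4" "signature form (V x) = (3, 1)"
      unfolding V_def by (rule signature_orth(3,4)[OF p F(3) F_null s])+
  qed
  \<comment> \<open>Orthogonal projection onto \<open>V\<close>, written in the orthogonal basis
    \<open>p\<close>, \<open>p - F x\<close> of the complement; the norms \<alpha> and - \<alpha>
    account for the two signs.\<close>
  let ?Q = "\<lambda>x v. v - (form p v / \<alpha>) *\<^sub>R p + (form (p - F x) v / \<alpha>) *\<^sub>R (p - F x)"
  have "smooth_subbundle 4 V"
  proof (rule smooth_subbundleI[where Q = ?Q])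
    show "?Q x v \<in> V x" for x v
      using p(2) by (simp add: V_def orth_def form_simps p F(3) F_null F_commute field_simps)
    show "?Q x v = v" if "v \<in> V x" for x v using that by (simp add: V_def orth_def form_simps)
    show "smooth_map (\<lambda>x. ?Q x v)" for v
      by (intro smooth_intros smooth_form smooth_divide open_UNIV F(1)) (use p(2) in auto)
  qed (use sig in \<open>auto simp: V_def\<close>)
  then show ?thesis using sig by (auto simp: sphere_congruence_def V_def orth_def)
qed

lemma envelops_V: "envelops (slice p) V" unfolding envelops_def
proof (intro allI derived_minimal[OF line_bundle_f_p])
  fix x \<sigma> Z assume "\<sigma> \<in> sections (slice p)"
  then have \<sigma>: "smooth_map \<sigma>" "\<And>y. \<sigma> y \<in> f y" "\<And>y. form p (\<sigma> y) = 0" by (auto simp: sections_def orth_def)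
  have "tderiv \<sigma> x Z \<in> orth (f x)" by (rule tderiv_section_orth[OF open_UNIV _ \<sigma>(1,2)]) simp
  then have "form (F x) (tderiv \<sigma> x Z) = 0" by (rule F_perp)
  moreover have "form p (tderiv \<sigma> x Z) = 0"
    using tderiv_form_eq[OF open_UNIV UNIV_I smooth_const \<sigma>(1,3), of x Z] by (simp add: form_simps)
  ultimately show "tderiv \<sigma> x Z \<in> V x" by (simp add: V_def orth_def)
qed (use f_p_V in \<open>auto simp: V_def\<close>)

lemma light_cone_map_f_p: "light_cone_map p (slice p)"
  using line_bundle_f_p isotropic_f by (auto simp: light_cone_map_def lightlike_def isotropic_def)

lemma sphere_normal_V: "sphere_normal p \<alpha> (- \<alpha>) V UNIV (\<lambda>y. p - F y)"
proof
  let ?\<nu> = "\<lambda>y. p - F y"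
  show "V y = orth {p, ?\<nu> y}" for y unfolding V_def orth_def by (auto simp: form_simps)
  show "form (?\<nu> y) (?\<nu> y) = - \<alpha>" for y by (simp add: form_simps p F(3) F_null F_commute)
  show "smooth_map ?\<nu>" by (intro smooth_intros F open_UNIV)
  show "form p (?\<nu> y) = 0" for y by (simp add: form_simps p F(3))
qed (use p in auto)

lemma d\<nu>: "tderiv (\<lambda>y. p - F y) x Z = - tderiv F x Z"
  using tderiv_diff[OF open_UNIV smooth_const F(1) UNIV_I, of p x Z] by simp

text \<open>For the normal p - F the constant \<kappa> is - \<alpha>, so
  \<open>ext_deriv_\<xi>\<close> is the equation that \<open>guichard_flatI\<close> asks for. Values
  of \<xi> at a point commute because all are wedges of one null vector with vectors orthogonal to
  it.\<close>

lemma guichard_data_V: "guichard_data p (slice p) V \<xi>"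
proof -
  let ?\<nu> = "\<lambda>y. p - F y"
  interpret sn: sphere_normal p \<alpha> "- \<alpha>" V UNIV ?\<nu> by (rule sphere_normal_V)
  have "\<xi> x Z \<in> wedge_space (slice p x) (derived (slice p) x)" for x Z
  proof -
    obtain \<sigma> where \<sigma>: "\<sigma> \<in> slice p x"
      and w: "\<exists>w. \<xi> x Z = wedge \<sigma> w \<and> w \<in> derived (slice p) x \<and> form \<sigma> w = 0" using \<xi>_wedge[of x] by metis
    then show ?thesis using wedge_in_wedge_space[OF \<sigma>] by metis
  qed
  moreover have "flat (guichard_conn V \<xi> t)" for t
  proof (rule sn.guichard_flatI[OF refl smooth_\<xi>])
    show "ext_deriv c \<xi> x e e' = - (1 / - \<alpha>) *\<^sub>R wedge (tderiv ?\<nu> x (coord_field c e x)) (tderiv ?\<nu> x (coord_field c e' x))"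
      if "c \<in> atlas" "x \<in> fst c" for c x e e'
      unfolding d\<nu> ext_deriv_\<xi>[OF that] by (simp add: wedge.minus_left wedge.minus_right)
    show "\<xi> x Z (?\<nu> x) = 0" for x Z using \<xi>_f[OF F(2)] \<xi>_p by (simp add: blinfun_simps)
    show "\<xi> x Z (\<xi> x W v) = \<xi> x W (\<xi> x Z v)" for x Z W v
    proof -
      obtain \<sigma> where \<sigma>: "\<sigma> \<in> slice p x" "\<sigma> \<noteq> 0"
        and w: "\<And>Z. \<exists>w. \<xi> x Z = wedge \<sigma> w \<and> w \<in> derived (slice p) x \<and> form \<sigma> w = 0"
        using \<xi>_wedge[of x] by blast
      obtain a b where "\<xi> x Z = wedge \<sigma> a" "form \<sigma> a = 0" "\<xi> x W = wedge \<sigma> b" "form \<sigma> b = 0" using w by metis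
      moreover have "form \<sigma> \<sigma> = 0" using \<sigma>(1) isotropic_f by (auto simp: isotropic_def)
      ultimately show ?thesis by (simp add: wedge_apply form_simps form_commute[of a \<sigma>] form_commute[of b \<sigma>] form_commute[of b a])
    qed
  qed (rule skew_\<xi>)
  ultimately show ?thesis
    using light_cone_map_f_p sphere_congruence_V envelops_V smooth_\<xi> by (simp add: guichard_data_def)
qed

lemma non_channel_guichard:
  assumes nd: "\<And>x. nondegenerate (omega_q f \<rho> x)"
  shows "non_channel_guichard_surface p (slice p)"
proof -
  note gd = guichard_data_V[unfolded guichard_data_def]
  have "omega_q f \<rho> x Z W = guichard_q (slice p) V \<xi> x Z W" for x Z W
  proof (rule omega_q_eq_guichard_q[OF sphere_normal_V UNIV_I F(1-3) _ _ line_bundle_f_p refl, where \<epsilon> = "- 1"])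
    show "derived (slice p) x \<subseteq> V x" for x using envelops_V by (simp add: envelops_def)
    show "\<xi> x Z \<in> wedge_space (slice p x) (derived (slice p) x)" for Z using gd by blast
    show "\<rho> x Z = 2 *\<^sub>R \<xi> x Z - (1 / \<alpha>) *\<^sub>R wedge (F x) (tderiv F x Z)" by (simp add: \<xi>_def)
  qed (simp_all add: d\<nu> \<rho>'(3))
  then have "omega_q f \<rho> x = guichard_q (slice p) V \<xi> x" for x by blast
  then show ?thesis using nd guichard_data_V unfolding non_channel_guichard_surface_def by metis
qed

end

end

text \<open>Non-degeneracy and the middle condition make \<mu>(X) e2 and \<mu>(Y) e1 non-zero
  multiples of \<sigma>2 and \<sigma>1. By skewness \<open>v\<close> is orthogonal to all values of
  \<mu>, hence to \<open>f\<close>, and null vectors orthogonal to \<open>f\<close> lie in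
  \<open>f\<close>.\<close>

lemma (in legendre_pair) conserved_quantity_in_f:
  assumes \<mu>: "f_potential f \<mu>" "middle \<mu>" and nd: "nondegenerate (omega_q f \<mu> x)"
    and v: "\<And>Z. \<mu> x Z v = 0" "form v v = 0"
  shows "v \<in> f x"
proof -
  obtain U \<sigma>1 \<sigma>2 X Y where "curvature_frame f s1 s2 U \<sigma>1 \<sigma>2 X Y" and x: "x \<in> U"
    by (rule curvature_frame_exists)
  then interpret fr: curvature_frame f s1 s2 U \<sigma>1 \<sigma>2 X Y by simp
  have low: "lowers (f x) (\<mu> x Z)" for Z using \<mu> by (auto simp: f_potential_def)
  have perp: "form (\<mu> x Z u) v = 0" for Z u
    using skewD[OF lowersD(1)[OF low], of Z u v] v(1) by (simp add: form_simps)
  let ?a = "\<mu> x (X x) (along X \<sigma>2 x)" and ?b = "\<mu> x (Y x) (along Y \<sigma>1 x)"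
  have q: "?a \<noteq> 0" "?b \<noteq> 0"
    using nd fr.nondegenerate_omega_q_iff[OF \<mu>(1) x] fr.omega_q_XY(3,4)[OF \<mu>(1) x] by (auto simp: form_simps)
  have "?a \<in> s2 x" "?b \<in> s1 x" using \<mu>(2) fr.curvature_frame_axioms x unfolding middle_def by blast+
  then obtain a b where ab: "?a = a *\<^sub>R \<sigma>2 x" "?b = b *\<^sub>R \<sigma>1 x"
    by (auto simp: fr.s1[OF x] fr.s2[OF x] span_singleton)
  then have "form (\<sigma>1 x) v = 0" "form (\<sigma>2 x) v = 0"
    using perp[of "X x" "along X \<sigma>2 x"] perp[of "Y x" "along Y \<sigma>1 x"] q by (auto simp: form_simps)
  then have "v \<in> orth (f x)" by (rule fr.orth_fI[OF x])
  then show ?thesis using isotropic_orth_nonneg(2)[OF subspace_f dim_f isotropic_f] v(2) by blast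
qed

lemma special_imp_guichard:
  fixes f :: "'m::smooth_surface \<Rightarrow> 'v::r42 set"
  assumes p0: "\<pp> \<noteq> 0" "\<not> lightlike \<pp>" and \<eta>: "omega_surface f \<eta>" "middle_potential f \<eta> \<mu>"
    and pcq: "polynomial_conserved_quantity \<mu> 1 p" "p 0 = (\<lambda>_. \<pp>)"
    and poly: "\<And>x. \<exists>P :: real poly. degree P = 1 \<and> coeff P 0 \<noteq> 0 \<and>
              (\<forall>t. form (section_poly 1 p t x) (section_poly 1 p t x) = poly P t)"
  shows "smooth_subbundle 1 (\<lambda>x. f x \<inter> orth {\<pp>})" "non_channel_guichard_surface \<pp> (\<lambda>x. f x \<inter> orth {\<pp>})"
proof -
  obtain s1 s2 where pair: "curvature_sphere_pair f s1 s2"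
    and mix: "\<And>x Z. mixed_component (second_osculating s1 (\<lambda>x. curvature_space f x (s2 x)) x)
      (second_osculating s2 (\<lambda>x. curvature_space f x (s1 x)) x) (\<mu> x Z) \<in> wedge_space (f x) (f x)"
    using \<eta>(2) unfolding middle_potential_def Let_def by blast
  interpret legendre_pair f s1 s2 using \<eta>(1) pair by unfold_locales (simp add: omega_surface_def)
  obtain \<tau> where \<tau>: "\<tau> \<in> sections (\<lambda>x. wedge_space (f x) (f x))" "\<mu> = (\<lambda>x X. \<eta> x X - tderiv \<tau> x X)"
    using \<eta>(2) unfolding middle_potential_def gauge_orbit_def by blast
  have pot\<eta>: "f_potential f \<eta>" using \<eta>(1) gauge_potential_f_potential by (auto simp: omega_surface_def)
  have \<mu>: "f_potential f \<mu>" unfolding \<tau>(2) by (rule gauge_f_potential[OF pot\<eta> \<tau>(1)])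
  then have low: "lowers (f x) (\<mu> x Z)" for x Z by (auto simp: f_potential_def)
  have mid: "middle \<mu>" using middle_iff[of \<mu>] low mix by blast
  have nd: "nondegenerate (omega_q f \<mu> x)" for x
    unfolding \<tau>(2) gauge_omega_q[OF pot\<eta> \<tau>(1)] by (rule omega_surface_nondegenerate[OF \<eta>(1)])
  define p1 where "p1 = p 1"
  have sp: "section_poly 1 p t x = \<pp> + t *\<^sub>R p1 x" for t x by (simp add: section_poly_def pcq(2) p1_def)
  have sm: "smooth_map p1" using pcq(1) by (simp add: polynomial_conserved_quantity_def p1_def)
  have d: "t *\<^sub>R tderiv p1 x Z + t *\<^sub>R \<mu> x Z (\<pp> + t *\<^sub>R p1 x) = 0" for t x Z
  proof -
    have sp': "section_poly 1 p t = (\<lambda>x. \<pp> + t *\<^sub>R p1 x)" using sp by blast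
    have "tderiv (section_poly 1 p t) x Z = t *\<^sub>R tderiv p1 x Z"
      unfolding sp' using tderiv_add[OF open_UNIV smooth_const smooth_scaleR[OF open_UNIV smooth_const sm] UNIV_I, of \<pp> t x Z]
        tderiv_scaleR_right[OF open_UNIV sm UNIV_I, of t x Z] by simp
    then show ?thesis using pcq(1) sp[of t x] unfolding polynomial_conserved_quantity_def by metis
  qed
  \<comment> \<open>The coefficients of t and t^2 in the conservation law, separated by the values t
    = 1 and t = -1.\<close>
  have d1: "tderiv p1 x Z = - \<mu> x Z \<pp>" and \<mu>p1: "\<mu> x Z (p1 x) = 0" for x Z
  proof -
    have 1: "tderiv p1 x Z + (\<mu> x Z \<pp> + \<mu> x Z (p1 x)) = 0" using d[of 1 x Z] by (simp add: blinfun_simps)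
    have 2: "\<mu> x Z (p1 x) - \<mu> x Z \<pp> = tderiv p1 x Z" using d[of "-1" x Z] by (simp add: blinfun_simps)
    have "2 *\<^sub>R \<mu> x Z (p1 x) = 0" using 1 unfolding 2[symmetric] by (simp add: scaleR_2)
    then show "\<mu> x Z (p1 x) = 0" by simp
    then show "tderiv p1 x Z = - \<mu> x Z \<pp>" using 1 by (simp add: eq_neg_iff_add_eq_0)
  qed
  define \<alpha> where "\<alpha> = form \<pp> \<pp>"
  have \<alpha>: "\<alpha> \<noteq> 0" using p0 by (auto simp: \<alpha>_def lightlike_def)
  \<comment> \<open>In degree 1 the t^2 coefficient (p1, p1) is 0 and the t coefficient, twice the
    pairing with \<open>p1\<close>, is not.\<close>
  have norms: "form (p1 x) (p1 x) = 0" "form \<pp> (p1 x) \<noteq> 0" for x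
  proof -
    obtain P :: "real poly" where P: "degree P = 1" "\<And>t. form (section_poly 1 p t x) (section_poly 1 p t x) = poly P t"
      using poly[of x] by blast
    obtain a b where ab: "P = [:a, b:]" using degree1_coeffs[OF P(1)] by blast
    have e: "form (\<pp> + t *\<^sub>R p1 x) (\<pp> + t *\<^sub>R p1 x) = a + t * b" for t using P(2)[of t] unfolding sp ab by simp
    have e': "\<alpha> + 2 * t * form \<pp> (p1 x) + t * t * form (p1 x) (p1 x) = a + t * b" for t
      using e[of t] form_commute[of "p1 x" \<pp>] by (simp add: form_simps \<alpha>_def algebra_simps)
    show "form (p1 x) (p1 x) = 0" using e'[of 0] e'[of 1] e'[of "-1"] by simp
    then show "form \<pp> (p1 x) \<noteq> 0" using e'[of 0] e'[of 1] P(1) by (auto simp: ab)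
  qed
  have p1f: "p1 x \<in> f x" for x by (rule conserved_quantity_in_f[OF \<mu> mid nd \<mu>p1 norms(1)])
  \<comment> \<open>Normalises the pairing of \<open>F\<close> with \<open>\<pp>\<close> to
    \<alpha>. The factor is only locally constant, as the surface may be disconnected; that its
    derivative vanishes keeps the rescaled potential closed.\<close>
  define k where "k x = \<alpha> / form \<pp> (p1 x)" for x
  have sk: "smooth_map k"
    unfolding k_def[abs_def] by (intro smooth_divide smooth_form smooth_const open_UNIV sm norms(2))
  have dpp: "form \<pp> (tderiv p1 x Z) = 0" for x Z
    using skew_self(2)[OF lowersD(1)[OF low], of \<pp> x Z] by (simp add: d1 form_simps)
  have sb: "smooth_map (\<lambda>x. form \<pp> (p1 x))" by (intro smooth_form smooth_const open_UNIV sm)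
  have db: "tderiv (\<lambda>x. form \<pp> (p1 x)) x Z = 0" for x Z
    using tderiv_form[OF open_UNIV smooth_const sm UNIV_I, of \<pp> x Z] dpp by (simp add: form_simps)
  have dk: "tderiv k x Z = 0" for x Z
  proof -
    have "tderiv (\<lambda>x. k x * form \<pp> (p1 x)) x Z = k x * tderiv (\<lambda>x. form \<pp> (p1 x)) x Z + tderiv k x Z * form \<pp> (p1 x)"
      by (rule tderiv_bilinear[OF bounded_bilinear_mult open_UNIV sk sb UNIV_I])
    moreover have "(\<lambda>x. k x * form \<pp> (p1 x)) = (\<lambda>_. \<alpha>)" using norms(2) by (auto simp: k_def)
    ultimately show ?thesis using db norms(2)[of x] by simp
  qed
  define F where "F x = k x *\<^sub>R p1 x" for x
  define \<rho> where "\<rho> x Z = k x *\<^sub>R \<mu> x Z" for x Z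
  have so: "smooth_one_form \<mu>" using \<mu> by (simp add: f_potential_def)
  have s\<rho>: "smooth_one_form \<rho>" unfolding \<rho>_def[abs_def] by (rule smooth_one_form_scaleR[OF sk so])
  have \<rho>: "f_potential f \<rho>" unfolding f_potential_def
  proof (intro conjI allI)
    show "closed_one_form \<rho>"
      using \<mu> ext_deriv_scaleR[OF sk dk so] by (simp add: closed_iff_ext_deriv \<rho>_def[abs_def] f_potential_def)
    show "lowers (f x) (\<rho> x Z)" for x Z unfolding \<rho>_def by (rule lowers_scaleR[OF subspace_f low])
  qed (rule s\<rho>)
  have mid\<rho>: "middle \<rho>" unfolding middle_def
  proof (intro allI impI)
    fix U \<sigma>1 \<sigma>2 X Y x Z assume "curvature_frame f s1 s2 U \<sigma>1 \<sigma>2 X Y" "x \<in> U"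
    then have "\<mu> x Z (along Y \<sigma>1 x) \<in> s1 x" "\<mu> x Z (along X \<sigma>2 x) \<in> s2 x"
      using mid unfolding middle_def by blast+
    then show "\<rho> x Z (along Y \<sigma>1 x) \<in> s1 x \<and> \<rho> x Z (along X \<sigma>2 x) \<in> s2 x"
      using subspace_fibre[OF bundle_s(1)] subspace_fibre[OF bundle_s(2)]
      by (simp add: \<rho>_def blinfun_simps subspace_scale)
  qed
  have F: "smooth_map F" "F y \<in> f y" "form \<pp> (F y) = \<alpha>" "tderiv F y Z = - \<rho> y Z \<pp>" for y Z
  proof -
    show "smooth_map F" unfolding F_def[abs_def] by (rule smooth_scaleR[OF open_UNIV sk sm])
    show "F y \<in> f y" by (simp add: F_def p1f subspace_scale subspace_f)
    show "form \<pp> (F y) = \<alpha>" using norms(2) by (simp add: F_def k_def form_simps)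
    show "tderiv F y Z = - \<rho> y Z \<pp>" using tderiv_scaleR[OF open_UNIV sk sm UNIV_I, of y Z] dk d1
      by (simp add: F_def[abs_def] \<rho>_def blinfun_simps)
  qed
  show "smooth_subbundle 1 (\<lambda>x. f x \<inter> orth {\<pp>})" by (rule line_bundle_f_p[OF \<rho> mid\<rho> \<alpha>_def[symmetric] \<alpha> F])
  have nd\<rho>: "nondegenerate (omega_q f \<rho> x)" for x
  proof -
    obtain U \<sigma>1 \<sigma>2 X Y where "curvature_frame f s1 s2 U \<sigma>1 \<sigma>2 X Y" and x: "x \<in> U"
      by (rule curvature_frame_exists)
    then interpret fr: curvature_frame f s1 s2 U \<sigma>1 \<sigma>2 X Y by simp
    have "k x \<noteq> 0" using norms(2)[of x] \<alpha> by (simp add: k_def)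
    then show ?thesis
      using nd[of x] unfolding fr.nondegenerate_omega_q_iff[OF \<rho> x] fr.nondegenerate_omega_q_iff[OF \<mu> x]
        fr.omega_q_XY(3,4)[OF \<rho> x] fr.omega_q_XY(3,4)[OF \<mu> x] by (simp add: \<rho>_def blinfun_simps form_simps)
  qed
  show "non_channel_guichard_surface \<pp> (\<lambda>x. f x \<inter> orth {\<pp>})"
    by (rule non_channel_guichard[OF \<rho> mid\<rho> \<alpha>_def[symmetric] \<alpha> F nd\<rho>])
qed

section \<open>Potentials and their middle representatives\<close>

lemma smooth_one_form_field:
  assumes \<eta>: "smooth_one_form \<eta>" and U: "open U" and X: "smooth_field_on U X"
  shows "smooth_map_on U (\<lambda>x. \<eta> x (X x))"
proof (rule smooth_local)
  fix x assume x: "x \<in> U"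
  define c where "c = chart_at x"
  have c: "c \<in> atlas" "x \<in> fst c" using chart_at by (auto simp: c_def)
  let ?W = "fst c \<inter> U"
  have W: "open ?W" "?W \<subseteq> fst c" using open_chart[OF c(1)] U by auto
  have s: "smooth_map_on ?W (\<lambda>y. tderiv (snd c) y (X y) \<bullet> b)" for b
    using X c by (intro smooth_bounded_linear[OF bounded_linear_inner_left W(1)]) (auto simp: smooth_field_on_def)
  have "smooth_map_on ?W (\<lambda>y. \<Sum>b\<in>Basis. (tderiv (snd c) y (X y) \<bullet> b) *\<^sub>R \<eta> y (coord_field c b y))"
    by (intro smooth_sum smooth_scaleR W(1) s smooth_one_form_coord[OF \<eta> c(1) W(2)])
  moreover have "(\<Sum>b\<in>Basis. (tderiv (snd c) y (X y) \<bullet> b) *\<^sub>R \<eta> y (coord_field c b y)) = \<eta> y (X y)" if "y \<in> ?W" for y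
  proof -
    have y: "y \<in> fst c" using that by simp
    note l = linear_compose[OF coord_field_linear[OF c(1) y] smooth_one_form_linear[OF \<eta>, of y]]
    show ?thesis
      using linear_Basis_expansion[OF l, of "tderiv (snd c) y (X y)"] coord_field_tderiv_chart[OF c(1) y, of "X y"] by simp
  qed
  ultimately have "smooth_map_on ?W (\<lambda>y. \<eta> y (X y))" by (rule smooth_cong[OF W(1), rotated])
  then show "\<exists>W. open W \<and> x \<in> W \<and> smooth_map_on W (\<lambda>x. \<eta> x (X x))" using W x c by blast
qed

context curvature_frame
begin

lemma wedge_space_of_lowers:
  assumes x: "x \<in> U" and A: "lowers (f x) A"
  shows "A \<in> wedge_space (f x) (orth (f x))"
proof -
  define c1 where "c1 = (- 1 / g1 x) *\<^sub>R z1 x"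
  define c2 where "c2 = (- 1 / g2 x) *\<^sub>R z2 x"
  have c: "form (\<sigma>1 x) c1 = 1" "form (\<sigma>2 x) c1 = 0" "form (\<sigma>1 x) c2 = 0" "form (\<sigma>2 x) c2 = 1"
    using z_\<sigma>[OF x] z_\<sigma>2[OF x] e_pos[OF x] e_pos2[OF x] by (simp_all add: c1_def c2_def form_simps)
  define k where "k = form (A c1) c2"
  \<comment> \<open>\<open>c1\<close> and \<open>c2\<close> are dual to \<open>\<sigma>1 x\<close>
    and \<open>\<sigma>2 x\<close>. The first two wedges count the part in the wedge square of
    \<open>f\<close> twice, and the last term corrects this.\<close>
  define B where "B = wedge (\<sigma>1 x) (A c1) + wedge (\<sigma>2 x) (A c2) - wedge (\<sigma>1 x) (k *\<^sub>R \<sigma>2 x)"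
  have \<sigma>: "\<sigma>1 x \<in> f x" "\<sigma>2 x \<in> f x" "k *\<^sub>R \<sigma>2 x \<in> orth (f x)" using section_\<sigma>[OF x] f_orth[of x] subspace_scale[OF subspace_f] by auto
  have B: "B \<in> wedge_space (f x) (orth (f x))"
    unfolding B_def by (intro subspace_diff subspace_add subspace_wedge_space wedge_in_wedge_space \<sigma> lowersD(4)[OF A])
  then have D: "lowers (f x) (A - B)" by (intro lowers_diff subspace_f A lowers_wedge_space isotropic_f)
  have sk: "form (A c2) c1 = - k" using skewD[OF lowersD(1)[OF A], of c2 c1] by (simp add: k_def form_commute[of "A c1"])
  have "(A - B) c1 = 0" "(A - B) c2 = 0" using c skew_self(1)[OF lowersD(1)[OF A]] sk
    by (simp_all add: B_def blinfun_simps wedge_apply form_simps k_def[symmetric])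
  then have "(A - B) (z1 x) = 0" "(A - B) (z2 x) = 0"
    using e_pos[OF x] e_pos2[OF x] by (simp_all add: c1_def c2_def blinfun_simps)
  then have "A = B" using lowers_eqI[OF x D] by simp
  then show ?thesis using B by simp
qed

text \<open>\<eta>(Y) v has no \<open>e2\<close> component because \<eta>(Y) e2 = 0, and \<eta>(X)
  annihilates what is left, \<open>f\<close> and \<open>e1\<close>.\<close>

lemma potential_XY_compose:
  assumes \<eta>: "f_potential f \<eta>" and x: "x \<in> U"
  shows "\<eta> x (X x) (\<eta> x (Y x) v) = 0"
proof -
  have low: "lowers (f x) (\<eta> x Z)" for Z using \<eta> by (simp add: f_potential_def)
  obtain a k l where a: "a \<in> f x" "\<eta> x (Y x) v = a + k *\<^sub>R e1 x + l *\<^sub>R e2 x"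
    by (rule orth_f_coeffs[OF x lowersD(4)[OF low]])
  have "form (\<eta> x (Y x) v) (e2 x) = 0"
    using skewD[OF lowersD(1)[OF low], of "Y x" v "e2 x"] potential_Y_e[OF \<eta> x] by (simp add: form_simps)
  then have "l * g2 x = 0" using f_perp(1)[OF x a(1) e_orth2[OF x]] e_e[OF x] by (simp add: a(2) form_simps)
  then have "l = 0" using e_pos2[OF x] by auto
  then show ?thesis using lowersD(2)[OF low a(1)] potential_X_e[OF \<eta> x] by (simp add: a(2) blinfun_simps)
qed

lemma wedge_space_f_f:
  assumes x: "x \<in> U" and A: "A \<in> wedge_space (f x) (f x)"
  obtains k where "A = k *\<^sub>R wedge (\<sigma>1 x) (\<sigma>2 x)"
proof -
  have "\<exists>k. A = k *\<^sub>R wedge (\<sigma>1 x) (\<sigma>2 x)" using A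
  proof (rule wedge_space_induct)
    show "subspace {A. \<exists>k. A = k *\<^sub>R wedge (\<sigma>1 x) (\<sigma>2 x)}"
      using subspace_span[of "{wedge (\<sigma>1 x) (\<sigma>2 x)}"] by (simp add: span_singleton image_def)
    fix a b assume "a \<in> f x" "b \<in> f x"
    then obtain a1 a2 b1 b2 where "a = a1 *\<^sub>R \<sigma>1 x + a2 *\<^sub>R \<sigma>2 x" "b = b1 *\<^sub>R \<sigma>1 x + b2 *\<^sub>R \<sigma>2 x"
      using f_expand[OF x] by metis
    then have "wedge a b = (a1 * b2 - a2 * b1) *\<^sub>R wedge (\<sigma>1 x) (\<sigma>2 x)" using wedge_swap[of "\<sigma>2 x" "\<sigma>1 x"]
      by (simp add: wedge.add_left wedge.add_right wedge.scaleR_left wedge.scaleR_right algebra_simps)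
    then show "\<exists>k. wedge a b = k *\<^sub>R wedge (\<sigma>1 x) (\<sigma>2 x)" by blast
  qed
  then show ?thesis using that by blast
qed

text \<open>The \<open>\<sigma>1\<close>-coefficient of \<open>\<eta>(X) d\<^sub>X \<sigma>2\<close> and the \<open>\<sigma>2\<close>-coefficient of \<open>\<eta>(Y) d\<^sub>Y \<sigma>1\<close> are removed by
  one and the same \<open>\<tau>\<close> because \<open>\<eta>\<close> is closed.\<close>

lemma local_middle:
  assumes \<eta>: "f_potential f \<eta>"
  obtains \<tau> where "\<tau> \<in> sections_on U (\<lambda>x. wedge_space (f x) (f x))"
    "\<forall>y\<in>U. \<forall>Z. (\<eta> y Z - tderiv \<tau> y Z) (e1 y) \<in> s1 y \<and> (\<eta> y Z - tderiv \<tau> y Z) (e2 y) \<in> s2 y"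
proof -
  have low: "lowers (f y) (\<eta> y Z)" and \<eta>': "smooth_one_form \<eta>" "closed_one_form \<eta>" for y Z
    using \<eta> by (auto simp: f_potential_def)
  note sk = skewD[OF lowersD(1)[OF low]]
  \<comment> \<open>Solves for a vanishing \<sigma>1 component of (\<eta> - d\<tau>)(X) e2, using
    d\<tau>(X) e2 = - \<tau> z2 and (\<sigma>2, z2) = - g2.\<close>
  define u where "u y = form (\<eta> y (X y) (e2 y)) (z1 y) / (g1 y * g2 y)" for y
  define \<tau> where "\<tau> y = u y *\<^sub>R wedge (\<sigma>1 y) (\<sigma>2 y)" for y
  have pos: "g1 y > 0" "g2 y > 0" if "y \<in> U" for y using e_pos e_pos2 that by auto
  have "smooth_map_on U u" unfolding u_def[abs_def]
    by (intro smooth_divide smooth_intros smooth_form smooth_apply smooth_one_form_field[OF \<eta>'(1)] U XY smooth_e smooth_e2 smooth_z)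
      (use pos in \<open>fastforce simp: mult_less_0_iff\<close>)
  then have "smooth_map_on U \<tau>" unfolding \<tau>_def[abs_def] by (intro smooth_scaleR smooth_wedge U smooth_\<sigma>)
  moreover have "\<tau> y \<in> wedge_space (f y) (f y)" if "y \<in> U" for y
    unfolding \<tau>_def by (intro subspace_scale subspace_wedge_space wedge_in_wedge_space section_\<sigma> that)
  ultimately have \<tau>: "\<tau> \<in> sections_on U (\<lambda>x. wedge_space (f x) (f x))" by (auto simp: sections_on_def)
  \<comment> \<open>Closedness, paired with \<open>e1\<close> and \<open>e2\<close>: the two
    unwanted components carry the same information, so a single scalar \<open>u\<close> removes
    both.\<close>
  have u2: "form (\<eta> y (Y y) (e1 y)) (z2 y) = - form (\<eta> y (X y) (e2 y)) (z1 y)" if y: "y \<in> U" for y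
  proof -
    have "form (\<eta> y Z (e1 y)) (e2 y) = 0" if "y \<in> U" for y Z
      using lowersD(3)[OF low e_orth[OF that]] f_perp(1)[OF that _ e_orth2[OF that]] by blast
    from closed_pairing[OF \<eta>' U y smooth_e smooth_e2 this, of "X y" "Y y"]
    have "form (\<eta> y (X y) (z1 y)) (e2 y) = form (\<eta> y (Y y) (e1 y)) (z2 y)"
      using potential_X_e[OF \<eta> y] potential_Y_e[OF \<eta> y] sk[of y "Y y" "along X e1 y" "e2 y"]
      by (simp add: form_simps flip: along_def)
    then show ?thesis using sk[of y "X y" "z1 y" "e2 y"] form_commute[of "z1 y" "\<eta> y (X y) (e2 y)"] by simp
  qed
  have d: "tderiv \<tau> y (W y) (e1 y) = - \<tau> y (along W e1 y)"
      "tderiv \<tau> y (W y) (e2 y) = - \<tau> y (along W e2 y)" if "y \<in> U" for y W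
    using tderiv_\<tau>_e[OF \<tau> that, of "W y"] by (auto simp: along_def[of W])
  have lin: "linear (\<lambda>Z. (\<eta> y Z - tderiv \<tau> y Z) v)" if "y \<in> U" for y v
    using linear_compose_sub[OF smooth_one_form_linear[OF \<eta>'(1)] tderiv_linear[OF U \<open>smooth_map_on U \<tau>\<close> that], of y]
      linear_compose[OF _ bounded_linear.linear[OF blinfun.bounded_linear_left[of v]]] by (simp add: o_def)
  have s: "subspace (s1 y)" "subspace (s2 y)" for y using subspace_fibre bundle_s by blast+
  have XY_ind: "(\<eta> y Z - tderiv \<tau> y Z) v \<in> s"
    if y: "y \<in> U" and s: "subspace s" "(\<eta> y (X y) - tderiv \<tau> y (X y)) v \<in> s" "(\<eta> y (Y y) - tderiv \<tau> y (Y y)) v \<in> s" for y Z v s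
  proof -
    obtain a b where Z: "Z = a *\<^sub>R X y + b *\<^sub>R Y y" by (rule XY_basis[OF y])
    show ?thesis
      unfolding Z linear_add[OF lin[OF y]] linear_scale[OF lin[OF y]] by (intro subspace_add subspace_scale s)
  qed
  have c: "form (\<sigma>1 y) (along X e1 y) = 0" "form (\<sigma>2 y) (along X e1 y) = 0"
    "form (\<sigma>1 y) (along Y e2 y) = 0" "form (\<sigma>2 y) (along Y e2 y) = 0" if "y \<in> U" for y
    using along_X_e(1)[OF that] curvature_frame.along_X_e(1)[OF frame_swap that] section_\<sigma>[OF that] f_perp(1)[OF that] by auto
  have \<tau>v: "\<tau> y v = u y *\<^sub>R (form (\<sigma>1 y) v *\<^sub>R \<sigma>2 y - form (\<sigma>2 y) v *\<^sub>R \<sigma>1 y)" for y v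
    by (simp add: \<tau>_def blinfun_simps wedge_apply)
  have "(\<eta> y Z - tderiv \<tau> y Z) (e1 y) \<in> s1 y" if y: "y \<in> U" for y Z
  proof (rule XY_ind[OF y s(1)])
    show "(\<eta> y (X y) - tderiv \<tau> y (X y)) (e1 y) \<in> s1 y"
      using c[OF y] potential_X_e[OF \<eta> y] subspace_0[OF s(1)[of y]]
      by (simp add: blinfun_simps d[OF y, of X] d[OF y, of Y] \<tau>v)
    let ?w = "(\<eta> y (Y y) - tderiv \<tau> y (Y y)) (e1 y)"
    have w: "?w = \<eta> y (Y y) (e1 y) - (u y * g1 y) *\<^sub>R \<sigma>2 y"
      using z_\<sigma>[OF y] by (simp add: blinfun_simps d[OF y, of X] d[OF y, of Y] \<tau>v)
    have wf: "?w \<in> f y" unfolding w using potential_values(2)[OF \<eta> y] section_\<sigma>(2)[OF y]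
      by (intro subspace_diff subspace_scale subspace_f)
    have "form ?w (z2 y) = 0" unfolding w using u2[OF y] z_\<sigma>2[OF y] pos[OF y] by (simp add: form_simps u_def)
    then show "?w \<in> s1 y" using f_coeffs[OF y wf] by (metis (no_types, lifting) s1[OF y] add.right_neutral divide_eq_0_iff neg_0_equal_iff_equal scale_zero_left span_base span_scale singletonI)
  qed
  moreover have "(\<eta> y Z - tderiv \<tau> y Z) (e2 y) \<in> s2 y" if y: "y \<in> U" for y Z
  proof (rule XY_ind[OF y s(2)])
    show "(\<eta> y (Y y) - tderiv \<tau> y (Y y)) (e2 y) \<in> s2 y"
      using c[OF y] potential_Y_e[OF \<eta> y] subspace_0[OF s(2)[of y]]
      by (simp add: blinfun_simps d[OF y, of X] d[OF y, of Y] \<tau>v)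
    let ?w = "(\<eta> y (X y) - tderiv \<tau> y (X y)) (e2 y)"
    have w: "?w = \<eta> y (X y) (e2 y) + (u y * g2 y) *\<^sub>R \<sigma>1 y"
      using z_\<sigma>2[OF y] by (simp add: blinfun_simps d[OF y, of X] d[OF y, of Y] \<tau>v)
    have wf: "?w \<in> f y" unfolding w using potential_values(1)[OF \<eta> y] section_\<sigma>(1)[OF y]
      by (intro subspace_add subspace_scale subspace_f)
    have "form ?w (z1 y) = 0" unfolding w using z_\<sigma>[OF y] pos[OF y] by (simp add: form_simps u_def)
    then show "?w \<in> s2 y" using f_coeffs[OF y wf] by (metis (no_types, lifting) s2[OF y] add.left_neutral divide_eq_0_iff neg_0_equal_iff_equal scale_zero_left span_base span_scale singletonI)
  qed
  ultimately show ?thesis using that \<tau> by blast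
qed

text \<open>For \<tau> = k \<sigma>1 \<and> \<sigma>2 one has d\<tau>(X) e2 = - k g2 \<sigma>1,
  which lies in \<open>s2\<close> only if k = 0.\<close>

lemma middle_unique:
  assumes x: "x \<in> U" and \<tau>: "\<tau> \<in> sections_on U (\<lambda>x. wedge_space (f x) (f x))"
    and m: "tderiv \<tau> x (X x) (e2 x) \<in> s2 x"
  shows "\<tau> x = 0"
proof -
  have "\<tau> x \<in> wedge_space (f x) (f x)" using \<tau> x by (auto simp: sections_on_def)
  then obtain k where k: "\<tau> x = k *\<^sub>R wedge (\<sigma>1 x) (\<sigma>2 x)" by (rule wedge_space_f_f[OF x])
  have "tderiv \<tau> x (X x) (e2 x) = - (k * g2 x) *\<^sub>R \<sigma>1 x" using tderiv_\<tau>_e(2)[OF \<tau> x, of "X x"] z_\<sigma>2[OF x]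
    by (simp add: k blinfun_simps wedge_apply flip: along_def)
  then have l: "- (k * g2 x) *\<^sub>R \<sigma>1 x \<in> span {\<sigma>2 x}" using m s2[OF x] by simp
  have "k * g2 x = 0"
  proof (rule ccontr)
    assume n: "k * g2 x \<noteq> 0"
    then have "\<sigma>1 x \<in> span {\<sigma>2 x}" using span_scale[OF l, of "- (1 / (k * g2 x))"] by simp
    then show False using indep[OF x] neq[OF x] by (simp add: independent_insert)
  qed
  then show ?thesis using e_pos2[OF x] k by simp
qed

end

section \<open>The global middle gauge and the defining properties of an \<Omega>-surface\<close>

context legendre_pair
begin

lemma f_potential_wedge_space:
  assumes "lowers (f x) A"
  shows "A \<in> wedge_space (f x) (orth (f x))"
proof -
  obtain U \<sigma>1 \<sigma>2 X Y where fr: "curvature_frame f s1 s2 U \<sigma>1 \<sigma>2 X Y" "x \<in> U" by (rule curvature_frame_exists)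
  show ?thesis by (rule curvature_frame.wedge_space_of_lowers[OF fr assms])
qed

lemma f_potential_commute:
  assumes \<eta>: "f_potential f \<eta>"
  shows "\<eta> x Z o\<^sub>L \<eta> x W = \<eta> x W o\<^sub>L \<eta> x Z"
proof (rule blinfun_eqI)
  fix v
  obtain U \<sigma>1 \<sigma>2 X Y where "curvature_frame f s1 s2 U \<sigma>1 \<sigma>2 X Y" and x: "x \<in> U"
    by (rule curvature_frame_exists)
  then interpret fr: curvature_frame f s1 s2 U \<sigma>1 \<sigma>2 X Y by simp
  obtain a b where Z: "Z = a *\<^sub>R X x + b *\<^sub>R Y x" by (rule fr.XY_basis[OF x])
  obtain c d where W: "W = c *\<^sub>R X x + d *\<^sub>R Y x" by (rule fr.XY_basis[OF x])
  have l: "linear (\<eta> x)" using \<eta> smooth_one_form_linear by (auto simp: f_potential_def)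
  have "\<eta> x (X x) (\<eta> x (Y x) v) = 0" "\<eta> x (Y x) (\<eta> x (X x) v) = 0"
    using fr.potential_XY_compose[OF \<eta> x] curvature_frame.potential_XY_compose[OF fr.frame_swap \<eta> x] by auto
  then show "(\<eta> x Z o\<^sub>L \<eta> x W) v = (\<eta> x W o\<^sub>L \<eta> x Z) v"
    by (simp add: Z W linear_add[OF l] linear_scale[OF l] blinfun_simps mult.commute[of c a] mult.commute[of d b])
qed

lemma gauge_potentialI:
  assumes \<eta>: "f_potential f \<eta>" and nd: "nondegenerate (omega_q f \<eta> x)"
  shows "gauge_potential f \<eta>"
proof -
  \<comment> \<open>\<open>1\<close> is the constant vector of the plane, here just some non-zero
    tangent vector.\<close>
  have "\<exists>Y. omega_q f \<eta> x 1 Y \<noteq> 0" using nd by (simp add: nondegenerate_def)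
  then show ?thesis using \<eta> f_potential_wedge_space f_potential_commute[OF \<eta>]
    unfolding gauge_potential_def f_potential_def by blast
qed

text \<open>In a frame the signature is read off from the signs of two continuous functions without
  zeros, hence is locally constant.\<close>

lemma constant_signature:
  assumes \<eta>: "f_potential f \<eta>" and nd: "\<And>x. nondegenerate (omega_q f \<eta> x)"
    and C: "connected C" "x \<in> C" "y \<in> C"
  shows "signature (omega_q f \<eta> x) UNIV = signature (omega_q f \<eta> y) UNIV"
proof (rule connected_local_const[OF C], rule ballI)
  fix x
  obtain U \<sigma>1 \<sigma>2 X Y where "curvature_frame f s1 s2 U \<sigma>1 \<sigma>2 X Y" and x: "x \<in> U"
    by (rule curvature_frame_exists)
  then interpret fr: curvature_frame f s1 s2 U \<sigma>1 \<sigma>2 X Y by simp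
  have \<eta>': "smooth_one_form \<eta>" using \<eta> by (simp add: f_potential_def)
  define a where "a y = - form (\<eta> y (X y) (along X \<sigma>2 y)) (fr.z2 y) / fr.g2 y" for y
  define b where "b y = - form (\<eta> y (Y y) (along Y \<sigma>1 y)) (fr.z1 y) / fr.g1 y" for y
  have q: "omega_q f \<eta> y (X y) (X y) = a y" "omega_q f \<eta> y (Y y) (Y y) = b y" if "y \<in> U" for y
    using fr.omega_q_XY(3,4)[OF \<eta> that] by (simp_all add: a_def b_def)
  have "smooth_map_on U (\<lambda>y. - form (\<eta> y (X y) (along X \<sigma>2 y)) (fr.z2 y))" "smooth_map_on U (\<lambda>y. - form (\<eta> y (Y y) (along Y \<sigma>1 y)) (fr.z1 y))"
    by (intro smooth_bounded_linear[OF bounded_linear_minus[OF bounded_linear_ident]] smooth_form smooth_apply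
      smooth_one_form_field[OF \<eta>'] fr.U fr.XY fr.smooth_e fr.smooth_e2 fr.smooth_z curvature_frame.smooth_z[OF fr.frame_swap])+
  then have "smooth_map_on U a" "smooth_map_on U b"
    unfolding a_def[abs_def] b_def[abs_def] using fr.e_pos fr.e_pos2
    by (intro smooth_divide smooth_form fr.U fr.smooth_e fr.smooth_e2; fastforce)+
  then have "continuous_on U a" "continuous_on U b" using smooth_continuous fr.U by blast+
  then have "(a \<longlongrightarrow> a x) (at x)" "(b \<longlongrightarrow> b x) (at x)"
    using fr.U x by (auto simp: continuous_on_eq_continuous_at isCont_def)
  moreover have "a x \<noteq> 0" "b x \<noteq> 0" using nd[of x] fr.nondegenerate_omega_q_iff[OF \<eta> x] q[OF x] by auto
  ultimately have "eventually (\<lambda>y. a y * a x > 0 \<and> b y * b x > 0) (at x)"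
    by (intro eventually_conj order_tendstoD(1)[of _ "a x * a x"] order_tendstoD(1)[of _ "b x * b x"] tendsto_intros)
      (auto simp: zero_less_mult_iff)
  moreover have "eventually (\<lambda>y. y \<in> U) (at x)" using fr.U x by (rule eventually_at_in_open')
  ultimately have "eventually (\<lambda>y. signature (omega_q f \<eta> x) UNIV = signature (omega_q f \<eta> y) UNIV) (at x)"
  proof eventually_elim
    case (elim y)
    then show ?case
      unfolding fr.signature_omega_q[OF \<eta> x] fr.signature_omega_q[OF \<eta> elim(2)] q[OF x] q[OF elim(2)]
      by (auto simp: zero_less_mult_iff of_bool_def)
  qed
  then show "eventually (\<lambda>y. signature (omega_q f \<eta> x) UNIV = signature (omega_q f \<eta> y) UNIV) (at x within C)"
    by (rule filter_leD[OF at_le[OF subset_UNIV]])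
qed

text \<open>Local solutions are glued under a condition stated with \<open>mixed\<close>, which
  mentions no frame. The difference of two of them falls under \<open>middle_unique\<close> and is
  therefore 0.\<close>

lemma middle_exists:
  assumes \<eta>: "f_potential f \<eta>"
  obtains \<tau> where "\<tau> \<in> sections (\<lambda>x. wedge_space (f x) (f x))" "middle (\<lambda>x X. \<eta> x X - tderiv \<tau> x X)"
proof -
  let ?ff = "\<lambda>x. wedge_space (f x) (f x)"
  define good where "good U \<tau> \<longleftrightarrow> \<tau> \<in> sections_on U ?ff \<and>
    (\<forall>y\<in>U. \<forall>Z. mixed y (\<eta> y Z - tderiv \<tau> y Z) \<in> ?ff y)" for U :: "'m set" and \<tau>
  have low: "lowers (f y) (\<eta> y Z)" for y Z using \<eta> by (auto simp: f_potential_def)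
  have low': "lowers (f x) (\<eta> x Z - tderiv \<tau> x Z)"
    if fr: "curvature_frame f s1 s2 U \<sigma>1 \<sigma>2 X Y" and x: "x \<in> U" and \<tau>: "\<tau> \<in> sections_on U ?ff" for U \<sigma>1 \<sigma>2 X Y x \<tau> Z
    using low curvature_frame.lowers_tderiv_\<tau>[OF fr \<tau> x] by (intro lowers_diff subspace_f)
  have "\<exists>G. smooth_map G \<and> (\<forall>x. \<exists>U g. open U \<and> x \<in> U \<and> smooth_map_on U g \<and> good U g \<and> (\<forall>y\<in>U. G y = g y))"
  proof (rule gluing[where good = good])
    fix x
    obtain U \<sigma>1 \<sigma>2 X Y where fr: "curvature_frame f s1 s2 U \<sigma>1 \<sigma>2 X Y" and x: "x \<in> U"
      by (rule curvature_frame_exists)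
    obtain \<tau> where \<tau>: "\<tau> \<in> sections_on U ?ff"
      "\<forall>y\<in>U. \<forall>Z. (\<eta> y Z - tderiv \<tau> y Z) (along Y \<sigma>1 y) \<in> s1 y \<and> (\<eta> y Z - tderiv \<tau> y Z) (along X \<sigma>2 y) \<in> s2 y"
      by (rule curvature_frame.local_middle[OF fr \<eta>])
    have "good U \<tau>" unfolding good_def using \<tau> mixed_iff[OF fr _ low'[OF fr _ \<tau>(1)]] by blast
    then show "\<exists>U g. open U \<and> x \<in> U \<and> smooth_map_on U g \<and> good U g"
      using curvature_frame.U[OF fr] x \<tau>(1) by (auto simp: sections_on_def)
  next
    fix U W :: "'m set" and g h y
    assume o: "open U" "open W" and gh: "good U g" "good W h" and y: "y \<in> U" "y \<in> W"
    obtain U' \<sigma>1 \<sigma>2 X Y where fr': "curvature_frame f s1 s2 U' \<sigma>1 \<sigma>2 X Y" "y \<in> U'"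
      by (rule curvature_frame_exists)
    define I where "I = U \<inter> W \<inter> U'"
    have I: "open I" "y \<in> I" using o y fr'(2) curvature_frame.U[OF fr'(1)] by (auto simp: I_def)
    have fr: "curvature_frame f s1 s2 I \<sigma>1 \<sigma>2 X Y"
      by (rule curvature_frame.frame_subset[OF fr'(1) I(1)]) (auto simp: I_def)
    interpret fr: curvature_frame f s1 s2 I \<sigma>1 \<sigma>2 X Y by (rule fr)
    have "smooth_map_on U g" "smooth_map_on W h" using gh by (simp_all add: good_def sections_on_def)
    moreover have "I \<subseteq> U" "I \<subseteq> W" by (auto simp: I_def)
    ultimately have sm: "smooth_map_on I g" "smooth_map_on I h" using smooth_subset by metis+
    have gI: "g \<in> sections_on I ?ff" "h \<in> sections_on I ?ff"
      using gh sm by (simp_all add: good_def sections_on_def I_def)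
    have d: "(\<lambda>y. g y - h y) \<in> sections_on I ?ff"
      using gI smooth_diff[OF I(1) sm] by (auto simp: sections_on_def subspace_diff)
    have "mixed y (\<eta> y (X y) - tderiv g y (X y)) \<in> ?ff y"
      "mixed y (\<eta> y (X y) - tderiv h y (X y)) \<in> ?ff y" using gh y by (simp_all add: good_def)
    then have "(\<eta> y (X y) - tderiv g y (X y)) (along X \<sigma>2 y) \<in> s2 y" "(\<eta> y (X y) - tderiv h y (X y)) (along X \<sigma>2 y) \<in> s2 y"
      unfolding mixed_iff[OF fr I(2) low'[OF fr I(2) gI(1)]] mixed_iff[OF fr I(2) low'[OF fr I(2) gI(2)]] by simp_all
    from subspace_diff[OF subspace_fibre[OF bundle_s(2)] this(2,1)]
    have "tderiv (\<lambda>y. g y - h y) y (X y) (along X \<sigma>2 y) \<in> s2 y"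
      using tderiv_diff[OF I(1) sm I(2), of "X y"] by (simp add: blinfun_simps)
    from fr.middle_unique[OF I(2) d this] show "g y = h y" by simp
  next
    fix G assume "smooth_map G" "\<And>x. \<exists>U g. open U \<and> x \<in> U \<and> smooth_map_on U g \<and> good U g \<and> (\<forall>y\<in>U. G y = g y)"
    then show ?thesis by (intro exI[of _ G] conjI allI)
  qed
  then obtain G where G: "smooth_map G" "\<forall>x. \<exists>U g. open U \<and> x \<in> U \<and> smooth_map_on U g \<and> good U g \<and> (\<forall>y\<in>U. G y = g y)"
    by auto
  have G': "G x \<in> ?ff x" "mixed x (\<eta> x Z - tderiv G x Z) \<in> ?ff x" for x Z
  proof -
    obtain U g where g: "open U" "x \<in> U" "smooth_map_on U g" "good U g" "\<And>y. y \<in> U \<Longrightarrow> G y = g y"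
      using G(2)[rule_format, of x] by auto
    have "tderiv G x Z = tderiv g x Z" using tderiv_cong[OF g(1-3), of G Z] g(5) by simp
    then show "G x \<in> ?ff x" "mixed x (\<eta> x Z - tderiv G x Z) \<in> ?ff x"
      using g(4) g(5)[OF g(2)] g(2) by (auto simp: good_def sections_on_def)
  qed
  have s: "G \<in> sections ?ff" using G(1) G'(1) by (auto simp: sections_def)
  have "lowers (f x) (\<eta> x Z - tderiv G x Z)" for x Z
    using gauge_f_potential[OF \<eta> s] by (auto simp: f_potential_def)
  then have "middle (\<lambda>x X. \<eta> x X - tderiv G x X)" using G'(2) by (subst middle_iff) auto
  then show ?thesis using that s by blast
qed

end

section \<open>From Guichard surfaces to special surfaces of type 1\<close>

lemma smooth_zero_on_closure:
  fixes g :: "'m::smooth_surface \<Rightarrow> 'b::real_normed_vector"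
  assumes U: "open U" "smooth_map_on U g" and 0: "\<And>y. y \<in> U \<Longrightarrow> y \<in> D \<Longrightarrow> g y = 0" and x: "x \<in> U" "x \<in> closure D"
  shows "g x = 0"
proof (rule ccontr)
  assume "g x \<noteq> 0"
  define G where "G = U \<inter> g -` (- {0})"
  have "open G" unfolding G_def by (rule continuous_open_preimage[OF smooth_continuous[OF U] U(1)]) auto
  moreover have "x \<in> G" using x \<open>g x \<noteq> 0\<close> by (simp add: G_def)
  ultimately have "G \<inter> D \<noteq> {}" using x(2) open_Int_closure_eq_empty[of G D] by auto
  then show False using 0 by (auto simp: G_def)
qed

lemma bounded_linear_inv_lower: "bounded_linear (inv (lower :: 'v::r42 \<Rightarrow> 'v))"
proof (rule linear_conv_bounded_linear[THEN iffD1], rule linearI)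
  have l: "lower (inv lower v) = v" for v :: 'v using surj_f_inv_f[OF bij_is_surj[OF bij_lower]] .
  have i: "inv lower v = w \<longleftrightarrow> v = lower w" for v w :: 'v using l inv_f_f[OF inj_lower] by metis
  show "inv lower (v + w) = inv lower v + inv lower w" for v w :: 'v by (simp add: i linear_add[OF linear_lower] l)
  show "inv lower (c *\<^sub>R v) = c *\<^sub>R inv lower v" for c and v :: 'v by (simp add: i linear_scale[OF linear_lower] l)
qed

lemma form_inv_lower: "form (inv lower v) w = v \<bullet> (w :: 'v::r42)"
  using lower_inner[of "inv lower v" w] surj_f_inv_f[OF bij_is_surj[OF bij_lower]] by metis

lemma sphere_congruence_normal:
  fixes V :: "'m::smooth_surface \<Rightarrow> 'v::r42 set"
  assumes p: "form p p = \<alpha>" "\<alpha> \<noteq> 0" and V: "sphere_congruence p V"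
  obtains \<kappa> Q \<nu> where "sphere_normal p \<alpha> \<kappa> V Q \<nu>" "x \<in> Q"
proof -
  have VV: "smooth_subbundle 4 V" "\<And>x. V x \<subseteq> orth {p}" "\<And>x. signature form (V x) = (3, 1)"
    using V by (auto simp: sphere_congruence_def)
  have sV: "subspace (V x)" "dim (V x) = 4" for x using subspace_fibre[OF VV(1)] dim_fibre[OF VV(1)] by auto
  have nd: "nondeg (V x)" for x by (rule signature_3_1(1)[OF sV VV(3)])
  have po: "p \<in> orth (V x)" for x using VV(2)[of x] by (auto simp: orth_def form_commute)
  have dim: "dim (orth (V x)) = 2" for x using dim_orth[OF sV(1), of x] sV(2)[of x] by simp
  have p0: "p \<noteq> 0" using p by (auto simp: form_simps)
  have "\<not> orth (V x) \<subseteq> span {p}"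
    using dim_subset[of "orth (V x)" "span {p}"] dim[of x] dim_le_card'[of "{p}"] by (auto simp: dim_span)
  then obtain u where u: "u \<in> orth (V x)" "u \<notin> span {p}" by blast
  define n where "n = u - (form p u / \<alpha>) *\<^sub>R p"
  have n: "n \<in> orth (V x)" "form p n = 0"
    using u po p by (auto simp: n_def form_simps intro!: subspace_diff subspace_scale)
  have n0: "n \<noteq> 0"
  proof
    assume "n = 0"
    then have "u = (form p u / \<alpha>) *\<^sub>R p" by (simp add: n_def)
    then show False using u(2) span_scale[OF span_base[of p "{p}"], of "form p u / \<alpha>"] by (metis singletonI)
  qed
  have span_eq: "orth (V y) = span {p, m}" if m: "m \<in> orth (V y)" "form p m = 0" "m \<noteq> 0" for y m
  proof -
    have "p \<notin> span {m}" using m(2) p by (auto simp: span_singleton form_simps form_commute)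
    then have "span {p} \<noteq> span {m}" using span_base[of p "{p}"] by auto
    then show ?thesis by (rule two_lines(1)[OF p0 _ m(3) subspace_orth dim po m(1)])
  qed
  have nn: "form n n \<noteq> 0"
  proof
    assume 0: "form n n = 0"
    have "form n w = 0" if "w \<in> orth (V x)" for w
    proof -
      obtain a b where "w = a *\<^sub>R p + b *\<^sub>R n" using \<open>w \<in> _\<close> unfolding span_eq[OF n n0]
        by (auto simp: span_insert span_singleton algebra_simps)
      then show ?thesis using 0 n(2) by (simp add: form_simps form_commute[of n p])
    qed
    then show False using nondeg_orth[OF nd, of x] n n0 by (auto simp: nondeg_def)
  qed
  \<comment> \<open>The Euclidean complement of \<open>V y\<close> is the image of
    \<open>orth (V y)\<close> under \<open>lower\<close>. Projecting there and raising the index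
    again extends \<open>n\<close> to a smooth section of \<open>orth (V y)\<close>.\<close>
  define w where "w y = inv lower (lower n - eproj (V y) (lower n))" for y
  have w: "w y \<in> orth (V y)" for y
    using eproj(2)[OF sV(1), of _ y "lower n"] by (auto simp: w_def orth_def form_commute[of _ "inv lower _"] form_inv_lower inner_commute)
  have "eproj (V x) (lower n) = 0"
    using n(1) by (intro eproj_eqI sV subspace_0) (auto simp: lower_inner inner_commute[of _ "lower n"] orth_def form_commute[of n])
  then have wx: "w x = n" using inv_f_f[OF inj_lower] by (simp add: w_def)
  have sw: "smooth_map w"
    unfolding w_def[abs_def] by (intro smooth_bounded_linear[OF bounded_linear_inv_lower] smooth_intros smooth_eproj[OF VV(1)] open_UNIV)
  define m where "m y = w y - (form p (w y) / \<alpha>) *\<^sub>R p" for y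
  have m: "m y \<in> orth (V y)" "form p (m y) = 0" for y
    using w po p by (auto simp: m_def form_simps intro!: subspace_diff subspace_scale)
  have mx: "m x = n" using n(2) by (simp add: m_def wx)
  have sm: "smooth_map m"
    unfolding m_def[abs_def] by (intro smooth_intros smooth_form smooth_divide sw open_UNIV) (use p in auto)
  \<comment> \<open>Only the sign of the norm survives the normalisation: \<open>\<nu>\<close> is
    \<open>m\<close> divided by the square root of the modulus of its norm, on the open set
    \<open>Q\<close> where that norm keeps its sign.\<close>
  define \<kappa> where "\<kappa> = sgn (form n n)"
  have \<kappa>: "\<kappa> * \<kappa> = 1" using nn by (auto simp: \<kappa>_def sgn_if)
  define g where "g y = \<kappa> * form (m y) (m y)" for y
  have sg: "smooth_map g"
    unfolding g_def[abs_def] by (intro smooth_bounded_linear[OF bounded_linear_mult_right] smooth_form sm open_UNIV)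
  define Q where "Q = g -` {0<..}"
  have "continuous_on UNIV g" by (rule smooth_continuous[OF open_UNIV sg])
  then have Q: "open Q" unfolding Q_def by (rule open_vimage[OF open_greaterThan])
  have xQ: "x \<in> Q" using nn by (auto simp: Q_def g_def mx \<kappa>_def sgn_if)
  define \<nu> where "\<nu> y = (g y powr (- 1 / 2)) *\<^sub>R m y" for y
  show ?thesis
  proof (rule that[OF _ xQ])
    show "sphere_normal p \<alpha> \<kappa> V Q \<nu>"
    proof
      show "\<kappa> \<noteq> 0" using \<kappa> by auto
      show "smooth_map_on Q \<nu>" unfolding \<nu>_def[abs_def]
        by (intro smooth_scaleR smooth_powr Q smooth_subset[OF sg] smooth_subset[OF sm]) (auto simp: Q_def)
      fix y assume "y \<in> Q"
      then have gy: "g y > 0" by (simp add: Q_def)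
      show "form p (\<nu> y) = 0" using m by (simp add: \<nu>_def form_simps)
      have pw: "(g y powr (- 1 / 2)) * (g y powr (- 1 / 2)) = 1 / g y"
        using gy by (simp add: powr_minus_divide flip: powr_add)
      have "form (m y) (m y) = \<kappa> * g y" using \<kappa> by (simp add: g_def mult.assoc[symmetric])
      then show "form (\<nu> y) (\<nu> y) = \<kappa>" using gy pw by (simp add: \<nu>_def form_simps mult.assoc[symmetric])
      have "m y \<noteq> 0" using gy by (auto simp: g_def form_simps)
      then have "\<nu> y \<noteq> 0" using gy by (simp add: \<nu>_def)
      moreover have "\<nu> y \<in> orth (V y)" using m by (simp add: \<nu>_def subspace_scale)
      ultimately have "orth (V y) = span {p, \<nu> y}" using \<open>form p (\<nu> y) = 0\<close> by (intro span_eq)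
      then show "V y = orth {p, \<nu> y}" using orth_orth[OF sV(1)[of y]] by (simp add: orth_span)
    qed (use p Q in auto)
  qed
qed

section \<open>Legendre maps with given Guichard data, and frames adapted to both\<close>

locale guichard_legendre = legendre_pair f s1 s2
  for f :: "'m::smooth_surface \<Rightarrow> 'v::r42 set" and s1 s2 :: "'m \<Rightarrow> 'v set" +
  fixes p :: 'v and \<alpha> :: real and V :: "'m \<Rightarrow> 'v set" and \<xi> :: "'m \<Rightarrow> real^2 \<Rightarrow> 'v \<Rightarrow>\<^sub>L 'v"
  assumes p_norm: "form p p = \<alpha>" "\<alpha> \<noteq> 0" and bundle_\<Lambda>: "smooth_subbundle 1 (\<lambda>x. f x \<inter> orth {p})"
    and data: "guichard_data p (\<lambda>x. f x \<inter> orth {p}) V \<xi>"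
    and nondegenerate_q: "\<And>x. nondegenerate (guichard_q (\<lambda>x. f x \<inter> orth {p}) V \<xi> x)"
begin

abbreviation \<Lambda> :: "'m \<Rightarrow> 'v set" where "\<Lambda> \<equiv> \<lambda>x. f x \<inter> orth {p}"

lemma swap_guichard: "guichard_legendre f s2 s1 p \<alpha> V \<xi>"
  by (intro guichard_legendre.intro guichard_legendre_axioms.intro swap p_norm bundle_\<Lambda> data nondegenerate_q)

lemma smooth_\<xi>: "smooth_one_form \<xi>" and \<xi>_wedge_space: "\<xi> x Z \<in> wedge_space (\<Lambda> x) (derived \<Lambda> x)"
  and flat_\<xi>: "flat (guichard_conn V \<xi> t)" and derived_V: "derived \<Lambda> x \<subseteq> V x" and congruence_V: "sphere_congruence p V"
  using data by (auto simp: guichard_data_def envelops_def)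

lemma V_fibre: "subspace (V x)" "dim (V x) = 4" "signature form (V x) = (3, 1)"
  using congruence_V subspace_fibre dim_fibre by (auto simp: sphere_congruence_def)

lemma derived_orth: "derived \<Lambda> x \<subseteq> orth (f x)"
proof -
  have "derived \<Lambda> x \<subseteq> derived f x" unfolding derived_def by (intro span_mono) (auto simp: sections_def)
  then show ?thesis using legendre by (auto simp: legendre_map_def)
qed

lemma lowers_\<xi>: "lowers (f x) (\<xi> x Z)"
  using wedge_space_mono[of "\<Lambda> x" "f x" "derived \<Lambda> x" "orth (f x)"] derived_orth[of x] \<xi>_wedge_space[of x Z]
  by (intro lowers_wedge_space subspace_f isotropic_f) auto

lemma \<xi>_orth_V: "v \<in> orth (V x) \<Longrightarrow> \<xi> x Z v = 0"
  using fibre_subset_derived[OF bundle_\<Lambda>, of x] derived_V[of x] orth_antimono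
  by (intro wedge_space_kills[OF \<xi>_wedge_space]) blast+

lemma exists_not_orth: "\<exists>v\<in>f x. form p v \<noteq> 0"
proof (rule ccontr)
  assume "\<not> ?thesis"
  then have "\<Lambda> x = f x" by (auto simp: orth_def)
  then show False using dim_fibre[OF bundle_\<Lambda>, of x] dim_f[of x] by simp
qed

end

context curvature_frame
begin

lemma hyp_swap: "curvature_frame.hyp \<sigma>2 \<sigma>1 p = (\<lambda>x. - hyp p x)"
  by (simp add: fun_eq_iff hyp_def curvature_frame.hyp_def[OF frame_swap])

lemma along_X_hyp_expand:
  assumes x: "x \<in> U"
  obtains a where "a \<in> f x" "along X (hyp p) x = a - form p (\<sigma>1 x) *\<^sub>R e2 x"
proof -
  obtain a k l where a: "a \<in> f x" "along X (hyp p) x = a + k *\<^sub>R e1 x + l *\<^sub>R e2 x"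
    by (rule orth_f_coeffs[OF x along_X_hyp(1)[OF x]])
  have e: "form (e2 x) (e1 x) = 0" using e_e[OF x] form_commute[of "e2 x" "e1 x"] by simp
  have "k * g1 x = 0" "l * g2 x = - form p (\<sigma>1 x) * g2 x"
    using along_X_hyp(2,3)[OF x, of p] f_perp(1)[OF x a(1) e_orth[OF x]] f_perp(1)[OF x a(1) e_orth2[OF x]] e_e[OF x] e
    unfolding a(2) by (simp_all add: form_simps)
  then have "k = 0" "l = - form p (\<sigma>1 x)"
    using e_pos[OF x] e_pos2[OF x] mult_right_cancel[of "g2 x" l "- form p (\<sigma>1 x)"] by auto
  then show ?thesis using that a by simp
qed

lemma along_Y_hyp_expand:
  assumes x: "x \<in> U"
  obtains a where "a \<in> f x" "along Y (hyp p) x = a + form p (\<sigma>2 x) *\<^sub>R e1 x"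
proof -
  obtain a where a: "a \<in> f x" "along Y (\<lambda>x. - hyp p x) x = a - form p (\<sigma>2 x) *\<^sub>R e1 x"
    using curvature_frame.along_X_hyp_expand[OF frame_swap x, of p] unfolding hyp_swap by blast
  have "along Y (\<lambda>x. - hyp p x) x = - along Y (hyp p) x"
    unfolding along_def by (rule tderiv_bounded_linear[OF bounded_linear_minus[OF bounded_linear_ident] U smooth_hyp x])
  then have "along Y (hyp p) x = - a + form p (\<sigma>2 x) *\<^sub>R e1 x" using a(2) by (simp add: algebra_simps)
  then show ?thesis using that[of "- a"] a(1) by (simp add: subspace_neg subspace_f)
qed

end

locale guichard_frame = guichard_legendre f s1 s2 p \<alpha> V \<xi> + curvature_frame f s1 s2 U \<sigma>1 \<sigma>2 X Y +
    sphere_normal p \<alpha> \<kappa> V U \<nu>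
  for f :: "'m::smooth_surface \<Rightarrow> 'v::r42 set" and s1 s2 :: "'m \<Rightarrow> 'v set" and p \<alpha> V \<xi> U \<sigma>1 \<sigma>2 X Y \<kappa> \<nu>

lemma (in guichard_legendre) guichard_frame_exists:
  obtains U \<sigma>1 \<sigma>2 X Y \<kappa> \<nu> where "guichard_frame f s1 s2 p \<alpha> V \<xi> U \<sigma>1 \<sigma>2 X Y \<kappa> \<nu>" "x \<in> U"
proof -
  obtain U \<sigma>1 \<sigma>2 X Y where fr: "curvature_frame f s1 s2 U \<sigma>1 \<sigma>2 X Y" "x \<in> U" by (rule curvature_frame_exists)
  obtain \<kappa> Q \<nu> where sn: "sphere_normal p \<alpha> \<kappa> V Q \<nu>" "x \<in> Q"
    by (rule sphere_congruence_normal[OF p_norm congruence_V])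
  define W where "W = U \<inter> Q"
  have W: "open W" "x \<in> W" "W \<subseteq> U" "W \<subseteq> Q"
    using fr sn curvature_frame.U[OF fr(1)] sphere_normal.Q[OF sn(1)] by (auto simp: W_def)
  have "sphere_normal p \<alpha> \<kappa> V W \<nu>"
  proof (rule sphere_normal.intro)
    show "smooth_map_on W \<nu>" by (rule smooth_subset[OF sphere_normal.\<nu>[OF sn(1)] W(4)])
  qed (use sn(1)[unfolded sphere_normal_def] W in blast)+
  then have "guichard_frame f s1 s2 p \<alpha> V \<xi> W \<sigma>1 \<sigma>2 X Y \<kappa> \<nu>"
    by (intro guichard_frame.intro guichard_legendre_axioms curvature_frame.frame_subset[OF fr(1)] W)
  then show ?thesis using that W(2) by blast
qed

context guichard_frame
begin

lemma guichard_frame_swap: "guichard_frame f s2 s1 p \<alpha> V \<xi> U \<sigma>2 \<sigma>1 Y X \<kappa> \<nu>"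
  by (intro guichard_frame.intro swap_guichard frame_swap sphere_normal_axioms)

lemma guichard_frame_subset:
  assumes "open W" "W \<subseteq> U"
  shows "guichard_frame f s1 s2 p \<alpha> V \<xi> W \<sigma>1 \<sigma>2 X Y \<kappa> \<nu>"
proof (intro guichard_frame.intro guichard_legendre_axioms frame_subset assms sphere_normal.intro)
  show "smooth_map_on W \<nu>" by (rule smooth_subset[OF \<nu> assms(2)])
qed (use assms p_norm \<kappa> p\<nu> \<nu>\<nu> sphere_normal.V[OF sphere_normal_axioms] in blast)+

abbreviation \<sigma> :: "'m \<Rightarrow> 'v" where "\<sigma> \<equiv> hyp p"

lemma \<sigma>: "x \<in> U \<Longrightarrow> \<sigma> x \<noteq> 0" "x \<in> U \<Longrightarrow> \<Lambda> x = span {\<sigma> x}" "x \<in> U \<Longrightarrow> \<sigma> x \<in> \<Lambda> x"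
proof -
  obtain v where v: "v \<in> f x" "form p v \<noteq> 0" using exists_not_orth[of x] by blast
  show "\<sigma> x \<noteq> 0" and *: "\<Lambda> x = span {\<sigma> x}" if "x \<in> U" using hyp_span[OF that v] by auto
  show "\<sigma> x \<in> \<Lambda> x" if "x \<in> U" unfolding *[OF that] by (simp add: span_base)
qed

lemma smooth_d\<sigma>: "smooth_map_on U (along X \<sigma>)" "smooth_map_on U (along Y \<sigma>)"
  by (intro smooth_along U smooth_hyp XY)+

lemma smooth_dd\<sigma>: "smooth_map_on U (along X (along X \<sigma>))" "smooth_map_on U (along Y (along Y \<sigma>))"
  by (intro smooth_along U smooth_d\<sigma> XY)+

lemma section_V:
  assumes g: "smooth_map_on U g" "\<And>y. y \<in> U \<Longrightarrow> g y \<in> \<Lambda> y" and x: "x \<in> U"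
  shows "form p (g x) = 0" "form (\<nu> x) (g x) = 0" "form p (tderiv g x Z) = 0" "form (\<nu> x) (tderiv g x Z) = 0"
    "form (tderiv \<nu> x Z) (g x) = 0" "tderiv g x Z \<in> orth (f x)"
proof -
  have V': "V x = orth {p, \<nu> x}" if "x \<in> U" for x by (rule sphere_normal.V[OF sphere_normal_axioms that])
  have gV: "g y \<in> V y" if "y \<in> U" for y using g(2)[OF that] fibre_subset_derived[OF bundle_\<Lambda>] derived_V by blast
  then have gV: "form p (g y) = 0" "form (\<nu> y) (g y) = 0" if "y \<in> U" for y using V' that by (auto simp: orth_def)
  show "form p (g x) = 0" "form (\<nu> x) (g x) = 0" using gV x by auto
  have d: "tderiv g x Z \<in> derived \<Lambda> x" by (rule tderiv_in_derived[OF bundle_\<Lambda> U x g])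
  then show "form p (tderiv g x Z) = 0" "form (\<nu> x) (tderiv g x Z) = 0" using derived_V[of x] V'[OF x] by (auto simp: orth_def)
  show "tderiv g x Z \<in> orth (f x)" using d derived_orth by blast
  show "form (tderiv \<nu> x Z) (g x) = 0"
    using tderiv_form_eq[OF U x \<nu> g(1) gV(2)] \<open>form (\<nu> x) (tderiv g x Z) = 0\<close> by simp
qed

lemma orth_\<sigma>: "v \<in> f x \<Longrightarrow> form v (\<sigma> x) = 0" if "x \<in> U"
  using \<sigma>(3)[OF that] isotropic_f[of x] by (auto simp: isotropic_def)

lemma \<sigma>_V:
  assumes x: "x \<in> U"
  shows "form p (\<sigma> x) = 0" "form (\<nu> x) (\<sigma> x) = 0" "form p (tderiv \<sigma> x Z) = 0" "form (\<nu> x) (tderiv \<sigma> x Z) = 0"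
    "form (tderiv \<nu> x Z) (\<sigma> x) = 0" "tderiv \<sigma> x Z \<in> orth (f x)" using section_V[OF smooth_hyp \<sigma>(3) x] by auto

lemma p_\<nu>_ddsigma:
  assumes x: "x \<in> U" and Z: "smooth_field_on U Z"
  shows "form p (along W (along Z \<sigma>) x) = 0" "form (\<nu> x) (along W (along Z \<sigma>) x) = - form (along W \<nu> x) (along Z \<sigma> x)"
proof -
  have s: "smooth_map_on U (along Z \<sigma>)" by (intro smooth_along U smooth_hyp Z)
  show "form p (along W (along Z \<sigma>) x) = 0"
    using along_form[OF x smooth_const[of U p] s, of 0 W] \<sigma>_V(3) by (simp add: along_def[of _ "\<lambda>_. p"] along_def[of Z] form_simps)
  show "form (\<nu> x) (along W (along Z \<sigma>) x) = - form (along W \<nu> x) (along Z \<sigma> x)"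
    using along_form[OF x \<nu> s, of 0 W] \<sigma>_V(4) by (simp add: along_def[of Z])
qed

lemma d\<sigma>_norm:
  assumes x: "x \<in> U"
  shows "form (along X \<sigma> x) (along X \<sigma> x) = (form p (\<sigma>1 x))\<^sup>2 * g2 x"
    "form (along Y \<sigma> x) (along Y \<sigma> x) = (form p (\<sigma>2 x))\<^sup>2 * g1 x"
    "form (along X \<sigma> x) (along Y \<sigma> x) = 0"
proof -
  obtain a where a: "a \<in> f x" "along X \<sigma> x = a - form p (\<sigma>1 x) *\<^sub>R e2 x" by (rule along_X_hyp_expand[OF x])
  obtain b where b: "b \<in> f x" "along Y \<sigma> x = b + form p (\<sigma>2 x) *\<^sub>R e1 x" by (rule along_Y_hyp_expand[OF x])
  have ab: "form a a = 0" "form b b = 0" "form a b = 0" "form b a = 0"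
    using a(1) b(1) isotropic_f[of x] by (auto simp: isotropic_def)
  note perp = f_perp[OF x a(1) e_orth[OF x]] f_perp[OF x a(1) e_orth2[OF x]] f_perp[OF x b(1) e_orth[OF x]] f_perp[OF x b(1) e_orth2[OF x]]
  have e: "form (e2 x) (e1 x) = 0" using e_e[OF x] form_commute[of "e2 x" "e1 x"] by simp
  show "form (along X \<sigma> x) (along X \<sigma> x) = (form p (\<sigma>1 x))\<^sup>2 * g2 x"
    "form (along Y \<sigma> x) (along Y \<sigma> x) = (form p (\<sigma>2 x))\<^sup>2 * g1 x"
    "form (along X \<sigma> x) (along Y \<sigma> x) = 0"
    unfolding a(2) b(2) using ab perp e by (simp_all add: form_simps power2_eq_square)
qed

lemma p_\<sigma>_nonzero: "x \<in> U \<Longrightarrow> form p (\<sigma>1 x) \<noteq> 0 \<or> form p (\<sigma>2 x) \<noteq> 0" using \<sigma>(1)[of x] by (auto simp: hyp_def)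

text \<open>Where \<open>\<Lambda>\<close> is immersed, \<open>\<Lambda> + d\<Lambda>\<close> is a hyperplane of \<open>V\<close> with normal \<open>\<Lambda>\<close>.\<close>

lemma immersed_normal:
  assumes x: "x \<in> U" and ab: "form p (\<sigma>1 x) \<noteq> 0" "form p (\<sigma>2 x) \<noteq> 0" and v: "v \<in> f x" "form p v = \<alpha>"
  obtains k where "v = p + (form (\<nu> x) v / \<kappa>) *\<^sub>R \<nu> x + k *\<^sub>R \<sigma> x"
proof -
  let ?d1 = "along X \<sigma> x" and ?d2 = "along Y \<sigma> x"
  note V = \<sigma>_V[OF x]
  have d: "form p ?d1 = 0" "form p ?d2 = 0" "form (\<nu> x) ?d1 = 0" "form (\<nu> x) ?d2 = 0" "?d1 \<in> orth (f x)" "?d2 \<in> orth (f x)"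
    using V unfolding along_def by auto
  have \<sigma>f: "\<sigma> x \<in> f x" using \<sigma>(3)[OF x] by simp
  have ds: "form (\<sigma> x) ?d1 = 0" "form (\<sigma> x) ?d2 = 0" using f_perp(1)[OF x \<sigma>f] d by auto
  have n: "form ?d1 ?d1 \<noteq> 0" "form ?d2 ?d2 \<noteq> 0" "form ?d1 ?d2 = 0"
    using d\<sigma>_norm[OF x] ab e_pos[OF x] e_pos2[OF x] by auto
  \<comment> \<open>Five independent vectors, so their complement is a line; the null vector
    \<open>\<sigma> x\<close> belongs to it and spans it, and \<open>w\<close> below is orthogonal
    to all five.\<close>
  let ?S = "{p, \<nu> x, ?d1, ?d2, \<sigma> x}"
  have "?d2 \<notin> span {\<sigma> x}" using n(2) ds(2) form_commute[of "\<sigma> x" ?d2] by (intro notin_span_orth) auto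
  moreover have "?d1 \<notin> span {?d2, \<sigma> x}" using n ds(1) form_commute[of "\<sigma> x" ?d1] by (intro notin_span_orth) auto
  moreover have "\<nu> x \<notin> span {?d1, ?d2, \<sigma> x}" using \<nu>\<nu>[OF x] \<kappa> d V(2) by (intro notin_span_orth) auto
  moreover have "p \<notin> span {\<nu> x, ?d1, ?d2, \<sigma> x}" using p_norm p\<nu>[OF x] d V(1) by (intro notin_span_orth) auto
  ultimately have "dim ?S = 5" using \<sigma>(1)[OF x] by (simp add: dim_insert)
  then have "dim (span ?S) = 5" by simp
  then have 1: "dim (orth ?S) = 1" using dim_orth[of "span ?S"] by (simp add: orth_span)
  have o\<sigma>: "\<sigma> x \<in> orth ?S"
    using V(1,2) ds orth_\<sigma>[OF x \<sigma>f] form_commute[of ?d1 "\<sigma> x"] form_commute[of ?d2 "\<sigma> x"] by (auto simp: orth_def)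
  have eq: "orth ?S = span {\<sigma> x}"
    using o\<sigma> \<sigma>(1)[OF x] 1 by (intro subspace_dim_equal[symmetric] span_minimal) auto
  define w where "w = v - p - (form (\<nu> x) v / \<kappa>) *\<^sub>R \<nu> x"
  have "w \<in> orth ?S"
    using v(2) p_norm p\<nu>[OF x] \<nu>\<nu>[OF x] \<kappa> d V(1,2) orth_\<sigma>[OF x v(1)] f_perp(2)[OF x v(1) d(5)] f_perp(2)[OF x v(1) d(6)]
      form_commute[of "\<nu> x" p] form_commute[of "\<sigma> x" p] form_commute[of "\<sigma> x" "\<nu> x"] form_commute[of "\<sigma> x" v]
      form_commute[of ?d1 p] form_commute[of ?d2 p] form_commute[of ?d1 "\<nu> x"] form_commute[of ?d2 "\<nu> x"]
    by (auto simp: orth_def w_def form_simps)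
  then obtain k where "w = k *\<^sub>R \<sigma> x" unfolding eq by (auto simp: span_singleton)
  then show ?thesis using that[of k] by (simp add: w_def algebra_simps)
qed

text \<open>Its pairing with \<open>\<sigma>\<close> is minus the sum of the norms of d_X \<sigma>
  and d_Y \<sigma>. This is non-zero even where \<Lambda> is not immersed, because \<Lambda> moves
  in at least one of the two directions; so the pairing can serve as a denominator at every
  point.\<close>

definition L :: "'m \<Rightarrow> 'v" where "L x = along X (along X \<sigma>) x + along Y (along Y \<sigma>) x"

text \<open>Some smooth section of \<open>f\<close> whose pairing with \<open>p\<close> is \<alpha>;
  the denominator is non-zero because \<open>f\<close> is not orthogonal to \<open>p\<close>. Moving
  it along \<Lambda> changes neither property, which is the freedom that \<open>F\<close>
  exploits.\<close>

definition P0 :: "'m \<Rightarrow> 'v" where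
  "P0 x = (\<alpha> / ((form p (\<sigma>1 x))\<^sup>2 + (form p (\<sigma>2 x))\<^sup>2)) *\<^sub>R (form p (\<sigma>1 x) *\<^sub>R \<sigma>1 x + form p (\<sigma>2 x) *\<^sub>R \<sigma>2 x)"

text \<open>One formula for the sphere orthogonal to \<open>V\<close>, where \<open>\<Lambda>\<close> is immersed, and for the other curvature
  sphere, where \<open>\<Lambda>\<close> is a curvature sphere: the projection of \<open>F\<close> to \<open>V\<close> is orthogonal to \<open>L\<close>.\<close>

definition F :: "'m \<Rightarrow> 'v" where
  "F x = P0 x - ((form (P0 x) (L x) - form (\<nu> x) (P0 x) * form (\<nu> x) (L x) / \<kappa>) / form (\<sigma> x) (L x)) *\<^sub>R \<sigma> x"

lemma smooth_L: "smooth_map_on U L" unfolding L_def[abs_def] by (intro smooth_add U smooth_dd\<sigma>)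

lemma \<sigma>_L: assumes x: "x \<in> U" shows "form (\<sigma> x) (L x) < 0" "form p (L x) = 0" "form (\<sigma> x) (L x) \<noteq> 0"
proof -
  have z: "form (\<sigma> y) (along Z \<sigma> y) = 0" if "y \<in> U" for Z y
    using \<sigma>_V(6)[OF that] \<sigma>(3)[OF that] f_perp(1)[OF that] unfolding along_def by blast
  have 1: "form (\<sigma> x) (along X (along X \<sigma>) x) = - form (along X \<sigma> x) (along X \<sigma> x)"
    "form (\<sigma> x) (along Y (along Y \<sigma>) x) = - form (along Y \<sigma> x) (along Y \<sigma> x)"
    using along_form[OF x smooth_hyp smooth_d\<sigma>(1) z, of X] along_form[OF x smooth_hyp smooth_d\<sigma>(2) z, of Y] by auto
  show *: "form (\<sigma> x) (L x) < 0"
  proof -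
    have "(form p (\<sigma>1 x))\<^sup>2 * g2 x + (form p (\<sigma>2 x))\<^sup>2 * g1 x > 0"
      using p_\<sigma>_nonzero[OF x] e_pos[OF x] e_pos2[OF x] by (auto intro: add_pos_nonneg add_nonneg_pos)
    then show ?thesis by (simp add: L_def form_simps 1 d\<sigma>_norm[OF x])
  qed
  show "form (\<sigma> x) (L x) \<noteq> 0" using * by simp
  show "form p (L x) = 0" using p_\<nu>_ddsigma(1)[OF x XY(1), of X] p_\<nu>_ddsigma(1)[OF x XY(2), of Y] by (simp add: L_def form_simps)
qed

lemma P0: assumes x: "x \<in> U" shows "P0 x \<in> f x" "form p (P0 x) = \<alpha>"
proof -
  show "P0 x \<in> f x" using section_\<sigma>[OF x] by (simp add: P0_def subspace_add subspace_scale subspace_f)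
  have "(form p (\<sigma>1 x))\<^sup>2 + (form p (\<sigma>2 x))\<^sup>2 \<noteq> 0" using p_\<sigma>_nonzero[OF x] by (auto simp: sum_power2_eq_zero_iff)
  then show "form p (P0 x) = \<alpha>" by (simp add: P0_def form_simps power2_eq_square)
qed

lemma smooth_F: "smooth_map_on U F"
proof -
  have nz: "(form p (\<sigma>1 x))\<^sup>2 + (form p (\<sigma>2 x))\<^sup>2 \<noteq> 0" if "x \<in> U" for x
    using p_\<sigma>_nonzero[OF that] by (auto simp: sum_power2_eq_zero_iff)
  have p: "smooth_map_on U (\<lambda>x. form p (\<sigma>1 x))" "smooth_map_on U (\<lambda>x. form p (\<sigma>2 x))"
    by (intro smooth_form U smooth_const smooth_\<sigma>)+
  have sq: "smooth_map_on U (\<lambda>x. (form p (\<sigma>1 x))\<^sup>2 + (form p (\<sigma>2 x))\<^sup>2)"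
    unfolding power2_eq_square by (intro smooth_add smooth_bilinear[OF bounded_bilinear_mult] U p)
  have P: "smooth_map_on U P0" unfolding P0_def[abs_def]
    by (intro smooth_scaleR smooth_divide smooth_add smooth_const U sq p smooth_\<sigma> nz)
  show ?thesis unfolding F_def[abs_def] by (intro smooth_diff smooth_scaleR smooth_divide smooth_const
        smooth_bilinear[OF bounded_bilinear_mult] smooth_form U P smooth_L smooth_hyp \<nu>) (use \<kappa> \<sigma>_L in auto)
qed

lemma F: assumes x: "x \<in> U" shows "F x \<in> f x" "form p (F x) = \<alpha>"
    "form (F x) (L x) = form (\<nu> x) (F x) * form (\<nu> x) (L x) / \<kappa>"
  using P0[OF x] \<sigma>(3)[OF x] \<sigma>_V(1,2)[OF x] \<sigma>_L[OF x]
  by (auto simp: F_def form_simps intro!: subspace_diff subspace_scale subspace_f)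

lemma F_unique:
  assumes x: "x \<in> U" and v: "v \<in> f x" "form p v = \<alpha>" "form v (L x) = form (\<nu> x) v * form (\<nu> x) (L x) / \<kappa>"
  shows "v = F x"
proof -
  have "v - F x \<in> \<Lambda> x" using v F[OF x] by (auto simp: orth_def form_simps intro!: subspace_diff subspace_f)
  then obtain k where "v - F x = k *\<^sub>R \<sigma> x" unfolding \<sigma>(2)[OF x] by (auto simp: span_singleton)
  then have k: "v = F x + k *\<^sub>R \<sigma> x" by (simp add: algebra_simps)
  then have "k * form (\<sigma> x) (L x) = 0" using v(3) F(3)[OF x] \<sigma>_V(2)[OF x] by (simp add: form_simps)
  then show ?thesis using \<sigma>_L[OF x] k by simp
qed

text \<open>By \<open>immersed_normal\<close> some P0 - k \<sigma> has the form p + c \<nu>. Its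
  projection to \<open>V\<close> is 0, so it satisfies the equation that characterises
  \<open>F\<close>.\<close>

lemma F_immersed:
  assumes x: "x \<in> U" and ab: "form p (\<sigma>1 x) \<noteq> 0" "form p (\<sigma>2 x) \<noteq> 0"
  shows "F x \<in> orth (V x)"
proof -
  obtain k where k: "P0 x = p + (form (\<nu> x) (P0 x) / \<kappa>) *\<^sub>R \<nu> x + k *\<^sub>R \<sigma> x"
    by (rule immersed_normal[OF x ab P0[OF x]])
  define c where "c = form (\<nu> x) (P0 x) / \<kappa>"
  have v: "P0 x - k *\<^sub>R \<sigma> x = p + c *\<^sub>R \<nu> x" using k by (simp add: c_def algebra_simps)
  have "P0 x - k *\<^sub>R \<sigma> x = F x"
  proof (rule F_unique[OF x])
    show "P0 x - k *\<^sub>R \<sigma> x \<in> f x" using P0[OF x] \<sigma>(3)[OF x] by (auto intro!: subspace_diff subspace_scale subspace_f)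
  qed (unfold v, use p_norm p\<nu>[OF x] \<nu>\<nu>[OF x] \<kappa> \<sigma>_L[OF x] form_commute[of "\<nu> x" p] in \<open>auto simp: form_simps\<close>)
  then have "F x = p + c *\<^sub>R \<nu> x" using v by simp
  moreover have "p + c *\<^sub>R \<nu> x \<in> span {p, \<nu> x}" by (intro span_add span_scale span_base) auto
  ultimately show ?thesis using orth_V[OF x] by simp
qed

end

lemma (in guichard_frame) ext_deriv_\<xi>_annihilator:
  assumes g: "smooth_map_on U g" "\<And>y Z. y \<in> U \<Longrightarrow> \<xi> y Z (g y) = 0" and x: "x \<in> U"
  shows "\<xi> x Z (tderiv g x W) - \<xi> x W (tderiv g x Z) = - (1 / \<kappa>) *\<^sub>R wedge (tderiv \<nu> x Z) (tderiv \<nu> x W) (g x)"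
proof -
  define c where "c = chart_at x"
  have c: "c \<in> atlas" "x \<in> fst c" using chart_at by (auto simp: c_def)
  obtain e where e: "Z = coord_field c e x" by (rule tangent_coord[OF c])
  obtain e' where e': "W = coord_field c e' x" by (rule tangent_coord[OF c])
  show ?thesis
    using ext_deriv_annihilator[OF smooth_\<xi> c U x g, of e e'] ext_deriv_of_flat[OF smooth_\<xi> flat_\<xi> c x, of e e']
    by (simp add: e e' blinfun_simps)
qed

text \<open>The case where \<open>\<Lambda> = s2\<close>, so that \<open>\<Lambda>\<close> depends on one parameter only.\<close>

locale guichard_curve_frame = guichard_frame +
  assumes curve: "\<And>x. x \<in> U \<Longrightarrow> form p (\<sigma>2 x) = 0"
begin

lemma \<sigma>2_\<Lambda>: "x \<in> U \<Longrightarrow> \<sigma>2 x \<in> \<Lambda> x" using section_\<sigma> curve by (auto simp: orth_def)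

context
  fixes x assumes x: "x \<in> U"
begin

lemma \<sigma>2_V: "form p (\<sigma>2 x) = 0" "form (\<nu> x) (\<sigma>2 x) = 0" "form p (tderiv \<sigma>2 x Z) = 0" "form (\<nu> x) (tderiv \<sigma>2 x Z) = 0"
    "form (tderiv \<nu> x Z) (\<sigma>2 x) = 0" "tderiv \<sigma>2 x Z \<in> orth (f x)"
  using section_V[OF smooth_\<sigma>(2) \<sigma>2_\<Lambda> x] by auto

lemma e2_V: "form p (e2 x) = 0" "form (\<nu> x) (e2 x) = 0" "form (\<sigma>2 x) (e2 x) = 0"
  using \<sigma>2_V f_perp(1)[OF x section_\<sigma>(2)[OF x] e_orth2[OF x]] by (auto simp: along_def)

lemma \<Lambda>_span: "\<Lambda> x = span {\<sigma>2 x}"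
proof -
  have "subspace (\<Lambda> x)" "dim (\<Lambda> x) = 1" using subspace_fibre[OF bundle_\<Lambda>] dim_fibre[OF bundle_\<Lambda>] by auto
  then show ?thesis using \<sigma>2_\<Lambda>[OF x] nz(2)[OF x] by (intro subspace_dim_equal[symmetric] span_minimal) auto
qed

lemma \<Lambda>_multiple: assumes "v \<in> f x" "form p v = 0" obtains k where "v = k *\<^sub>R \<sigma>2 x"
proof -
  have "v \<in> \<Lambda> x" using assms by (simp add: orth_def)
  then show ?thesis using that unfolding \<Lambda>_span by (auto simp: span_singleton)
qed

lemma along_Y_multiple: obtains k where "along Y \<sigma>2 x = k *\<^sub>R \<sigma>2 x"
  using \<Lambda>_multiple[OF along_Y_\<sigma>2[OF x]] \<sigma>2_V(3) by (auto simp: along_def)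

lemma derived_span: "derived \<Lambda> x \<subseteq> span {\<sigma>2 x, e2 x}"
proof (rule derived_minimal[OF bundle_\<Lambda> subspace_span])
  show "\<Lambda> x \<subseteq> span {\<sigma>2 x, e2 x}" unfolding \<Lambda>_span by (rule span_mono) auto
  fix g Z assume g: "g \<in> sections \<Lambda>"
  have gs: "smooth_map_on U g" "\<And>y. y \<in> U \<Longrightarrow> g y \<in> s2 y"
  proof -
    show "smooth_map_on U g" using g smooth_subset by (auto simp: sections_def)
    fix y assume y: "y \<in> U"
    have "subspace (\<Lambda> y)" "dim (\<Lambda> y) = 1" using subspace_fibre[OF bundle_\<Lambda>] dim_fibre[OF bundle_\<Lambda>] by auto
    then have "\<Lambda> y = span {\<sigma>2 y}"
      using \<sigma>2_\<Lambda>[OF y] nz(2)[OF y] by (intro subspace_dim_equal[symmetric] span_minimal) auto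
    then show "g y \<in> s2 y" using g s2[OF y] by (auto simp: sections_def)
  qed
  obtain h where h: "smooth_map_on U h" "\<And>y. y \<in> U \<Longrightarrow> g y = h y *\<^sub>R \<sigma>2 y"
    using curvature_frame.line_section[OF frame_swap gs] by blast
  obtain k where k: "tderiv \<sigma>2 x (Y x) = k *\<^sub>R \<sigma>2 x" using along_Y_multiple by (auto simp: along_def)
  obtain a b where Z: "Z = a *\<^sub>R X x + b *\<^sub>R Y x" by (rule XY_basis[OF x])
  note l = tderiv_linear[OF U smooth_\<sigma>(2) x]
  have "tderiv g x Z = tderiv (\<lambda>y. h y *\<^sub>R \<sigma>2 y) x Z"
    using tderiv_cong[OF U x smooth_scaleR[OF U h(1) smooth_\<sigma>(2)], of g Z] h(2) by simp
  also have "\<dots> = h x *\<^sub>R tderiv \<sigma>2 x Z + tderiv h x Z *\<^sub>R \<sigma>2 x"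
    by (rule tderiv_scaleR[OF U h(1) smooth_\<sigma>(2) x])
  also have "\<dots> = (h x * a) *\<^sub>R e2 x + (h x * (b * k) + tderiv h x Z) *\<^sub>R \<sigma>2 x"
    by (simp add: Z linear_add[OF l] linear_scale[OF l] k along_def algebra_simps)
  also have "\<dots> \<in> span {\<sigma>2 x, e2 x}" by (intro span_add span_scale span_base) auto
  finally show "tderiv g x Z \<in> span {\<sigma>2 x, e2 x}" .
qed

lemma \<xi>_multiple: obtains r where "\<xi> x Z = r *\<^sub>R wedge (\<sigma>2 x) (e2 x)"
proof -
  have "\<exists>r. \<xi> x Z = r *\<^sub>R wedge (\<sigma>2 x) (e2 x)" using \<xi>_wedge_space[of x Z]
  proof (rule wedge_space_induct)
    show "subspace {A. \<exists>r. A = r *\<^sub>R wedge (\<sigma>2 x) (e2 x)}"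
      using subspace_span[of "{wedge (\<sigma>2 x) (e2 x)}"] by (simp add: span_singleton image_def)
    fix a b assume a: "a \<in> \<Lambda> x" and b: "b \<in> derived \<Lambda> x"
    obtain i where i: "a = i *\<^sub>R \<sigma>2 x" using a unfolding \<Lambda>_span by (auto simp: span_singleton)
    have "b \<in> span {\<sigma>2 x, e2 x}" using b derived_span by blast
    then obtain j l where "b - j *\<^sub>R \<sigma>2 x = l *\<^sub>R e2 x" by (auto simp: span_insert span_singleton)
    then have "b = j *\<^sub>R \<sigma>2 x + l *\<^sub>R e2 x" by (simp add: algebra_simps)
    then have "wedge a b = (i * l) *\<^sub>R wedge (\<sigma>2 x) (e2 x)"
      by (simp add: i wedge.add_right wedge.scaleR_left wedge.scaleR_right)
    then show "\<exists>r. wedge a b = r *\<^sub>R wedge (\<sigma>2 x) (e2 x)" by blast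
  qed
  then show ?thesis using that by blast
qed

text \<open>Differentiating \<xi> \<sigma>2 = 0 relates \<xi>(Y) e2 to \<xi>(X) d_Y \<sigma>2, which
  is 0 because d_Y \<sigma>2 is a multiple of \<sigma>2. The curvature term vanishes since d\<nu> is
  orthogonal to \<sigma>2.\<close>

lemma \<xi>_Y: "\<xi> x (Y x) = 0"
proof -
  obtain k where k: "along Y \<sigma>2 x = k *\<^sub>R \<sigma>2 x" by (rule along_Y_multiple)
  have 0: "\<xi> y Z (\<sigma>2 y) = 0" if "y \<in> U" for y Z by (rule lowersD(2)[OF lowers_\<xi> section_\<sigma>(2)[OF that]])
  obtain r where r: "\<xi> x (Y x) = r *\<^sub>R wedge (\<sigma>2 x) (e2 x)" by (rule \<xi>_multiple)
  have "\<xi> x (Y x) (e2 x) = 0"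
    using ext_deriv_\<xi>_annihilator[OF smooth_\<sigma>(2) 0 x, of "X x" "Y x"] k 0[OF x] \<sigma>2_V(5)
    by (simp add: along_def blinfun_simps wedge_apply)
  then have "(r * g2 x) *\<^sub>R \<sigma>2 x = 0" using e2_V(3) by (simp add: r blinfun_simps wedge_apply)
  then show ?thesis using r nz(2)[OF x] e_pos2[OF x] by auto
qed

lemma along_Y_e2: obtains i l where "along Y e2 x = i *\<^sub>R \<sigma>2 x + l *\<^sub>R e2 x"
proof -
  note o = curvature_frame.along_X_e[OF frame_swap x]
  obtain a k l where a: "a \<in> f x" "along Y e2 x = a + k *\<^sub>R e1 x + l *\<^sub>R e2 x"
    by (rule orth_f_coeffs[OF x o(1)])
  have "k * g1 x = 0" using o(2) f_perp(1)[OF x a(1) e_orth[OF x]] e_e[OF x] form_commute[of "e2 x" "e1 x"]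
    by (simp add: a(2) form_simps)
  then have k: "k = 0" using e_pos[OF x] by auto
  have "form p (e2 y) = 0" if "y \<in> U" for y using section_V(3)[OF smooth_\<sigma>(2) \<sigma>2_\<Lambda> that] by (simp add: along_def)
  from along_form[OF x smooth_const smooth_e2 this, of Y]
  have "form p (along Y e2 x) = 0" by (simp add: along_def[of _ "\<lambda>_. p"] form_simps)
  then have "form p a = 0" using e2_V(1) k by (simp add: a(2) form_simps)
  then obtain i where "a = i *\<^sub>R \<sigma>2 x" by (rule \<Lambda>_multiple[OF a(1)])
  then show ?thesis using that a(2) k by simp
qed

end

abbreviation n :: "'a \<Rightarrow> 'b" where "n \<equiv> along Y \<nu>"

lemma smooth_n: "smooth_map_on U n" "smooth_map_on U (along X \<nu>)" and smooth_z2: "smooth_map_on U z2"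
  by (intro smooth_along U \<nu> XY smooth_\<sigma>)+

context
  fixes x assumes x: "x \<in> U"
begin

lemma \<nu>_e2: "form (along Z \<nu> x) (\<sigma>2 x) = 0" "form (\<nu> x) (along Y e2 x) = 0" "form (n x) (e2 x) = 0"
    "form (n x) (along Y e2 x) = 0"
proof -
  show *: "form (along Z \<nu> x) (\<sigma>2 x) = 0" for Z using \<sigma>2_V(5)[OF x] by (simp add: along_def)
  obtain i l where il: "along Y e2 x = i *\<^sub>R \<sigma>2 x + l *\<^sub>R e2 x" by (rule along_Y_e2[OF x])
  show 1: "form (\<nu> x) (along Y e2 x) = 0" using e2_V[OF x] \<sigma>2_V[OF x] by (simp add: il form_simps)
  show "form (n x) (e2 x) = 0" using along_form[OF x \<nu> smooth_e2 e2_V(2), of Y] 1 by simp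
  then show "form (n x) (along Y e2 x) = 0" using *[of Y] by (simp add: il form_simps)
qed

text \<open>If n were null, it would be a null vector of the Lorentzian space \<open>V\<close>
  orthogonal to \<sigma>2, hence a multiple of \<sigma>2. As also \<xi>(Y) = 0, the direction
  \<open>Y\<close> would lie in the kernel of the Guichard differential.\<close>

lemma n_norm: "form (n x) (n x) \<noteq> 0"
proof
  assume 0: "form (n x) (n x) = 0"
  have V': "V x = orth {p, \<nu> x}" by (rule sphere_normal.V[OF sphere_normal_axioms x])
  have "n x \<in> V x" "\<sigma>2 x \<in> V x" using d\<nu>[OF x] \<sigma>2_V[OF x] by (auto simp: V' orth_def along_def)
  moreover have "form (\<sigma>2 x) (\<sigma>2 x) = 0" using section_\<sigma>(2)[OF x] isotropic_f[of x] by (auto simp: isotropic_def)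
  moreover have "form (n x) (\<sigma>2 x) = 0" by (rule \<nu>_e2(1))
  ultimately obtain j where j: "n x = j *\<^sub>R \<sigma>2 x"
    using signature_3_1(2)[OF V_fibre[of x], of "n x" "\<sigma>2 x"] 0 nz(2)[OF x] by auto
  have "guichard_q \<Lambda> V \<xi> x (Y x) W = 2 * 0 - form (tderiv \<nu> x (Y x)) (tderiv \<nu> x W) / \<kappa>" for W
  proof (rule guichard_q_eq[OF x bundle_\<Lambda> derived_V U x smooth_\<sigma>(2) \<sigma>2_\<Lambda> nz(2)[OF x]])
    show "\<Lambda> y \<subseteq> V y" for y using fibre_subset_derived[OF bundle_\<Lambda>] derived_V by blast
  qed (simp_all add: \<xi>_Y[OF x])
  moreover have "form (tderiv \<nu> x (Y x)) (tderiv \<nu> x W) = 0" for W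
    using j \<sigma>2_V(5)[OF x, of W] form_commute[of "\<sigma>2 x" "tderiv \<nu> x W"] by (simp add: along_def form_simps)
  ultimately show False using nondegenerate_q[of x] Y(1)[OF x] by (auto simp: nondegenerate_def)
qed

end

context
  fixes x assumes x: "x \<in> U"
begin

lemma n_sections: "form (\<sigma>2 x) (n x) = 0" "form (e2 x) (n x) = 0"
  using \<nu>_e2(1,3)[OF x] form_commute[of "n x" "\<sigma>2 x"] form_commute[of "n x" "e2 x"] by auto

end

context
  fixes x assumes x: "x \<in> U"
begin

text \<open>\<xi> annihilates n, which is orthogonal to \<sigma>2 and e2. Differentiating this
  leaves the curvature term alone, that is (d_X \<nu> \<and> n) n = 0, and n is not null. So d\<nu>
  has rank 1.\<close>

lemma \<nu>_parallel: obtains h where "along X \<nu> x = h *\<^sub>R n x"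
proof -
  have 0: "\<xi> y Z (n y) = 0" if y: "y \<in> U" for y Z
  proof -
    obtain r where r: "\<xi> y Z = r *\<^sub>R wedge (\<sigma>2 y) (e2 y)" by (rule \<xi>_multiple[OF y])
    show ?thesis using n_sections[OF y] by (simp add: r blinfun_simps wedge_apply)
  qed
  obtain r where r: "\<xi> x (X x) = r *\<^sub>R wedge (\<sigma>2 x) (e2 x)" by (rule \<xi>_multiple[OF x])
  obtain k where k: "along Y \<sigma>2 x = k *\<^sub>R \<sigma>2 x" by (rule along_Y_multiple[OF x])
  have "form (along Y n x) (\<sigma>2 x) = - form (n x) (along Y \<sigma>2 x)"
    by (rule along_form[OF x smooth_n(1) smooth_\<sigma>(2) \<nu>_e2(1)])
  then have 1: "form (\<sigma>2 x) (along Y n x) = 0"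
    using k \<nu>_e2(1)[OF x, of Y] form_commute[of "along Y n x" "\<sigma>2 x"] by (simp add: form_simps)
  have "form (along Y n x) (e2 x) = - form (n x) (along Y e2 x)"
    by (rule along_form[OF x smooth_n(1) smooth_e2 \<nu>_e2(3)])
  then have 2: "form (e2 x) (along Y n x) = 0"
    using \<nu>_e2(4)[OF x] form_commute[of "along Y n x" "e2 x"] by simp
  have "\<xi> x (X x) (along Y n x) - \<xi> x (Y x) (along X n x) = - (1 / \<kappa>) *\<^sub>R wedge (along X \<nu> x) (n x) (n x)"
  proof -
    have "\<xi> x (X x) (tderiv n x (Y x)) - \<xi> x (Y x) (tderiv n x (X x)) =
        - (1 / \<kappa>) *\<^sub>R wedge (tderiv \<nu> x (X x)) (tderiv \<nu> x (Y x)) (n x)"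
      by (rule ext_deriv_\<xi>_annihilator[OF smooth_n(1) 0 x])
    then show ?thesis by (simp only: along_def[of X n x] along_def[of Y n x] along_def[of X \<nu> x] along_def[of Y \<nu> x])
  qed
  moreover have "\<xi> x (X x) (along Y n x) = 0" using 1 2 by (simp add: r blinfun_simps wedge_apply)
  ultimately have "wedge (along X \<nu> x) (n x) (n x) = 0" using \<xi>_Y[OF x] \<kappa> by (simp add: blinfun_simps)
  then have "(1 / form (n x) (n x)) *\<^sub>R (form (n x) (n x) *\<^sub>R along X \<nu> x) =
      (1 / form (n x) (n x)) *\<^sub>R (form (along X \<nu> x) (n x) *\<^sub>R n x)" by (simp add: wedge_apply)
  then have "along X \<nu> x = (form (along X \<nu> x) (n x) / form (n x) (n x)) *\<^sub>R n x" using n_norm[OF x] by simp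
  then show ?thesis by (rule that)
qed

lemma d\<nu>_e2: "form (along X \<nu> x) (e2 x) = 0" "form (\<nu> x) (z2 x) = 0" "form p (z2 x) = 0"
proof -
  obtain h where h: "along X \<nu> x = h *\<^sub>R n x" by (rule \<nu>_parallel)
  show 1: "form (along X \<nu> x) (e2 x) = 0" using \<nu>_e2(3)[OF x] by (simp add: h form_simps)
  show "form (\<nu> x) (z2 x) = 0" using along_form[OF x \<nu> smooth_e2 e2_V(2), of X] 1 by simp
  show "form p (z2 x) = 0"
    using along_form[OF x smooth_const smooth_e2 e2_V(1), of X] by (simp add: along_def[of _ "\<lambda>_. p"] form_simps)
qed

end

text \<open>\<open>p\<close>, \<open>\<nu>\<close> and \<open>d\<^sub>Y \<nu>\<close> span \<open>S1\<close>, so that \<open>S1\<close> and \<open>S2\<close> are parallel.\<close>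

lemma n_z2: assumes x: "x \<in> U"
  shows "form (n x) (z2 x) = 0"
proof -
  obtain i l where il: "along Y e2 x = i *\<^sub>R \<sigma>2 x + l *\<^sub>R e2 x" by (rule along_Y_e2[OF x])
  obtain a b where ab: "along X (along Y e2) x = along Y z2 x + a *\<^sub>R z2 x + b *\<^sub>R along Y e2 x"
    by (rule commute_XY[OF x smooth_e2])
  have s: "smooth_map_on U (along Y e2)" by (intro smooth_along U XY smooth_e2)
  have "form (\<nu> x) (along X (along Y e2) x) = - form (along X \<nu> x) (along Y e2 x)"
    using along_form[OF x \<nu> s \<nu>_e2(2), of X] by simp
  also have "\<dots> = 0" using \<nu>_e2(1)[OF x, of X] d\<nu>_e2(1)[OF x] by (simp add: il form_simps)
  finally have "form (\<nu> x) (along Y z2 x) = 0" using d\<nu>_e2(2)[OF x] \<nu>_e2(2)[OF x] by (simp add: ab form_simps)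
  then show ?thesis using along_form[OF x \<nu> smooth_z2 d\<nu>_e2(2), of Y] by simp
qed

text \<open>Commuting the fields in third derivatives of \<sigma>2 gives (n, d_Y z2) = 0. As d_X
  \<nu> is parallel to n, it follows that d_Y d_X \<nu> is orthogonal to z2, and commuting the
  fields once more carries this over to d_X n.\<close>

lemma dn_z2: assumes x: "x \<in> U"
  shows "form (along X n x) (z2 x) = 0"
proof -
  obtain h where h: "along X \<nu> x = h *\<^sub>R n x" by (rule \<nu>_parallel[OF x])
  obtain i l where il: "along Y e2 x = i *\<^sub>R \<sigma>2 x + l *\<^sub>R e2 x" by (rule along_Y_e2[OF x])
  obtain a b where ab: "along X (along Y e2) x = along Y z2 x + a *\<^sub>R z2 x + b *\<^sub>R along Y e2 x"
    by (rule commute_XY[OF x smooth_e2])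
  have s: "smooth_map_on U (along Y e2)" by (intro smooth_along U XY smooth_e2)
  have "form (along X n x) (\<sigma>2 x) = 0" "form (along X n x) (e2 x) = 0"
    using along_form[OF x smooth_n(1) smooth_\<sigma>(2) \<nu>_e2(1), of X] along_form[OF x smooth_n(1) smooth_e2 \<nu>_e2(3), of X]
      \<nu>_e2(3)[OF x] n_z2[OF x] by auto
  then have "form (along X n x) (along Y e2 x) = 0" by (simp add: il form_simps)
  then have "form (n x) (along X (along Y e2) x) = 0"
    using along_form[OF x smooth_n(1) s \<nu>_e2(4), of X] by simp
  then have nz: "form (n x) (along Y z2 x) = 0" using n_z2[OF x] \<nu>_e2(4)[OF x] by (simp add: ab form_simps)
  have "form (along X \<nu> y) (z2 y) = 0" if y: "y \<in> U" for y
    using \<nu>_parallel[OF y] n_z2[OF y] by (metis form.scaleR_left scaleR_zero_right)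
  from along_form[OF x smooth_n(2) smooth_z2 this, of Y]
  have "form (along Y (along X \<nu>) x) (z2 x) = 0" using nz by (simp add: h form_simps)
  moreover obtain c d where "along X n x = along Y (along X \<nu>) x + c *\<^sub>R along X \<nu> x + d *\<^sub>R n x"
    by (rule commute_XY[OF x \<nu>])
  ultimately show ?thesis using n_z2[OF x] by (simp add: h form_simps)
qed

text \<open>Here \<sigma>1 and \<nu> are both orthogonal to \<open>L\<close>, so both sides of the
  equation that characterises \<open>F\<close> vanish for a multiple of \<sigma>1.\<close>

lemma F_curve:
  assumes x: "x \<in> U"
  shows "F x = (\<alpha> / form p (\<sigma>1 x)) *\<^sub>R \<sigma>1 x"
proof (rule F_unique[OF x, symmetric])
  have p1: "form p (\<sigma>1 x) \<noteq> 0" using p_\<sigma>_nonzero[OF x] curve[OF x] by simp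
  then show "form p ((\<alpha> / form p (\<sigma>1 x)) *\<^sub>R \<sigma>1 x) = \<alpha>" by (simp add: form_simps)
  show "(\<alpha> / form p (\<sigma>1 x)) *\<^sub>R \<sigma>1 x \<in> f x" by (intro subspace_scale subspace_f section_\<sigma> x)
  obtain a where a: "a \<in> f x" "along X \<sigma> x = a - form p (\<sigma>1 x) *\<^sub>R e2 x" by (rule along_X_hyp_expand[OF x])
  obtain b where b: "b \<in> f x" "along Y \<sigma> x = b + form p (\<sigma>2 x) *\<^sub>R e1 x" by (rule along_Y_hyp_expand[OF x])
  have pd: "form p (along X \<sigma> x) = 0" "form p (along Y \<sigma> x) = 0" using \<sigma>_V(3)[OF x] by (auto simp: along_def)
  have "form p a = 0" "form p b = 0" using pd curve[OF x] e2_V(1)[OF x] unfolding a(2) b(2) by (auto simp: form_simps)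
  then obtain i j where i: "a = i *\<^sub>R \<sigma>2 x" and j: "b = j *\<^sub>R \<sigma>2 x" using \<Lambda>_multiple[OF x] a(1) b(1) by metis
  have \<nu>L: "form (\<nu> x) (L x) = 0"
    using p_\<nu>_ddsigma(2)[OF x XY(1), of X] p_\<nu>_ddsigma(2)[OF x XY(2), of Y] \<nu>_e2[OF x] d\<nu>_e2(1)[OF x] curve[OF x]
    unfolding L_def a(2) b(2) i j by (simp add: form_simps)
  have 0: "form (\<sigma>1 y) (along Z \<sigma> y) = 0" if "y \<in> U" for Z y
    using \<sigma>_V(6)[OF that] section_\<sigma>(1)[OF that] f_perp(1)[OF that] unfolding along_def by blast
  have "form (\<sigma>1 x) (along X (along X \<sigma>) x) = - form (along X \<sigma>1 x) (along X \<sigma> x)"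
    "form (\<sigma>1 x) (along Y (along Y \<sigma>) x) = - form (e1 x) (along Y \<sigma> x)"
    using along_form[OF x smooth_\<sigma>(1) smooth_d\<sigma>(1) 0, of X] along_form[OF x smooth_\<sigma>(1) smooth_d\<sigma>(2) 0, of Y] by auto
  moreover have "form (along X \<sigma>1 x) (along X \<sigma> x) = 0"
    using f_perp(1)[OF x tderiv_X_\<sigma>1[OF x]] \<sigma>_V(6)[OF x] by (simp add: along_def)
  moreover have "form (e1 x) (along Y \<sigma> x) = 0"
    using f_perp(2)[OF x b(1) e_orth[OF x]] curve[OF x] by (simp add: b(2) form_simps)
  ultimately have "form (\<sigma>1 x) (L x) = 0" by (simp add: L_def form_simps)
  then show "form ((\<alpha> / form p (\<sigma>1 x)) *\<^sub>R \<sigma>1 x) (L x) =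
      form (\<nu> x) ((\<alpha> / form p (\<sigma>1 x)) *\<^sub>R \<sigma>1 x) * form (\<nu> x) (L x) / \<kappa>" using \<nu>L by (simp add: form_simps)
qed

text \<open>d_X F lies in \<open>f\<close> and is orthogonal to \<open>p\<close>, so it is l
  \<sigma>2, and pairing with z2 detects l: l g2 = (F, d_X z2). Now \<open>F\<close> lies in
  \<open>S1\<close>, which is spanned by p, \<nu> and n, and these three are orthogonal to d_X
  z2.\<close>

lemma along_X_F:
  assumes x: "x \<in> U"
  shows "along X F x = 0"
proof -
  note z = z_\<sigma>2 e2_V
  have z2S: "form (\<sigma>1 y) (z2 y) = 0" if "y \<in> U" for y using z_\<sigma>2(2)[OF that] .
  have Ff: "F y \<in> f y" if "y \<in> U" for y by (rule F(1)[OF that])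
  have XF: "along X F x \<in> f x" unfolding along_def
  proof (rule curvature_space_tderiv[OF X(2)[OF x] U x smooth_F Ff])
    show "F x \<in> s1 x" unfolding F_curve[OF x] s1[OF x] by (intro span_scale span_base) simp
  qed
  have pF: "form p (F y) = \<alpha>" if "y \<in> U" for y by (rule F(2)[OF that])
  have "form p (along X F x) = 0"
    using along_form[OF x smooth_const smooth_F pF, of X] by (simp add: along_def[of _ "\<lambda>_. p"] form_simps)
  then obtain l where l: "along X F x = l *\<^sub>R \<sigma>2 x" by (rule \<Lambda>_multiple[OF x XF])
  have "form (F y) (z2 y) = 0" if "y \<in> U" for y using z2S[OF that] by (simp add: F_curve[OF that] form_simps)
  from along_form[OF x smooth_F smooth_z2 this, of X]
  have lz: "- l * g2 x = - form (F x) (along X z2 x)" using z_\<sigma>2(1)[OF x] by (simp add: l form_simps)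
  let ?S2 = "{\<sigma>2 x, e2 x, z2 x}" and ?S1 = "{\<sigma>1 x, e1 x, z1 x}" and ?T = "{p, \<nu> x, n x}"
  have S1: "orth ?S2 = span ?S1" using curvature_frame.splitting(2)[OF frame_swap x] by (simp add: orth_span)
  have "dim (span ?S1) \<le> 3" using dim_le_card'[of ?S1] card_insert_le_m1[of 3 "{e1 x, z1 x}" "\<sigma>1 x"]
      card_insert_le_m1[of 2 "{z1 x}" "e1 x"] by simp
  have dn: "form p (n x) = 0" "form (\<nu> x) (n x) = 0" using d\<nu>[OF x] by (auto simp: along_def)
  have "p \<notin> span {\<nu> x, n x}" using p_norm p\<nu>[OF x] dn by (intro notin_span_orth) auto
  moreover have "\<nu> x \<notin> span {n x}" using \<nu>\<nu>[OF x] \<kappa> dn by (intro notin_span_orth) auto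
  moreover have "n x \<noteq> 0" using n_norm[OF x] by (auto simp: form_simps)
  ultimately have dT: "dim (span ?T) = 3" by (simp add: dim_insert)
  have TS: "form t s = 0" if "t \<in> ?T" "s \<in> ?S2" for t s
    using that \<sigma>2_V[OF x] e2_V[OF x] d\<nu>_e2[OF x] \<nu>_e2[OF x] n_z2[OF x] by auto
  have "?T \<subseteq> orth ?S2"
  proof
    fix t assume t: "t \<in> ?T"
    have "form s t = 0" if "s \<in> ?S2" for s using TS[OF t that] form_commute[of s t] by simp
    then show "t \<in> orth ?S2" unfolding orth_def by blast
  qed
  then have "span ?T \<subseteq> span ?S1" using S1 by (metis span_minimal subspace_orth)
  then have "span ?T = span ?S1" using dT \<open>dim (span ?S1) \<le> 3\<close> by (intro subspace_dim_equal) auto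
  moreover have "F x \<in> span ?S1" unfolding F_curve[OF x] by (intro span_scale span_base) simp
  ultimately have FT: "F x \<in> span ?T" by simp
  have "form (\<nu> x) (along X z2 x) = 0"
    using along_form[OF x \<nu> smooth_z2 d\<nu>_e2(2), of X] \<nu>_parallel[OF x] n_z2[OF x] by (metis form.scaleR_left scaleR_zero_right neg_equal_0_iff_equal)
  moreover have "form (n x) (along X z2 x) = 0"
    using along_form[OF x smooth_n(1) smooth_z2 n_z2, of X] dn_z2[OF x] by simp
  moreover have "form p (along X z2 x) = 0"
    using along_form[OF x smooth_const smooth_z2 d\<nu>_e2(3), of X] by (simp add: along_def[of _ "\<lambda>_. p"] form_simps)
  ultimately have "?T \<subseteq> orth {along X z2 x}" using form_commute[of "along X z2 x"] by (auto simp: orth_def)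
  then have "span ?T \<subseteq> orth {along X z2 x}" by (rule span_minimal) (rule subspace_orth)
  then have "form (F x) (along X z2 x) = 0" using FT by (auto simp: orth_def form_commute)
  then show ?thesis using lz l e_pos2[OF x] by simp
qed

text \<open>If \<xi>(X) vanished, both \<xi> and d\<nu> would vanish on the non-zero direction X - h
  Y, which would lie in the kernel of the Guichard differential.\<close>

lemma \<xi>_X_nonzero:
  assumes x: "x \<in> U"
  obtains r where "r \<noteq> 0" "\<xi> x (X x) (e2 x) = r *\<^sub>R \<sigma>2 x"
proof -
  obtain r where r: "\<xi> x (X x) = r *\<^sub>R wedge (\<sigma>2 x) (e2 x)" by (rule \<xi>_multiple[OF x])
  obtain h where h: "along X \<nu> x = h *\<^sub>R n x" by (rule \<nu>_parallel[OF x])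
  have "r \<noteq> 0"
  proof
    assume "r = 0"
    then have 0: "\<xi> x (X x) = 0" by (simp add: r)
    define Z where "Z = X x - h *\<^sub>R Y x"
    note l = smooth_one_form_linear[OF smooth_\<xi>, of x] tderiv_linear[OF U \<nu> x]
    have \<xi>Z: "\<xi> x Z = 0" using 0 \<xi>_Y[OF x] by (simp add: Z_def linear_diff[OF l(1)] linear_scale[OF l(1)])
    have \<nu>Z: "tderiv \<nu> x Z = 0" using h by (simp add: Z_def linear_diff[OF l(2)] linear_scale[OF l(2)] along_def)
    have "guichard_q \<Lambda> V \<xi> x Z W = 2 * 0 - form (tderiv \<nu> x Z) (tderiv \<nu> x W) / \<kappa>" for W
    proof (rule guichard_q_eq[OF x bundle_\<Lambda> derived_V U x smooth_\<sigma>(2) \<sigma>2_\<Lambda> nz(2)[OF x]])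
      show "\<Lambda> y \<subseteq> V y" for y using fibre_subset_derived[OF bundle_\<Lambda>] derived_V by blast
    qed (simp_all add: \<xi>Z)
    moreover have "Z \<noteq> 0"
    proof
      assume "Z = 0"
      then have X': "X x = h *\<^sub>R Y x" by (simp add: Z_def)
      then have "X x \<in> curvature_space f x (s2 x)" using Y(2)[OF x] by (simp add: subspace_scale subspace_curvature_space)
      then show False using curvature_spaces_disjoint[OF X(2)[OF x]] X(1)[OF x] by blast
    qed
    ultimately show False using nondegenerate_q[of x] by (auto simp: nondegenerate_def \<nu>Z form_simps)
  qed
  then show ?thesis using that[of "- r * g2 x"] e2_V(3)[OF x] e_pos2[OF x]
    by (simp add: r blinfun_simps wedge_apply)
qed

end

section \<open>Gluing the section \<open>F\<close> across immersed and tangential points\<close>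

context guichard_frame
begin

lemma s_orth_p:
  assumes x: "x \<in> U"
  shows "s1 x \<subseteq> orth {p} \<longleftrightarrow> form p (\<sigma>1 x) = 0" "s2 x \<subseteq> orth {p} \<longleftrightarrow> form p (\<sigma>2 x) = 0"
proof -
  have "span {v} \<subseteq> orth {p} \<longleftrightarrow> form p v = 0" for v
    using span_base[of v "{v}"] by (auto simp: orth_def span_singleton form_simps)
  then show "s1 x \<subseteq> orth {p} \<longleftrightarrow> form p (\<sigma>1 x) = 0" "s2 x \<subseteq> orth {p} \<longleftrightarrow> form p (\<sigma>2 x) = 0"
    by (simp_all add: s1[OF x] s2[OF x])
qed

text \<open>Exchanging the spheres changes the sign of \<open>\<sigma>\<close> and with it that of
  \<open>L\<close>, and the equation that characterises \<open>F\<close> is homogeneous in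
  \<open>L\<close>.\<close>

lemma F_swap:
  assumes x: "x \<in> U"
  shows "guichard_frame.F p \<alpha> \<sigma>2 \<sigma>1 Y X \<kappa> \<nu> x = F x"
proof -
  interpret sw: guichard_frame f s2 s1 p \<alpha> V \<xi> U \<sigma>2 \<sigma>1 Y X \<kappa> \<nu> by (rule guichard_frame_swap)
  have m: "along Z (\<lambda>x. - g x) y = - along Z g y" if "y \<in> U" "smooth_map_on U g" for Z and g :: "'m \<Rightarrow> 'v" and y
    unfolding along_def by (rule tderiv_bounded_linear[OF bounded_linear_minus[OF bounded_linear_ident] U that(2,1)])
  have mm: "along Z (along Z (\<lambda>x. - \<sigma> x)) x = - along Z (along Z \<sigma>) x" if Z: "smooth_field_on U Z" for Z
  proof -
    have s: "smooth_map_on U (along Z \<sigma>)" by (rule smooth_along[OF U smooth_hyp Z])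
    have "along Z (along Z (\<lambda>x. - \<sigma> x)) x = along Z (\<lambda>y. - along Z \<sigma> y) x" unfolding along_def[of Z _ x]
      by (rule tderiv_cong[OF U x smooth_bounded_linear[OF bounded_linear_minus[OF bounded_linear_ident] U s]])
        (simp add: m smooth_hyp)
    then show ?thesis using m[OF x s] by simp
  qed
  have "sw.L x = - L x" unfolding L_def sw.L_def hyp_swap by (simp add: mm XY)
  then show ?thesis using F[OF x] by (intro sw.F_unique[OF x, symmetric]) (simp_all add: form_simps)
qed

end

text \<open>The interior is taken because the one-parameter case differentiates the relation that
  the sphere is orthogonal to \<open>p\<close>, and so needs it on an open set.\<close>

definition tangential :: "('m::topological_space \<Rightarrow> 'v::r42 set) \<Rightarrow> 'v \<Rightarrow> 'm set" where
  "tangential s p = interior {x. s x \<subseteq> orth {p}}"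

definition immersed :: "('m \<Rightarrow> 'v::r42 set) \<Rightarrow> ('m \<Rightarrow> 'v set) \<Rightarrow> 'v \<Rightarrow> 'm set" where
  "immersed s1 s2 p = {x. \<not> s1 x \<subseteq> orth {p} \<and> \<not> s2 x \<subseteq> orth {p}}"

lemma (in guichard_frame) tangential_frame:
  assumes x: "x \<in> U" "x \<in> tangential s2 p"
  shows "guichard_curve_frame f s1 s2 p \<alpha> V \<xi> (U \<inter> tangential s2 p) \<sigma>1 \<sigma>2 X Y \<kappa> \<nu>"
proof (intro guichard_curve_frame.intro guichard_frame_subset guichard_curve_frame_axioms.intro)
  show "open (U \<inter> tangential s2 p)" using U by (auto simp: tangential_def)
  show "form p (\<sigma>2 y) = 0" if "y \<in> U \<inter> tangential s2 p" for y
    using that interior_subset[of "{x. s2 x \<subseteq> orth {p}}"] s_orth_p(2)[of y] by (auto simp: tangential_def)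
qed simp

context guichard_legendre
begin

text \<open>Away from the closure of the immersed points one of (p, \<sigma>1), (p, \<sigma>2)
  vanishes at every point, but never both. The one that is non-zero at \<open>x\<close> stays so
  nearby, and there the other vanishes identically.\<close>

lemma trichotomy: "x \<in> closure (immersed s1 s2 p) \<or> x \<in> tangential s1 p \<or> x \<in> tangential s2 p"
proof (rule ccontr)
  assume n: "\<not> ?thesis"
  obtain U \<sigma>1 \<sigma>2 X Y \<kappa> \<nu> where "guichard_frame f s1 s2 p \<alpha> V \<xi> U \<sigma>1 \<sigma>2 X Y \<kappa> \<nu>" and x: "x \<in> U"
    by (rule guichard_frame_exists)
  then interpret fr: guichard_frame f s1 s2 p \<alpha> V \<xi> U \<sigma>1 \<sigma>2 X Y \<kappa> \<nu> by simp
  define G where "G = U - closure (immersed s1 s2 p)"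
  have G: "open G" "x \<in> G" "G \<subseteq> U" using fr.U x n by (auto simp: G_def)
  have GI: "form p (\<sigma>1 y) = 0 \<or> form p (\<sigma>2 y) = 0" if "y \<in> G" for y
    using that closure_subset[of "immersed s1 s2 p"] fr.s_orth_p[of y] by (auto simp: G_def immersed_def)
  have tang: "x \<in> tangential s p" if s: "smooth_map_on U g" "form p (g x) \<noteq> 0"
    and z: "\<And>y. y \<in> G \<Longrightarrow> form p (g y) \<noteq> 0 \<Longrightarrow> s y \<subseteq> orth {p}" for g and s :: "'m \<Rightarrow> 'v set"
  proof -
    define H where "H = G \<inter> (\<lambda>y. form p (g y)) -` (- {0})"
    have "smooth_map_on U (\<lambda>y. form p (g y))" by (intro smooth_form smooth_const fr.U s)
    then have "continuous_on G (\<lambda>y. form p (g y))" using smooth_continuous[OF fr.U] G(3) continuous_on_subset by blast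
    then have "open H" unfolding H_def by (intro continuous_open_preimage G) auto
    then show ?thesis unfolding tangential_def by (rule interiorI) (use G s z in \<open>auto simp: H_def\<close>)
  qed
  show False
  proof (cases "form p (\<sigma>1 x) = 0")
    case False
    have "x \<in> tangential s2 p" using GI fr.s_orth_p(2) G(3) by (intro tang[OF fr.smooth_\<sigma>(1) False]) auto
    then show False using n by simp
  next
    case True
    then have "form p (\<sigma>2 x) \<noteq> 0" using fr.p_\<sigma>_nonzero[OF x] by simp
    then have "x \<in> tangential s1 p" using GI fr.s_orth_p(1) G(3) by (intro tang[OF fr.smooth_\<sigma>(2)]) auto
    then show False using n by simp
  qed
qed

text \<open>A description of \<open>F\<close> that mentions neither a frame nor a normal, made for
  gluing: with \<open>trichotomy\<close> and continuity it determines \<open>F\<close>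
  uniquely.\<close>

definition adapted :: "'m set \<Rightarrow> ('m \<Rightarrow> 'v) \<Rightarrow> bool" where
  "adapted U g \<longleftrightarrow> (\<forall>y\<in>U. g y \<in> f y \<and> form p (g y) = \<alpha> \<and> (y \<in> immersed s1 s2 p \<longrightarrow> g y \<in> orth (V y)) \<and>
    (y \<in> tangential s1 p \<longrightarrow> g y \<in> s2 y) \<and> (y \<in> tangential s2 p \<longrightarrow> g y \<in> s1 y))"

lemma adapted_F:
  assumes "guichard_frame f s1 s2 p \<alpha> V \<xi> U \<sigma>1 \<sigma>2 X Y \<kappa> \<nu>"
  shows "adapted U (guichard_frame.F p \<alpha> \<sigma>1 \<sigma>2 X Y \<kappa> \<nu>)" unfolding adapted_def
proof (intro ballI conjI impI)
  interpret fr: guichard_frame f s1 s2 p \<alpha> V \<xi> U \<sigma>1 \<sigma>2 X Y \<kappa> \<nu> by (rule assms)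
  fix y assume y: "y \<in> U"
  show "fr.F y \<in> f y" "form p (fr.F y) = \<alpha>" using fr.F[OF y] by auto
  show "fr.F y \<in> orth (V y)" if "y \<in> immersed s1 s2 p"
    using that fr.s_orth_p[OF y] by (intro fr.F_immersed[OF y]) (auto simp: immersed_def)
  show "fr.F y \<in> s1 y" if t: "y \<in> tangential s2 p"
    using guichard_curve_frame.F_curve[OF fr.tangential_frame[OF y t], of y] y t fr.s1[OF y]
    by (simp add: span_base span_scale)
  show "fr.F y \<in> s2 y" if t: "y \<in> tangential s1 p"
    using guichard_curve_frame.F_curve[OF guichard_frame.tangential_frame[OF fr.guichard_frame_swap y t], of y] y t fr.s2[OF y] fr.F_swap[OF y]
    by (simp add: span_base span_scale)
qed

lemma tangential_unique:
  assumes "x \<in> tangential s2 p" "v \<in> s1 x" "form p v = 0"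
  shows "v = 0"
proof -
  obtain U \<sigma>1 \<sigma>2 X Y \<kappa> \<nu> where "guichard_frame f s1 s2 p \<alpha> V \<xi> U \<sigma>1 \<sigma>2 X Y \<kappa> \<nu>" and x: "x \<in> U"
    by (rule guichard_frame_exists)
  then interpret fr: guichard_frame f s1 s2 p \<alpha> V \<xi> U \<sigma>1 \<sigma>2 X Y \<kappa> \<nu> by simp
  have "form p (\<sigma>2 x) = 0"
    using assms(1) interior_subset[of "{x. s2 x \<subseteq> orth {p}}"] fr.s_orth_p(2)[OF x] by (auto simp: tangential_def)
  then have "form p (\<sigma>1 x) \<noteq> 0" using fr.p_\<sigma>_nonzero[OF x] by simp
  then show ?thesis using assms(2,3) by (auto simp: fr.s1[OF x] span_singleton form_simps)
qed

text \<open>The difference lies in \<Lambda>, hence in \<open>V\<close>. At immersed points it is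
  also orthogonal to the non-degenerate \<open>V\<close>, so it is 0, and continuity extends this to
  the closure. At tangential points it lies in the other curvature sphere, which is not orthogonal
  to \<open>p\<close>.\<close>

lemma adapted_unique:
  assumes U: "open U" "smooth_map_on U g" "smooth_map_on U h" and gh: "adapted U g" "adapted U h" and y: "y \<in> U"
  shows "g y = h y"
proof -
  have d: "g y - h y \<in> \<Lambda> y" "form p (g y - h y) = 0" if "y \<in> U" for y
  proof -
    have a: "g y \<in> f y" "h y \<in> f y" "form p (g y) = \<alpha>" "form p (h y) = \<alpha>" using gh that by (simp_all add: adapted_def)
    show "form p (g y - h y) = 0" using a by (simp add: form_simps)
    then show "g y - h y \<in> \<Lambda> y" using subspace_diff[OF subspace_f a(1,2)] by (simp add: orth_def)
  qed
  have I: "g y - h y = 0" if y: "y \<in> U" "y \<in> immersed s1 s2 p" for y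
  proof -
    have "g y \<in> orth (V y)" "h y \<in> orth (V y)" using gh y by (simp_all add: adapted_def)
    then have o: "g y - h y \<in> orth (V y)" by (rule subspace_diff[OF subspace_orth])
    have "g y - h y \<in> V y" using d[OF y(1)] fibre_subset_derived[OF bundle_\<Lambda>] derived_V by blast
    moreover have "nondeg (V y)" by (rule signature_3_1(1)[OF V_fibre])
    ultimately show ?thesis using orthD(2)[OF o] unfolding nondeg_def by blast
  qed
  consider "y \<in> closure (immersed s1 s2 p)" | "y \<in> tangential s1 p" | "y \<in> tangential s2 p" using trichotomy by blast
  then have "g y - h y = 0"
  proof cases
    case 1
    show ?thesis by (rule smooth_zero_on_closure[OF U(1) smooth_diff[OF U] I y 1])
  next
    case 2
    then have "g y \<in> s2 y" "h y \<in> s2 y" using gh y by (simp_all add: adapted_def)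
    then have "g y - h y \<in> s2 y" by (rule subspace_diff[OF subspace_fibre[OF bundle_s(2)]])
    then show ?thesis using guichard_legendre.tangential_unique[OF swap_guichard 2] d[OF y] by blast
  next
    case 3
    then have "g y \<in> s1 y" "h y \<in> s1 y" using gh y by (simp_all add: adapted_def)
    then have "g y - h y \<in> s1 y" by (rule subspace_diff[OF subspace_fibre[OF bundle_s(1)]])
    then show ?thesis using tangential_unique[OF 3] d[OF y] by blast
  qed
  then show ?thesis by simp
qed

lemma adapted_subset: "adapted U g \<Longrightarrow> W \<subseteq> U \<Longrightarrow> adapted W g" by (auto simp: adapted_def)

lemma adapted_exists: "\<exists>F. smooth_map F \<and> adapted UNIV F"
proof (rule gluing[where good = adapted])
  fix x
  obtain U \<sigma>1 \<sigma>2 X Y \<kappa> \<nu> where fr: "guichard_frame f s1 s2 p \<alpha> V \<xi> U \<sigma>1 \<sigma>2 X Y \<kappa> \<nu>" and x: "x \<in> U"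
    by (rule guichard_frame_exists)
  then interpret fr: guichard_frame f s1 s2 p \<alpha> V \<xi> U \<sigma>1 \<sigma>2 X Y \<kappa> \<nu> by simp
  show "\<exists>U g. open U \<and> x \<in> U \<and> smooth_map_on U g \<and> adapted U g"
    using fr.U x fr.smooth_F adapted_F[OF fr] by blast
next
  fix U W :: "'m set" and g h y
  assume o: "open U" "open W" and s: "smooth_map_on U g" "smooth_map_on W h" and gh: "adapted U g" "adapted W h" and y: "y \<in> U" "y \<in> W"
  have "smooth_map_on (U \<inter> W) g" "smooth_map_on (U \<inter> W) h"
    using smooth_subset[OF s(1), of "U \<inter> W"] smooth_subset[OF s(2), of "U \<inter> W"] by auto
  then show "g y = h y" using o y adapted_subset[OF gh(1), of "U \<inter> W"] adapted_subset[OF gh(2), of "U \<inter> W"]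
    by (intro adapted_unique[of "U \<inter> W"]) auto
next
  fix G assume G: "smooth_map G" "\<And>x. \<exists>U g. open U \<and> x \<in> U \<and> smooth_map_on U g \<and> adapted U g \<and> (\<forall>y\<in>U. G y = g y)"
  have "adapted {x} G" for x
  proof -
    obtain U g where "x \<in> U" "adapted U g" "G x = g x" using G(2)[of x] by blast
    then show ?thesis by (auto simp: adapted_def)
  qed
  then have "adapted UNIV G" by (auto simp: adapted_def)
  then show ?thesis using G(1) by blast
qed

end

lemma (in curvature_frame) wedge_parallel:
  assumes x: "x \<in> U" and g: "smooth_map_on U g" "along X g x = h *\<^sub>R along Y g x"
  shows "wedge (tderiv g x Z) (tderiv g x W) = 0"
proof -
  note l = tderiv_linear[OF U g(1) x]
  have *: "\<exists>k. tderiv g x Z = k *\<^sub>R along Y g x" for Z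
  proof -
    obtain a b where Z: "Z = a *\<^sub>R X x + b *\<^sub>R Y x" by (rule XY_basis[OF x])
    have "tderiv g x Z = (a * h + b) *\<^sub>R along Y g x"
      using g(2) by (simp add: Z linear_add[OF l] linear_scale[OF l] along_def algebra_simps)
    then show ?thesis by blast
  qed
  obtain j k where "tderiv g x Z = j *\<^sub>R along Y g x" "tderiv g x W = k *\<^sub>R along Y g x"
    using *[of Z] *[of W] by blast
  then show ?thesis by (simp add: wedge.scaleR_left wedge.scaleR_right)
qed

context guichard_curve_frame
begin

lemma curve_wedge:
  assumes x: "x \<in> U"
  shows "wedge (tderiv \<nu> x Z) (tderiv \<nu> x W) = 0" "wedge (tderiv F x Z) (tderiv F x W) = 0"
proof -
  obtain h where "along X \<nu> x = h *\<^sub>R n x" by (rule \<nu>_parallel[OF x])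
  then show "wedge (tderiv \<nu> x Z) (tderiv \<nu> x W) = 0" by (rule wedge_parallel[OF x \<nu>])
  have "along X F x = 0 *\<^sub>R along Y F x" using along_X_F[OF x] by simp
  then show "wedge (tderiv F x Z) (tderiv F x W) = 0" by (rule wedge_parallel[OF x smooth_F])
qed

text \<open>The two diagonal entries of q have separate sources: d_X F = 0 leaves \<xi>(X) e2 for
  the first, and \<xi>(Y) = 0 leaves F \<and> dF for the second, where (F, z1) is non-zero because
  \<open>F\<close> is a multiple of \<sigma>1.\<close>

lemma curve_nondegenerate:
  assumes \<eta>: "f_potential f \<eta>" and x: "x \<in> U"
    and \<eta>x: "\<And>Z. \<eta> x Z = 2 *\<^sub>R \<xi> x Z - (1 / \<alpha>) *\<^sub>R wedge (F x) (tderiv F x Z)"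
  shows "nondegenerate (omega_q f \<eta> x)"
proof -
  have Ff: "F y \<in> f y" if "y \<in> U" for y by (rule F(1)[OF that])
  have Fe: "form (F y) (e1 y) = 0" "form (F y) (e2 y) = 0" if "y \<in> U" for y
    using f_perp(1)[OF that Ff[OF that]] e_orth[OF that] e_orth2[OF that] by auto
  have p1: "form p (\<sigma>1 x) \<noteq> 0" using p_\<sigma>_nonzero[OF x] curve[OF x] by simp
  obtain r where r: "r \<noteq> 0" "\<xi> x (X x) (e2 x) = r *\<^sub>R \<sigma>2 x" by (rule \<xi>_X_nonzero[OF x])
  have dX: "tderiv F x (X x) = 0" using along_X_F[OF x] by (simp add: along_def)
  have "\<eta> x (X x) (e2 x) = (2 * r) *\<^sub>R \<sigma>2 x" by (simp add: \<eta>x dX r blinfun_simps wedge_apply form.zero_left)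
  then have 1: "form (\<eta> x (X x) (e2 x)) (z2 x) \<noteq> 0"
    using r(1) z_\<sigma>2(1)[OF x] e_pos2[OF x] by (simp add: form_simps)
  have Fz: "form (F x) (z1 x) \<noteq> 0"
    using z_\<sigma>(1)[OF x] e_pos[OF x] p1 p_norm(2) by (simp add: F_curve[OF x] form_simps)
  have "form (along Y F x) (e1 x) = - form (F x) (z1 x)" by (rule along_form[OF x smooth_F smooth_e Fe(1)])
  then have d: "form (tderiv F x (Y x)) (e1 x) = - form (F x) (z1 x)" by (simp add: along_def[of Y F])
  have "\<eta> x (Y x) (e1 x) = (- form (F x) (z1 x) / \<alpha>) *\<^sub>R F x"
    using Fe(1)[OF x] d by (simp add: \<eta>x \<xi>_Y[OF x] blinfun_simps wedge_apply)
  then have 2: "form (\<eta> x (Y x) (e1 x)) (z1 x) \<noteq> 0" using Fz p_norm(2) by (simp add: form_simps)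
  show ?thesis using 1 2 e_pos[OF x] e_pos2[OF x]
    by (simp add: nondegenerate_omega_q_iff[OF \<eta> x] omega_q_XY[OF \<eta> x])
qed

end

section \<open>Closedness and non-degeneracy of the potential built from \<open>F\<close>\<close>

context guichard_frame
begin

lemma F_null: assumes x: "x \<in> U" shows "form (F x) (F x) = 0"
  using F(1)[OF x] isotropic_f[of x] by (auto simp: isotropic_def)

text \<open>At immersed points F = p + c \<nu>, so (F, F) = 0 forces c^2 = - \<alpha> / \<kappa>;
  thus c is locally constant there and dF = c d\<nu>. Both relations are closed conditions between
  smooth quantities and persist on the closure.\<close>

lemma F_closure:
  assumes x: "x \<in> U" "x \<in> closure (immersed s1 s2 p)"
  obtains \<epsilon> where "\<epsilon>\<^sup>2 * \<kappa> = - \<alpha>" "\<And>Z. tderiv F x Z = \<epsilon> *\<^sub>R tderiv \<nu> x Z"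
proof -
  \<comment> \<open>The coefficient of \<open>\<nu>\<close> in \<open>F\<close>, given by a formula
    that stays smooth on all of \<open>U\<close>.\<close>
  define c where "c y = form (\<nu> y) (F y) / \<kappa>" for y
  have sc: "smooth_map_on U c"
    unfolding c_def[abs_def] by (intro smooth_divide smooth_form smooth_const U \<nu> smooth_F) (use \<kappa> in auto)
  define I where "I = {y \<in> U. form p (\<sigma>1 y) \<noteq> 0 \<and> form p (\<sigma>2 y) \<noteq> 0}"
  have I: "y \<in> I" if "y \<in> U" "y \<in> immersed s1 s2 p" for y
    using that s_orth_p[OF that(1)] by (auto simp: I_def immersed_def)
  have "I = (U \<inter> (\<lambda>y. form p (\<sigma>1 y)) -` (- {0})) \<inter> (U \<inter> (\<lambda>y. form p (\<sigma>2 y)) -` (- {0}))" by (auto simp: I_def)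
  moreover have "open (U \<inter> (\<lambda>y. form p (g y)) -` (- {0}))" if "smooth_map_on U g" for g :: "'m \<Rightarrow> 'v"
    by (rule continuous_open_preimage[OF smooth_continuous[OF U smooth_form[OF U smooth_const that]] U]) auto
  ultimately have oI: "open I" using smooth_\<sigma> by (metis open_Int)
  have FI: "F y = p + c y *\<^sub>R \<nu> y" if "y \<in> I" for y
  proof -
    have y: "y \<in> U" "form p (\<sigma>1 y) \<noteq> 0" "form p (\<sigma>2 y) \<noteq> 0" using that by (auto simp: I_def)
    have "F y \<in> span {p, \<nu> y}" using F_immersed[OF y] orth_V[OF y(1)] by simp
    then obtain a b where "F y - a *\<^sub>R p = b *\<^sub>R \<nu> y" by (auto simp: span_insert span_singleton)
    then have Fy: "F y = a *\<^sub>R p + b *\<^sub>R \<nu> y" by (simp add: algebra_simps)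
    have "a = 1" using F(2)[OF y(1)] p_norm p\<nu>[OF y(1)] by (simp add: Fy form_simps)
    moreover have "b = c y" using \<kappa> p\<nu>[OF y(1)] \<nu>\<nu>[OF y(1)] form_commute[of "\<nu> y" p] by (simp add: c_def Fy form_simps)
    ultimately show ?thesis using Fy by simp
  qed
  have cI: "c y * c y = - \<alpha> / \<kappa>" if "y \<in> I" for y
  proof -
    have y: "y \<in> U" using that by (auto simp: I_def)
    have "\<alpha> + c y * c y * \<kappa> = 0"
      using F_null[OF y] p_norm p\<nu>[OF y] \<nu>\<nu>[OF y] form_commute[of "\<nu> y" p] by (simp add: FI[OF that] form_simps)
    then show ?thesis using \<kappa> by (simp add: field_simps)
  qed
  have sI: "smooth_map_on I c" "smooth_map_on I \<nu>" "smooth_map_on I F"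
    using sc \<nu> smooth_F by (auto intro: smooth_subset simp: I_def)
  have dI: "tderiv F y Z = c y *\<^sub>R tderiv \<nu> y Z" if y: "y \<in> I" for y Z
  proof -
    have "c y * tderiv c y Z + tderiv c y Z * c y = tderiv (\<lambda>y. c y * c y) y Z"
      by (rule tderiv_bilinear[OF bounded_bilinear_mult oI sI(1,1) y, symmetric])
    also have "\<dots> = tderiv (\<lambda>_. - \<alpha> / \<kappa>) y Z" by (rule tderiv_cong[OF oI y smooth_const]) (simp add: cI)
    finally have "c y * tderiv c y Z = 0" by simp
    moreover have "c y \<noteq> 0" using cI[OF y] p_norm \<kappa> by auto
    ultimately have dc: "tderiv c y Z = 0" by simp
    have s: "smooth_map_on I (\<lambda>y. c y *\<^sub>R \<nu> y)" by (rule smooth_scaleR[OF oI sI(1,2)])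
    have "tderiv F y Z = tderiv (\<lambda>y. p + c y *\<^sub>R \<nu> y) y Z"
      by (rule tderiv_cong[OF oI y smooth_add[OF oI smooth_const s]]) (simp add: FI)
    then show ?thesis using tderiv_add[OF oI smooth_const s y] tderiv_scaleR[OF oI sI(1,2) y, of Z] dc by simp
  qed
  have along0: "along Z F x - c x *\<^sub>R along Z \<nu> x = 0" if Z: "smooth_field_on U Z" for Z
  proof (rule smooth_zero_on_closure[OF U _ _ x])
    show "smooth_map_on U (\<lambda>x. along Z F x - c x *\<^sub>R along Z \<nu> x)"
      by (intro smooth_diff smooth_scaleR smooth_along U Z \<nu> sc smooth_F)
    show "along Z F y - c y *\<^sub>R along Z \<nu> y = 0" if "y \<in> U" "y \<in> immersed s1 s2 p" for y
      using dI[OF I[OF that]] by (simp add: along_def)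
  qed
  have "c x * c x - - \<alpha> / \<kappa> = 0"
  proof (rule smooth_zero_on_closure[OF U _ _ x])
    show "smooth_map_on U (\<lambda>x. c x * c x - - \<alpha> / \<kappa>)"
      by (intro smooth_diff smooth_const smooth_bilinear[OF bounded_bilinear_mult] U sc)
    show "c y * c y - - \<alpha> / \<kappa> = 0" if "y \<in> U" "y \<in> immersed s1 s2 p" for y using cI[OF I[OF that]] by simp
  qed
  then have "c x * c x = - (\<alpha> / \<kappa>)" by simp
  then have "(c x)\<^sup>2 * \<kappa> = - \<alpha>" using \<kappa> by (simp add: power2_eq_square)
  moreover have "tderiv F x Z = c x *\<^sub>R tderiv \<nu> x Z" for Z
  proof -
    obtain a b where Z: "Z = a *\<^sub>R X x + b *\<^sub>R Y x" by (rule XY_basis[OF x(1)])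
    note l = tderiv_linear[OF U smooth_F x(1)] tderiv_linear[OF U \<nu> x(1)]
    have "tderiv F x (X x) = c x *\<^sub>R tderiv \<nu> x (X x)" "tderiv F x (Y x) = c x *\<^sub>R tderiv \<nu> x (Y x)"
      using along0[OF XY(1)] along0[OF XY(2)] by (simp_all add: along_def)
    then show ?thesis
      by (simp add: Z linear_add[OF l(1)] linear_scale[OF l(1)] linear_add[OF l(2)] linear_scale[OF l(2)] algebra_simps)
  qed
  ultimately show ?thesis by (rule that)
qed

lemma tderiv_F_swap: "x \<in> U \<Longrightarrow> tderiv (guichard_frame.F p \<alpha> \<sigma>2 \<sigma>1 Y X \<kappa> \<nu>) x Z = tderiv F x Z"
  by (rule tderiv_cong[OF U _ smooth_F]) (simp_all add: F_swap)

text \<open>Up to the factor -2 this says that 2 \<xi> - \<alpha>^-1 F \<and> dF is closed. On the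
  closure of the immersed points the two terms cancel; at tangential points each is 0, because \<nu>
  and \<open>F\<close> vary in at most one direction there.\<close>

lemma curvature_balance:
  assumes x: "x \<in> U"
  shows "(1 / \<kappa>) *\<^sub>R wedge (tderiv \<nu> x Z) (tderiv \<nu> x W) + (1 / \<alpha>) *\<^sub>R wedge (tderiv F x Z) (tderiv F x W) = 0"
proof -
  consider "x \<in> closure (immersed s1 s2 p)" | "x \<in> tangential s1 p" | "x \<in> tangential s2 p" using trichotomy by blast
  then show ?thesis
  proof cases
    case 1
    obtain \<epsilon> where e: "\<epsilon>\<^sup>2 * \<kappa> = - \<alpha>" "\<And>Z. tderiv F x Z = \<epsilon> *\<^sub>R tderiv \<nu> x Z" using F_closure[OF x 1] by blast
    have "1 / \<kappa> + (1 / \<alpha>) * (\<epsilon> * \<epsilon>) = 0" using e(1) \<kappa> p_norm(2) by (simp add: power2_eq_square field_simps)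
    moreover have "(1 / \<kappa>) *\<^sub>R w + (1 / \<alpha>) *\<^sub>R \<epsilon> *\<^sub>R \<epsilon> *\<^sub>R w = (1 / \<kappa> + (1 / \<alpha>) * (\<epsilon> * \<epsilon>)) *\<^sub>R w" for w :: "'v \<Rightarrow>\<^sub>L 'v"
      by (simp add: scaleR_add_left)
    ultimately show ?thesis by (simp only: e(2) wedge.scaleR_left wedge.scaleR_right scaleR_zero_left)
  next
    case 2
    interpret sw: guichard_curve_frame f s2 s1 p \<alpha> V \<xi> "U \<inter> tangential s1 p" \<sigma>2 \<sigma>1 Y X \<kappa> \<nu>
      by (rule guichard_frame.tangential_frame[OF guichard_frame_swap x 2])
    have "wedge (tderiv F x Z) (tderiv F x W) = 0" "wedge (tderiv \<nu> x Z) (tderiv \<nu> x W) = 0"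
      using sw.curve_wedge[of x] x 2 by (simp_all add: tderiv_F_swap[OF x])
    then show ?thesis by simp
  next
    case 3
    then show ?thesis using guichard_curve_frame.curve_wedge[OF tangential_frame[OF x 3], of x] x by simp
  qed
qed

text \<open>On the closure of the immersed points q coincides with the Guichard differential. In the
  one-parameter case no multiple of d\<nu> is at hand for dF, and the diagonal entries are examined
  directly.\<close>

lemma nondegenerate_potential:
  assumes \<eta>: "f_potential f \<eta>" and x: "x \<in> U"
    and \<eta>x: "\<And>Z. \<eta> x Z = 2 *\<^sub>R \<xi> x Z - (1 / \<alpha>) *\<^sub>R wedge (F x) (tderiv F x Z)"
  shows "nondegenerate (omega_q f \<eta> x)"
proof -
  consider "x \<in> closure (immersed s1 s2 p)" | "x \<in> tangential s1 p" | "x \<in> tangential s2 p" using trichotomy by blast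
  then show ?thesis
  proof cases
    case 1
    obtain \<epsilon> where e: "\<epsilon>\<^sup>2 * \<kappa> = - \<alpha>" "\<And>Z. tderiv F x Z = \<epsilon> *\<^sub>R tderiv \<nu> x Z" using F_closure[OF x 1] by blast
    have "omega_q f \<eta> x Z W = guichard_q \<Lambda> V \<xi> x Z W" for Z W
    proof (rule omega_q_eq_guichard_q[where \<Lambda> = \<Lambda> and \<xi> = \<xi> and \<eta> = \<eta> and x = x and Z = Z and F = F,
          OF sphere_normal_axioms x smooth_F F(1) F(2) e(2) e(1) bundle_\<Lambda> _ derived_V])
      show "lowers (f x) (\<eta> x Z)" using \<eta> by (simp add: f_potential_def)
    qed (simp_all add: \<xi>_wedge_space \<eta>x)
    then have "omega_q f \<eta> x = guichard_q \<Lambda> V \<xi> x" by blast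
    then show ?thesis using nondegenerate_q[of x] by simp
  next
    case 2
    interpret sw: guichard_curve_frame f s2 s1 p \<alpha> V \<xi> "U \<inter> tangential s1 p" \<sigma>2 \<sigma>1 Y X \<kappa> \<nu>
      by (rule guichard_frame.tangential_frame[OF guichard_frame_swap x 2])
    show ?thesis
      by (rule sw.curve_nondegenerate[OF \<eta>]) (use x 2 \<eta>x in \<open>simp_all add: tderiv_F_swap[OF x] F_swap[OF x]\<close>)
  next
    case 3
    show ?thesis
      by (rule guichard_curve_frame.curve_nondegenerate[OF tangential_frame[OF x 3] \<eta> _ \<eta>x]) (use x 3 in simp)
  qed
qed

end

context guichard_legendre
begin

text \<open>The relation between \<open>\<eta>\<close> and \<open>F\<close> says that p + t F is
  conserved by d + t \<eta>, before the passage to the middle gauge.\<close>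

lemma special_potential:
  obtains F \<eta> where "smooth_map F" "\<And>x. F x \<in> f x" "\<And>x. form p (F x) = \<alpha>" "f_potential f \<eta>"
    "\<And>x Z. \<eta> x Z p = - tderiv F x Z" "\<And>x. nondegenerate (omega_q f \<eta> x)"
proof -
  obtain F where F: "smooth_map F" "adapted UNIV F" using adapted_exists by blast
  have Ff: "F x \<in> f x" and pF: "form p (F x) = \<alpha>" for x using F(2) by (simp_all add: adapted_def)
  define \<eta> where "\<eta> x Z = 2 *\<^sub>R \<xi> x Z - (1 / \<alpha>) *\<^sub>R wedge (F x) (tderiv F x Z)" for x Z
  let ?w = "\<lambda>x Z. wedge (F x) (tderiv F x Z)"
  have dF: "tderiv F x Z \<in> orth (f x)" for x Z by (rule tderiv_section_orth[OF open_UNIV UNIV_I F(1) Ff])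
  note sw = smooth_one_form_wedge[OF F(1)]
  have s1: "smooth_one_form (\<lambda>x Z. 2 *\<^sub>R \<xi> x Z)" by (intro smooth_one_form_scaleR smooth_const smooth_\<xi>)
  have s2: "smooth_one_form (\<lambda>x Z. (1 / \<alpha>) *\<^sub>R ?w x Z)" by (intro smooth_one_form_scaleR smooth_const sw)
  have frameF: "F y = guichard_frame.F p \<alpha> \<sigma>1 \<sigma>2 X Y \<kappa> \<nu> y"
    if fr: "guichard_frame f s1 s2 p \<alpha> V \<xi> U \<sigma>1 \<sigma>2 X Y \<kappa> \<nu>" and y: "y \<in> U" for U \<sigma>1 \<sigma>2 X Y \<kappa> \<nu> y
  proof (rule adapted_unique[OF _ _ _ _ adapted_F[OF fr] y])
    interpret fr: guichard_frame f s1 s2 p \<alpha> V \<xi> U \<sigma>1 \<sigma>2 X Y \<kappa> \<nu> by (rule fr)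
    show "open U" "smooth_map_on U fr.F" by (rule fr.U fr.smooth_F)+
  qed (use smooth_subset[OF F(1)] adapted_subset[OF F(2)] in auto)
  have tderivF: "tderiv F y Z = tderiv (guichard_frame.F p \<alpha> \<sigma>1 \<sigma>2 X Y \<kappa> \<nu>) y Z"
    if fr: "guichard_frame f s1 s2 p \<alpha> V \<xi> U \<sigma>1 \<sigma>2 X Y \<kappa> \<nu>" and y: "y \<in> U" for U \<sigma>1 \<sigma>2 X Y \<kappa> \<nu> y Z
  proof -
    interpret fr: guichard_frame f s1 s2 p \<alpha> V \<xi> U \<sigma>1 \<sigma>2 X Y \<kappa> \<nu> by (rule fr)
    show ?thesis by (rule tderiv_cong[OF fr.U y fr.smooth_F]) (simp add: frameF[OF fr])
  qed
  have "ext_deriv c \<eta> x e e' = 0" if c: "c \<in> atlas" "x \<in> fst c" for c x e e'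
  proof -
    obtain U \<sigma>1 \<sigma>2 X Y \<kappa> \<nu> where fr: "guichard_frame f s1 s2 p \<alpha> V \<xi> U \<sigma>1 \<sigma>2 X Y \<kappa> \<nu>" and x: "x \<in> U"
      by (rule guichard_frame_exists)
    interpret fr: guichard_frame f s1 s2 p \<alpha> V \<xi> U \<sigma>1 \<sigma>2 X Y \<kappa> \<nu> by (rule fr)
    let ?Z = "coord_field c e x" and ?W = "coord_field c e' x"
    have "ext_deriv c \<eta> x e e' = 2 *\<^sub>R ext_deriv c \<xi> x e e' - (1 / \<alpha>) *\<^sub>R ext_deriv c ?w x e e'"
      unfolding \<eta>_def[abs_def]
      using ext_deriv_diff[OF s1 s2 c] ext_deriv_scaleR[OF smooth_const _ smooth_\<xi> c, of 2]
        ext_deriv_scaleR[OF smooth_const _ sw c, of "1 / \<alpha>"] by simp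
    also have "\<dots> = - 2 *\<^sub>R ((1 / \<kappa>) *\<^sub>R wedge (tderiv \<nu> x ?Z) (tderiv \<nu> x ?W) + (1 / \<alpha>) *\<^sub>R wedge (tderiv F x ?Z) (tderiv F x ?W))"
      using fr.ext_deriv_of_flat[OF smooth_\<xi> flat_\<xi> c x, of e e'] ext_deriv_wedge[OF open_UNIV UNIV_I F(1) c, of e e']
      by (simp add: scaleR_add_right)
    finally show ?thesis using fr.curvature_balance[OF x] by (simp add: tderivF[OF fr x])
  qed
  moreover have "lowers (f x) (\<eta> x Z)" for x Z unfolding \<eta>_def
    by (intro lowers_diff lowers_scaleR subspace_f lowers_\<xi> lowers_wedge_space isotropic_f wedge_in_wedge_space Ff dF)
  moreover have "smooth_one_form \<eta>" unfolding \<eta>_def[abs_def] by (rule smooth_one_form_diff[OF s1 s2])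
  ultimately have \<eta>: "f_potential f \<eta>" by (auto simp: f_potential_def closed_iff_ext_deriv)
  have nd: "nondegenerate (omega_q f \<eta> x)" for x
  proof -
    obtain U \<sigma>1 \<sigma>2 X Y \<kappa> \<nu> where fr: "guichard_frame f s1 s2 p \<alpha> V \<xi> U \<sigma>1 \<sigma>2 X Y \<kappa> \<nu>" and x: "x \<in> U"
      by (rule guichard_frame_exists)
    show ?thesis
      by (rule guichard_frame.nondegenerate_potential[OF fr \<eta> x]) (simp add: \<eta>_def frameF[OF fr x] tderivF[OF fr x])
  qed
  have "\<eta> x Z p = - tderiv F x Z" for x Z
  proof -
    have "p \<in> orth (V x)" using congruence_V by (auto simp: sphere_congruence_def orth_def form_commute)
    then have "\<xi> x Z p = 0" by (rule \<xi>_orth_V)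
    moreover have "form p (tderiv F x Z) = 0"
      using tderiv_form_eq[OF open_UNIV UNIV_I smooth_const F(1) pF, of x Z] by (simp add: form_simps)
    ultimately show ?thesis using pF[of x] p_norm form_commute[of "F x" p] form_commute[of "tderiv F x Z" p]
      by (simp add: \<eta>_def blinfun_simps wedge_apply)
  qed
  then show ?thesis using that[OF F(1) Ff pF \<eta> _ nd] by blast
qed

end

lemma guichard_imp_special:
  fixes f :: "'m::smooth_surface \<Rightarrow> 'v::r42 set"
  assumes p0: "\<pp> \<noteq> 0" "\<not> lightlike \<pp>" and f: "legendre_map f" "umbilic_free f"
    and \<Lambda>: "smooth_subbundle 1 (\<lambda>x. f x \<inter> orth {\<pp>})" "non_channel_guichard_surface \<pp> (\<lambda>x. f x \<inter> orth {\<pp>})"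
  shows "\<exists>\<eta> \<mu> p. special_omega_surface 1 f \<eta> \<and> middle_potential f \<eta> \<mu> \<and>
            polynomial_conserved_quantity \<mu> 1 p \<and> p 0 = (\<lambda>_. \<pp>) \<and>
            (\<forall>x. \<exists>P :: real poly. degree P = 1 \<and> coeff P 0 \<noteq> 0 \<and>
              (\<forall>t. form (section_poly 1 p t x) (section_poly 1 p t x) = poly P t))"
proof -
  obtain s1 s2 where pair: "curvature_sphere_pair f s1 s2" using f(2) by (auto simp: umbilic_free_def)
  obtain V \<xi> where V: "guichard_data \<pp> (\<lambda>x. f x \<inter> orth {\<pp>}) V \<xi>"
    "\<And>x. nondegenerate (guichard_q (\<lambda>x. f x \<inter> orth {\<pp>}) V \<xi> x)"
    using \<Lambda>(2) unfolding non_channel_guichard_surface_def by blast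
  define \<alpha> where "\<alpha> = form \<pp> \<pp>"
  have \<alpha>: "\<alpha> \<noteq> 0" using p0 by (auto simp: \<alpha>_def lightlike_def)
  interpret guichard_legendre f s1 s2 \<pp> \<alpha> V \<xi> by unfold_locales (use f pair V \<Lambda> \<alpha> in \<open>simp_all add: \<alpha>_def\<close>)
  obtain F \<eta> where F: "smooth_map F" "\<And>x. F x \<in> f x" "\<And>x. form \<pp> (F x) = \<alpha>" and \<eta>: "f_potential f \<eta>"
    and \<eta>p: "\<And>x Z. \<eta> x Z \<pp> = - tderiv F x Z" and nd: "\<And>x. nondegenerate (omega_q f \<eta> x)"
    using special_potential by blast
  obtain \<tau> where \<tau>: "\<tau> \<in> sections (\<lambda>x. wedge_space (f x) (f x))" "middle (\<lambda>x X. \<eta> x X - tderiv \<tau> x X)"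
    by (rule middle_exists[OF \<eta>])
  define \<mu> where "\<mu> = (\<lambda>x X. \<eta> x X - tderiv \<tau> x X)"
  have \<mu>: "f_potential f \<mu>" unfolding \<mu>_def by (rule gauge_f_potential[OF \<eta> \<tau>(1)])
  then have low: "lowers (f x) (\<mu> x Z)" for x Z by (simp add: f_potential_def)
  have mp: "middle_potential f \<eta> \<mu>" unfolding middle_potential_def Let_def gauge_orbit_def
    using \<tau> middle_iff[of \<mu>] low pair unfolding \<mu>_def by blast
  have \<tau>s: "smooth_map \<tau>" "\<And>x. \<tau> x \<in> wedge_space (f x) (f x)" using \<tau>(1) by (auto simp: sections_def)
  \<comment> \<open>The gauge transformation acts on conserved quantities by 1 + t \<tau>. It takes
    p + t F to p + t (F + \<tau> p), because \<tau> annihilates \<open>F\<close>.\<close>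
  define P1 where "P1 x = F x + \<tau> x \<pp>" for x
  define p where "p k = (if k = 0 then (\<lambda>_. \<pp>) else if k = 1 then P1 else (\<lambda>_. 0))" for k :: nat
  have s\<tau>: "smooth_map (\<lambda>x. \<tau> x \<pp>)" by (intro smooth_apply open_UNIV \<tau>s smooth_const)
  have sP: "smooth_map P1" unfolding P1_def[abs_def] by (rule smooth_add[OF open_UNIV F(1) s\<tau>])
  have Pf: "P1 x \<in> f x" for x unfolding P1_def
    by (intro subspace_add subspace_f F(2) wedge_space_range[OF \<tau>s(2) subspace_f order_refl order_refl])
  have pP: "form \<pp> (P1 x) = \<alpha>" for x
    using F(3) skew_self(2)[OF skew_wedge_space[OF \<tau>s(2)]] by (simp add: P1_def form_simps)
  have dP: "tderiv P1 x Z = - \<mu> x Z \<pp>" for x Z using tderiv_add[OF open_UNIV F(1) s\<tau> UNIV_I, of x Z]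
      tderiv_apply[OF open_UNIV \<tau>s(1) smooth_const UNIV_I, of \<pp> x Z]
    by (simp add: P1_def[abs_def] \<mu>_def \<eta>p blinfun_simps)
  have sp: "section_poly 1 p t x = \<pp> + t *\<^sub>R P1 x" for t x by (simp add: section_poly_def p_def)
  have pcq: "polynomial_conserved_quantity \<mu> 1 p" unfolding polynomial_conserved_quantity_def
  proof (intro conjI allI impI)
    show "smooth_map (p k)" for k using sP by (simp add: p_def smooth_const)
    show "p 1 \<noteq> (\<lambda>_. 0)"
    proof
      assume "p 1 = (\<lambda>_. 0)"
      \<comment> \<open>\<open>undefined\<close> serves as an arbitrary point of the
        surface.\<close>
      then have "P1 undefined = 0" by (simp add: p_def)
      then show False using pP[of undefined] \<alpha> by (simp add: form_simps)
    qed
    show "p k = (\<lambda>_. 0)" if "k > 1" for k using that by (simp add: p_def)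
    fix t x Z
    have sp': "section_poly 1 p t = (\<lambda>x. \<pp> + t *\<^sub>R P1 x)" using sp by blast
    have "tderiv (section_poly 1 p t) x Z = t *\<^sub>R tderiv P1 x Z"
      unfolding sp' using tderiv_add[OF open_UNIV smooth_const smooth_scaleR[OF open_UNIV smooth_const sP] UNIV_I, of \<pp> t x Z]
        tderiv_scaleR_right[OF open_UNIV sP UNIV_I, of t x Z] by simp
    then show "tderiv (section_poly 1 p t) x Z + t *\<^sub>R \<mu> x Z (section_poly 1 p t x) = 0"
      using lowersD(2)[OF low Pf] unfolding sp by (simp add: dP blinfun_simps)
  qed
  have omega: "omega_surface f \<eta>" unfolding omega_surface_def
  proof (intro conjI)
    show "gauge_potential f \<eta>" by (rule gauge_potentialI[OF \<eta> nd])
    show "\<exists>U. open U \<and> closure U = UNIV \<and> (\<forall>x\<in>U. nondegenerate (omega_q f \<eta> x))"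
      using nd by (intro exI[of _ UNIV]) auto
    show "\<forall>C. connected C \<longrightarrow> (\<forall>x\<in>C. \<forall>y\<in>C. signature (omega_q f \<eta> x) UNIV = signature (omega_q f \<eta> y) UNIV)"
      using constant_signature[OF \<eta> nd] by blast
  qed (rule f(1))
  \<comment> \<open>\<open>P1\<close> is null and pairs with \<open>\<pp>\<close> to \<alpha>, so
    the norm is \<alpha> + 2 \<alpha> t.\<close>
  have "form (section_poly 1 p t x) (section_poly 1 p t x) = poly [:\<alpha>, 2 * \<alpha>:] t" for t x
  proof -
    have "form (P1 x) (P1 x) = 0" using Pf isotropic_f by (auto simp: isotropic_def)
    then show ?thesis unfolding sp using pP[of x] form_commute[of "P1 x" \<pp>] by (simp add: form_simps \<alpha>_def)
  qed
  then have poly: "\<forall>x. \<exists>P :: real poly. degree P = 1 \<and> coeff P 0 \<noteq> 0 \<and>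
      (\<forall>t. form (section_poly 1 p t x) (section_poly 1 p t x) = poly P t)"
    using \<alpha> by (intro allI exI[of _ "[:\<alpha>, 2 * \<alpha>:]"]) auto
  have "special_omega_surface 1 f \<eta>" using f(2) omega mp pcq by (auto simp: special_omega_surface_def)
  moreover have "p 0 = (\<lambda>_. \<pp>)" by (simp add: p_def)
  ultimately show ?thesis using mp pcq poly by blast
qed

theorem theorem5p7:
  fixes f :: "'m::smooth_surface \<Rightarrow> 'v::r42 set" and \<pp> :: 'v
  assumes "\<pp> \<noteq> 0" and "\<not> lightlike \<pp>"
    and "legendre_map f" and "umbilic_free f"
  shows "(\<exists>\<eta> \<mu> p. special_omega_surface 1 f \<eta> \<and> middle_potential f \<eta> \<mu> \<and>
            polynomial_conserved_quantity \<mu> 1 p \<and> p 0 = (\<lambda>_. \<pp>) \<and>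
            (\<forall>x. \<exists>P :: real poly. degree P = 1 \<and> coeff P 0 \<noteq> 0 \<and>
              (\<forall>t. form (section_poly 1 p t x) (section_poly 1 p t x) = poly P t)))
         \<longleftrightarrow>
         (smooth_subbundle 1 (\<lambda>x. f x \<inter> orth {\<pp>}) \<and>
          non_channel_guichard_surface \<pp> (\<lambda>x. f x \<inter> orth {\<pp>}))" (is "?a \<longleftrightarrow> ?b")
proof
  assume ?a
  then obtain \<eta> \<mu> p where a: "special_omega_surface 1 f \<eta>" "middle_potential f \<eta> \<mu>"
    "polynomial_conserved_quantity \<mu> 1 p" "p 0 = (\<lambda>_. \<pp>)"
    "\<forall>x. \<exists>P :: real poly. degree P = 1 \<and> coeff P 0 \<noteq> 0 \<and>
      (\<forall>t. form (section_poly 1 p t x) (section_poly 1 p t x) = poly P t)" by blast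
  have "omega_surface f \<eta>" using a(1) by (simp add: special_omega_surface_def)
  from special_imp_guichard[OF assms(1,2) this a(2-4)] a(5) show ?b by blast
next
  assume ?b
  then show ?a using guichard_imp_special[OF assms] by blast
qed

end
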